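(* Let $p \in \mathbb{R}[x_0,x_1,x_2]$ be a homogeneous polynomial of degree $d$ that is semi-hyperbolic with respect to $e_2=(0,0,1)$. Then there exist $d\times d$ self-adjoint (complex Hermitian) matrices $A_0,A_1,A_2$ with $A_2$ positive semi-definite and a constant $c \in \mathbb{R}$ such that \[ p(x_0,x_1,x_2) = c\det(x_0 A_0+x_1A_1 + x_2 A_2). \] Moreover, assuming $p$ has no (non-constant) factors depending on $x_0,x_1$ alone, the matrices $A_0,A_1,A_2$ and the constant $c$ above can be chosen to additionally satisfy all of the following: \begin{itemize} \item $\operatorname{rank} A_1 = \deg_1 p$ and $\operatorname{rank} A_2 = \deg_2 p$; \item $A_1 = B_{+}-B_{-}$ with $B_{+}$ and $B_{-}$ both positive semi-definite, where $\operatorname{rank} B_{-}$ equals the number of roots (counted with multiplicity) of the univariate polynomial $t\mapsto p(1,t,i)$ in the open upper half plane $\{z\in\mathbb{C}: \operatorname{Im} z>0\}$, and $\operatorname{rank} B_{+} + \operatorname{rank} B_{-} = \operatorname{rank} A_1$; \item $B_{-} + B_{+} + A_2 = I$. \end{itemize}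
   Context: A homogeneous polynomial $P \in \mathbb{R}[x_0,x_1,\dots,x_n]$ is called semi-hyperbolic with respect to the direction $e \in \mathbb{R}^{n+1}\setminus\{0\}$ if for every $x \in \mathbb{R}^{n+1}$ the univariate polynomial $t \mapsto P(x-te)$ is either identically zero or has only real roots. (It is not assumed that $P(e)\neq 0$.) The notation $\deg_j p$ denotes the degree of $p$ in the variable $x_j$. Here $i=\sqrt{-1}$ and $I$ is the $d\times d$ identity matrix. *)

theory Defs
  imports
    "HOL-Computational_Algebra.Polynomial"
    "Jordan_Normal_Form.Schur_Decomposition"
    "Jordan_Normal_Form.DL_Rank"
begin

text \<open>
  The ring \<open>\<real>[x0, x1, x2]\<close> is taken to be \<open>real poly poly poly\<close>, with \<open>x2\<close> the outermost and
  \<open>x0\<close> the innermost variable: \<open>coeff (coeff (coeff p k) j) i\<close> is the coefficient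
  of \<open>x0 ^ i * x1 ^ j * x2 ^ k\<close>.
\<close>

definition homogeneous :: "nat \<Rightarrow> real poly poly poly \<Rightarrow> bool" where
  "homogeneous d p \<longleftrightarrow> (\<forall>i j k. coeff (coeff (coeff p k) j) i \<noteq> 0 \<longrightarrow> i + j + k = d)"

definition degree1 :: "real poly poly poly \<Rightarrow> nat" where
  "degree1 p = (MAX k\<in>{..degree p}. degree (coeff p k))"

definition degree2 :: "real poly poly poly \<Rightarrow> nat" where
  "degree2 p = degree p"

text \<open>
  The parameter \<open>h\<close> is the inclusion of the real coefficients into the ring \<open>'a\<close> in which the
  polynomial is evaluated.
\<close>

definition eval3 ::
    "(real \<Rightarrow> 'a::comm_ring_1) \<Rightarrow> real poly poly poly \<Rightarrow> 'a \<Rightarrow> 'a \<Rightarrow> 'a \<Rightarrow> 'a" where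
  "eval3 h p a0 a1 a2 =
     poly (map_poly (\<lambda>q. poly (map_poly (\<lambda>r. poly (map_poly h r) a0) q) a1) p) a2"

definition line_poly ::
    "real poly poly poly \<Rightarrow> real \<times> real \<times> real \<Rightarrow> real \<times> real \<times> real \<Rightarrow> real poly" where
  "line_poly p e x = (case (e, x) of ((e0, e1, e2), (x0, x1, x2)) \<Rightarrow>
     eval3 (\<lambda>a. [:a:]) p [:x0, - e0:] [:x1, - e1:] [:x2, - e2:])"

definition only_real_roots :: "real poly \<Rightarrow> bool" where
  "only_real_roots q \<longleftrightarrow> (\<forall>z::complex. poly (map_poly complex_of_real q) z = 0 \<longrightarrow> z \<in> \<real>)"

definition semi_hyperbolic :: "real poly poly poly \<Rightarrow> real \<times> real \<times> real \<Rightarrow> bool" where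
  "semi_hyperbolic p e \<longleftrightarrow>
     e \<noteq> (0, 0, 0) \<and> (\<forall>x. line_poly p e x = 0 \<or> only_real_roots (line_poly p e x))"

text \<open>
  A polynomial in \<open>x0, x1\<close> alone is \<open>[:r:]\<close> with \<open>r :: real poly poly\<close>.  Since every polynomial
  divides \<open>0\<close>, the zero polynomial does not satisfy this predicate.
\<close>

definition no_factor_in_x0_x1 :: "real poly poly poly \<Rightarrow> bool" where
  "no_factor_in_x0_x1 p \<longleftrightarrow> (\<forall>r :: real poly poly. [:r:] dvd p \<longrightarrow> (\<exists>a. r = [:[:a:]:]))"

definition num_roots_upper :: "complex poly \<Rightarrow> nat" where
  "num_roots_upper q = (\<Sum>z \<in> {z. poly q z = 0 \<and> Im z > 0}. order z q)"

definition hermitian :: "complex mat \<Rightarrow> bool" where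
  "hermitian A \<longleftrightarrow> mat_adjoint A = A"

text \<open>The order is that of \<open>Complex_Order\<close>, where \<open>0 \<le> z\<close> says that \<open>z\<close> is real and nonnegative.\<close>

definition pos_semidef :: "complex mat \<Rightarrow> bool" where
  "pos_semidef A \<longleftrightarrow>
     hermitian A \<and> (\<forall>v \<in> carrier_vec (dim_row A). 0 \<le> (A *\<^sub>v v) \<bullet>c v)"

definition mat_rank :: "complex mat \<Rightarrow> nat" where
  "mat_rank A = vec_space.rank (dim_row A) A"

definition det_representation ::
    "nat \<Rightarrow> real poly poly poly \<Rightarrow> real \<Rightarrow> complex mat \<Rightarrow> complex mat \<Rightarrow> complex mat \<Rightarrow> bool" where
  "det_representation d p c A0 A1 A2 \<longleftrightarrow>
     A0 \<in> carrier_mat d d \<and> A1 \<in> carrier_mat d d \<and> A2 \<in> carrier_mat d d \<and>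
     hermitian A0 \<and> hermitian A1 \<and> hermitian A2 \<and> pos_semidef A2 \<and>
     (\<forall>x0 x1 x2 :: real.
        complex_of_real (eval3 (\<lambda>a. a) p x0 x1 x2) =
        complex_of_real c *
        det (complex_of_real x0 \<cdot>\<^sub>m A0 + complex_of_real x1 \<cdot>\<^sub>m A1 + complex_of_real x2 \<cdot>\<^sub>m A2))"

end

theory Submission
  imports
    Defs
    "HOL-Computational_Algebra.Field_as_Ring"
    "HOL-Computational_Algebra.Polynomial_Factorial"
begin

text \<open>
  Put \<open>q(y, z) = p(1, y, z)\<close>.  For almost every real \<open>y\<close> the polynomial \<open>q(y, \<cdot>)\<close> is real-rooted.
  Representations of factors combine to direct sums, so let \<open>q\<close> be irreducible.  The substitution
  \<open>w = -1/(z - t)\<close> with a generic real \<open>t\<close> turns \<open>q\<close> into \<open>b\<^sub>0(y) + \<dots> + b\<^sub>m(y) w\<^sup>m\<close>, where \<open>b\<^sub>m\<close> has only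
  simple zeros and the highest degree \<open>n\<close> among the \<open>b\<^sub>k\<close>.  Let \<open>C\<close> be \<open>b\<^sub>m\<close> times the companion
  matrix.  Its Hermite matrix \<open>H\<close>, formed from the power sums of the roots, is positive definite
  for almost all real \<open>y\<close> and satisfies \<open>H C = C\<^sup>T H\<close>.  A Fejer--Riesz factorization
  \<open>s H = F\<^sup>* F\<close> on the real line, with \<open>det F\<close> free of zeros in the upper half plane, makes
  \<open>M = F C F\<^sup>-\<^sup>1\<close> a polynomial matrix of degree at most \<open>n\<close> that is Hermitian on the real line.  At a
  zero of \<open>b\<^sub>m\<close> the residue of \<open>M / b\<^sub>m\<close> has rank one, so the partial fraction decomposition is the Schur
  complement of a linear pencil: up to a constant, \<open>q\<close> is the determinant of the Hermitian matrix
  with diagonal blocks \<open>w I + K\<^sub>2\<^sub>2\<close> and \<open>y J + K\<^sub>1\<^sub>1\<close> and constant off-diagonal blocks.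

  Comparing imaginary parts in the pencil at fixed \<open>w\<close> in the upper half plane shows that the
  negative index of \<open>J\<close> counts the zeros \<open>y\<close> in the upper half plane, which gives the rank of the
  negative part of \<open>A\<^sub>1\<close>.  Undoing the substitution on the complement of the kernel of \<open>K\<^sub>2\<^sub>2\<close>
  makes the pencil linear in \<open>z\<close> with a positive semidefinite coefficient, and a congruence
  normalizes \<open>Y\<^sub>1\<^sup>* Y\<^sub>1 + Y\<^sub>2\<^sup>* Y\<^sub>2 = I\<close>, where \<open>A\<^sub>1 = Y\<^sub>1\<^sup>* J Y\<^sub>1\<close> and \<open>A\<^sub>2 = Y\<^sub>2\<^sup>* Y\<^sub>2\<close>.
  A factor in \<open>x\<^sub>0, x\<^sub>1\<close> alone only needs blocks of size one or two.
\<close>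

section \<open>Conjugate transposes and positive definite matrices\<close>

text \<open>Conjugating the companion matrix threatens to create poles. On the real line they are
  excluded by the trace of \<open>C * C\<close>, which bounds every entry of a Hermitian conjugate;
  in the lower half plane by reflection; in the upper half plane by the choice of \<open>F\<close>.
  The rank of the residues follows the same division: above the axis \<open>F\<close> is invertible
  and \<open>C\<close> has a single nonzero column at a zero of the top coefficient, while on the
  axis \<open>F\<close> may degenerate and similarity invariants bound the minors instead. Residues
  at conjugate points are adjoint to each other, so \<open>J\<close> is the permutation of
  conjugation times signs.

  Since -1/(z - t) preserves the upper half plane, zeros of p(1, y, i) become zeros at one fixed
  \<open>w\<close> with positive imaginary part, where the inertia is read off. The matrices come
  out of a size D that may be smaller than d; comparison at x0 = 0 shows that the gap is a power of
  x0, which cannot occur when no factor depends on x0, x1 alone. That p(1, y, i) has degree deg_1 p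
  in y rests on real-rootedness: values at a real level are dominated by values at i.\<close>

abbreviation ct :: "complex mat \<Rightarrow> complex mat" where
  "ct \<equiv> mat_adjoint"

lemma ct_dim [simp]: "dim_row (ct A) = dim_col A" "dim_col (ct A) = dim_row A"
  by (simp_all add: mat_adjoint_def mat_of_rows_def)

lemma ct_index [simp]: "i < dim_col A \<Longrightarrow> j < dim_row A \<Longrightarrow> ct A $$ (i, j) = cnj (A $$ (j, i))"
  by (simp add: mat_adjoint_def mat_of_rows_def)

lemma ct_carrier [simp]: "A \<in> carrier_mat n m \<Longrightarrow> ct A \<in> carrier_mat m n"
  by (auto intro: carrier_matI)

lemma ct_ct [simp]: "ct (ct A) = A"
  by (rule eq_matI) auto

lemma ct_mult: "dim_col A = dim_row B \<Longrightarrow> ct (A * B) = ct B * ct A"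
  by (rule eq_matI) (auto simp: scalar_prod_def ac_simps)

lemma ct_add: "dim_row A = dim_row B \<Longrightarrow> dim_col A = dim_col B \<Longrightarrow> ct (A + B) = ct A + ct B"
  by (rule eq_matI) auto

lemma ct_minus: "dim_row A = dim_row B \<Longrightarrow> dim_col A = dim_col B \<Longrightarrow> ct (A - B) = ct A - ct B"
  by (rule eq_matI) auto

lemma ct_smult: "ct (a \<cdot>\<^sub>m A) = cnj a \<cdot>\<^sub>m ct A"
  by (rule eq_matI) auto

lemma ct_one [simp]: "ct (1\<^sub>m n) = 1\<^sub>m n"
  by (rule eq_matI) auto

lemma ct_zero [simp]: "ct (0\<^sub>m n m) = 0\<^sub>m m n"
  by (rule eq_matI) auto

lemma ct_four_block:
  assumes "dim_row B = dim_row A" "dim_col C = dim_col A" "dim_row C = dim_row D" "dim_col B = dim_col D"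
  shows "ct (four_block_mat A B C D) = four_block_mat (ct A) (ct C) (ct B) (ct D)"
  by (rule eq_matI) (use assms in auto)

lemma det_ct:
  assumes "A \<in> carrier_mat n n" shows "det (ct A) = cnj (det A)"
proof -
  interpret cnj: comm_ring_hom cnj by unfold_locales auto
  have "ct A = transpose_mat (map_mat cnj A)" by (rule eq_matI) auto
  moreover have "det (transpose_mat (map_mat cnj A)) = det (map_mat cnj A)"
    using assms by (intro det_transpose[of _ n]) auto
  ultimately show ?thesis by (simp add: cnj.hom_det)
qed

text \<open>The library states the ring laws for matrices with carriers, whose indices the simplifier
  cannot instantiate; the dimension equations below are decidable by rewriting.\<close>

lemma mat_mult_assoc:
  "dim_col A = dim_row B \<Longrightarrow> dim_col B = dim_row C \<Longrightarrow> (A * B) * C = A * (B * (C :: 'a :: semiring_0 mat))"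
  by (rule assoc_mult_mat) (auto intro: carrier_matI)

lemma mat_mult_add:
  "dim_col A = dim_row B \<Longrightarrow> dim_row B = dim_row C \<Longrightarrow> dim_col B = dim_col C \<Longrightarrow>
     A * (B + C) = A * B + A * (C :: 'a :: semiring_0 mat)"
  by (rule mult_add_distrib_mat) (auto intro: carrier_matI)

lemma mat_add_mult:
  "dim_col A = dim_row C \<Longrightarrow> dim_row A = dim_row B \<Longrightarrow> dim_col A = dim_col B \<Longrightarrow>
     (A + B) * C = A * C + B * (C :: 'a :: semiring_0 mat)"
  by (rule add_mult_distrib_mat) (auto intro: carrier_matI)

lemma mat_mult_minus:
  "dim_col A = dim_row B \<Longrightarrow> dim_row B = dim_row C \<Longrightarrow> dim_col B = dim_col C \<Longrightarrow>
     A * (B - C) = A * B - A * (C :: 'a :: ring mat)"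
  by (rule mult_minus_distrib_mat) (auto intro: carrier_matI)

lemma mat_minus_mult:
  "dim_col A = dim_row C \<Longrightarrow> dim_row A = dim_row B \<Longrightarrow> dim_col A = dim_col B \<Longrightarrow>
     (A - B) * C = A * C - B * (C :: 'a :: ring mat)"
  by (rule minus_mult_distrib_mat) (auto intro: carrier_matI)

lemma mat_mult_smult:
  "dim_col A = dim_row B \<Longrightarrow> A * (k \<cdot>\<^sub>m B) = k \<cdot>\<^sub>m (A * (B :: 'a :: comm_semiring_0 mat))"
  by (rule mult_smult_distrib) (auto intro: carrier_matI)

lemma mat_smult_mult:
  "dim_col A = dim_row B \<Longrightarrow> (k \<cdot>\<^sub>m A) * B = k \<cdot>\<^sub>m (A * (B :: 'a :: comm_semiring_0 mat))"
  by (rule mult_smult_assoc_mat) (auto intro: carrier_matI)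

lemma mat_one_mult: "dim_row A = n \<Longrightarrow> 1\<^sub>m n * A = (A :: 'a :: semiring_1 mat)"
  by (rule left_mult_one_mat) (auto intro: carrier_matI)

lemma mat_mult_one: "dim_col A = n \<Longrightarrow> A * 1\<^sub>m n = (A :: 'a :: semiring_1 mat)"
  by (rule right_mult_one_mat) (auto intro: carrier_matI)

lemma mat_zero_mult: "dim_row A = n \<Longrightarrow> 0\<^sub>m m n * A = 0\<^sub>m m (dim_col (A :: 'a :: semiring_0 mat))"
  by (rule left_mult_zero_mat) (auto intro: carrier_matI)

lemma mat_mult_zero: "dim_col A = n \<Longrightarrow> A * 0\<^sub>m n m = 0\<^sub>m (dim_row (A :: 'a :: semiring_0 mat)) m"
  by (rule right_mult_zero_mat) (auto intro: carrier_matI)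

lemmas mat_ring = mat_mult_assoc mat_mult_add mat_add_mult mat_mult_minus mat_minus_mult
  mat_mult_smult mat_smult_mult mat_one_mult mat_mult_one mat_zero_mult mat_mult_zero

section \<open>Juxtaposed columns and block products\<close>

definition hcat :: "'a mat \<Rightarrow> 'a mat \<Rightarrow> 'a mat" where
  "hcat A B = mat (dim_row A) (dim_col A + dim_col B)
     (\<lambda>(i, j). if j < dim_col A then A $$ (i, j) else B $$ (i, j - dim_col A))"

lemma hcat_dim [simp]: "dim_row (hcat A B) = dim_row A" "dim_col (hcat A B) = dim_col A + dim_col B"
  by (simp_all add: hcat_def)

lemma hcat_carrier [simp]:
  "A \<in> carrier_mat n k \<Longrightarrow> B \<in> carrier_mat n l \<Longrightarrow> hcat A B \<in> carrier_mat n (k + l)"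
  by (auto intro!: carrier_matI)

lemma hcat_index: "i < dim_row A \<Longrightarrow> j < dim_col A + dim_col B \<Longrightarrow>
    hcat A B $$ (i, j) = (if j < dim_col A then A $$ (i, j) else B $$ (i, j - dim_col A))"
  by (simp add: hcat_def)

lemma mult_hcat:
  assumes "dim_col M = dim_row A" "dim_row A = dim_row B"
  shows "M * hcat A B = hcat (M * A) (M * (B :: 'a :: semiring_0 mat))"
proof (rule eq_matI)
  fix i j assume "i < dim_row (hcat (M * A) (M * B))" "j < dim_col (hcat (M * A) (M * B))"
  then show "(M * hcat A B) $$ (i, j) = hcat (M * A) (M * B) $$ (i, j)"
    using assms by (auto simp: hcat_index scalar_prod_def intro!: sum.cong)
qed (use assms in auto)

lemma ct_hcat_mult:
  assumes "dim_row A = dim_row B" "dim_row B = dim_row C" "dim_row C = dim_row D"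
  shows "ct (hcat A B) * hcat C D = four_block_mat (ct A * C) (ct A * D) (ct B * C) (ct B * D)"
proof (rule eq_matI)
  fix i j assume *: "i < dim_row (four_block_mat (ct A * C) (ct A * D) (ct B * C) (ct B * D))"
    "j < dim_col (four_block_mat (ct A * C) (ct A * D) (ct B * C) (ct B * D))"
  then have *: "i < dim_col A + dim_col B" "j < dim_col C + dim_col D" by auto
  have "(ct (hcat A B) * hcat C D) $$ (i, j) = (\<Sum>k<dim_row A. cnj (hcat A B $$ (k, i)) * hcat C D $$ (k, j))"
    using assms * by (auto simp: scalar_prod_def atLeast0LessThan)
  also have "\<dots> = four_block_mat (ct A * C) (ct A * D) (ct B * C) (ct B * D) $$ (i, j)"
    using assms * by (auto simp: hcat_index scalar_prod_def atLeast0LessThan)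
  finally show "(ct (hcat A B) * hcat C D) $$ (i, j) =
    four_block_mat (ct A * C) (ct A * D) (ct B * C) (ct B * D) $$ (i, j)" .
qed (use assms in auto)

lemma hcat_mult_four_block:
  assumes "dim_row A = dim_row B" "dim_col A = dim_row P" "dim_col B = dim_row R"
    "dim_row Q = dim_row P" "dim_row S = dim_row R" "dim_col R = dim_col P" "dim_col S = dim_col Q"
  shows "hcat A B * four_block_mat P Q R S = hcat (A * P + B * R) (A * Q + B * (S :: 'a :: comm_semiring_0 mat))"
proof (rule eq_matI)
  fix i j assume "i < dim_row (hcat (A * P + B * R) (A * Q + B * S))"
    "j < dim_col (hcat (A * P + B * R) (A * Q + B * S))"
  then have *: "i < dim_row A" "j < dim_col P + dim_col Q" using assms by auto
  have "(hcat A B * four_block_mat P Q R S) $$ (i, j) =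
      (\<Sum>k<dim_row P + dim_row R. hcat A B $$ (i, k) * four_block_mat P Q R S $$ (k, j))"
    using assms * by (auto simp: scalar_prod_def atLeast0LessThan)
  also have "\<dots> = (\<Sum>k<dim_row P. A $$ (i, k) * four_block_mat P Q R S $$ (k, j)) +
     (\<Sum>k<dim_row R. B $$ (i, k) * four_block_mat P Q R S $$ (k + dim_row P, j))"
  proof -
    have "(\<Sum>k<a + b. f k) = (\<Sum>k<a. f k) + (\<Sum>k<b. f (k + a))" for a b :: nat and f :: "nat \<Rightarrow> 'a"
      by (induction b) (auto simp: ac_simps)
    then show ?thesis using assms * by (auto simp: hcat_index intro!: sum.cong)
  qed
  also have "\<dots> = hcat (A * P + B * R) (A * Q + B * S) $$ (i, j)"
    using assms * by (auto simp: hcat_index scalar_prod_def atLeast0LessThan intro!: arg_cong2[of _ _ _ _ "(+)"] sum.cong)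
  finally show "(hcat A B * four_block_mat P Q R S) $$ (i, j) = hcat (A * P + B * R) (A * Q + B * S) $$ (i, j)" .
qed (use assms in auto)

lemma gram_index:
  "i < dim_col A \<Longrightarrow> (ct A * A) $$ (i, i) = of_real (\<Sum>k<dim_row A. (cmod (A $$ (k, i)))\<^sup>2)"
  unfolding of_real_sum
  by (auto simp: scalar_prod_def atLeast0LessThan complex_norm_square mult.commute
      simp del: of_real_power intro!: sum.cong)

text \<open>The diagonal of \<open>ct A * A\<close> consists of the squared norms of the columns, so
  already its vanishing forces \<open>A\<close> to vanish.\<close>

lemma gram_eq_0_iff: "ct A * A = 0\<^sub>m (dim_col A) (dim_col A) \<longleftrightarrow> A = 0\<^sub>m (dim_row A) (dim_col A)"
proof
  assume *: "ct A * A = 0\<^sub>m (dim_col A) (dim_col A)"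
  have "A $$ (k, i) = 0" if "k < dim_row A" "i < dim_col A" for k i
  proof -
    have "(\<Sum>k<dim_row A. (cmod (A $$ (k, i)))\<^sup>2) = 0"
      using gram_index[OF that(2)] * that(2) by (metis index_zero_mat(1) of_real_eq_0_iff)
    then show ?thesis using that by (simp add: sum_nonneg_eq_0_iff)
  qed
  then show "A = 0\<^sub>m (dim_row A) (dim_col A)" by (intro eq_matI) auto
next
  assume *: "A = 0\<^sub>m (dim_row A) (dim_col A)"
  show "ct A * A = 0\<^sub>m (dim_col A) (dim_col A)"
    by (subst (2) *) (simp add: mat_mult_zero)
qed

text \<open>Vectors are n by 1 matrices throughout, so that adjoints, forms and the rules
  \<open>mat_ring\<close> apply to them without conversion; this is the bridge from kernels stated
  with vectors.\<close>

lemma det_zero_iff_kernel: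
  fixes A :: "'a :: field mat"
  assumes A: "A \<in> carrier_mat n n"
  shows "det A = 0 \<longleftrightarrow> (\<exists>x \<in> carrier_mat n 1. x \<noteq> 0\<^sub>m n 1 \<and> A * x = 0\<^sub>m n 1)"
proof -
  have "(\<exists>v. v \<in> carrier_vec n \<and> v \<noteq> 0\<^sub>v n \<and> A *\<^sub>v v = 0\<^sub>v n) \<longleftrightarrow>
     (\<exists>x \<in> carrier_mat n 1. x \<noteq> 0\<^sub>m n 1 \<and> A * x = 0\<^sub>m n 1)"
  proof safe
    fix v :: "'a vec" assume v: "v \<in> carrier_vec n" "v \<noteq> 0\<^sub>v n" "A *\<^sub>v v = 0\<^sub>v n"
    let ?x = "mat n 1 (\<lambda>(i, j). v $ i)"
    have "?x \<noteq> 0\<^sub>m n 1"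
    proof
      assume "?x = 0\<^sub>m n 1"
      then have "v $ i = 0" if "i < n" for i
        using that by (metis (no_types, lifting) case_prod_conv index_mat(1) index_zero_mat(1) less_one)
      with v show False by (auto simp: vec_eq_iff)
    qed
    have "vec n (($) v) = v" using v by (intro eq_vecI) auto
    moreover have "row A i \<bullet> v = 0" if "i < n" for i
      using that A arg_cong[OF v(3), of "\<lambda>w. w $ i"] by simp
    ultimately have "(A * ?x) $$ (i, 0) = 0" if "i < n" for i
      using A that by simp
    then have "A * ?x = 0\<^sub>m n 1"
      using A by (intro eq_matI) auto
    moreover note \<open>?x \<noteq> 0\<^sub>m n 1\<close>
    ultimately show "\<exists>x \<in> carrier_mat n 1. x \<noteq> 0\<^sub>m n 1 \<and> A * x = 0\<^sub>m n 1" by (intro bexI[of _ ?x]) auto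
  next
    fix x :: "'a mat" assume x: "x \<in> carrier_mat n 1" "x \<noteq> 0\<^sub>m n 1" "A * x = 0\<^sub>m n 1"
    let ?v = "col x 0"
    have "?v \<noteq> 0\<^sub>v n"
    proof
      assume "?v = 0\<^sub>v n"
      then have "?v $ i = 0" if "i < n" for i
        using that by simp
      then have "x $$ (i, 0) = 0" if "i < n" for i
        using that x(1) by simp
      then have "x = 0\<^sub>m n 1" using x(1) by (intro eq_matI) auto
      with x show False by simp
    qed
    moreover have "A *\<^sub>v ?v = 0\<^sub>v n"
    proof (rule eq_vecI)
      fix i assume "i < dim_vec (0\<^sub>v n :: 'a vec)"
      moreover from this have "(A * x) $$ (i, 0) = 0" by (simp add: x(3))
      ultimately show "(A *\<^sub>v ?v) $ i = 0\<^sub>v n $ i" using x(1) A by simp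
    qed (use A in auto)
    ultimately show "\<exists>v. v \<in> carrier_vec n \<and> v \<noteq> 0\<^sub>v n \<and> A *\<^sub>v v = 0\<^sub>v n" using x by (intro exI[of _ ?v]) auto
  qed
  then show ?thesis using det_0_iff_vec_prod_zero_field[OF A] by auto
qed

lemma det_nonzero_inverse:
  fixes A :: "'a :: field mat"
  assumes A: "A \<in> carrier_mat n n" and "det A \<noteq> 0"
  obtains B where "B \<in> carrier_mat n n" "A * B = 1\<^sub>m n" "B * A = 1\<^sub>m n"
  using det_non_zero_imp_unit[OF A assms(2)] unfolding Units_def ring_mat_def by auto

lemma det_nonzero_left_inverse:
  fixes A :: "'a :: field mat"
  assumes "A \<in> carrier_mat n n" "B \<in> carrier_mat n n" "B * A = 1\<^sub>m n"
  shows "det A \<noteq> 0" "A * B = 1\<^sub>m n"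
proof -
  have "det B * det A = 1" using assms det_mult[of B n A] by simp
  then show "det A \<noteq> 0" by auto
  then obtain C where C: "C \<in> carrier_mat n n" "A * C = 1\<^sub>m n" using det_nonzero_inverse[OF assms(1)] by metis
  have "B = B * (A * C)" using assms C by (simp add: mat_mult_one)
  also have "\<dots> = (B * A) * C" using assms C by (intro mat_mult_assoc[symmetric]) auto
  also have "\<dots> = C" using assms C by (simp add: mat_one_mult)
  finally show "A * B = 1\<^sub>m n" using C by simp
qed

lemma mat_1_1_eq: "A \<in> carrier_mat 1 1 \<Longrightarrow> A = (A $$ (0, 0) :: 'a :: semiring_1) \<cdot>\<^sub>m 1\<^sub>m 1"
  by (rule eq_matI) auto

section \<open>Completion of a vector to a basis\<close>

lemma exists_completion:
  fixes x :: "'a :: field mat"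
  assumes x: "x \<in> carrier_mat (Suc n) 1" "x \<noteq> 0\<^sub>m (Suc n) 1"
  shows "\<exists>Y \<in> carrier_mat (Suc n) n. det (hcat x Y) \<noteq> 0"
proof -
  obtain k where k: "k < Suc n" "x $$ (k, 0) \<noteq> 0"
    using x by (metis (no_types, lifting) carrier_matD eq_matI index_zero_mat less_one)
  \<comment> \<open>The standard basis vectors other than the one at position \<open>k\<close>,
    where \<open>x\<close> has a nonzero entry; the index \<open>if j < k then j else Suc j\<close>
    skips \<open>k\<close>.\<close>
  define Y :: "'a mat" where "Y = mat (Suc n) n (\<lambda>(i, j). if i = (if j < k then j else Suc j) then 1 else 0)"
  have Y: "Y \<in> carrier_mat (Suc n) n" by (simp add: Y_def)
  have XY: "hcat x Y \<in> carrier_mat (Suc n) (Suc n)" using hcat_carrier[OF x(1) Y] by simp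
  have "det (hcat x Y) \<noteq> 0"
  proof
    assume "det (hcat x Y) = 0"
    then obtain v where v: "v \<in> carrier_mat (Suc n) 1" "v \<noteq> 0\<^sub>m (Suc n) 1" "hcat x Y * v = 0\<^sub>m (Suc n) 1"
      using det_zero_iff_kernel[OF XY] by auto
    have e: "x $$ (i, 0) * v $$ (0, 0) + (\<Sum>j<n. Y $$ (i, j) * v $$ (Suc j, 0)) = 0" if "i < Suc n" for i
    proof -
      have "(hcat x Y * v) $$ (i, 0) = (\<Sum>j<Suc n. hcat x Y $$ (i, j) * v $$ (j, 0))"
        using that v(1) x Y by (auto simp: scalar_prod_def atLeast0LessThan)
      also have "\<dots> = x $$ (i, 0) * v $$ (0, 0) + (\<Sum>j<n. Y $$ (i, j) * v $$ (Suc j, 0))"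
        unfolding sum.lessThan_Suc_shift using that x Y by (auto simp: hcat_index intro!: sum.cong)
      finally show ?thesis using v(3) that by simp
    qed
    have "(\<Sum>j<n. Y $$ (k, j) * v $$ (Suc j, 0)) = 0"
      using k by (intro sum.neutral) (auto simp: Y_def)
    then have v0: "v $$ (0, 0) = 0" using e[OF k(1)] k(2) by auto
    have "v $$ (Suc j, 0) = 0" if j: "j < n" for j
    proof -
      let ?i = "if j < k then j else Suc j"
      have i: "?i < Suc n" using j k by auto
      have "(\<Sum>l<n. Y $$ (?i, l) * v $$ (Suc l, 0)) = (\<Sum>l<n. if l = j then v $$ (Suc j, 0) else 0)"
        using i j by (intro sum.cong) (auto simp: Y_def)
      then show ?thesis using e[OF i] j v0 by auto
    qed
    with v0 have "v $$ (i, 0) = 0" if "i < Suc n" for i using that by (cases i) auto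
    with v show False by (auto intro!: eq_matI)
  qed
  with Y show ?thesis by auto
qed

text \<open>A vector on which the form does not vanish splits off even from an indefinite form: each
  vector of an arbitrary completion is corrected by a multiple of \<open>x\<close>. The passage from
  \<open>hcat x Y\<close> to \<open>hcat x Z\<close> is unitriangular and keeps the
  determinant.\<close>

lemma exists_orthogonal_completion:
  assumes J: "J \<in> carrier_mat (Suc n) (Suc n)" and x: "x \<in> carrier_mat (Suc n) 1"
    and a: "ct x * J * x = a \<cdot>\<^sub>m 1\<^sub>m 1" "a \<noteq> 0"
  shows "\<exists>Y \<in> carrier_mat (Suc n) n. det (hcat x Y) \<noteq> 0 \<and> ct x * J * Y = 0\<^sub>m 1 n"
proof -
  have "x \<noteq> 0\<^sub>m (Suc n) 1"
  proof
    assume "x = 0\<^sub>m (Suc n) 1"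
    then have "a \<cdot>\<^sub>m 1\<^sub>m 1 = (0\<^sub>m 1 1 :: complex mat)" using a(1) J by (simp add: mat_mult_zero)
    from arg_cong[OF this, of "\<lambda>M. M $$ (0, 0)"] show False using a(2) by simp
  qed
  then obtain Y where Y: "Y \<in> carrier_mat (Suc n) n" "det (hcat x Y) \<noteq> 0"
    using exists_completion[OF x] by auto
  define b where "b = (-1 / a) \<cdot>\<^sub>m (ct x * J * Y)"
  have b: "b \<in> carrier_mat 1 n" using x Y J by (auto simp: b_def)
  define Z where "Z = x * b + Y"
  have Z: "Z \<in> carrier_mat (Suc n) n" using x Y b by (auto simp: Z_def)
  have "hcat x Y * four_block_mat (1\<^sub>m 1) b (0\<^sub>m n 1) (1\<^sub>m n) = hcat x Z"
    using x Y b by (subst hcat_mult_four_block) (auto simp: Z_def mat_ring)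
  moreover have "det (four_block_mat (1\<^sub>m 1) b (0\<^sub>m n 1) (1\<^sub>m n)) = 1"
    using b by (subst det_four_block_mat_lower_left_zero[of _ 1 _ n]) auto
  moreover have "hcat x Y \<in> carrier_mat (Suc n) (Suc n)" using hcat_carrier[OF x Y(1)] by simp
  moreover have "four_block_mat (1\<^sub>m 1) b (0\<^sub>m n 1) (1\<^sub>m n) \<in> carrier_mat (Suc n) (Suc n)"
    using four_block_carrier_mat[of "1\<^sub>m 1" 1 1 "1\<^sub>m n" n n] by simp
  ultimately have "det (hcat x Z) \<noteq> 0" using Y(2) by (metis det_mult mult.right_neutral)
  moreover have "ct x * J * Z = 0\<^sub>m 1 n"
  proof -
    have "ct x * J * Z = (ct x * J * x) * b + ct x * J * Y"
      using x J Y b unfolding Z_def by (simp add: mat_ring)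
    also have "\<dots> = a \<cdot>\<^sub>m b + ct x * J * Y" using a b by (simp add: mat_ring)
    also have "\<dots> = 0\<^sub>m 1 n" using a x Y J unfolding b_def by (intro eq_matI) auto
    finally show ?thesis .
  qed
  ultimately show ?thesis using Z by auto
qed

lemma scalar_1_1: "A \<in> carrier_mat 1 1 \<Longrightarrow> \<exists>a :: complex. A = a \<cdot>\<^sub>m 1\<^sub>m 1"
  using mat_1_1_eq by blast

lemma smult_one_1_eq_iff: "a \<cdot>\<^sub>m 1\<^sub>m (Suc 0) = (b \<cdot>\<^sub>m 1\<^sub>m (Suc 0) :: complex mat) \<longleftrightarrow> a = b"
proof
  assume "a \<cdot>\<^sub>m 1\<^sub>m (Suc 0) = (b \<cdot>\<^sub>m 1\<^sub>m (Suc 0) :: complex mat)"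
  from arg_cong[OF this, of "\<lambda>M. M $$ (0, 0)"] show "a = b" by simp
qed simp

lemma hermitian_form_real:
  assumes J: "J \<in> carrier_mat n n" "ct J = J" and x: "x \<in> carrier_mat n 1"
  shows "\<exists>a :: real. ct x * J * x = of_real a \<cdot>\<^sub>m 1\<^sub>m 1"
proof -
  have "ct x * J * x \<in> carrier_mat 1 1" using J x by (auto intro!: carrier_matI)
  then obtain a where a: "ct x * J * x = a \<cdot>\<^sub>m 1\<^sub>m 1" using scalar_1_1 by blast
  have "ct (ct x * J * x) = ct x * J * x" using J x by (simp add: ct_mult mat_mult_assoc)
  then have "a = cnj a" by (simp add: a ct_smult smult_one_1_eq_iff)
  then show ?thesis using a by (metis Reals_cnj_iff Reals_cases)
qed

lemma gram_form:
  assumes x: "x \<in> carrier_mat n 1"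
  shows "\<exists>r \<ge> 0. ct x * x = of_real r \<cdot>\<^sub>m 1\<^sub>m 1 \<and> (r = 0 \<longleftrightarrow> x = 0\<^sub>m n 1)"
proof -
  define r where "r = (\<Sum>k<dim_row x. (cmod (x $$ (k, 0)))\<^sup>2)"
  have "(ct x * x) $$ (0, 0) = of_real r"
    unfolding r_def using x by (intro gram_index) auto
  moreover have "ct x * x \<in> carrier_mat 1 1" using x by (auto intro!: carrier_matI)
  ultimately have e: "ct x * x = of_real r \<cdot>\<^sub>m 1\<^sub>m 1" by (subst mat_1_1_eq) auto
  have "r = 0 \<longleftrightarrow> ct x * x = 0\<^sub>m 1 1"
  proof
    assume "ct x * x = 0\<^sub>m 1 1"
    then have "(of_real r \<cdot>\<^sub>m 1\<^sub>m 1 :: complex mat) = 0 \<cdot>\<^sub>m 1\<^sub>m 1" using e by (auto intro!: eq_matI)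
    then show "r = 0" by (simp add: smult_one_1_eq_iff)
  qed (use e in \<open>auto intro!: eq_matI\<close>)
  then show ?thesis using e gram_eq_0_iff[of x] x by (intro exI[of _ r]) (auto simp: r_def sum_nonneg)
qed

text \<open>With column matrices as vectors, a form takes values in 1 by 1 matrices; asking for a
  positive real multiple of the identity states realness and positivity in one clause.\<close>

definition posdef :: "nat \<Rightarrow> complex mat \<Rightarrow> bool" where
  "posdef n P \<longleftrightarrow> P \<in> carrier_mat n n \<and> ct P = P \<and>
     (\<forall>x \<in> carrier_mat n 1. x \<noteq> 0\<^sub>m n 1 \<longrightarrow> (\<exists>r > 0. ct x * P * x = of_real r \<cdot>\<^sub>m 1\<^sub>m 1))"

text \<open>The coefficients \<open>w\<close> are padded with zeros in the directions of
  \<open>x\<close>, which turns a relation among the columns of \<open>Y\<close> into a kernel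
  vector of the invertible matrix \<open>hcat x Y\<close>.\<close>

lemma injective_mult:
  fixes Y :: "complex mat"
  assumes x: "x \<in> carrier_mat n k" and Y: "Y \<in> carrier_mat n m" and "n = k + m"
    and d: "det (hcat x Y) \<noteq> 0"
    and w: "w \<in> carrier_mat m 1" "w \<noteq> 0\<^sub>m m 1"
  shows "Y * w \<noteq> 0\<^sub>m n 1"
proof
  assume *: "Y * w = 0\<^sub>m n 1"
  define v where "v = four_block_mat (0\<^sub>m k 1) (0\<^sub>m k 0) w (0\<^sub>m m 0)"
  have v: "v \<in> carrier_mat n 1" using w assms(3) by (auto simp: v_def intro!: carrier_matI)
  have "hcat x Y * v = hcat (Y * w) (0\<^sub>m n 0)"
    unfolding v_def using x Y w * by (subst hcat_mult_four_block) (auto simp: mat_ring)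
  also have "\<dots> = 0\<^sub>m n 1" using * by (intro eq_matI) (auto simp: hcat_index)
  finally have "hcat x Y * v = 0\<^sub>m n 1" .
  moreover have "v \<noteq> 0\<^sub>m n 1"
  proof
    assume v0: "v = 0\<^sub>m n 1"
    have "w $$ (i, 0) = 0" if "i < m" for i
    proof -
      have "v $$ (k + i, 0) = 0" using that assms(3) by (simp add: v0)
      then show ?thesis using that w(1) by (simp add: v_def)
    qed
    with w show False by (auto intro!: eq_matI)
  qed
  ultimately show False using det_zero_iff_kernel[of "hcat x Y" n] hcat_carrier[OF x Y] assms(3) d v by auto
qed

lemma posdef_compression:
  fixes P :: "complex mat"
  assumes P: "posdef n P" and Y: "Y \<in> carrier_mat n m"
    and inj: "\<And>w. w \<in> carrier_mat m 1 \<Longrightarrow> w \<noteq> 0\<^sub>m m 1 \<Longrightarrow> Y * w \<noteq> 0\<^sub>m n 1"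
  shows "posdef m (ct Y * P * Y)"
  unfolding posdef_def
proof (intro conjI ballI impI)
  have Pc: "P \<in> carrier_mat n n" "ct P = P" using P by (auto simp: posdef_def)
  show "ct Y * P * Y \<in> carrier_mat m m" using Pc Y by (auto intro!: carrier_matI)
  show "ct (ct Y * P * Y) = ct Y * P * Y" using Pc Y by (simp add: ct_mult mat_mult_assoc)
  fix w :: "complex mat" assume w: "w \<in> carrier_mat m 1" "w \<noteq> 0\<^sub>m m 1"
  have "Y * w \<in> carrier_mat n 1" using Y w by auto
  moreover have "ct w * (ct Y * P * Y) * w = ct (Y * w) * P * (Y * w)"
    using w Y Pc by (simp add: ct_mult mat_mult_assoc)
  ultimately show "\<exists>r>0. ct w * (ct Y * P * Y) * w = of_real r \<cdot>\<^sub>m 1\<^sub>m 1"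
    using P inj[OF w] by (auto simp: posdef_def)
qed

text \<open>Gram--Schmidt for the inner product given by \<open>P\<close>; the first vector may be prescribed up to
  scaling.\<close>

lemma posdef_orthonormal_basis:
  assumes "posdef n P"
  shows "\<exists>X \<in> carrier_mat n n. ct X * P * X = 1\<^sub>m n"
    and "x \<in> carrier_mat n 1 \<Longrightarrow> x \<noteq> 0\<^sub>m n 1 \<Longrightarrow>
      \<exists>Y \<in> carrier_mat n (n - 1). \<exists>a. a \<noteq> 0 \<and> ct (hcat (a \<cdot>\<^sub>m x) Y) * P * hcat (a \<cdot>\<^sub>m x) Y = 1\<^sub>m n"
  using assms
proof (induction n arbitrary: P x)
  case 0
  {
    case 1
    show ?case by (intro bexI[of _ "1\<^sub>m 0"]) auto
  next
    case 2
    then show ?case by (auto intro!: eq_matI)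
  }
next
  case (Suc n)
  have step: "\<exists>Y \<in> carrier_mat (Suc n) n. \<exists>a. a \<noteq> 0 \<and> ct (hcat (a \<cdot>\<^sub>m x) Y) * P * hcat (a \<cdot>\<^sub>m x) Y = 1\<^sub>m (Suc n)"
    if P: "posdef (Suc n) P" and x: "x \<in> carrier_mat (Suc n) 1" "x \<noteq> 0\<^sub>m (Suc n) 1" for P x
  proof -
    have Pc: "P \<in> carrier_mat (Suc n) (Suc n)" "ct P = P" using P by (auto simp: posdef_def)
    obtain r where r: "r > 0" "ct x * P * x = complex_of_real r \<cdot>\<^sub>m 1\<^sub>m 1" using P x by (auto simp: posdef_def)
    obtain Y where Y: "Y \<in> carrier_mat (Suc n) n" "det (hcat x Y) \<noteq> 0" "ct x * P * Y = 0\<^sub>m 1 n"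
      using exists_orthogonal_completion[OF Pc(1) x(1) r(2)] r(1) by auto
    have "posdef n (ct Y * P * Y)"
      using injective_mult[OF x(1) Y(1) _ Y(2)] by (intro posdef_compression[OF P Y(1)]) auto
    from Suc.IH(1)[OF this] obtain Z where Z: "Z \<in> carrier_mat n n" "ct Z * (ct Y * P * Y) * Z = 1\<^sub>m n" by auto
    define a where "a = complex_of_real (1 / sqrt r)"
    have a: "a \<noteq> 0" "cnj a * a * of_real r = 1"
      using r(1) by (auto simp: a_def field_simps simp flip: of_real_mult)
    have "ct Y * P * x = ct (ct x * P * Y)"
      using x Y(1) Pc by (simp add: ct_mult mat_mult_assoc)
    then have z: "ct Y * P * x = 0\<^sub>m n 1" by (simp add: Y(3))
    have W: "Y * Z \<in> carrier_mat (Suc n) n" using Y Z by auto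
    have "ct (hcat (a \<cdot>\<^sub>m x) (Y * Z)) * P * hcat (a \<cdot>\<^sub>m x) (Y * Z) =
       ct (hcat (a \<cdot>\<^sub>m x) (Y * Z)) * hcat (P * (a \<cdot>\<^sub>m x)) (P * (Y * Z))"
      using x Y Z Pc by (simp add: mat_mult_assoc mult_hcat)
    also have "\<dots> = four_block_mat (ct (a \<cdot>\<^sub>m x) * (P * (a \<cdot>\<^sub>m x))) (ct (a \<cdot>\<^sub>m x) * (P * (Y * Z)))
        (ct (Y * Z) * (P * (a \<cdot>\<^sub>m x))) (ct (Y * Z) * (P * (Y * Z)))"
      using x Y Z Pc by (subst ct_hcat_mult) auto
    also have "ct (a \<cdot>\<^sub>m x) * (P * (a \<cdot>\<^sub>m x)) = (cnj a * a) \<cdot>\<^sub>m (ct x * P * x)"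
      using x Pc by (simp add: ct_smult mat_ring; auto intro!: eq_matI)
    also have "\<dots> = 1\<^sub>m 1" using a(2) by (simp add: r(2); auto intro!: eq_matI)
    also have "ct (a \<cdot>\<^sub>m x) * (P * (Y * Z)) = 0\<^sub>m 1 n"
    proof -
      have "ct x * (P * (Y * Z)) = (ct x * P * Y) * Z" using x Pc Y(1) Z by (simp add: mat_ring)
      also have "\<dots> = 0\<^sub>m 1 n" using Z by (simp only: Y(3)) (simp add: mat_ring)
      finally show ?thesis using x Pc Y(1) Z by (simp add: ct_smult mat_ring)
    qed
    also have "ct (Y * Z) * (P * (a \<cdot>\<^sub>m x)) = a \<cdot>\<^sub>m (ct Z * (ct Y * P * x))"
      using x Pc Y Z by (simp add: ct_mult mat_ring)
    also have "\<dots> = 0\<^sub>m n 1" using Z by (simp add: z mat_ring; auto intro!: eq_matI)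
    also have "ct (Y * Z) * (P * (Y * Z)) = 1\<^sub>m n"
      using Z Y Pc by (simp add: ct_mult mat_ring)
    finally show ?thesis using W a(1) by auto
  qed
  {
    case 1
    define e :: "complex mat" where "e = mat (Suc n) 1 (\<lambda>_. 1)"
    have "e \<in> carrier_mat (Suc n) 1" "e \<noteq> 0\<^sub>m (Suc n) 1"
      by (auto simp: e_def dest!: arg_cong[of _ _ "\<lambda>M. M $$ (0, 0)"])
    from step[OF 1 this] obtain Y a where "Y \<in> carrier_mat (Suc n) n"
      "ct (hcat (a \<cdot>\<^sub>m e) Y) * P * hcat (a \<cdot>\<^sub>m e) Y = 1\<^sub>m (Suc n)" by auto
    then show ?case by (intro bexI[of _ "hcat (a \<cdot>\<^sub>m e) Y"]) (auto simp: e_def intro!: carrier_matI)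
  next
    case 2
    from step[OF 2(3,1,2)] show ?case by simp
  }
qed

lemma posdef_one: "posdef n (1\<^sub>m n)"
  unfolding posdef_def
proof (intro conjI ballI impI)
  fix x :: "complex mat" assume x: "x \<in> carrier_mat n 1" "x \<noteq> 0\<^sub>m n 1"
  then show "\<exists>r>0. ct x * 1\<^sub>m n * x = of_real r \<cdot>\<^sub>m 1\<^sub>m 1"
    using gram_form[OF x(1)] by (auto simp: mat_ring less_le)
qed auto

lemma unitary_completion:
  assumes x: "x \<in> carrier_mat (Suc n) 1" "x \<noteq> 0\<^sub>m (Suc n) 1"
  obtains Y a where "Y \<in> carrier_mat (Suc n) n" "a \<noteq> 0" "ct (hcat (a \<cdot>\<^sub>m x) Y) * hcat (a \<cdot>\<^sub>m x) Y = 1\<^sub>m (Suc n)"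
  using posdef_orthonormal_basis(2)[OF posdef_one x] x
  by (auto simp: mat_mult_one)

text \<open>The argument is a list of zeros rather than of signs: a zero in the upper half plane
  contributes a negative square. One list thus carries both the factorization of a polynomial in
  \<open>y\<close> and the inertia of its matrix coefficient.\<close>

definition sign_mat :: "complex list \<Rightarrow> complex mat" where
  "sign_mat ls = mat (length ls) (length ls) (\<lambda>(i, j). if i = j then (if Im (ls ! i) > 0 then -1 else 1) else 0)"

lemma sign_mat_carrier [simp]: "sign_mat ls \<in> carrier_mat (length ls) (length ls)"
  by (simp add: sign_mat_def)

lemma sign_mat_dim [simp]: "dim_row (sign_mat ls) = length ls" "dim_col (sign_mat ls) = length ls"
  by (simp_all add: sign_mat_def)

lemma sign_mat_append:
  "sign_mat (ls @ ls') = four_block_mat (sign_mat ls) (0\<^sub>m (length ls) (length ls')) (0\<^sub>m (length ls') (length ls)) (sign_mat ls')"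
  by (rule eq_matI) (auto simp: sign_mat_def nth_append)

lemma ct_sign_mat [simp]: "ct (sign_mat ls) = sign_mat ls"
  by (rule eq_matI) (auto simp: sign_mat_def)

lemma sign_mat_square: "sign_mat ls * sign_mat ls = 1\<^sub>m (length ls)"
proof (rule eq_matI)
  fix i j assume ij: "i < dim_row (1\<^sub>m (length ls))" "j < dim_col (1\<^sub>m (length ls))"
  have "(sign_mat ls * sign_mat ls) $$ (i, j) = (\<Sum>k<length ls. sign_mat ls $$ (i, k) * sign_mat ls $$ (k, j))"
    using ij by (auto simp: scalar_prod_def atLeast0LessThan)
  also have "\<dots> = (\<Sum>k<length ls. if k = i then (if i = j then 1 else 0) else 0)"
    using ij by (intro sum.cong) (auto simp: sign_mat_def)
  finally show "(sign_mat ls * sign_mat ls) $$ (i, j) = 1\<^sub>m (length ls) $$ (i, j)" using ij by auto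
qed auto

section \<open>Schur complements and rank certificates\<close>

lemma det_schur_complement:
  fixes A :: "complex mat"
  assumes A: "A \<in> carrier_mat n n" and B: "B \<in> carrier_mat n m" and C: "C \<in> carrier_mat m n"
    and D: "D \<in> carrier_mat m m" and E: "E \<in> carrier_mat m m" "D * E = 1\<^sub>m m"
  shows "det (four_block_mat A B C D) = det (A - B * E * C) * det D"
proof -
  have ED: "E * D = 1\<^sub>m m" using det_nonzero_left_inverse(2)[OF E(1) D E(2)] .
  have "four_block_mat A B C D * four_block_mat (1\<^sub>m n) (0\<^sub>m n m) (- (E * C)) (1\<^sub>m m) =
    four_block_mat (A - B * E * C) B (C - D * (E * C)) D"
  proof -
    have u: "M * (- N) = - (M * N)" if "dim_col M = dim_row N" for M N :: "complex mat"
      using that by (intro eq_matI) (auto simp: scalar_prod_def sum_negf)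
    have "A + - (B * (E * C)) = A - B * (E * C)" "C + - (D * (E * C)) = C - D * (E * C)"
      using assms by (auto intro!: eq_matI)
    then show ?thesis
      using A B C D E by (subst mult_four_block_mat[of _ n n _ m _ m]) (auto simp: mat_ring u)
  qed
  also have "D * (E * C) = C" using C D E by (simp add: mat_mult_assoc[symmetric] mat_one_mult del: mat_mult_assoc)
  also have "C - C = 0\<^sub>m m n" using C by (auto intro!: eq_matI)
  finally have "det (four_block_mat A B C D) * det (four_block_mat (1\<^sub>m n) (0\<^sub>m n m) (- (E * C)) (1\<^sub>m m)) =
      det (four_block_mat (A - B * E * C) B (0\<^sub>m m n) D)"
    using A B C D E by (subst det_mult[symmetric, of _ "n + m"]) auto
  also have "det (four_block_mat (1\<^sub>m n) (0\<^sub>m n m) (- (E * C)) (1\<^sub>m m)) = 1"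
    using C E by (subst det_four_block_mat_upper_right_zero[of _ n _ m]) auto
  also have "det (four_block_mat (A - B * E * C) B (0\<^sub>m m n) D) = det (A - B * E * C) * det D"
    using A B C D E by (subst det_four_block_mat_lower_left_zero[of _ n _ m]) auto
  finally show ?thesis by simp
qed

text \<open>The left inverse of \<open>U\<close> makes its columns distinct and independent; the
  right inverse of \<open>V\<close> gives \<open>U = A * V'\<close>, so \<open>A\<close> and
  \<open>U\<close> have the same column space. One-sided inverses therefore act as certificates of
  rank.\<close>

lemma rank_eq_factor:
  fixes A :: "complex mat"
  assumes A: "A = U * V" and U: "U \<in> carrier_mat n k" "U' \<in> carrier_mat k n" "U' * U = 1\<^sub>m k"
    and V: "V \<in> carrier_mat k m" "V' \<in> carrier_mat m k" "V * V' = 1\<^sub>m k"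
  shows "vec_space.rank n A = k"
proof -
  interpret vec_space "TYPE(complex)" n .
  have sub: "span (set (cols (B * C))) \<subseteq> span (set (cols B))"
    if B: "B \<in> carrier_mat n p" and C: "C \<in> carrier_mat p q" for B C :: "complex mat" and p q
  proof -
    have BC: "B * C \<in> carrier_mat n q" using B C by auto
    have "\<exists>z\<in>carrier_vec p. B *\<^sub>v z = B * C *\<^sub>v x" if "x \<in> carrier_vec q" for x
      using that B C by (intro bexI[of _ "C *\<^sub>v x"]) (auto simp: assoc_mult_mat_vec)
    then show ?thesis
      using col_space_eq[OF B] col_space_eq[OF BC] B C by (auto simp: col_space_def)
  qed
  have "U = A * V'" using A U V by (simp add: mat_mult_assoc mat_mult_one)
  then have "span (set (cols A)) = span (set (cols U))"
    using sub[OF U(1) V(1)] sub[of A m V' k] A U(1) V by auto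
  then have "rank A = rank U" by (simp add: rank_def)
  also have "rank U = k"
  proof (rule lin_indpt_full_rank[OF U(1)])
    have inj: "v = 0\<^sub>v k" if "v \<in> carrier_vec k" "U *\<^sub>v v = 0\<^sub>v n" for v
    proof -
      have "v = (U' * U) *\<^sub>v v" using that U by simp
      also have "\<dots> = U' *\<^sub>v (U *\<^sub>v v)" using that U by (intro assoc_mult_mat_vec) auto
      also have "\<dots> = 0\<^sub>v k" using that U by auto
      finally show ?thesis .
    qed
    show dist: "distinct (cols U)"
      unfolding distinct_conv_nth
    proof (intro allI impI notI)
      fix i j assume ij: "i < length (cols U)" "j < length (cols U)" "i \<noteq> j" "cols U ! i = cols U ! j"
      then have "col U i = col U j" using U by auto
      moreover have "row U' i \<bullet> col U i = (U' * U) $$ (i, i)" "row U' i \<bullet> col U j = (U' * U) $$ (i, j)"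
        using ij(1,2) U(1,2) by auto
      ultimately show False using ij(1-3) U(1) by (simp add: U(3))
    qed
    show "lin_indpt (set (cols U))"
      using lin_depE[OF U(1) _ dist] inj by metis
  qed
  finally show ?thesis .
qed

section \<open>Inertia of dissipative pencils\<close>

text \<open>The two orthogonality conditions say that the adjoint of an invertible matrix
  annihilates \<open>v\<close>.\<close>

lemma orthogonal_to_basis_eq_0:
  assumes x: "x \<in> carrier_mat n k" and Y: "Y \<in> carrier_mat n m" and n: "n = k + m"
    and d: "det (hcat x Y) \<noteq> 0" and v: "v \<in> carrier_mat n 1"
    and "ct x * v = 0\<^sub>m k 1" "ct Y * v = 0\<^sub>m m 1"
  shows "v = 0\<^sub>m n 1"
proof (rule ccontr)
  assume "v \<noteq> 0\<^sub>m n 1"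
  have B: "hcat x Y \<in> carrier_mat n n" using hcat_carrier[OF x Y] n by simp
  have "(ct (hcat x Y) * v) $$ (i, 0) = 0" if i: "i < n" for i
  proof -
    have "(ct (hcat x Y) * v) $$ (i, 0) = (\<Sum>j<n. cnj (hcat x Y $$ (j, i)) * v $$ (j, 0))"
      using x Y v n i by (auto simp: scalar_prod_def atLeast0LessThan)
    also have "\<dots> = (if i < k then (ct x * v) $$ (i, 0) else (ct Y * v) $$ (i - k, 0))"
      using x Y v n i by (auto simp: scalar_prod_def atLeast0LessThan hcat_index)
    also have "\<dots> = 0" using assms(6,7) n i by auto
    finally show ?thesis .
  qed
  then have "ct (hcat x Y) * v = 0\<^sub>m n 1" using B v by (intro eq_matI) auto
  then have "det (ct (hcat x Y)) = 0"
    using det_zero_iff_kernel[of "ct (hcat x Y)" n] B v \<open>v \<noteq> _\<close> by auto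
  then show False using det_ct[OF B] d by simp
qed

text \<open>The pencil is singular exactly at the eigenvalues of \<open>- K * S\<close>, where
  \<open>K\<close> inverts \<open>J\<close>, and a characteristic polynomial of positive degree has
  a complex root.\<close>

lemma exists_pencil_kernel:
  fixes J S :: "complex mat"
  assumes J: "J \<in> carrier_mat (Suc n) (Suc n)" "det J \<noteq> 0" and S: "S \<in> carrier_mat (Suc n) (Suc n)"
  shows "\<exists>l. \<exists>x \<in> carrier_mat (Suc n) 1. x \<noteq> 0\<^sub>m (Suc n) 1 \<and> (l \<cdot>\<^sub>m J + S) * x = 0\<^sub>m (Suc n) 1"
proof -
  obtain K where K: "K \<in> carrier_mat (Suc n) (Suc n)" "J * K = 1\<^sub>m (Suc n)"
    using det_nonzero_inverse[OF J] by metis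
  define A where "A = (-1) \<cdot>\<^sub>m (K * S)"
  have A: "A \<in> carrier_mat (Suc n) (Suc n)" using K S by (auto simp: A_def)
  have "degree (char_poly A) = Suc n" using degree_monic_char_poly[OF A] by simp
  then obtain l where "poly (char_poly A) l = 0"
    using fundamental_theorem_of_algebra[of "char_poly A"] by (auto simp: constant_degree)
  then have "det (char_matrix A l) = 0"
    using eigenvalue_root_char_poly[OF A] eigenvalue_det[OF A] by auto
  moreover have "(l \<cdot>\<^sub>m J + S) = (-1) \<cdot>\<^sub>m (J * char_matrix A l)"
  proof -
    have "J * (K * S) = (J * K) * S" using J K S by (intro mat_mult_assoc[symmetric]) auto
    also have "\<dots> = S" using S by (simp add: K(2) mat_ring)
    finally have "J * (K * S) = S" .
    then have "J * char_matrix A l = (-1) \<cdot>\<^sub>m S + (-l) \<cdot>\<^sub>m J"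
      using J K S A unfolding char_matrix_def by (simp add: A_def mat_ring)
    then show ?thesis using J S by (auto intro!: eq_matI)
  qed
  ultimately have "det (l \<cdot>\<^sub>m J + S) = 0"
    using J A by (simp add: det_smult det_mult[of _ "Suc n"])
  then show ?thesis using det_zero_iff_kernel[of "l \<cdot>\<^sub>m J + S" "Suc n"] J S by auto
qed

lemma det_mult3:
  fixes A :: "'a :: idom mat"
  assumes "A \<in> carrier_mat n n" "B \<in> carrier_mat n n" "C \<in> carrier_mat n n"
  shows "det (A * B * C) = det A * det B * det C"
  using assms det_mult[OF mult_carrier_mat[OF assms(1,2)] assms(3)] det_mult[OF assms(1,2)] by simp

lemma diag_block_mult:
  fixes A :: "'a :: comm_semiring_0 mat"
  assumes "A \<in> carrier_mat a b" "D \<in> carrier_mat c d" "A' \<in> carrier_mat b e" "D' \<in> carrier_mat d f"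
  shows "four_block_mat A (0\<^sub>m a d) (0\<^sub>m c b) D * four_block_mat A' (0\<^sub>m b f) (0\<^sub>m d e) D' =
    four_block_mat (A * A') (0\<^sub>m a f) (0\<^sub>m c e) (D * D')"
  using assms by (subst mult_four_block_mat[of _ a b _ d _ c _ _ e _ f]) (auto simp: mat_ring)

lemma sign_mat_Cons:
  "sign_mat (l # ls) = four_block_mat ((if Im l > 0 then -1 else 1) \<cdot>\<^sub>m 1\<^sub>m 1) (0\<^sub>m 1 (length ls)) (0\<^sub>m (length ls) 1) (sign_mat ls)"
  by (rule eq_matI) (auto simp: sign_mat_def nth_Cons split: nat.split)

text \<open>If \<open>x\<close> lies in the kernel of \<open>l J + S\<close>, then \<open>x\<^sup>* J x\<close> is real and
  \<open>Im l * x\<^sup>* J x = - \<bar>R x\<bar>\<^sup>2\<close>, so roots in the upper half plane correspond to negative directions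
  of \<open>J\<close>; moreover \<open>S\<close> maps \<open>x\<close> to a multiple of \<open>J x\<close>, so one can deflate to the
  \<open>J\<close>-orthogonal complement of \<open>x\<close>, where the hypotheses persist.\<close>

lemma dissipative_pencil_inertia:
  fixes J S R :: "complex mat"
  assumes "J \<in> carrier_mat n n" "ct J = J" "det J \<noteq> 0"
    and "S \<in> carrier_mat n n" "R \<in> carrier_mat k n"
    and "S = ct S + (2 * \<i>) \<cdot>\<^sub>m (ct R * R)"
    and "\<And>l x. x \<in> carrier_mat n 1 \<Longrightarrow> x \<noteq> 0\<^sub>m n 1 \<Longrightarrow> (l \<cdot>\<^sub>m J + S) * x = 0\<^sub>m n 1 \<Longrightarrow> R * x \<noteq> 0\<^sub>m k 1"
  shows "\<exists>X \<in> carrier_mat n n. \<exists>ls c. det X \<noteq> 0 \<and> length ls = n \<and> (\<forall>l \<in> set ls. Im l \<noteq> 0) \<and>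
    ct X * J * X = sign_mat ls \<and> c \<noteq> 0 \<and> (\<forall>y. det (y \<cdot>\<^sub>m J + S) = c * (\<Prod>l\<leftarrow>ls. y - l))"
  using assms
proof (induction n arbitrary: J S R)
  case 0
  show ?case
  proof (intro bexI[of _ "1\<^sub>m 0"] exI[of _ "[]"] exI[of _ 1] conjI allI)
    show "ct (1\<^sub>m 0) * J * 1\<^sub>m 0 = sign_mat []" using 0 by (intro eq_matI) auto
    show "det (y \<cdot>\<^sub>m J + S) = 1 * (\<Prod>l\<leftarrow>[]. y - l)" for y using 0 by (subst det_dim_zero) auto
  qed auto
next
  case (Suc n)
  note J = Suc.prems(1-3) and S = Suc.prems(4,6) and R = Suc.prems(5) and O = Suc.prems(7)
  obtain l x0 where x0: "x0 \<in> carrier_mat (Suc n) 1" "x0 \<noteq> 0\<^sub>m (Suc n) 1" "(l \<cdot>\<^sub>m J + S) * x0 = 0\<^sub>m (Suc n) 1"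
    using exists_pencil_kernel[OF J(1,3) S(1)] by auto
  obtain a where a: "ct x0 * J * x0 = complex_of_real a \<cdot>\<^sub>m 1\<^sub>m 1" using hermitian_form_real[OF J(1,2) x0(1)] by auto
  have ker: "S * x = (-l) \<cdot>\<^sub>m (J * x)" if "x \<in> carrier_mat (Suc n) 1" "(l \<cdot>\<^sub>m J + S) * x = 0\<^sub>m (Suc n) 1" for x
  proof -
    have "l \<cdot>\<^sub>m (J * x) + S * x = 0\<^sub>m (Suc n) 1" using that J S(1) by (simp add: mat_ring)
    from arg_cong[OF this, of "\<lambda>M. (-l) \<cdot>\<^sub>m (J * x) + M"] show ?thesis
      using that(1) J S(1) by (auto intro!: eq_matI simp: mat_eq_iff simp del: index_mult_mat(1)) 
  qed
  obtain r where r: "r > 0" "ct (R * x0) * (R * x0) = complex_of_real r \<cdot>\<^sub>m 1\<^sub>m 1"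
    using gram_form[of "R * x0" k] R x0 O[OF x0] by (auto simp: less_le)
  have Ia: "Im l * a = - r"
  proof -
    have "ct x0 * S * x0 = ct x0 * (S * x0)" using x0 S(1) by (simp add: mat_ring)
    also have "\<dots> = (-l) \<cdot>\<^sub>m (ct x0 * J * x0)" unfolding ker[OF x0(1,3)] using x0 J by (simp add: mat_ring)
    finally have 1: "ct x0 * S * x0 = (- l * of_real a) \<cdot>\<^sub>m 1\<^sub>m 1" by (simp add: a; auto intro!: eq_matI)
    have "ct x0 * S * x0 = ct (ct x0 * S * x0) + (2 * \<i>) \<cdot>\<^sub>m (ct (R * x0) * (R * x0))"
    proof -
      have "ct x0 * S * x0 = ct x0 * (ct S + (2 * \<i>) \<cdot>\<^sub>m (ct R * R)) * x0" using S(2) by simp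
      also have "\<dots> = ct x0 * ct S * x0 + (2 * \<i>) \<cdot>\<^sub>m (ct x0 * (ct R * R) * x0)"
        using x0 S(1) R by (simp add: mat_ring)
      also have "ct x0 * ct S * x0 = ct (ct x0 * S * x0)" using x0 S(1) by (simp add: ct_mult mat_ring)
      also have "ct x0 * (ct R * R) * x0 = ct (R * x0) * (R * x0)" using x0 R by (simp add: ct_mult mat_ring)
      finally show ?thesis .
    qed
    then have "(- l * of_real a) \<cdot>\<^sub>m 1\<^sub>m (Suc 0) = (- cnj l * of_real a + 2 * \<i> * of_real r) \<cdot>\<^sub>m 1\<^sub>m (Suc 0)"
      unfolding 1 r by (simp add: ct_smult; auto intro!: eq_matI simp: mat_eq_iff)
    then have "- l * of_real a = - cnj l * of_real a + 2 * \<i> * of_real r"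
      by (simp only: smult_one_1_eq_iff)
    from arg_cong[OF this, of Im] have "2 * (Im l * a) + 2 * r = 0" by (simp add: mult.commute)
    then show ?thesis by linarith
  qed
  have a0: "a \<noteq> 0" and l0: "Im l \<noteq> 0" using Ia r(1) by auto
  define s :: real where "s = (if Im l > 0 then -1 else 1)"
  \<comment> \<open>By \<open>Ia\<close> the value \<open>a\<close> of the form has the sign
    opposite to \<open>Im l\<close>, which is the sign that \<open>sign_mat\<close> records;
    dividing by the square root of its modulus normalizes it.\<close>
  have sa: "a = s * \<bar>a\<bar>"
    using Ia r(1) by (auto simp: s_def abs_if mult_less_0_iff dest: arg_cong[of _ _ "\<lambda>t. t < 0"])
  define x where "x = complex_of_real (1 / sqrt \<bar>a\<bar>) \<cdot>\<^sub>m x0"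
  have x: "x \<in> carrier_mat (Suc n) 1" using x0 by (simp add: x_def)
  have Sx: "S * x = (-l) \<cdot>\<^sub>m (J * x)"
  proof -
    have "S * x = complex_of_real (1 / sqrt \<bar>a\<bar>) \<cdot>\<^sub>m (S * x0)" unfolding x_def using x0 S(1) by (simp add: mat_ring)
    also have "\<dots> = (-l) \<cdot>\<^sub>m (J * x)" unfolding ker[OF x0(1,3)] x_def using x0 J
      by (simp add: mat_ring; auto intro!: eq_matI)
    finally show ?thesis .
  qed
  have xJx: "ct x * J * x = of_real s \<cdot>\<^sub>m 1\<^sub>m 1"
  proof -
    have ss: "p \<cdot>\<^sub>m (q \<cdot>\<^sub>m A) = (p * q) \<cdot>\<^sub>m A" for p q and A :: "complex mat" by (intro eq_matI) auto
    have "ct x * J * x = of_real (1 / sqrt \<bar>a\<bar> * (1 / sqrt \<bar>a\<bar>)) \<cdot>\<^sub>m (ct x0 * J * x0)"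
      unfolding x_def using x0 J by (simp add: ct_smult mat_ring ss del: real_sqrt_mult_self)
    also have "1 / sqrt \<bar>a\<bar> * (1 / sqrt \<bar>a\<bar>) = 1 / \<bar>a\<bar>" by (simp add: field_simps)
    finally have "ct x * J * x = (of_real (1 / \<bar>a\<bar> * a)) \<cdot>\<^sub>m 1\<^sub>m 1" by (simp add: a ss)
    also have "1 / \<bar>a\<bar> * a = s" using a0 sa by (simp add: field_simps)
    finally show ?thesis .
  qed
  have "complex_of_real s \<noteq> 0" by (simp add: s_def)
  from exists_orthogonal_completion[OF J(1) x xJx this]
  obtain Y where Y: "Y \<in> carrier_mat (Suc n) n" "det (hcat x Y) \<noteq> 0" "ct x * J * Y = 0\<^sub>m 1 n" by auto
  define B where "B = hcat x Y"
  have B: "B \<in> carrier_mat (Suc n) (Suc n)" using hcat_carrier[OF x Y(1)] by (simp add: B_def)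
  have "ct Y * J * x = ct (ct x * J * Y)" using x Y(1) J by (simp add: ct_mult mat_mult_assoc)
  then have YJx: "ct Y * J * x = 0\<^sub>m n 1" by (simp add: Y(3))
  \<comment> \<open>Only the column below the corner is cleared; \<open>ct x * S * Y\<close> remains
    arbitrary. The congruent pencil is thus block upper triangular, which suffices for its
    determinant.\<close>
  have "ct Y * S * x = ct Y * (S * x)" using x Y(1) S(1) by (simp add: mat_ring)
  also have "\<dots> = (-l) \<cdot>\<^sub>m (ct Y * J * x)" unfolding Sx using x Y(1) J by (simp add: mat_ring)
  finally have YSx: "ct Y * S * x = 0\<^sub>m n 1" by (simp add: YJx; auto intro!: eq_matI)
  have "ct x * S * x = ct x * (S * x)" using x S(1) by (simp add: mat_ring)
  also have "\<dots> = (-l) \<cdot>\<^sub>m (ct x * J * x)" unfolding Sx using x J by (simp add: mat_ring)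
  finally have xSx: "ct x * S * x = (-l * of_real s) \<cdot>\<^sub>m 1\<^sub>m 1" by (simp add: xJx; auto intro!: eq_matI)
  define J1 where "J1 = ct Y * J * Y"
  define S1 where "S1 = ct Y * S * Y"
  have J1: "J1 \<in> carrier_mat n n" "ct J1 = J1"
    using Y(1) J by (auto simp: J1_def ct_mult mat_mult_assoc intro!: carrier_matI)
  have S1: "S1 \<in> carrier_mat n n" using Y(1) S(1) by (auto simp: S1_def intro!: carrier_matI)
  have blk: "ct B * M * B = four_block_mat (ct x * M * x) (ct x * M * Y) (ct Y * M * x) (ct Y * M * Y)"
    if "M \<in> carrier_mat (Suc n) (Suc n)" for M
  proof -
    have "ct B * M * B = ct B * (M * hcat x Y)" using x Y(1) that by (simp add: mat_ring B_def)
    also have "M * hcat x Y = hcat (M * x) (M * Y)" using x Y(1) that by (simp add: mult_hcat)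
    finally show ?thesis unfolding B_def using x Y(1) that by (simp add: ct_hcat_mult mat_ring)
  qed
  have BJ: "ct B * J * B = four_block_mat (of_real s \<cdot>\<^sub>m 1\<^sub>m 1) (0\<^sub>m 1 n) (0\<^sub>m n 1) J1"
    unfolding blk[OF J(1)] xJx Y(3) YJx J1_def ..
  have cB: "det (ct B) \<noteq> 0" using det_ct[OF B] Y(2) by (simp add: B_def)
  have detJ1: "det J1 \<noteq> 0"
  proof
    assume "det J1 = 0"
    then have "det (ct B * J * B) = 0"
      unfolding BJ using J1 by (subst det_four_block_mat_lower_left_zero[of _ 1 _ n]) auto
    moreover have "det (ct B * J * B) = det (ct B) * det J * det B"
      using B J by (intro det_mult3) auto
    ultimately show False using J(3) cB Y(2) by (simp add: B_def)
  qed
  have det1: "det (ct B) * det B * det (y \<cdot>\<^sub>m J + S) = of_real s * (y - l) * det (y \<cdot>\<^sub>m J1 + S1)" for y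
  proof -
    let ?M = "y \<cdot>\<^sub>m J + S"
    have M: "?M \<in> carrier_mat (Suc n) (Suc n)" using J S(1) by auto
    have "ct x * ?M * x = y \<cdot>\<^sub>m (ct x * J * x) + ct x * S * x" using x J S(1) by (simp add: mat_ring)
    also have "\<dots> = (of_real s * (y - l)) \<cdot>\<^sub>m 1\<^sub>m 1" unfolding xJx xSx by (auto intro!: eq_matI simp: algebra_simps)
    finally have e1: "ct x * ?M * x = (of_real s * (y - l)) \<cdot>\<^sub>m 1\<^sub>m 1" .
    have "ct Y * ?M * x = y \<cdot>\<^sub>m (ct Y * J * x) + ct Y * S * x" using x Y(1) J S(1) by (simp add: mat_ring)
    then have e2: "ct Y * ?M * x = 0\<^sub>m n 1" unfolding YJx YSx by (auto intro!: eq_matI)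
    have e3: "ct Y * ?M * Y = y \<cdot>\<^sub>m J1 + S1" unfolding J1_def S1_def using Y(1) J S(1) by (simp add: mat_ring)
    have "det (ct B * ?M * B) = det ((of_real s * (y - l)) \<cdot>\<^sub>m 1\<^sub>m 1) * det (y \<cdot>\<^sub>m J1 + S1)"
      unfolding blk[OF M] e1 e2 e3 using x Y(1) J1 S1 M
      by (subst det_four_block_mat_lower_left_zero[of _ 1 _ n]) (auto intro!: carrier_matI)
    moreover have "det (ct B * ?M * B) = det (ct B) * det ?M * det B"
      using B M by (intro det_mult3) auto
    ultimately show ?thesis by (simp add: det_smult mult_ac)
  qed
  have S1R: "S1 = ct S1 + (2 * \<i>) \<cdot>\<^sub>m (ct (R * Y) * (R * Y))"
  proof -
    have "S1 = ct Y * (ct S + (2 * \<i>) \<cdot>\<^sub>m (ct R * R)) * Y" unfolding S1_def using S(2) by simp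
    also have "\<dots> = ct Y * ct S * Y + (2 * \<i>) \<cdot>\<^sub>m (ct Y * (ct R * R) * Y)"
      using Y(1) S(1) R by (simp add: mat_ring)
    also have "ct Y * ct S * Y = ct S1" unfolding S1_def using Y(1) S(1) by (simp add: ct_mult mat_ring)
    also have "ct Y * (ct R * R) * Y = ct (R * Y) * (R * Y)" using Y(1) R by (simp add: ct_mult mat_ring)
    finally show ?thesis .
  qed
  \<comment> \<open>If \<open>R\<close> annihilates \<open>u = Y * w\<close>, then \<open>S\<close>
    and its adjoint agree on \<open>u\<close>, and
    \<open>S * x = (-l) \<cdot>\<^sub>m (J * x)\<close> forces \<open>(m J + S) u\<close> to be
    orthogonal to \<open>x\<close>, besides being orthogonal to the columns of \<open>Y\<close>. So
    \<open>u\<close> lies in the kernel of the full pencil, against the hypothesis on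
    \<open>R\<close>.\<close>
  have O1: "(R * Y) * w \<noteq> 0\<^sub>m k 1"
    if w: "w \<in> carrier_mat n 1" "w \<noteq> 0\<^sub>m n 1" "(m \<cdot>\<^sub>m J1 + S1) * w = 0\<^sub>m n 1" for m w
  proof
    assume z: "(R * Y) * w = 0\<^sub>m k 1"
    define u where "u = Y * w"
    have u: "u \<in> carrier_mat (Suc n) 1" using Y w by (auto simp: u_def)
    have u0: "u \<noteq> 0\<^sub>m (Suc n) 1"
      unfolding u_def using injective_mult[OF x Y(1) _ Y(2) w(1,2)] by simp
    have Ru: "R * u = 0\<^sub>m k 1" using z R Y(1) w by (simp add: u_def mat_ring)
    define v where "v = (m \<cdot>\<^sub>m J + S) * u"
    have v: "v \<in> carrier_mat (Suc n) 1" using u J S(1) by (auto simp: v_def intro!: carrier_matI)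
    have "ct Y * v = (m \<cdot>\<^sub>m J1 + S1) * w"
      unfolding v_def u_def J1_def S1_def using Y(1) w J S(1) by (simp add: mat_ring)
    then have v1: "ct Y * v = 0\<^sub>m n 1" using w(3) by simp
    have xJu: "ct x * J * u = 0\<^sub>m 1 1"
    proof -
      have "ct x * J * u = (ct x * J * Y) * w" using x J Y(1) w by (simp add: u_def mat_ring)
      then show ?thesis using w(1) by (simp only: Y(3)) (simp add: mat_ring)
    qed
    have "ct x * (S * u) = ct x * ((ct S + (2 * \<i>) \<cdot>\<^sub>m (ct R * R)) * u)" using S(2) by simp
    also have "\<dots> = ct (S * x) * u + (2 * \<i>) \<cdot>\<^sub>m (ct x * (ct R * (R * u)))"
      using x S(1) R u by (simp add: mat_ring ct_mult)
    also have "ct (S * x) * u = cnj (-l) \<cdot>\<^sub>m (ct x * J * u)"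
      unfolding Sx using x J u by (simp add: ct_mult ct_smult mat_ring)
    also have "\<dots> + (2 * \<i>) \<cdot>\<^sub>m (ct x * (ct R * (R * u))) = 0\<^sub>m 1 1"
      unfolding xJu Ru using x R by (simp add: mat_ring; auto intro!: eq_matI)
    finally have "ct x * (S * u) = 0\<^sub>m 1 1" .
    moreover have "ct x * v = m \<cdot>\<^sub>m (ct x * J * u) + ct x * (S * u)"
      unfolding v_def using x u J S(1) by (simp add: mat_ring)
    ultimately have v2: "ct x * v = 0\<^sub>m 1 1" unfolding xJu by (auto intro!: eq_matI)
    have "v = 0\<^sub>m (Suc n) 1" using orthogonal_to_basis_eq_0[OF x Y(1) _ Y(2) v v2 v1] by simp
    then show False using O[OF u u0, of m] Ru by (simp add: v_def)
  qed
  have RY: "R * Y \<in> carrier_mat k n" using R Y(1) by simp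
  have "\<exists>X \<in> carrier_mat n n. \<exists>ls c. det X \<noteq> 0 \<and> length ls = n \<and> (\<forall>l \<in> set ls. Im l \<noteq> 0) \<and>
    ct X * J1 * X = sign_mat ls \<and> c \<noteq> 0 \<and> (\<forall>y. det (y \<cdot>\<^sub>m J1 + S1) = c * (\<Prod>l\<leftarrow>ls. y - l))"
    by (rule Suc.IH[OF J1 detJ1 S1 RY S1R]) (rule O1)
  then obtain X1 ls c where X1: "X1 \<in> carrier_mat n n" "det X1 \<noteq> 0"
    and ls: "length ls = n" "\<forall>l \<in> set ls. Im l \<noteq> 0" "ct X1 * J1 * X1 = sign_mat ls"
    and c: "c \<noteq> 0" "\<forall>y. det (y \<cdot>\<^sub>m J1 + S1) = c * (\<Prod>l\<leftarrow>ls. y - l)" by metis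
  define U where "U = four_block_mat (1\<^sub>m 1) (0\<^sub>m 1 n) (0\<^sub>m n 1) X1"
  have U: "U \<in> carrier_mat (Suc n) (Suc n)" using four_block_carrier_mat[of "1\<^sub>m 1" 1 1 X1 n n] X1 by (simp add: U_def)
  have "det U = det X1" unfolding U_def using X1
    by (subst det_four_block_mat_lower_left_zero[of _ 1 _ n]) auto
  then have dX: "det (B * U) \<noteq> 0" using B U X1 Y(2) by (simp add: det_mult[of _ "Suc n"] B_def)
  have "ct (B * U) * J * (B * U) = ct U * (ct B * J * B) * U"
    using B U J by (simp add: ct_mult mat_ring)
  also have "\<dots> = four_block_mat (of_real s \<cdot>\<^sub>m 1\<^sub>m 1) (0\<^sub>m 1 n) (0\<^sub>m n 1) (ct X1 * J1 * X1)"
  proof -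
    have c1: "1\<^sub>m 1 \<in> carrier_mat 1 1" "complex_of_real s \<cdot>\<^sub>m 1\<^sub>m 1 \<in> carrier_mat 1 1" by auto
    have cU: "ct U = four_block_mat (1\<^sub>m 1) (0\<^sub>m 1 n) (0\<^sub>m n 1) (ct X1)"
      unfolding U_def using X1 by (subst ct_four_block) auto
    have z: "1\<^sub>m 1 * (complex_of_real s \<cdot>\<^sub>m 1\<^sub>m 1) * 1\<^sub>m 1 = (complex_of_real s \<cdot>\<^sub>m 1\<^sub>m 1)"
      by (simp add: mat_ring)
    show ?thesis
      unfolding BJ cU unfolding U_def diag_block_mult[OF c1(1) ct_carrier[OF X1(1)] c1(2) J1(1)]
        diag_block_mult[OF mult_carrier_mat[OF c1] mult_carrier_mat[OF ct_carrier[OF X1(1)] J1(1)] c1(1) X1(1)] z ..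
  qed
  also have "ct X1 * J1 * X1 = sign_mat ls" by (rule ls(3))
  finally have XJX: "ct (B * U) * J * (B * U) = sign_mat (l # ls)"
    using ls(1) by (simp add: sign_mat_Cons s_def)
  define c' where "c' = of_real s * c / (det (ct B) * det B)"
  show ?case
  proof (intro bexI[of _ "B * U"] exI[of _ "l # ls"] exI[of _ c'] conjI allI)
    show "c' \<noteq> 0" using c(1) cB Y(2) by (simp add: c'_def s_def B_def)
    show "det (y \<cdot>\<^sub>m J + S) = c' * (\<Prod>l\<leftarrow>l # ls. y - l)" for y
      using det1[of y] cB Y(2) by (simp add: c(2)[rule_format] c'_def B_def field_simps)
  qed (use dX ls l0 XJX B U in auto)
qed

text \<open>Kernel vectors are split off one at a time. The change of basis is kept unitary so that
  it also preserves the scalar term \<open>w \<cdot>\<^sub>m 1\<^sub>m m\<close> that later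
  accompanies \<open>K\<close> in the pencil.\<close>

lemma hermitian_split_kernel:
  assumes "K \<in> carrier_mat m m" "ct K = K"
  shows "\<exists>r W N. r \<le> m \<and> W \<in> carrier_mat m m \<and> ct W * W = 1\<^sub>m m \<and> N \<in> carrier_mat r r \<and> ct N = N \<and> det N \<noteq> 0 \<and>
    ct W * K * W = four_block_mat (0\<^sub>m (m - r) (m - r)) (0\<^sub>m (m - r) r) (0\<^sub>m r (m - r)) N"
  using assms
proof (induction m arbitrary: K)
  case 0
  show ?case
    by (intro exI[of _ 0] exI[of _ "1\<^sub>m 0"]) (use 0 in \<open>auto intro!: eq_matI simp: det_dim_zero\<close>)
next
  case (Suc m)
  note K = Suc.prems
  show ?case
  proof (cases "det K = 0")
    case False
    show ?thesis
      by (intro exI[of _ "Suc m"] exI[of _ "1\<^sub>m (Suc m)"] exI[of _ K])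
        (use K False in \<open>auto simp: mat_ring intro!: eq_matI\<close>)
  next
    case True
    then obtain x0 where x0: "x0 \<in> carrier_mat (Suc m) 1" "x0 \<noteq> 0\<^sub>m (Suc m) 1" "K * x0 = 0\<^sub>m (Suc m) 1"
      using det_zero_iff_kernel[OF K(1)] by auto
    obtain Y a where Y: "Y \<in> carrier_mat (Suc m) m" "ct (hcat (a \<cdot>\<^sub>m x0) Y) * hcat (a \<cdot>\<^sub>m x0) Y = 1\<^sub>m (Suc m)"
      using unitary_completion[OF x0(1,2)] by metis
    define x where "x = a \<cdot>\<^sub>m x0"
    have x: "x \<in> carrier_mat (Suc m) 1" using x0 by (simp add: x_def)
    have "K * x = a \<cdot>\<^sub>m (K * x0)" using x0 K by (simp add: x_def mat_ring)
    then have Kx: "K * x = 0\<^sub>m (Suc m) 1" by (simp add: x0(3); auto intro!: eq_matI)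
    have "ct x * K = ct (K * x)" using K x by (simp add: ct_mult)
    then have xK: "ct x * K = 0\<^sub>m 1 (Suc m)" by (simp add: Kx)
    have "ct Y * K * Y \<in> carrier_mat m m" "ct (ct Y * K * Y) = ct Y * K * Y"
      using Y K by (auto simp: ct_mult mat_ring intro!: carrier_matI)
    from Suc.IH[OF this] obtain r W N where r: "r \<le> m" and W: "W \<in> carrier_mat m m" "ct W * W = 1\<^sub>m m"
      and N: "N \<in> carrier_mat r r" "ct N = N" "det N \<noteq> 0"
      and e: "ct W * (ct Y * K * Y) * W = four_block_mat (0\<^sub>m (m - r) (m - r)) (0\<^sub>m (m - r) r) (0\<^sub>m r (m - r)) N"
      by blast
    have h: "ct (hcat x Y) * hcat x Y = four_block_mat (ct x * x) (ct x * Y) (ct Y * x) (ct Y * Y)"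
      using x Y by (subst ct_hcat_mult) auto
    also have "\<dots> = four_block_mat (1\<^sub>m 1) (0\<^sub>m 1 m) (0\<^sub>m m 1) (1\<^sub>m m)"
      using Y(2) h unfolding x_def by simp
    finally have "ct (hcat x Y) * hcat x Y = 1\<^sub>m (Suc m)" by simp
    define U where "U = four_block_mat (1\<^sub>m 1) (0\<^sub>m 1 m) (0\<^sub>m m 1) W"
    have U: "U \<in> carrier_mat (Suc m) (Suc m)" using four_block_carrier_mat[of "1\<^sub>m 1" 1 1 W m m] W by (simp add: U_def)
    have "ct U = four_block_mat (1\<^sub>m 1) (0\<^sub>m 1 m) (0\<^sub>m m 1) (ct W)"
      unfolding U_def using W by (subst ct_four_block) auto
    then have "ct U * U = four_block_mat (1\<^sub>m 1) (0\<^sub>m 1 m) (0\<^sub>m m 1) (1\<^sub>m m)"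
      unfolding U_def using W by (simp only:) (subst mult_four_block_mat[of _ 1 1 _ m _ m _ _ 1 _ m], auto simp: mat_ring)
    then have UU: "ct U * U = 1\<^sub>m (Suc m)" by simp
    define B where "B = hcat x Y"
    have B: "B \<in> carrier_mat (Suc m) (Suc m)" using hcat_carrier[OF x Y(1)] by (simp add: B_def)
    have BB: "ct B * B = 1\<^sub>m (Suc m)" using Y(2) by (simp add: B_def x_def)
    have BK: "ct B * K * B = four_block_mat (0\<^sub>m 1 1) (0\<^sub>m 1 m) (0\<^sub>m m 1) (ct Y * K * Y)"
    proof -
      have "ct B * K * B = four_block_mat (ct x * (K * x)) (ct x * (K * Y)) (ct Y * (K * x)) (ct Y * (K * Y))"
      proof -
        have "ct B * K * B = ct B * (K * hcat x Y)" using x Y(1) K by (simp add: mat_ring B_def)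
        also have "K * hcat x Y = hcat (K * x) (K * Y)" using x Y(1) K by (simp add: mult_hcat)
        finally show ?thesis unfolding B_def using x Y(1) K by (simp add: ct_hcat_mult)
      qed
      also have "ct x * (K * Y) = (ct x * K) * Y" using x K Y by (simp add: mat_ring)
      finally show ?thesis unfolding Kx xK using x K Y(1) by (simp add: mat_ring)
    qed
    have "ct (B * U) * K * (B * U) = ct U * (ct B * K * B) * U"
      using B U K by (simp add: ct_mult mat_ring)
    also have "\<dots> = four_block_mat (0\<^sub>m 1 1) (0\<^sub>m 1 m) (0\<^sub>m m 1) (ct W * (ct Y * K * Y) * W)"
    proof -
      have K': "ct Y * K * Y \<in> carrier_mat m m" "0\<^sub>m 1 1 \<in> carrier_mat 1 1" "1\<^sub>m 1 \<in> carrier_mat 1 1"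
        using Y(1) K by (auto intro!: carrier_matI)
      have cU: "ct U = four_block_mat (1\<^sub>m 1) (0\<^sub>m 1 m) (0\<^sub>m m 1) (ct W)"
        unfolding U_def using W by (subst ct_four_block) auto
      have WK: "ct W * (ct Y * K * Y) \<in> carrier_mat m m" using mult_carrier_mat[OF ct_carrier[OF W(1)] K'(1)] .
      have z: "1\<^sub>m 1 * 0\<^sub>m 1 1 * 1\<^sub>m 1 = (0\<^sub>m 1 1 :: complex mat)" by (simp add: mat_ring)
      show ?thesis
        unfolding BK cU unfolding U_def diag_block_mult[OF K'(3) ct_carrier[OF W(1)] K'(2,1)]
          diag_block_mult[OF mult_carrier_mat[OF K'(3,2)] WK K'(3) W(1)] z ..
    qed
    also have "\<dots> = four_block_mat (0\<^sub>m (Suc m - r) (Suc m - r)) (0\<^sub>m (Suc m - r) r) (0\<^sub>m r (Suc m - r)) N"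
      unfolding e using r N by (intro eq_matI) auto
    finally have e': "ct (B * U) * K * (B * U) = \<dots>" .
    have "ct (B * U) * (B * U) = ct U * (ct B * B) * U" using B U by (simp add: ct_mult mat_ring)
    also have "\<dots> = 1\<^sub>m (Suc m)" unfolding BB using U UU by (simp add: mat_ring)
    finally show ?thesis
      using r N B U e' by (intro exI[of _ r] exI[of _ "B * U"] exI[of _ N]) auto
  qed
qed

section \<open>Factorization of positive polynomial matrices\<close>

text \<open>Statements about real \<open>y\<close> hold away from finitely many points. Continuity
  carries the inequalities among them to the exceptional points, in particular to real zeros of the
  top coefficient and of \<open>det F\<close>.\<close>

lemma cofinite_nonneg_imp_nonneg:
  fixes f :: "real \<Rightarrow> real"
  assumes f: "continuous_on UNIV f" and "\<forall>\<^sub>\<infinity>y. 0 \<le> f y"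
  shows "0 \<le> f x"
proof (rule ccontr)
  assume "\<not> 0 \<le> f x"
  then have "x \<in> {y. f y < 0}" by auto
  moreover have "open {y. f y < 0}" using f by (intro open_Collect_less continuous_on_const)
  ultimately obtain e where e: "e > 0" "\<And>y. dist y x < e \<Longrightarrow> y \<in> {y. f y < 0}"
    by (auto simp: open_dist)
  then have "{x<..<x + e} \<subseteq> {y. f y < 0}" by (auto simp: dist_real_def)
  moreover have "finite {y. f y < 0}" using assms(2) by (simp add: eventually_cofinite not_le)
  ultimately have "finite {x<..<x + e}" using finite_subset by blast
  then show False using e(1) by (simp add: infinite_Ioo)
qed

lemma continuous_on_poly_of_real [continuous_intros]:
  "continuous_on A (\<lambda>y. poly p (complex_of_real y))"
  by (intro continuous_intros)

lemma MOST_poly_nonzero: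
  fixes p :: "complex poly" assumes "p \<noteq> 0"
  shows "\<forall>\<^sub>\<infinity>y :: real. poly p (complex_of_real y) \<noteq> 0"
proof -
  have "finite (complex_of_real -` {z. poly p z = 0})"
    by (intro finite_vimageI poly_roots_finite assms) (auto simp: inj_on_def)
  then show ?thesis by (simp add: eventually_cofinite vimage_def)
qed

lemma MOST_real_nonempty: "\<forall>\<^sub>\<infinity>y :: real. P y \<Longrightarrow> \<exists>y. P y"
  using infinite_UNIV_char_0[where 'a = real] by (auto simp: eventually_cofinite intro: ccontr)

text \<open>Hermitian symmetry of a polynomial matrix is a statement about real arguments; this is
  the passage from such pointwise facts to identities of polynomials, and so to complex
  arguments.\<close>

lemma poly_eqI_MOST:
  fixes p q :: "complex poly"
  assumes "\<forall>\<^sub>\<infinity>y :: real. poly p (complex_of_real y) = poly q (complex_of_real y)"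
  shows "p = q"
proof (rule ccontr)
  assume "p \<noteq> q"
  then have "\<forall>\<^sub>\<infinity>y :: real. poly (p - q) (complex_of_real y) \<noteq> 0" by (intro MOST_poly_nonzero) simp
  with assms have "\<forall>\<^sub>\<infinity>y :: real. False" by eventually_elim auto
  then show False using MOST_real_nonempty by blast
qed

section \<open>The scalar Fejer-Riesz theorem\<close>

definition norm_square_on_reals :: "complex poly \<Rightarrow> bool" where
  "norm_square_on_reals h \<longleftrightarrow> (\<exists>g. \<forall>y :: real. poly h (of_real y) = cnj (poly g (of_real y)) * poly g (of_real y))"

text \<open>Zeros are removed in pairs \<open>a\<close>, \<open>cnj a\<close>, since on the real
  line the product of the two linear factors is the squared modulus of \<open>y - a\<close> and is
  absorbed into \<open>g\<close>. A nonreal zero comes with its conjugate because the coefficients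
  are real; a real zero is at least double because the quotient \<open>h1\<close> changes sign
  there.\<close>

theorem scalar_fejer_riesz:
  fixes h :: "complex poly"
  assumes "\<forall>\<^sub>\<infinity>y :: real. Im (poly h (of_real y)) = 0 \<and> 0 \<le> Re (poly h (of_real y))"
  shows "norm_square_on_reals h"
  using assms
proof (induction "degree h" arbitrary: h rule: less_induct)
  case less
  have nonneg: "Im (poly h (of_real y)) = 0 \<and> 0 \<le> Re (poly h (of_real y))"
    if "\<forall>\<^sub>\<infinity>y :: real. Im (poly h (of_real y)) = 0 \<and> 0 \<le> Re (poly h (of_real y))" for h :: "complex poly" and y :: real
  proof -
    have "0 \<le> Re (poly h (of_real y))" "0 \<le> Im (poly h (of_real y))" "0 \<le> - Im (poly h (of_real y))"
      using that by (rule_tac cofinite_nonneg_imp_nonneg; force intro!: continuous_intros elim: eventually_mono)+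
    then show ?thesis by auto
  qed
  note h = nonneg[OF less.prems]
  show ?case
  proof (cases "degree h = 0")
    case True
    then obtain c where c: "h = [:c:]" by (rule degree_eq_zeroE)
    then have "Im c = 0" "0 \<le> Re c" using h[of 0] by auto
    then have "c = cnj (of_real (sqrt (Re c))) * of_real (sqrt (Re c))"
      by (auto simp: complex_eq_iff simp flip: of_real_mult)
    then show ?thesis unfolding norm_square_on_reals_def c by (intro exI[of _ "[:of_real (sqrt (Re c)):]"]) auto
  next
    case False
    then obtain a where a: "poly h a = 0"
      using fundamental_theorem_of_algebra[of h] by (auto simp: constant_degree)
    then obtain h1 where h1: "h = [:-a, 1:] * h1" by (auto simp: poly_eq_0_iff_dvd dvd_def)
    have "h \<noteq> 0" using False by auto
    have "poly h1 (cnj a) = 0"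
    proof (cases "Im a = 0")
      case False
      have "map_poly cnj h = h"
      proof (rule poly_eqI_MOST, rule always_eventually, rule allI)
        fix y :: real
        have "poly (map_poly cnj h) (of_real y) = cnj (poly h (of_real y))" by (metis poly_cnj complex_cnj_complex_of_real)
        then show "poly (map_poly cnj h) (of_real y) = poly h (of_real y)" using h[of y] by (simp add: complex_eq_iff)
      qed
      then have "poly h (cnj a) = 0" by (metis a complex_cnj_zero poly_cnj)
      then show ?thesis using False by (auto simp: h1 complex_eq_iff)
    next
      case True
      define \<alpha> where "\<alpha> = Re a"
      have \<alpha>: "a = of_real \<alpha>" using True by (simp add: \<alpha>_def complex_eq_iff)
      have e: "poly h (of_real y) = of_real (y - \<alpha>) * poly h1 (of_real y)" for y by (simp add: h1 \<alpha> algebra_simps)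
      have "Im (poly h1 (of_real y)) = 0" if "y \<noteq> \<alpha>" for y
        using h[of y] that by (simp add: e)
      then have "\<forall>\<^sub>\<infinity>y. Im (poly h1 (of_real y)) = 0"
        by (auto simp: eventually_cofinite intro: finite_subset[of _ "{\<alpha>}"])
      then have "0 \<le> Im (poly h1 (of_real \<alpha>))" "0 \<le> - Im (poly h1 (of_real \<alpha>))"
        by (rule_tac cofinite_nonneg_imp_nonneg; force intro!: continuous_intros elim: eventually_mono)+
      moreover have pr: "0 \<le> (y - \<alpha>) * Re (poly h1 (of_real y))" for y using h[of y] by (simp add: e)
      have r: "y > \<alpha> \<Longrightarrow> 0 \<le> Re (poly h1 (of_real y))" "y < \<alpha> \<Longrightarrow> Re (poly h1 (of_real y)) \<le> 0" for y
        using pr[of y] by (auto simp: zero_le_mult_iff)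
      have "((\<lambda>y. Re (poly h1 (of_real y))) \<longlongrightarrow> Re (poly h1 (of_real \<alpha>))) (at \<alpha> within S)" for S
        using continuous_on_Re[OF continuous_on_poly_of_real[of UNIV h1]]
        by (auto simp: continuous_on_def intro: tendsto_within_subset)
      note lim = this
      have "eventually (\<lambda>y. 0 \<le> Re (poly h1 (of_real y))) (at_right \<alpha>)"
        by (auto simp: eventually_at_filter r)
      then have "0 \<le> Re (poly h1 (of_real \<alpha>))"
        by (intro tendsto_lowerbound[OF lim]) auto
      moreover have "eventually (\<lambda>y. Re (poly h1 (of_real y)) \<le> 0) (at_left \<alpha>)"
        by (auto simp: eventually_at_filter r)
      then have "Re (poly h1 (of_real \<alpha>)) \<le> 0"
        by (intro tendsto_upperbound[OF lim]) auto
      ultimately show ?thesis by (simp add: \<alpha> complex_eq_iff)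
    qed
    then obtain h2 where h2: "h1 = [:- cnj a, 1:] * h2" by (auto simp: poly_eq_0_iff_dvd dvd_def)
    have e: "poly h (of_real y) = of_real ((cmod (of_real y - a))\<^sup>2) * poly h2 (of_real y)" for y
      unfolding h1 h2 complex_norm_square by (simp add: algebra_simps)
    have "\<forall>\<^sub>\<infinity>y :: real. Im (poly h2 (of_real y)) = 0 \<and> 0 \<le> Re (poly h2 (of_real y))"
    proof -
      have "\<forall>\<^sub>\<infinity>y :: real. poly [:-a, 1:] (of_real y) \<noteq> 0" by (intro MOST_poly_nonzero) simp
      then show ?thesis
      proof eventually_elim
        case (elim y)
        then have "(cmod (of_real y - a))\<^sup>2 > 0" by auto
        then show ?case using h[of y] unfolding e by (auto simp: zero_le_mult_iff simp del: of_real_power)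
      qed
    qed
    moreover have "degree h2 < degree h"
    proof -
      have "h2 \<noteq> 0" using \<open>h \<noteq> 0\<close> by (auto simp: h1 h2)
      then have "degree h = degree h2 + 2" unfolding h1 h2 by (simp add: degree_mult_eq del: mult_pCons_left)
      then show ?thesis by simp
    qed
    ultimately have "norm_square_on_reals h2" by (intro less.hyps)
    then obtain g where g: "\<And>y :: real. poly h2 (of_real y) = cnj (poly g (of_real y)) * poly g (of_real y)"
      by (auto simp: norm_square_on_reals_def)
    show ?thesis unfolding norm_square_on_reals_def
    proof (intro exI[of _ "[:-a, 1:] * g"] allI)
      fix y :: real
      show "poly h (of_real y) = cnj (poly ([:-a, 1:] * g) (of_real y)) * poly ([:-a, 1:] * g) (of_real y)"
        unfolding e g complex_norm_square by (simp add: algebra_simps)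
    qed
  qed
qed

text \<open>The bound handles real zeros of \<open>q\<close>, the reflection identity those in the lower half plane.\<close>

lemma dvd_of_bounded_quotient:
  fixes p p' q :: "complex poly" and B :: "real \<Rightarrow> real"
  assumes "q \<noteq> 0"
    and bd: "\<forall>\<^sub>\<infinity>y :: real. cmod (poly p (of_real y)) \<le> cmod (poly q (of_real y)) * B y"
    and B: "continuous_on UNIV B"
    and refl: "p * map_poly cnj q = p' * q"
    and up: "\<And>z. Im z > 0 \<Longrightarrow> poly q z \<noteq> 0"
  shows "q dvd p"
proof -
  have "gcd p q \<noteq> 0" using assms(1) by simp
  from gcd_coprime_exists[OF this] obtain p1 q1 where p1: "p = p1 * gcd p q" and q1: "q = q1 * gcd p q"
    and cop: "coprime p1 q1" by auto
  define g where "g = gcd p q"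
  have g0: "g \<noteq> 0" using assms(1) by (simp add: g_def)
  have pg: "p = p1 * g" and qg: "q = q1 * g" using p1 q1 by (simp_all add: g_def)
  have "degree q1 = 0"
  proof (rule ccontr)
    assume "degree q1 \<noteq> 0"
    then obtain a where a: "poly q1 a = 0"
      using fundamental_theorem_of_algebra[of q1] by (auto simp: constant_degree)
    have "poly p1 a \<noteq> 0"
    proof
      assume "poly p1 a = 0"
      then have "is_unit [:-a, 1:]" using a cop by (meson coprime_common_divisor poly_eq_0_iff_dvd)
      then show False by (simp add: is_unit_poly_iff)
    qed
    moreover have "poly p1 a = 0"
    proof -
      consider "Im a > 0" | "Im a < 0" | "Im a = 0" by linarith
      then show ?thesis
      proof cases
        case 1
        then show ?thesis using up[OF 1] a by (simp add: qg)
      next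
        case 2
        \<comment> \<open>After cancelling \<open>g\<close>, the left side at \<open>a\<close> is
          \<open>p1\<close> times the conjugate of the value of \<open>q\<close> at
          \<open>cnj a\<close>; that point lies in the upper half plane and is no zero of
          \<open>q\<close>.\<close>
        have "p1 * map_poly cnj q * g = p' * q1 * g" using refl pg qg by (simp add: mult_ac)
        then have "p1 * map_poly cnj q = p' * q1" using g0 by simp
        from arg_cong[OF this, of "\<lambda>r. poly r a"] have "poly p1 a * poly (map_poly cnj q) a = 0" by (simp add: a)
        moreover have "poly (map_poly cnj q) a = cnj (poly q (cnj a))" by (metis poly_cnj complex_cnj_cnj)
        ultimately show ?thesis using up[of "cnj a"] 2 by simp
      next
        case 3
        define \<alpha> where "\<alpha> = Re a"
        have \<alpha>: "a = of_real \<alpha>" using 3 by (simp add: \<alpha>_def complex_eq_iff)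
        have "0 \<le> cmod (poly q1 (of_real \<alpha>)) * B \<alpha> - cmod (poly p1 (of_real \<alpha>))"
        proof (rule cofinite_nonneg_imp_nonneg
            [where f = "\<lambda>y. cmod (poly q1 (of_real y)) * B y - cmod (poly p1 (of_real y))"])
          show "continuous_on UNIV (\<lambda>y. cmod (poly q1 (of_real y)) * B y - cmod (poly p1 (of_real y)))"
            by (intro continuous_intros B)
          show "\<forall>\<^sub>\<infinity>y. 0 \<le> cmod (poly q1 (of_real y)) * B y - cmod (poly p1 (of_real y))"
            using bd MOST_poly_nonzero[OF g0]
          proof eventually_elim
            case (elim y)
            then have "cmod (poly p1 (of_real y)) * cmod (poly g (of_real y)) \<le>
              (cmod (poly q1 (of_real y)) * B y) * cmod (poly g (of_real y))"
              unfolding pg qg by (simp add: norm_mult mult_ac)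
            then show ?case using elim(2) by (simp add: mult_le_cancel_right)
          qed
        qed
        then show ?thesis using a by (simp add: \<alpha>)
      qed
    qed
    ultimately show False by simp
  qed
  then obtain c where "q1 = [:c:]" by (rule degree_eq_zeroE)
  then have "q = smult c g" "c \<noteq> 0" using qg assms(1) by auto
  then show ?thesis using pg by (simp add: smult_dvd_iff)
qed

text \<open>Growth at infinity is moved to the origin by the substitution
  \<open>y = inverse t\<close>. For the reflected polynomials the bound acquires a factor
  \<open>\<bar>t\<bar> ^ e\<close> with \<open>e > 0\<close>, and at \<open>t = 0\<close> it would
  make the leading coefficient of \<open>p\<close> vanish.\<close>

lemma degree_le_of_square_bound:
  fixes p T :: "complex poly"
  assumes bd: "\<forall>\<^sub>\<infinity>y :: real. (cmod (poly p (of_real y)))\<^sup>2 \<le> cmod (poly T (of_real y))"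
    and T: "degree T \<le> 2 * n"
  shows "degree p \<le> n"
proof (rule ccontr)
  assume "\<not> degree p \<le> n"
  then have k: "degree p > n" "degree T < 2 * degree p" using T by auto
  then have "p \<noteq> 0" by auto
  let ?k = "degree p"
  define e where "e = 2 * ?k - degree T"
  have e: "e > 0" "2 * ?k = e + degree T" using k by (auto simp: e_def)
  let ?f = "\<lambda>t. \<bar>t\<bar> ^ e * cmod (poly (reflect_poly T) (of_real t)) - (cmod (poly (reflect_poly p) (of_real t)))\<^sup>2"
  have "0 \<le> ?f 0"
  proof (rule cofinite_nonneg_imp_nonneg[where f = ?f and x = 0])
    show "continuous_on UNIV ?f" by (intro continuous_intros)
    have "finite {y :: real. \<not> (cmod (poly p (of_real y)))\<^sup>2 \<le> cmod (poly T (of_real y))}"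
      using bd by (simp add: eventually_cofinite)
    then have "finite (inverse -` {y :: real. \<not> (cmod (poly p (of_real y)))\<^sup>2 \<le> cmod (poly T (of_real y))})"
      by (intro finite_vimageI) (auto simp: inj_on_def)
    then have "\<forall>\<^sub>\<infinity>t :: real. (cmod (poly p (of_real (inverse t))))\<^sup>2 \<le> cmod (poly T (of_real (inverse t)))"
      by (simp add: eventually_cofinite vimage_def)
    moreover have "\<forall>\<^sub>\<infinity>t :: real. t \<noteq> 0" by (simp add: eventually_cofinite)
    ultimately show "\<forall>\<^sub>\<infinity>t. 0 \<le> ?f t"
    proof eventually_elim
      case (elim t)
      have t: "complex_of_real t \<noteq> 0" using elim(2) by simp
      have "(cmod (poly (reflect_poly p) (of_real t)))\<^sup>2 = \<bar>t\<bar> ^ (2 * ?k) * (cmod (poly p (of_real (inverse t))))\<^sup>2"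
        unfolding poly_reflect_poly_nz[OF t] by (simp add: norm_mult norm_power power_mult_distrib power_mult mult.commute)
      also have "\<dots> \<le> \<bar>t\<bar> ^ (2 * ?k) * cmod (poly T (of_real (inverse t)))"
        using elim(1) by (intro mult_left_mono) auto
      also have "\<dots> = \<bar>t\<bar> ^ e * cmod (poly (reflect_poly T) (of_real t))"
        unfolding poly_reflect_poly_nz[OF t] e(2) by (simp add: norm_mult norm_power power_add)
      finally show ?case by simp
    qed
  qed
  then show False using e(1) \<open>p \<noteq> 0\<close> by (simp add: zero_power)
qed

section \<open>Polynomial matrices and their values\<close>

definition evm :: "complex poly mat \<Rightarrow> complex \<Rightarrow> complex mat" where
  "evm F z = map_mat (\<lambda>p. poly p z) F"

lemma evm_dim [simp]: "dim_row (evm F z) = dim_row F" "dim_col (evm F z) = dim_col F"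
  by (simp_all add: evm_def)

lemma evm_carrier [simp]: "F \<in> carrier_mat n m \<Longrightarrow> evm F z \<in> carrier_mat n m"
  by (auto intro: carrier_matI)

lemma evm_index [simp]: "i < dim_row F \<Longrightarrow> j < dim_col F \<Longrightarrow> evm F z $$ (i, j) = poly (F $$ (i, j)) z"
  by (simp add: evm_def)

lemma evm_mult: "dim_col F = dim_row G \<Longrightarrow> evm (F * G) z = evm F z * evm G z"
  by (rule eq_matI) (auto simp: scalar_prod_def poly_sum)

lemma evm_smult: "evm (p \<cdot>\<^sub>m F) z = poly p z \<cdot>\<^sub>m evm F z"
  by (rule eq_matI) auto

lemma evm_add: "dim_row F = dim_row G \<Longrightarrow> dim_col F = dim_col G \<Longrightarrow> evm (F + G) z = evm F z + evm G z"
  by (rule eq_matI) auto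

lemma evm_minus: "dim_row F = dim_row G \<Longrightarrow> dim_col F = dim_col G \<Longrightarrow> evm (F - G) z = evm F z - evm G z"
  by (rule eq_matI) auto

lemma evm_one [simp]: "evm (1\<^sub>m n) z = 1\<^sub>m n"
  by (rule eq_matI) auto

lemma evm_const: "evm (map_mat (\<lambda>c. [:c:]) Q) z = Q"
  by (rule eq_matI) auto

lemma evm_four_block:
  assumes "dim_row B = dim_row A" "dim_col C = dim_col A" "dim_row C = dim_row D" "dim_col B = dim_col D"
  shows "evm (four_block_mat A B C D) z = four_block_mat (evm A z) (evm B z) (evm C z) (evm D z)"
  by (rule eq_matI) (use assms in auto)

lemma poly_det_evm: "poly (det F) z = det (evm F z)"
  using comm_ring_hom.hom_det[of "\<lambda>p. poly p z" F] by (simp add: evm_def poly_hom.comm_ring_hom_axioms)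

lemma posdef_scale:
  assumes P: "posdef n (of_real a \<cdot>\<^sub>m P)" and a: "a > 0" and Pc: "P \<in> carrier_mat n n"
  shows "posdef n P"
proof -
  have ss: "of_real (1 / a) \<cdot>\<^sub>m (of_real a \<cdot>\<^sub>m P) = P" using a by (intro eq_matI) auto
  show ?thesis
    unfolding posdef_def
  proof (intro conjI ballI impI Pc)
    have eq: "of_real a \<cdot>\<^sub>m ct P = of_real a \<cdot>\<^sub>m P" using P by (simp add: posdef_def ct_smult)
    show "ct P = P"
    proof (rule eq_matI)
      fix i j assume ij: "i < dim_row P" "j < dim_col P"
      then have "of_real a * ct P $$ (i, j) = of_real a * P $$ (i, j)"
        using arg_cong[OF eq, of "\<lambda>M. M $$ (i, j)"] Pc by simp
      then show "ct P $$ (i, j) = P $$ (i, j)" using a by simp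
    qed (use Pc in auto)
    fix x :: "complex mat" assume x: "x \<in> carrier_mat n 1" "x \<noteq> 0\<^sub>m n 1"
    then obtain r where r: "r > 0" "ct x * (of_real a \<cdot>\<^sub>m P) * x = of_real r \<cdot>\<^sub>m 1\<^sub>m 1" using P by (auto simp: posdef_def)
    have "ct x * P * x = of_real (1 / a) \<cdot>\<^sub>m (ct x * (of_real a \<cdot>\<^sub>m P) * x)"
      using x Pc a by (simp add: mat_ring; auto intro!: eq_matI)
    also have "\<dots> = of_real (r / a) \<cdot>\<^sub>m 1\<^sub>m 1" unfolding r(2) by (auto intro!: eq_matI)
    finally show "\<exists>r>0. ct x * P * x = of_real r \<cdot>\<^sub>m 1\<^sub>m 1" using r a by (intro exI[of _ "r / a"]) auto
  qed
qed

lemma hcat_mult_ct_hcat: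
  assumes "dim_col A = dim_col C" "dim_col B = dim_col D" "dim_row A = dim_row B" "dim_row C = dim_row D"
  shows "hcat A B * ct (hcat C D) = A * ct C + B * ct D"
proof (rule eq_matI)
  fix i j assume "i < dim_row (A * ct C + B * ct D)" "j < dim_col (A * ct C + B * ct D)"
  then have *: "i < dim_row A" "j < dim_row C" using assms by auto
  have s: "(\<Sum>k<a + b. f k) = (\<Sum>k<a. f k) + (\<Sum>k<b. f (k + a))" for a b :: nat and f :: "nat \<Rightarrow> complex"
    by (induction b) (auto simp: ac_simps)
  have "(hcat A B * ct (hcat C D)) $$ (i, j) = (\<Sum>k<dim_col A + dim_col B. hcat A B $$ (i, k) * cnj (hcat C D $$ (j, k)))"
    using assms * by (auto simp: scalar_prod_def atLeast0LessThan)
  also have "\<dots> = (A * ct C + B * ct D) $$ (i, j)"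
    unfolding s using assms * by (auto simp: hcat_index scalar_prod_def atLeast0LessThan intro!: arg_cong2[of _ _ _ _ "(+)"] sum.cong)
  finally show "(hcat A B * ct (hcat C D)) $$ (i, j) = (A * ct C + B * ct D) $$ (i, j)" .
qed (use assms in auto)

text \<open>The pivot times the Schur complement, which avoids a division.\<close>

lemma posdef_schur_complement:
  assumes P: "posdef (Suc m) (four_block_mat (h \<cdot>\<^sub>m 1\<^sub>m 1) B b D)"
    and B: "B \<in> carrier_mat 1 m" and b: "b \<in> carrier_mat m 1" and D: "D \<in> carrier_mat m m"
  shows "\<exists>r > 0. h = of_real r" "b = ct B" "posdef m (h \<cdot>\<^sub>m D - b * B)"
proof -
  let ?P = "four_block_mat (h \<cdot>\<^sub>m 1\<^sub>m 1) B b D"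
  have ctP: "ct ?P = ?P" using P by (simp add: posdef_def)
  have Pc: "?P \<in> carrier_mat (Suc m) (Suc m)" using P by (simp add: posdef_def)
  show bB: "b = ct B"
  proof (rule eq_matI)
    fix i j assume ij: "i < dim_row (ct B)" "j < dim_col (ct B)"
    have "?P $$ (Suc i, 0) = ct ?P $$ (Suc i, 0)" by (simp only: ctP)
    then show "b $$ (i, j) = ct B $$ (i, j)" using ij B b D by auto
  qed (use b B in auto)
  define e :: "complex mat" where "e = mat (Suc m) 1 (\<lambda>(i, j). if i = 0 then 1 else 0)"
  have "e \<in> carrier_mat (Suc m) 1" "e \<noteq> 0\<^sub>m (Suc m) 1"
    by (auto simp: e_def dest!: arg_cong[of _ _ "\<lambda>M. M $$ (0, 0)"])
  then obtain r where r: "r > 0" "ct e * ?P * e = of_real r \<cdot>\<^sub>m 1\<^sub>m 1" using P by (auto simp: posdef_def)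
  have "(ct e * ?P * e) $$ (0, 0) = h"
  proof -
    define A where "A = ?P"
    have A: "A \<in> carrier_mat (Suc m) (Suc m)" using Pc by (simp add: A_def)
    have "(A * e) $$ (l, 0) = A $$ (l, 0)" if "l < Suc m" for l
    proof -
      have "(A * e) $$ (l, 0) = (\<Sum>k<Suc m. A $$ (l, k) * e $$ (k, 0))"
        using that A by (simp add: e_def scalar_prod_def atLeast0LessThan del: sum.lessThan_Suc)
      also have "\<dots> = (\<Sum>k<Suc m. if k = 0 then A $$ (l, k) else 0)"
        by (intro sum.cong) (auto simp: e_def)
      finally show ?thesis by (simp del: sum.lessThan_Suc)
    qed
    moreover have "(ct e * (A * e)) $$ (0, 0) = (\<Sum>k<Suc m. cnj (e $$ (k, 0)) * (A * e) $$ (k, 0))"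
      using A by (simp add: e_def scalar_prod_def atLeast0LessThan del: sum.lessThan_Suc)
    moreover have "ct e * A * e = ct e * (A * e)" using A by (simp add: e_def mat_ring)
    ultimately have "(ct e * A * e) $$ (0, 0) = (\<Sum>k<Suc m. cnj (e $$ (k, 0)) * A $$ (k, 0))" by simp
    also have "\<dots> = (\<Sum>k<Suc m. if k = 0 then A $$ (0, 0) else 0)"
      by (intro sum.cong) (auto simp: e_def)
    also have "\<dots> = A $$ (0, 0)" by (simp del: sum.lessThan_Suc)
    also have "\<dots> = h" using b B D by (simp add: A_def)
    finally show ?thesis by (simp add: A_def)
  qed
  then have "(of_real r \<cdot>\<^sub>m 1\<^sub>m 1 :: complex mat) $$ (0, 0) = h" by (simp only: r(2))
  then have h: "h = of_real r" by simp
  then show "\<exists>r > 0. h = of_real r" using r(1) by auto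
  \<comment> \<open>The rows of \<open>ct Y\<close>, composed of \<open>- b\<close> and
    \<open>h\<close> times the identity, eliminate the first column of the matrix. Compression by
    \<open>Y\<close> gives the desired matrix times \<open>r\<close>, and
    \<open>posdef_scale\<close> removes that factor.\<close>
  define Y where "Y = ct (hcat (- b) (h \<cdot>\<^sub>m 1\<^sub>m m))"
  have Y: "Y \<in> carrier_mat (Suc m) m" using b by (auto simp: Y_def intro!: carrier_matI)
  have "posdef m (ct Y * ?P * Y)"
  proof (rule posdef_compression[OF P Y])
    fix w :: "complex mat" assume w: "w \<in> carrier_mat m 1" "w \<noteq> 0\<^sub>m m 1"
    show "Y * w \<noteq> 0\<^sub>m (Suc m) 1"
    proof
      assume z: "Y * w = 0\<^sub>m (Suc m) 1"
      have "w $$ (i, 0) = 0" if i: "i < m" for i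
      proof -
        have "(Y * w) $$ (Suc i, 0) = (\<Sum>k<m. cnj (hcat (- b) (h \<cdot>\<^sub>m 1\<^sub>m m) $$ (k, Suc i)) * w $$ (k, 0))"
          using i w b Y by (simp add: Y_def scalar_prod_def atLeast0LessThan)
        also have "\<dots> = (\<Sum>k<m. if k = i then cnj h * w $$ (i, 0) else 0)"
          using i b by (intro sum.cong) (auto simp: hcat_index)
        finally show ?thesis using i z h r(1) by simp
      qed
      with w show False by (auto intro!: eq_matI)
    qed
  qed
  also have "ct Y * ?P * Y = of_real r \<cdot>\<^sub>m (h \<cdot>\<^sub>m D - b * B)"
  proof -
    have neg: "- M * N = - (M * N)" if "dim_col M = dim_row N" for M N :: "complex mat"
      using that by (intro eq_matI) (auto simp: scalar_prod_def sum_negf)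
    have "ct Y * ?P = hcat ((- b) * (h \<cdot>\<^sub>m 1\<^sub>m 1) + h \<cdot>\<^sub>m 1\<^sub>m m * b) ((- b) * B + h \<cdot>\<^sub>m 1\<^sub>m m * D)"
      unfolding Y_def ct_ct using b B D by (subst hcat_mult_four_block) auto
    also have "(- b) * (h \<cdot>\<^sub>m 1\<^sub>m 1) + h \<cdot>\<^sub>m 1\<^sub>m m * b = 0\<^sub>m m 1"
      using b by (simp add: mat_ring; auto intro!: eq_matI)
    also have "(- b) * B + h \<cdot>\<^sub>m 1\<^sub>m m * D = h \<cdot>\<^sub>m D - b * B"
      using b B D by (simp add: mat_ring neg; auto intro!: eq_matI)
    finally have "ct Y * ?P * Y = hcat (0\<^sub>m m 1) (h \<cdot>\<^sub>m D - b * B) * ct (hcat (- b) (h \<cdot>\<^sub>m 1\<^sub>m m))"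
      by (simp add: Y_def)
    also have "\<dots> = 0\<^sub>m m 1 * ct (- b) + (h \<cdot>\<^sub>m D - b * B) * ct (h \<cdot>\<^sub>m 1\<^sub>m m)"
      using b B D by (subst hcat_mult_ct_hcat) auto
    also have "\<dots> = cnj h \<cdot>\<^sub>m (h \<cdot>\<^sub>m D - b * B)"
      using b B D by (simp add: mat_ring ct_smult; auto intro!: eq_matI)
    finally show ?thesis by (simp add: h)
  qed
  finally have *: "posdef m (of_real r \<cdot>\<^sub>m (h \<cdot>\<^sub>m D - b * B))" .
  have "h \<cdot>\<^sub>m D - b * B \<in> carrier_mat m m" using b B D by (auto intro!: carrier_matI)
  from posdef_scale[OF * r(1) this] show "posdef m (h \<cdot>\<^sub>m D - b * B)" .
qed

text \<open>Congruence diagonalisation over the polynomial ring.  The spurious scalar \<open>s\<close> clears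
  denominators and is harmless, since the factor is only used for a similarity.\<close>

lemma polynomial_gram_factorization:
  fixes H :: "complex poly mat"
  assumes "H \<in> carrier_mat m m" and "\<forall>\<^sub>\<infinity>y :: real. posdef m (evm H (of_real y))"
  shows "\<exists>F \<in> carrier_mat m m. \<exists>s. \<forall>\<^sub>\<infinity>y :: real. (\<exists>r > 0. poly s (of_real y) = of_real r) \<and>
    ct (evm F (of_real y)) * evm F (of_real y) = poly s (of_real y) \<cdot>\<^sub>m evm H (of_real y)"
  using assms
proof (induction m arbitrary: H)
  case 0
  show ?case
    by (intro bexI[of _ "1\<^sub>m 0"] exI[of _ 1] always_eventually)
      (use 0 in \<open>auto intro!: eq_matI exI[of _ 1]\<close>)
next
  case (Suc m)
  define h where "h = H $$ (0, 0)"
  define B where "B = mat 1 m (\<lambda>(i, j). H $$ (0, Suc j))"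
  define b where "b = mat m 1 (\<lambda>(i, j). H $$ (Suc i, 0))"
  define D where "D = mat m m (\<lambda>(i, j). H $$ (Suc i, Suc j))"
  have c: "B \<in> carrier_mat 1 m" "b \<in> carrier_mat m 1" "D \<in> carrier_mat m m" by (simp_all add: B_def b_def D_def)
  have H: "H = four_block_mat (h \<cdot>\<^sub>m 1\<^sub>m 1) B b D"
    using Suc.prems(1) by (intro eq_matI) (auto simp: h_def B_def b_def D_def)
  have eH: "evm H y = four_block_mat (poly h y \<cdot>\<^sub>m 1\<^sub>m 1) (evm B y) (evm b y) (evm D y)" for y
    unfolding H using c by (subst evm_four_block) (auto simp: evm_smult)
  note sch = posdef_schur_complement[OF _ evm_carrier[OF c(1)] evm_carrier[OF c(2)] evm_carrier[OF c(3)]]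
  define H' where "H' = h \<cdot>\<^sub>m D - b * B"
  have H': "H' \<in> carrier_mat m m" using c by (auto simp: H'_def intro!: carrier_matI)
  have eH': "evm H' y = poly h y \<cdot>\<^sub>m evm D y - evm b y * evm B y" for y
    unfolding H'_def using c by (simp add: evm_minus evm_smult evm_mult)
  have "\<forall>\<^sub>\<infinity>y :: real. posdef m (evm H' (of_real y))"
    using Suc.prems(2)
  proof eventually_elim
    case (elim y)
    then show ?case unfolding eH eH' by (rule sch(3))
  qed
  from Suc.IH[OF H' this] obtain F' s' where F': "F' \<in> carrier_mat m m" and
    s': "\<forall>\<^sub>\<infinity>y :: real. (\<exists>r > 0. poly s' (of_real y) = of_real r) \<and>
      ct (evm F' (of_real y)) * evm F' (of_real y) = poly s' (of_real y) \<cdot>\<^sub>m evm H' (of_real y)" by blast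
  from s' have "\<forall>\<^sub>\<infinity>y :: real. Im (poly s' (of_real y)) = 0 \<and> 0 \<le> Re (poly s' (of_real y))"
    by eventually_elim auto
  \<comment> \<open>The scalar left over by the smaller block is a squared modulus on the real line.
    Its root \<open>t\<close> multiplies the first row, so that all four blocks of the product carry
    the common scalar \<open>s' * h\<close>.\<close>
  from scalar_fejer_riesz[OF this] obtain t where
    t: "\<And>y :: real. poly s' (of_real y) = cnj (poly t (of_real y)) * poly t (of_real y)"
    by (auto simp: norm_square_on_reals_def)
  define F where "F = four_block_mat ((t * h) \<cdot>\<^sub>m 1\<^sub>m 1) (t \<cdot>\<^sub>m B) (0\<^sub>m m 1) F'"
  have F: "F \<in> carrier_mat (Suc m) (Suc m)"
    using c F' by (auto simp: F_def intro!: carrier_matI)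
  have "\<forall>\<^sub>\<infinity>y :: real. (\<exists>r > 0. poly (s' * h) (of_real y) = of_real r) \<and>
    ct (evm F (of_real y)) * evm F (of_real y) = poly (s' * h) (of_real y) \<cdot>\<^sub>m evm H (of_real y)"
    using Suc.prems(2) s'
  proof eventually_elim
    case (elim y)
    define hh where "hh = poly h (complex_of_real y)"
    define tt where "tt = poly t (complex_of_real y)"
    define BB where "BB = evm B (complex_of_real y)"
    define bb where "bb = evm b (complex_of_real y)"
    define DD where "DD = evm D (complex_of_real y)"
    define FF where "FF = evm F' (complex_of_real y)"
    have c': "BB \<in> carrier_mat 1 m" "bb \<in> carrier_mat m 1" "DD \<in> carrier_mat m m" "FF \<in> carrier_mat m m"
      using c F' by (simp_all add: BB_def bb_def DD_def FF_def)
    obtain r where r: "r > 0" "hh = of_real r" and bB: "bb = ct BB"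
      using sch(1)[OF elim(1)[unfolded eH]] sch(2)[OF elim(1)[unfolded eH]] unfolding hh_def bb_def BB_def by auto
    have FF: "ct FF * FF = (cnj tt * tt) \<cdot>\<^sub>m (hh \<cdot>\<^sub>m DD - bb * BB)"
      using elim(2) by (simp add: FF_def tt_def hh_def DD_def bb_def BB_def eH' t)
    have eF: "evm F (of_real y) = four_block_mat ((tt * hh) \<cdot>\<^sub>m 1\<^sub>m 1) (tt \<cdot>\<^sub>m BB) (0\<^sub>m m 1) FF"
      unfolding F_def using c F' by (subst evm_four_block)
        (auto simp: evm_smult tt_def hh_def BB_def FF_def intro!: cong_four_block_mat eq_matI)
    have ctF: "ct (evm F (of_real y)) = four_block_mat (cnj (tt * hh) \<cdot>\<^sub>m 1\<^sub>m 1) (0\<^sub>m 1 m) (cnj tt \<cdot>\<^sub>m bb) (ct FF)"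
      unfolding eF using c' bB by (subst ct_four_block) (auto simp: ct_smult)
    have "ct (evm F (of_real y)) * evm F (of_real y) =
      four_block_mat ((cnj (tt * hh) \<cdot>\<^sub>m 1\<^sub>m 1) * ((tt * hh) \<cdot>\<^sub>m 1\<^sub>m 1) + 0\<^sub>m 1 m * 0\<^sub>m m 1)
       ((cnj (tt * hh) \<cdot>\<^sub>m 1\<^sub>m 1) * (tt \<cdot>\<^sub>m BB) + 0\<^sub>m 1 m * FF)
       ((cnj tt \<cdot>\<^sub>m bb) * ((tt * hh) \<cdot>\<^sub>m 1\<^sub>m 1) + ct FF * 0\<^sub>m m 1)
       ((cnj tt \<cdot>\<^sub>m bb) * (tt \<cdot>\<^sub>m BB) + ct FF * FF)"
      unfolding ctF unfolding eF using c' by (subst mult_four_block_mat[of _ 1 1 _ m _ m _ _ 1 _ m]) auto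
    also have "\<dots> = four_block_mat ((cnj tt * tt * hh * hh) \<cdot>\<^sub>m 1\<^sub>m 1) ((cnj tt * tt * hh) \<cdot>\<^sub>m BB)
       ((cnj tt * tt * hh) \<cdot>\<^sub>m bb) ((cnj tt * tt * hh) \<cdot>\<^sub>m DD)"
    proof (intro cong_four_block_mat)
      have ch: "cnj hh = hh" by (simp add: r)
      show "(cnj (tt * hh) \<cdot>\<^sub>m 1\<^sub>m 1) * ((tt * hh) \<cdot>\<^sub>m 1\<^sub>m 1) + 0\<^sub>m 1 m * 0\<^sub>m m 1 = (cnj tt * tt * hh * hh) \<cdot>\<^sub>m 1\<^sub>m 1"
        by (simp add: mat_ring ch; auto intro!: eq_matI)
      show "(cnj (tt * hh) \<cdot>\<^sub>m 1\<^sub>m 1) * (tt \<cdot>\<^sub>m BB) + 0\<^sub>m 1 m * FF = (cnj tt * tt * hh) \<cdot>\<^sub>m BB"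
        using c' by (simp add: mat_ring ch; auto intro!: eq_matI)
      show "(cnj tt \<cdot>\<^sub>m bb) * ((tt * hh) \<cdot>\<^sub>m 1\<^sub>m 1) + ct FF * 0\<^sub>m m 1 = (cnj tt * tt * hh) \<cdot>\<^sub>m bb"
        using c' by (simp add: mat_ring ch; auto intro!: eq_matI)
      show "(cnj tt \<cdot>\<^sub>m bb) * (tt \<cdot>\<^sub>m BB) + ct FF * FF = (cnj tt * tt * hh) \<cdot>\<^sub>m DD"
        unfolding FF using c' by (simp add: mat_ring; auto intro!: eq_matI simp: algebra_simps)
    qed
    also have "\<dots> = poly (s' * h) (of_real y) \<cdot>\<^sub>m evm H (of_real y)"
      unfolding eH using c' by (subst smult_four_block_mat[of _ 1 1 _ m _ m])
        (auto simp: t tt_def hh_def BB_def bb_def DD_def intro!: cong_four_block_mat eq_matI)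
    finally have "ct (evm F (of_real y)) * evm F (of_real y) = poly (s' * h) (of_real y) \<cdot>\<^sub>m evm H (of_real y)" .
    moreover obtain r' where "r' > 0" "poly s' (of_real y) = of_real r'" using elim(2) by auto
    then have "\<exists>r > 0. poly (s' * h) (of_real y) = of_real r"
      using r by (intro exI[of _ "r' * r"]) (auto simp: hh_def)
    ultimately show ?case by blast
  qed
  then show ?case using F by blast
qed

lemma det_map_const: "det (map_mat (\<lambda>c :: complex. [:c:]) Q) = [:det Q:]"
proof (rule poly_eqI_MOST, rule always_eventually, rule allI)
  show "poly (det (map_mat (\<lambda>c. [:c:]) Q)) (of_real y) = poly [:det Q:] (of_real y)" for y :: real
    by (simp add: poly_det_evm evm_const)
qed

text \<open>At a zero \<open>a\<close> of \<open>det F\<close> a constant unitary change of basis makes the first row of \<open>F\<close> divisible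
  by \<open>X - a\<close>; replacing that factor by \<open>X - cnj a\<close> does not change \<open>F\<^sup>* F\<close> on the real line.\<close>

lemma zero_free_in_upper_half_plane:
  fixes F :: "complex poly mat"
  assumes "F \<in> carrier_mat m m" "det F \<noteq> 0"
  shows "\<exists>G \<in> carrier_mat m m. det G \<noteq> 0 \<and> (\<forall>z. Im z > 0 \<longrightarrow> poly (det G) z \<noteq> 0) \<and>
    (\<forall>y :: real. ct (evm G (of_real y)) * evm G (of_real y) = ct (evm F (of_real y)) * evm F (of_real y))"
  using assms
proof (induction "size (filter_mset (\<lambda>z. Im z > 0) (proots (det F)))" arbitrary: F rule: less_induct)
  case less
  show ?case
  proof (cases "\<exists>a. Im a > 0 \<and> poly (det F) a = 0")
    case False
    then show ?thesis using less.prems by (intro bexI[of _ F]) auto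
  next
    case True
    then obtain a where a: "Im a > 0" "poly (det F) a = 0" by auto
    have "m \<noteq> 0" using a(2) less.prems(1) by (intro notI) (simp add: det_dim_zero)
    then obtain n where n: "m = Suc n" by (cases m) auto
    note F = less.prems[unfolded n]
    have "det (ct (evm F a)) = 0" using a(2) F(1) by (simp add: poly_det_evm det_ct[of _ "Suc n"])
    then obtain u where u: "u \<in> carrier_mat (Suc n) 1" "u \<noteq> 0\<^sub>m (Suc n) 1" "ct (evm F a) * u = 0\<^sub>m (Suc n) 1"
      using det_zero_iff_kernel[of "ct (evm F a)" "Suc n"] F(1) by auto
    obtain Y k where Y: "Y \<in> carrier_mat (Suc n) n" "ct (hcat (k \<cdot>\<^sub>m u) Y) * hcat (k \<cdot>\<^sub>m u) Y = 1\<^sub>m (Suc n)"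
      using unitary_completion[OF u(1,2)] by metis
    define U where "U = hcat (k \<cdot>\<^sub>m u) Y"
    have U: "U \<in> carrier_mat (Suc n) (Suc n)" using hcat_carrier[of "k \<cdot>\<^sub>m u" "Suc n" 1 Y n] u Y by (simp add: U_def)
    have UU: "U * ct U = 1\<^sub>m (Suc n)" "det (ct U) \<noteq> 0"
      using det_nonzero_left_inverse[OF U ct_carrier[OF U]] Y(2) by (auto simp: U_def det_ct[OF U, unfolded U_def])
    define Q where "Q = map_mat (\<lambda>c. [:c:]) (ct U)"
    have Q: "Q \<in> carrier_mat (Suc n) (Suc n)" "\<And>y. evm Q y = ct U" using U by (auto simp: Q_def evm_const)
    define G where "G = Q * F"
    have G: "G \<in> carrier_mat (Suc n) (Suc n)" using Q F by (auto simp: G_def)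
    have eG: "evm G y = ct U * evm F y" for y unfolding G_def using Q F by (simp add: evm_mult)
    have dG: "det G = smult (det (ct U)) (det F)" using det_mult[OF Q(1) F(1)] by (simp add: G_def Q_def det_map_const)
    have GG: "ct (evm G y) * evm G y = ct (evm F y) * evm F y" for y
    proof -
      have "ct (evm G y) * evm G y = ct (evm F y) * (U * ct U) * evm F y"
        unfolding eG using U F(1) by (simp add: ct_mult mat_ring)
      then show ?thesis unfolding UU(1) using F(1) by (simp add: mat_ring)
    qed
    have row0: "poly (G $$ (0, j)) a = 0" if j: "j < Suc n" for j
    proof -
      have "(ct (evm F a) * U) $$ (j, 0) = (\<Sum>l<Suc n. ct (evm F a) $$ (j, l) * U $$ (l, 0))"
        using j U F(1) by (auto simp: scalar_prod_def atLeast0LessThan)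
      also have "\<dots> = k * (\<Sum>l<Suc n. ct (evm F a) $$ (j, l) * u $$ (l, 0))"
        using u Y by (simp add: U_def hcat_index sum_distrib_left mult_ac distrib_left)
      also have "(\<Sum>l<Suc n. ct (evm F a) $$ (j, l) * u $$ (l, 0)) = (ct (evm F a) * u) $$ (j, 0)"
        using j u(1) F(1) by (auto simp: scalar_prod_def atLeast0LessThan)
      also have "\<dots> = 0" using j by (simp add: u(3))
      finally have "(ct (evm F a) * U) $$ (j, 0) = 0" by simp
      moreover have "ct (evm F a) * U = ct (evm G a)" unfolding eG using U F(1) by (simp add: ct_mult)
      ultimately show ?thesis using j G by simp
    qed
    define R where "R = mat (Suc n) (Suc n) (\<lambda>(i, j). if i = 0 then G $$ (0, j) div [:-a, 1:] else G $$ (i, j))"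
    have R: "R \<in> carrier_mat (Suc n) (Suc n)" by (simp add: R_def)
    have G': "G = multrow 0 [:-a, 1:] R"
    proof (rule eq_matI)
      fix i j assume "i < dim_row (multrow 0 [:-a, 1:] R)" "j < dim_col (multrow 0 [:-a, 1:] R)"
      then show "G $$ (i, j) = multrow 0 [:-a, 1:] R $$ (i, j)"
        using row0[of j] by (auto simp: R_def poly_eq_0_iff_dvd simp del: mult_pCons_left)
    qed (use G in \<open>auto simp: R_def\<close>)
    define F1 where "F1 = multrow 0 [:- cnj a, 1:] R"
    have F1: "F1 \<in> carrier_mat m m" using R by (simp add: F1_def n)
    have dR: "det G = [:-a, 1:] * det R" "det F1 = [:- cnj a, 1:] * det R"
      unfolding G' F1_def by (intro det_multrow[OF _ R]; simp)+
    have R0: "det R \<noteq> 0" using dG dR UU F by auto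
    have FF1: "ct (evm F1 (of_real y)) * evm F1 (of_real y) = ct (evm G (of_real y)) * evm G (of_real y)" for y :: real
    proof (rule eq_matI)
      fix i j assume "i < dim_row (ct (evm G (of_real y)) * evm G (of_real y))" "j < dim_col (ct (evm G (of_real y)) * evm G (of_real y))"
      then have ij: "i < Suc n" "j < Suc n" using G by auto
      have "cnj (poly (F1 $$ (l, i)) (of_real y)) * poly (F1 $$ (l, j)) (of_real y) =
          cnj (poly (G $$ (l, i)) (of_real y)) * poly (G $$ (l, j)) (of_real y)" if "l < Suc n" for l
        unfolding G' F1_def using that ij R by (auto simp: algebra_simps)
      then show "(ct (evm F1 (of_real y)) * evm F1 (of_real y)) $$ (i, j) = (ct (evm G (of_real y)) * evm G (of_real y)) $$ (i, j)"
        using ij F1 G unfolding n by (auto simp: scalar_prod_def intro!: sum.cong)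
    qed (use F1 G n in auto)
    have "size (filter_mset (\<lambda>z. Im z > 0) (proots (det F))) = size (filter_mset (\<lambda>z. Im z > 0) (proots (det G)))"
      using UU(2) by (simp add: dG)
    also have "proots (det G) = {#a#} + proots (det R)" unfolding dR using R0 by (simp add: proots_mult del: mult_pCons_left)
    finally have "size (filter_mset (\<lambda>z. Im z > 0) (proots (det F1))) < size (filter_mset (\<lambda>z. Im z > 0) (proots (det F)))"
      unfolding dR using R0 a by (simp add: proots_mult del: mult_pCons_left)
    moreover have "det F1 \<noteq> 0" unfolding dR using R0 by (simp del: mult_pCons_left)
    ultimately obtain G1 where "G1 \<in> carrier_mat m m" "det G1 \<noteq> 0" "\<forall>z. Im z > 0 \<longrightarrow> poly (det G1) z \<noteq> 0"
      "\<forall>y :: real. ct (evm G1 (of_real y)) * evm G1 (of_real y) = ct (evm F1 (of_real y)) * evm F1 (of_real y)"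
      using less.hyps[OF _ F1] by auto
    then show ?thesis unfolding FF1 GG by blast
  qed
qed

section \<open>Families of real-rooted polynomials\<close>

definition tr :: "'a :: comm_monoid_add mat \<Rightarrow> 'a" where
  "tr A = (\<Sum>i<dim_row A. A $$ (i, i))"

lemma tr_mult: "dim_col A = dim_row B \<Longrightarrow> dim_row A = dim_col B \<Longrightarrow>
    tr (A * B) = (\<Sum>i<dim_row A. \<Sum>j<dim_col A. A $$ (i, j) * (B :: 'a :: comm_semiring_0 mat) $$ (j, i))"
  by (auto simp: tr_def scalar_prod_def atLeast0LessThan intro!: sum.cong)

lemma tr_comm: "dim_col A = dim_row B \<Longrightarrow> dim_row A = dim_col B \<Longrightarrow> tr (A * B) = tr (B * (A :: 'a :: comm_semiring_0 mat))"
  by (simp add: tr_mult) (subst sum.swap, simp add: mult.commute)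

lemma tr_similar:
  fixes A :: "complex mat"
  assumes "A \<in> carrier_mat m m" "B \<in> carrier_mat m m" "F \<in> carrier_mat m m" "det F \<noteq> 0" "A * F = F * B"
  shows "tr A = tr B"
proof -
  obtain G where G: "G \<in> carrier_mat m m" "F * G = 1\<^sub>m m" "G * F = 1\<^sub>m m"
    using det_nonzero_inverse[OF assms(3,4)] by metis
  have "A = A * (F * G)" using assms(1) G by (simp add: mat_ring)
  also have "\<dots> = (A * F) * G" using assms(1,3) G(1) by (simp add: mat_ring)
  also have "\<dots> = F * (B * G)" unfolding assms(5) using assms(2,3) G(1) by (simp add: mat_ring)
  finally have "tr A = tr ((B * G) * F)" using assms(2,3) G(1) tr_comm[of F "B * G"] by simp
  also have "(B * G) * F = B * (G * F)" using assms(2,3) G(1) by (simp add: mat_ring)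
  also have "\<dots> = B" using assms(2) G by (simp add: mat_ring)
  finally show ?thesis .
qed

lemma tr_evm: "dim_row A = dim_col A \<Longrightarrow> poly (tr A) z = tr (evm A z)"
  by (simp add: tr_def poly_sum)

text \<open>For a Hermitian matrix the trace of the square is the sum of all squared moduli of
  entries. Being a similarity invariant, it can be computed from the companion matrix.\<close>

lemma hermitian_entry_bound:
  assumes M: "M \<in> carrier_mat m m" "ct M = M" and ij: "i < m" "j < m"
  shows "(cmod (M $$ (i, j)))\<^sup>2 \<le> cmod (tr (M * M))"
proof -
  have c: "cnj (M $$ (l, k)) = M $$ (k, l)" if "k < m" "l < m" for k l
    using that M by (metis carrier_matD ct_index)
  have "tr (M * M) = (\<Sum>k<m. \<Sum>l<m. of_real ((cmod (M $$ (k, l)))\<^sup>2))"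
    using M c unfolding complex_norm_square by (auto simp: tr_mult intro!: sum.cong)
  then have "tr (M * M) = of_real (\<Sum>k<m. \<Sum>l<m. (cmod (M $$ (k, l)))\<^sup>2)" by simp
  then have "cmod (tr (M * M)) = (\<Sum>k<m. \<Sum>l<m. (cmod (M $$ (k, l)))\<^sup>2)"
    by (simp only: norm_of_real) (simp add: sum_nonneg)
  moreover have "(cmod (M $$ (i, j)))\<^sup>2 \<le> (\<Sum>l<m. (cmod (M $$ (i, l)))\<^sup>2)"
    using ij by (intro member_le_sum) auto
  moreover have "\<dots> \<le> (\<Sum>k<m. \<Sum>l<m. (cmod (M $$ (k, l)))\<^sup>2)"
    using ij by (intro member_le_sum[of i "{..<m}" "\<lambda>k. \<Sum>l<m. (cmod (M $$ (k, l)))\<^sup>2"] sum_nonneg) auto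
  ultimately show ?thesis by linarith
qed

text \<open>The sum of the squared \<open>2 \<times> 2\<close> minors of a Hermitian matrix is a similarity invariant.\<close>

lemma hermitian_minor_bound:
  assumes M: "M \<in> carrier_mat m m" "ct M = M" and ij: "i < m" "j < m" "k < m" "l < m"
  shows "(cmod (M $$ (i, j) * M $$ (k, l) - M $$ (i, l) * M $$ (k, j)))\<^sup>2
    \<le> cmod (2 * (tr (M * M) * tr (M * M) - tr ((M * M) * (M * M))))"
proof -
  have c: "cnj (M $$ (l, k)) = M $$ (k, l)" if "k < m" "l < m" for k l
    using that M by (metis carrier_matD ct_index)
  define S where "S = {..<m} \<times> {..<m} \<times> {..<m} \<times> {..<m}"
  let ?f = "\<lambda>(i, j, k, l). (cmod (M $$ (i, j) * M $$ (k, l) - M $$ (i, l) * M $$ (k, j)))\<^sup>2"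
  have t2: "tr (M * M) = (\<Sum>i<m. \<Sum>j<m. M $$ (i, j) * M $$ (j, i))" using M by (simp add: tr_mult)
  have t4: "tr ((M * M) * (M * M)) = (\<Sum>i<m. \<Sum>k<m. (\<Sum>j<m. M $$ (i, j) * M $$ (j, k)) * (\<Sum>l<m. M $$ (k, l) * M $$ (l, i)))"
    using M by (subst tr_mult) (auto simp: scalar_prod_def atLeast0LessThan intro!: sum.cong)
  have e: "complex_of_real (?f (i, j, k, l)) =
      (M $$ (i, j) * M $$ (j, i)) * (M $$ (k, l) * M $$ (l, k)) + (M $$ (i, l) * M $$ (l, i)) * (M $$ (k, j) * M $$ (j, k))
      - (M $$ (i, j) * M $$ (j, k)) * (M $$ (k, l) * M $$ (l, i)) - (M $$ (i, l) * M $$ (l, k)) * (M $$ (k, j) * M $$ (j, i))"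
    if "i < m" "j < m" "k < m" "l < m" for i j k l
    unfolding prod.case complex_norm_square using that by (simp add: c algebra_simps)
  have "complex_of_real (\<Sum>x\<in>S. ?f x) = (\<Sum>i<m. \<Sum>j<m. \<Sum>k<m. \<Sum>l<m. complex_of_real (?f (i, j, k, l)))"
    unfolding S_def of_real_sum by (simp add: sum.cartesian_product case_prod_unfold)
  also have "\<dots> = (\<Sum>i<m. \<Sum>j<m. \<Sum>k<m. \<Sum>l<m.
      (M $$ (i, j) * M $$ (j, i)) * (M $$ (k, l) * M $$ (l, k)) + (M $$ (i, l) * M $$ (l, i)) * (M $$ (k, j) * M $$ (j, k))
      - (M $$ (i, j) * M $$ (j, k)) * (M $$ (k, l) * M $$ (l, i)) - (M $$ (i, l) * M $$ (l, k)) * (M $$ (k, j) * M $$ (j, i)))"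
    by (intro sum.cong refl e) auto
  also have "\<dots> = 2 * (tr (M * M) * tr (M * M) - tr ((M * M) * (M * M)))"
  proof -
    \<comment> \<open>Exchanging the names of \<open>j\<close> and \<open>l\<close> identifies the
      second and fourth of the four sums with the first and third.\<close>
    have swap3: "(\<Sum>j<m. \<Sum>k<m. \<Sum>l<m. \<phi> l k j) = (\<Sum>l<m. \<Sum>k<m. \<Sum>j<m. \<phi> l k j)" for \<phi> :: "nat \<Rightarrow> nat \<Rightarrow> nat \<Rightarrow> complex"
    proof -
      have "(\<Sum>j<m. \<Sum>k<m. \<Sum>l<m. \<phi> l k j) = (\<Sum>k<m. \<Sum>j<m. \<Sum>l<m. \<phi> l k j)" by (rule sum.swap)
      also have "\<dots> = (\<Sum>k<m. \<Sum>l<m. \<Sum>j<m. \<phi> l k j)" by (intro sum.cong refl sum.swap)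
      also have "\<dots> = (\<Sum>l<m. \<Sum>k<m. \<Sum>j<m. \<phi> l k j)" by (rule sum.swap)
      finally show ?thesis .
    qed
    let ?A = "\<lambda>i j k l. (M $$ (i, j) * M $$ (j, i)) * (M $$ (k, l) * M $$ (l, k))"
    let ?C = "\<lambda>i j k l. (M $$ (i, j) * M $$ (j, k)) * (M $$ (k, l) * M $$ (l, i))"
    have A: "(\<Sum>i<m. \<Sum>j<m. \<Sum>k<m. \<Sum>l<m. ?A i j k l) = tr (M * M) * tr (M * M)"
      unfolding t2 by (simp only: sum_distrib_right) (simp only: sum_distrib_left)
    have B: "(\<Sum>i<m. \<Sum>j<m. \<Sum>k<m. \<Sum>l<m. ?A i l k j) = tr (M * M) * tr (M * M)"
      unfolding A[symmetric] by (intro sum.cong refl swap3)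
    have C: "(\<Sum>i<m. \<Sum>j<m. \<Sum>k<m. \<Sum>l<m. ?C i j k l) = tr ((M * M) * (M * M))"
      unfolding t4 sum_product by (intro sum.cong refl sum.swap)
    have D: "(\<Sum>i<m. \<Sum>j<m. \<Sum>k<m. \<Sum>l<m. ?C i l k j) = tr ((M * M) * (M * M))"
      unfolding C[symmetric] by (intro sum.cong refl swap3)
    show ?thesis by (simp only: sum.distrib sum_subtractf A B C D) simp
  qed
  finally have eq: "complex_of_real (\<Sum>x\<in>S. ?f x) = 2 * (tr (M * M) * tr (M * M) - tr ((M * M) * (M * M)))" .
  have nn: "0 \<le> (\<Sum>x\<in>S. ?f x)" by (intro sum_nonneg) (auto split: prod.split)
  have "cmod (2 * (tr (M * M) * tr (M * M) - tr ((M * M) * (M * M)))) = (\<Sum>x\<in>S. ?f x)"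
    unfolding eq[symmetric] norm_of_real by (rule abs_of_nonneg[OF nn])
  moreover have "?f (i, j, k, l) \<le> (\<Sum>x\<in>S. ?f x)"
    using ij by (intro member_le_sum) (auto simp: S_def)
  ultimately show ?thesis by simp
qed

text \<open>The normal form reached by the substitution for \<open>w\<close>, with \<open>m\<close>
  distinct real roots at almost every real \<open>y\<close>. The last two assumptions give the top
  coefficient \<open>n\<close> distinct zeros and the largest degree, so that the quotient of the
  conjugated matrix by it has simple poles and a finite value at infinity.\<close>

locale hyperbolic_family =
  fixes b :: "nat \<Rightarrow> complex poly" and m n :: nat
  assumes m_pos: "m > 0"
    and real_coeffs: "\<And>k y. k \<le> m \<Longrightarrow> cnj (poly (b k) (complex_of_real y)) = poly (b k) (of_real y)"
    and degree_coeffs: "\<And>k. k \<le> m \<Longrightarrow> degree (b k) \<le> n"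
    and real_rooted: "\<forall>\<^sub>\<infinity>y :: real. poly (b m) (of_real y) \<noteq> 0 \<and> (\<exists>ws :: real list. distinct ws \<and> length ws = m \<and>
        (\<forall>w \<in> set ws. (\<Sum>k\<le>m. poly (b k) (of_real y) * of_real w ^ k) = 0))"
    and degree_top: "degree (b m) = n"
    and simple_top: "card {z. poly (b m) z = 0} = n"
begin

section \<open>The companion matrix and its Hermite matrix\<close>

definition q :: "complex \<Rightarrow> complex \<Rightarrow> complex" where
  "q y w = (\<Sum>k\<le>m. poly (b k) y * w ^ k)"

text \<open>The companion matrix of \<open>q y\<close>, multiplied by the leading coefficient.\<close>

definition C :: "complex poly mat" where
  "C = mat m m (\<lambda>(i, k). if k = m - 1 then - b i else if i = Suc k then b m else 0)"

lemma C_carrier [simp]: "C \<in> carrier_mat m m"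
  by (simp add: C_def)

definition vander :: "real list \<Rightarrow> complex mat" where
  "vander ws = mat m m (\<lambda>(j, k). of_real (ws ! j) ^ k)"

definition diag_of :: "(nat \<Rightarrow> complex) \<Rightarrow> complex mat" where
  "diag_of d = mat m m (\<lambda>(i, j). if i = j then d i else 0)"

lemma vander_carrier [simp]: "vander ws \<in> carrier_mat m m"
  by (simp add: vander_def)

lemma diag_of_carrier [simp]: "diag_of d \<in> carrier_mat m m"
  by (simp add: diag_of_def)

lemma diag_of_mult:
  assumes "A \<in> carrier_mat m k" "i < m" "j < k"
  shows "(diag_of d * A) $$ (i, j) = d i * A $$ (i, j)"
proof -
  have "(diag_of d * A) $$ (i, j) = (\<Sum>l<m. diag_of d $$ (i, l) * A $$ (l, j))"
    using assms by (auto simp: diag_of_def scalar_prod_def atLeast0LessThan)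
  also have "\<dots> = (\<Sum>l<m. if l = i then d i * A $$ (i, j) else 0)"
    using assms by (intro sum.cong) (auto simp: diag_of_def)
  finally show ?thesis using assms by simp
qed

lemma det_diag_of: "det (diag_of d) = (\<Prod>i<m. d i)"
proof -
  have "upper_triangular (diag_of d)" by (auto simp: diag_of_def upper_triangular_def)
  from det_upper_triangular[OF this diag_of_carrier] show ?thesis
    by (simp add: diag_mat_def diag_of_def prod.list_conv_set_nth atLeast0LessThan)
qed

definition good :: "real \<Rightarrow> real list \<Rightarrow> bool" where
  "good y ws \<longleftrightarrow> poly (b m) (of_real y) \<noteq> 0 \<and> distinct ws \<and> length ws = m \<and> (\<forall>w \<in> set ws. q (of_real y) (of_real w) = 0)"

lemma MOST_good: "\<forall>\<^sub>\<infinity>y. \<exists>ws. good y ws"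
  using real_rooted by eventually_elim (auto simp: good_def q_def)

text \<open>The row of powers of a root is a left eigenvector of the companion matrix. All columns
  but the last merely shift the powers; the last one is where the root equation enters.\<close>

lemma vander_C:
  assumes g: "good y ws"
  shows "vander ws * evm C (of_real y) = diag_of (\<lambda>j. poly (b m) (of_real y) * of_real (ws ! j)) * vander ws"
proof (rule eq_matI)
  fix j k assume "j < dim_row (diag_of (\<lambda>j. poly (b m) (of_real y) * of_real (ws ! j)) * vander ws)"
    "k < dim_col (diag_of (\<lambda>j. poly (b m) (of_real y) * of_real (ws ! j)) * vander ws)"
  then have jk: "j < m" "k < m" by (auto simp: diag_of_def vander_def)
  let ?y = "complex_of_real y" and ?w = "complex_of_real (ws ! j)"
  have L: "(vander ws * evm C ?y) $$ (j, k) = (\<Sum>i<m. ?w ^ i * poly (C $$ (i, k)) ?y)"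
    using jk by (auto simp: vander_def C_def scalar_prod_def atLeast0LessThan)
  have "(\<Sum>i<m. ?w ^ i * poly (C $$ (i, k)) ?y) = poly (b m) ?y * ?w * ?w ^ k"
  proof (cases "k = m - 1")
    case True
    have "q ?y ?w = 0" using g jk by (auto simp: good_def)
    moreover have "q ?y ?w = (\<Sum>i<m. ?w ^ i * poly (b i) ?y) + poly (b m) ?y * ?w ^ m"
      unfolding q_def lessThan_Suc_atMost[symmetric] by (simp add: mult.commute)
    moreover have "?w ^ m = ?w * ?w ^ k" using True m_pos by (cases m) auto
    ultimately have "- (\<Sum>i<m. ?w ^ i * poly (b i) ?y) = poly (b m) ?y * ?w * ?w ^ k"
      by (simp add: add_eq_0_iff mult_ac)
    moreover have "(\<Sum>i<m. ?w ^ i * poly (C $$ (i, k)) ?y) = - (\<Sum>i<m. ?w ^ i * poly (b i) ?y)"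
      using True jk by (simp add: C_def sum_negf)
    ultimately show ?thesis by simp
  next
    case False
    then have k: "Suc k < m" using jk by auto
    have "(\<Sum>i<m. ?w ^ i * poly (C $$ (i, k)) ?y) = (\<Sum>i<m. if i = Suc k then ?w ^ Suc k * poly (b m) ?y else 0)"
      using False jk by (intro sum.cong) (auto simp: C_def)
    then show ?thesis using k by simp
  qed
  then show "(vander ws * evm C ?y) $$ (j, k) = (diag_of (\<lambda>j. poly (b m) ?y * of_real (ws ! j)) * vander ws) $$ (j, k)"
    using L diag_of_mult[OF vander_carrier jk] jk by (simp add: vander_def)
qed (auto simp: diag_of_def vander_def C_def)

text \<open>A kernel vector is the coefficient list of a nonzero polynomial of degree below
  \<open>m\<close> that vanishes at \<open>m\<close> distinct points.\<close>

lemma det_vander: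
  assumes g: "good y ws" shows "det (vander ws) \<noteq> 0"
proof
  assume "det (vander ws) = 0"
  then obtain x where x: "x \<in> carrier_mat m 1" "x \<noteq> 0\<^sub>m m 1" "vander ws * x = 0\<^sub>m m 1"
    using det_zero_iff_kernel[OF vander_carrier] by auto
  define p where "p = (\<Sum>k<m. monom (x $$ (k, 0)) k)"
  have cp: "coeff p k = (if k < m then x $$ (k, 0) else 0)" for k
    by (auto simp: p_def coeff_sum)
  have "p \<noteq> 0"
  proof
    assume "p = 0"
    then have "x $$ (k, 0) = 0" if "k < m" for k using cp[of k] that by simp
    with x show False by (auto intro!: eq_matI)
  qed
  have "degree p < m" using m_pos cp by (intro degree_lessI) auto
  have "poly p (of_real (ws ! j)) = 0" if j: "j < m" for j
  proof -
    have "(vander ws * x) $$ (j, 0) = (\<Sum>k<m. of_real (ws ! j) ^ k * x $$ (k, 0))"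
      using j x(1) by (auto simp: vander_def scalar_prod_def atLeast0LessThan)
    also have "\<dots> = poly p (of_real (ws ! j))" by (simp add: p_def poly_sum poly_monom mult.commute)
    finally show ?thesis using x(3) j by simp
  qed
  then have "complex_of_real ` set ws \<subseteq> {z. poly p z = 0}" using g by (auto simp: good_def in_set_conv_nth)
  moreover have "card (complex_of_real ` set ws) = m"
    using g by (simp add: card_image inj_on_def good_def distinct_card)
  ultimately have "m \<le> card {z. poly p z = 0}" using poly_roots_finite[OF \<open>p \<noteq> 0\<close>] card_mono by metis
  also have "\<dots> \<le> degree p" by (rule card_poly_roots_bound[OF \<open>p \<noteq> 0\<close>])
  finally show False using \<open>degree p < m\<close> by simp
qed

lemma vander_C_pow:
  assumes g: "good y ws"
  shows "vander ws * evm C (of_real y) ^\<^sub>m r = diag_of (\<lambda>j. (poly (b m) (of_real y) * of_real (ws ! j)) ^ r) * vander ws"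
proof (induction r)
  case 0
  have "diag_of (\<lambda>j. 1) = 1\<^sub>m m" by (rule eq_matI) (auto simp: diag_of_def)
  then show ?case by (simp add: mat_ring vander_def C_def)
next
  case (Suc r)
  let ?C = "evm C (of_real y)" and ?d = "\<lambda>j. poly (b m) (of_real y) * complex_of_real (ws ! j)"
  have Cc: "?C \<in> carrier_mat m m" "?C ^\<^sub>m r \<in> carrier_mat m m" by (auto intro: pow_carrier_mat)
  have "vander ws * ?C ^\<^sub>m Suc r = (vander ws * ?C ^\<^sub>m r) * ?C"
    using Cc by (simp add: assoc_mult_mat[of _ m m _ m _ m])
  also have "\<dots> = diag_of (\<lambda>j. ?d j ^ r) * (vander ws * ?C)"
    unfolding Suc.IH using Cc by (simp add: assoc_mult_mat[of _ m m _ m _ m])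
  also have "\<dots> = (diag_of (\<lambda>j. ?d j ^ r) * diag_of ?d) * vander ws"
    unfolding vander_C[OF g] by (simp add: assoc_mult_mat[of _ m m _ m _ m])
  also have "diag_of (\<lambda>j. ?d j ^ r) * diag_of ?d = diag_of (\<lambda>j. ?d j ^ Suc r)"
  proof (rule eq_matI)
    fix i j assume "i < dim_row (diag_of (\<lambda>j. ?d j ^ Suc r))" "j < dim_col (diag_of (\<lambda>j. ?d j ^ Suc r))"
    then have ij: "i < m" "j < m" by (auto simp: diag_of_def)
    show "(diag_of (\<lambda>j. ?d j ^ r) * diag_of ?d) $$ (i, j) = diag_of (\<lambda>j. ?d j ^ Suc r) $$ (i, j)"
      unfolding diag_of_mult[OF diag_of_carrier ij] using ij by (simp add: diag_of_def)
  qed (auto simp: diag_of_def)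
  finally show ?case .
qed

lemma tr_C_pow:
  assumes g: "good y ws"
  shows "tr (evm C (of_real y) ^\<^sub>m r) = (\<Sum>j<m. (poly (b m) (of_real y) * of_real (ws ! j)) ^ r)"
proof -
  have "tr (diag_of (\<lambda>j. (poly (b m) (of_real y) * of_real (ws ! j)) ^ r)) = tr (evm C (of_real y) ^\<^sub>m r)"
    by (rule tr_similar[where F = "vander ws" and m = m])
      (use det_vander[OF g] vander_C_pow[OF g, of r] in \<open>auto intro: pow_carrier_mat\<close>)
  then show ?thesis by (simp add: tr_def diag_of_def)
qed

text \<open>On the real line \<open>H = b\<^sub>m\<^bsup>2m\<^esup> V\<^sup>T V\<close> for the Vandermonde matrix \<open>V\<close> of the roots.\<close>

definition H :: "complex poly mat" where
  "H = mat m m (\<lambda>(k, l). b m ^ (2 * m - (k + l)) * tr (C ^\<^sub>m (k + l)))"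

lemma H_carrier [simp]: "H \<in> carrier_mat m m"
  by (simp add: H_def)

lemma evm_pow: "A \<in> carrier_mat k k \<Longrightarrow> evm (A ^\<^sub>m r) z = evm A z ^\<^sub>m r"
  by (induction r) (auto simp: evm_mult)

lemma H_good:
  assumes g: "good y ws"
  shows "evm H (of_real y) = poly (b m) (of_real y) ^ (2 * m) \<cdot>\<^sub>m (ct (vander ws) * vander ws)"
proof (rule eq_matI)
  let ?a = "poly (b m) (complex_of_real y)"
  fix k l assume "k < dim_row (?a ^ (2 * m) \<cdot>\<^sub>m (ct (vander ws) * vander ws))"
    "l < dim_col (?a ^ (2 * m) \<cdot>\<^sub>m (ct (vander ws) * vander ws))"
  then have kl: "k < m" "l < m" by (auto simp: vander_def)
  have cp: "C ^\<^sub>m (k + l) \<in> carrier_mat m m" by (intro pow_carrier_mat) simp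
  have "evm H (of_real y) $$ (k, l) = ?a ^ (2 * m - (k + l)) * tr (evm C (of_real y) ^\<^sub>m (k + l))"
    using kl carrier_matD[OF cp] by (simp add: H_def tr_evm evm_pow[OF C_carrier])
  also have "\<dots> = ?a ^ (2 * m - (k + l)) * (\<Sum>j<m. ?a ^ (k + l) * of_real (ws ! j) ^ (k + l))"
    unfolding tr_C_pow[OF g] by (simp add: power_mult_distrib)
  also have "\<dots> = ?a ^ (2 * m) * (\<Sum>j<m. of_real (ws ! j) ^ (k + l))"
    using kl by (simp add: sum_distrib_left mult.assoc[symmetric] power_add[symmetric])
  also have "(\<Sum>j<m. complex_of_real (ws ! j) ^ (k + l)) = (ct (vander ws) * vander ws) $$ (k, l)"
    using kl by (auto simp: vander_def scalar_prod_def atLeast0LessThan power_add)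
  finally show "evm H (of_real y) $$ (k, l) = (?a ^ (2 * m) \<cdot>\<^sub>m (ct (vander ws) * vander ws)) $$ (k, l)"
    using kl by (simp add: vander_def)
qed (auto simp: H_def vander_def)

lemma top_real: "\<exists>r :: real. poly (b m) (of_real y) = of_real r"
  using real_coeffs[of m y] by (metis Reals_cnj_iff Reals_cases le_refl)

text \<open>The top coefficient is real on the real line and enters with the even exponent
  \<open>2 * m\<close>, so the scalar in front of the Gram matrix of the Vandermonde matrix is
  positive.\<close>

lemma posdef_H: "\<forall>\<^sub>\<infinity>y :: real. posdef m (evm H (of_real y))"
  using MOST_good
proof eventually_elim
  case (elim y)
  then obtain ws where g: "good y ws" by auto
  obtain r where r: "poly (b m) (of_real y) = complex_of_real r" using top_real by auto
  have "r \<noteq> 0" using g r by (auto simp: good_def)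
  then have r0: "r ^ (2 * m) > 0" by (auto simp: power_mult)
  have "posdef m (ct (vander ws) * 1\<^sub>m m * vander ws)"
    using det_vander[OF g] det_zero_iff_kernel[OF vander_carrier[of ws]]
    by (intro posdef_compression[OF posdef_one vander_carrier]) auto
  then have P: "posdef m (ct (vander ws) * vander ws)" by (simp add: mat_ring vander_def)
  have "of_real (1 / r ^ (2 * m)) \<cdot>\<^sub>m evm H (of_real y) = ct (vander ws) * vander ws"
    unfolding H_good[OF g] r using r0 \<open>r \<noteq> 0\<close> by (intro eq_matI) auto
  then have P': "posdef m (of_real (1 / r ^ (2 * m)) \<cdot>\<^sub>m evm H (of_real y))" by (simp only: P)
  have "1 / r ^ (2 * m) > 0" using r0 by simp
  from posdef_scale[OF P' this] show ?case by simp
qed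

end

section \<open>The Hermitian conjugate of the companion matrix\<close>

context hyperbolic_family
begin

text \<open>At good points \<open>H\<close> is a nonzero multiple of the Gram matrix of an
  invertible matrix, so the first factor \<open>F0\<close> has nonzero determinant; moving its zeros
  out of the upper half plane keeps the Gram matrix on the real line.\<close>

lemma exists_spectral_factor:
  "\<exists>F \<in> carrier_mat m m. det F \<noteq> 0 \<and> (\<forall>z. Im z > 0 \<longrightarrow> poly (det F) z \<noteq> 0) \<and>
    (\<forall>\<^sub>\<infinity>y :: real. \<exists>r > 0. ct (evm F (of_real y)) * evm F (of_real y) = complex_of_real r \<cdot>\<^sub>m evm H (of_real y))"
proof -
  obtain F0 s where F0: "F0 \<in> carrier_mat m m" and
    s: "\<forall>\<^sub>\<infinity>y :: real. (\<exists>r > 0. poly s (of_real y) = of_real r) \<and>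
      ct (evm F0 (of_real y)) * evm F0 (of_real y) = poly s (of_real y) \<cdot>\<^sub>m evm H (of_real y)"
    using polynomial_gram_factorization[OF H_carrier posdef_H] by blast
  have "\<forall>\<^sub>\<infinity>y :: real. poly (det F0) (of_real y) \<noteq> 0"
    using s MOST_good
  proof eventually_elim
    case (elim y)
    then obtain ws r where g: "good y ws" and r: "r > 0" "poly s (of_real y) = complex_of_real r" by auto
    have "det (ct (evm F0 (of_real y)) * evm F0 (of_real y)) = det (ct (evm F0 (of_real y))) * det (evm F0 (of_real y))"
      using F0 by (intro det_mult[of _ m]) auto
    moreover have "det (ct (evm F0 (of_real y)) * evm F0 (of_real y)) \<noteq> 0"
    proof -
      have "det (ct (vander ws) * vander ws) = det (ct (vander ws)) * det (vander ws)"
        by (intro det_mult[of _ m]) auto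
      then have "det (ct (vander ws) * vander ws) \<noteq> 0"
        using det_vander[OF g] by (simp add: det_ct[OF vander_carrier])
      then show ?thesis using elim(1) r g unfolding H_good[OF g] by (auto simp: good_def det_smult)
    qed
    ultimately show ?case by (auto simp: poly_det_evm)
  qed
  then have "det F0 \<noteq> 0" using MOST_real_nonempty by force
  from zero_free_in_upper_half_plane[OF F0 this] obtain F where F: "F \<in> carrier_mat m m" "det F \<noteq> 0"
    "\<forall>z. Im z > 0 \<longrightarrow> poly (det F) z \<noteq> 0"
    "\<forall>y :: real. ct (evm F (of_real y)) * evm F (of_real y) = ct (evm F0 (of_real y)) * evm F0 (of_real y)" by blast
  have "\<forall>\<^sub>\<infinity>y :: real. \<exists>r > 0. ct (evm F (of_real y)) * evm F (of_real y) = complex_of_real r \<cdot>\<^sub>m evm H (of_real y)"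
    using s
  proof eventually_elim
    case (elim y)
    then show ?case using F(4) by metis
  qed
  then show ?thesis using F by blast
qed

definition F :: "complex poly mat" where
  "F = (SOME F. F \<in> carrier_mat m m \<and> det F \<noteq> 0 \<and> (\<forall>z. Im z > 0 \<longrightarrow> poly (det F) z \<noteq> 0) \<and>
    (\<forall>\<^sub>\<infinity>y :: real. \<exists>r > 0. ct (evm F (of_real y)) * evm F (of_real y) = complex_of_real r \<cdot>\<^sub>m evm H (of_real y)))"

lemma F_carrier [simp]: "F \<in> carrier_mat m m"
  and det_F: "det F \<noteq> 0" and det_F_upper: "\<And>z. Im z > 0 \<Longrightarrow> poly (det F) z \<noteq> 0"
  and F_gram: "\<forall>\<^sub>\<infinity>y :: real. \<exists>r > 0. ct (evm F (of_real y)) * evm F (of_real y) = complex_of_real r \<cdot>\<^sub>m evm H (of_real y)"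
proof -
  have "\<exists>F. F \<in> carrier_mat m m \<and> det F \<noteq> 0 \<and> (\<forall>z. Im z > 0 \<longrightarrow> poly (det F) z \<noteq> 0) \<and>
    (\<forall>\<^sub>\<infinity>y :: real. \<exists>r > 0. ct (evm F (of_real y)) * evm F (of_real y) = complex_of_real r \<cdot>\<^sub>m evm H (of_real y))"
    using exists_spectral_factor by blast
  from someI_ex[OF this] show "F \<in> carrier_mat m m" "det F \<noteq> 0" "\<And>z. Im z > 0 \<Longrightarrow> poly (det F) z \<noteq> 0"
    "\<forall>\<^sub>\<infinity>y :: real. \<exists>r > 0. ct (evm F (of_real y)) * evm F (of_real y) = complex_of_real r \<cdot>\<^sub>m evm H (of_real y)"
    unfolding F_def[symmetric] by auto
qed

text \<open>\<open>det F\<close> times the conjugate of \<open>C\<close> by \<open>F\<close>: the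
  entries stay polynomial until divisibility by \<open>det F\<close> is known.\<close>

definition N :: "complex poly mat" where
  "N = F * C * adj_mat F"

lemma N_carrier [simp]: "N \<in> carrier_mat m m"
  using adj_mat(1)[OF F_carrier] carrier_matD[OF F_carrier] carrier_matD[OF C_carrier]
  by (auto simp: N_def intro!: carrier_matI)

lemma N_F: "N * F = det F \<cdot>\<^sub>m (F * C)"
proof -
  have "N * F = F * C * (adj_mat F * F)"
    unfolding N_def using adj_mat(1)[OF F_carrier] carrier_matD[OF F_carrier] carrier_matD[OF C_carrier]
    by (simp add: mat_ring)
  then show ?thesis unfolding adj_mat(3)[OF F_carrier]
    using carrier_matD[OF F_carrier] carrier_matD[OF C_carrier] by (simp add: mat_ring)
qed

definition T :: "complex poly" where "T = tr (C * C)"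

lemma C_gram_hermitian:
  assumes g: "good y ws"
  shows "ct (ct (vander ws) * vander ws * evm C (of_real y)) = ct (vander ws) * vander ws * evm C (of_real y)"
proof -
  obtain r where r: "poly (b m) (of_real y) = complex_of_real r" using top_real by auto
  let ?D = "diag_of (\<lambda>j. poly (b m) (of_real y) * of_real (ws ! j))"
  have D: "ct ?D = ?D" unfolding r by (rule eq_matI) (auto simp: diag_of_def)
  have dims: "dim_row (vander ws) = m" "dim_col (vander ws) = m" "dim_row ?D = m" "dim_col ?D = m"
    "dim_row C = m" "dim_col C = m"
    by (simp_all add: vander_def diag_of_def C_def)
  have e: "ct (vander ws) * vander ws * evm C (of_real y) = ct (vander ws) * ?D * vander ws"
    using vander_C[OF g] dims by (simp add: mat_ring)
  show ?thesis unfolding e using dims by (simp add: ct_mult D mat_ring)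
qed

text \<open>The Gram matrix of \<open>F\<close> is a real multiple of that of the Vandermonde
  matrix, which diagonalizes \<open>C\<close> with real eigenvalues. Hence
  \<open>ct F * F * C\<close> is Hermitian, and the conjugate of \<open>C\<close> by
  \<open>F\<close> is congruent to it through the inverse \<open>G\<close> of
  \<open>F\<close>.\<close>

lemma exists_conjugate:
  "\<forall>\<^sub>\<infinity>y :: real. \<exists>M ws. good y ws \<and> det (evm F (of_real y)) \<noteq> 0 \<and> M \<in> carrier_mat m m \<and> ct M = M \<and>
     M * evm F (of_real y) = evm F (of_real y) * evm C (of_real y) \<and> evm N (of_real y) = poly (det F) (of_real y) \<cdot>\<^sub>m M"
  using F_gram MOST_good MOST_poly_nonzero[OF det_F]
proof eventually_elim
  case (elim y)
  let ?F = "evm F (of_real y)" and ?C = "evm C (of_real y)"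
  obtain ws where g: "good y ws" using elim(2) by auto
  have dF: "det ?F \<noteq> 0" using elim(3) by (simp add: poly_det_evm)
  have Fc: "?F \<in> carrier_mat m m" and Cc: "?C \<in> carrier_mat m m" by simp_all
  obtain G where G: "G \<in> carrier_mat m m" "?F * G = 1\<^sub>m m" "G * ?F = 1\<^sub>m m"
    using det_nonzero_inverse[OF Fc dF] by metis
  note dims = carrier_matD[OF F_carrier] carrier_matD[OF C_carrier] carrier_matD[OF G(1)] carrier_matD[OF N_carrier]
  define M where "M = ?F * ?C * G"
  have Mc: "M \<in> carrier_mat m m" unfolding M_def using dims by (auto intro!: carrier_matI)
  have MF: "M * ?F = ?F * ?C" using dims G(3) by (simp add: M_def mat_ring)
  obtain k where k: "ct ?F * ?F = k \<cdot>\<^sub>m (ct (vander ws) * vander ws)" "cnj k = k"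
  proof -
    obtain r where r: "ct ?F * ?F = complex_of_real r \<cdot>\<^sub>m evm H (of_real y)" using elim(1) by auto
    obtain a where a: "poly (b m) (of_real y) = complex_of_real a" using top_real by auto
    show thesis
      by (rule that[of "of_real (r * a ^ (2 * m))"]) (use r in \<open>auto simp: H_good[OF g] a intro!: eq_matI\<close>)
  qed
  have dv: "dim_row (vander ws) = m" "dim_col (vander ws) = m" by (simp_all add: vander_def)
  have FFC: "ct ?F * ?F * ?C = k \<cdot>\<^sub>m (ct (vander ws) * vander ws * ?C)"
    unfolding k(1) using dims dv by (simp add: mat_ring)
  have h: "ct (ct ?F * ?F * ?C) = ct ?F * ?F * ?C"
    unfolding FFC ct_smult C_gram_hermitian[OF g] k(2) ..
  have cG: "ct G * ct ?F = 1\<^sub>m m" using arg_cong[OF G(2), of ct] dims by (simp add: ct_mult)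
  have Mh: "M = ct G * (ct ?F * ?F * ?C) * G"
  proof -
    have "ct G * (ct ?F * ?F * ?C) * G = (ct G * ct ?F) * (?F * ?C * G)" using dims by (simp add: mat_ring)
    then show ?thesis unfolding cG M_def using dims by (simp add: mat_ring)
  qed
  have "ct M = ct G * ct (ct ?F * ?F * ?C) * G" unfolding Mh using dims by (simp add: ct_mult mat_ring)
  also have "\<dots> = M" unfolding h Mh[symmetric] ..
  finally have "ct M = M" .
  moreover have "evm N (of_real y) = poly (det F) (of_real y) \<cdot>\<^sub>m M"
  proof -
    have "evm N (of_real y) = (evm N (of_real y) * ?F) * G" using dims G(2) by (simp add: mat_ring)
    also have "evm N (of_real y) * ?F = evm (N * F) (of_real y)" using dims by (simp add: evm_mult)
    also have "\<dots> = poly (det F) (of_real y) \<cdot>\<^sub>m (?F * ?C)" unfolding N_F evm_smult using dims by (simp add: evm_mult)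
    finally show ?thesis using dims by (simp add: M_def mat_ring)
  qed
  ultimately show ?case using g dF Mc MF by blast
qed

lemma tr_conjugate:
  assumes "M \<in> carrier_mat m m" "M * evm F z = evm F z * evm C z" "det (evm F z) \<noteq> 0"
  shows "tr (M * M) = poly T z" "tr ((M * M) * (M * M)) = poly (tr ((C * C) * (C * C))) z"
proof -
  let ?F = "evm F z" and ?C = "evm C z"
  note dims = carrier_matD[OF F_carrier] carrier_matD[OF C_carrier] carrier_matD[OF assms(1)]
  have c: "?F \<in> carrier_mat m m" "?C \<in> carrier_mat m m" "M * M \<in> carrier_mat m m" "?C * ?C \<in> carrier_mat m m"
    "(M * M) * (M * M) \<in> carrier_mat m m" "(?C * ?C) * (?C * ?C) \<in> carrier_mat m m"
    using dims by (auto intro!: carrier_matI)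
  have sq: "(A * A) * ?F = ?F * (B * B)" if "A * ?F = ?F * B" "A \<in> carrier_mat m m" "B \<in> carrier_mat m m" for A B
  proof -
    have "(A * A) * ?F = A * (A * ?F)" using that(2) dims by (simp add: mat_ring)
    also have "\<dots> = A * (?F * B)" by (simp only: that(1))
    also have "\<dots> = (A * ?F) * B" using that(2,3) dims by (intro mat_mult_assoc[symmetric]) auto
    also have "\<dots> = (?F * B) * B" by (simp only: that(1))
    also have "\<dots> = ?F * (B * B)" using that(3) dims by (simp add: mat_ring)
    finally show ?thesis .
  qed
  have s2: "(M * M) * ?F = ?F * (?C * ?C)" by (rule sq[OF assms(2,1) c(2)])
  have s4: "((M * M) * (M * M)) * ?F = ?F * ((?C * ?C) * (?C * ?C))" by (rule sq[OF s2 c(3,4)])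
  show "tr (M * M) = poly T z"
    using tr_similar[OF c(3,4,1) assms(3) s2] dims by (simp add: T_def tr_evm evm_mult)
  show "tr ((M * M) * (M * M)) = poly (tr ((C * C) * (C * C))) z"
    using tr_similar[OF c(5,6,1) assms(3) s4] dims by (simp add: tr_evm evm_mult)
qed

text \<open>At generic real points the quotient is an entry of a Hermitian conjugate of
  \<open>C\<close>, so the trace bound excludes real poles. Hermitian symmetry supplies the
  reflection identity for the lower half plane, and \<open>det_F_upper\<close> settles the upper
  one.\<close>

lemma det_F_dvd_N:
  assumes ij: "i < m" "j < m"
  shows "det F dvd N $$ (i, j)"
proof (rule dvd_of_bounded_quotient[where p' = "map_poly cnj (N $$ (j, i))" and B = "\<lambda>y. sqrt (cmod (poly T (of_real y)))"])
  show "\<forall>\<^sub>\<infinity>y :: real. cmod (poly (N $$ (i, j)) (of_real y)) \<le> cmod (poly (det F) (of_real y)) * sqrt (cmod (poly T (of_real y)))"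
    using exists_conjugate
  proof eventually_elim
    case (elim y)
    then obtain M where M: "det (evm F (of_real y)) \<noteq> 0" "M \<in> carrier_mat m m" "ct M = M"
      "M * evm F (of_real y) = evm F (of_real y) * evm C (of_real y)" "evm N (of_real y) = poly (det F) (of_real y) \<cdot>\<^sub>m M" by auto
    have "poly (N $$ (i, j)) (of_real y) = evm N (of_real y) $$ (i, j)"
      using ij carrier_matD[OF N_carrier] by simp
    then have "poly (N $$ (i, j)) (of_real y) = poly (det F) (of_real y) * M $$ (i, j)"
      using ij M(2) by (simp add: M(5))
    moreover have "cmod (M $$ (i, j)) \<le> sqrt (cmod (poly T (of_real y)))"
      using hermitian_entry_bound[OF M(2,3) ij] tr_conjugate(1)[OF M(2,4,1)] by (intro real_le_rsqrt) auto
    ultimately show ?case by (simp add: norm_mult mult_left_mono)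
  qed
  show "continuous_on UNIV (\<lambda>y. sqrt (cmod (poly T (complex_of_real y))))" by (intro continuous_intros)
  show "N $$ (i, j) * map_poly cnj (det F) = map_poly cnj (N $$ (j, i)) * det F"
  proof (rule poly_eqI_MOST)
    have pc: "poly (map_poly cnj p) (of_real y) = cnj (poly p (of_real y))" for p and y :: real
      by (metis poly_cnj complex_cnj_complex_of_real)
    show "\<forall>\<^sub>\<infinity>y :: real. poly (N $$ (i, j) * map_poly cnj (det F)) (of_real y) = poly (map_poly cnj (N $$ (j, i)) * det F) (of_real y)"
      using exists_conjugate
    proof eventually_elim
      case (elim y)
      then obtain M where M: "M \<in> carrier_mat m m" "ct M = M" "evm N (of_real y) = poly (det F) (of_real y) \<cdot>\<^sub>m M" by auto
      have e: "poly (N $$ (i, j)) (of_real y) = poly (det F) (of_real y) * M $$ (i, j)" if "i < m" "j < m" for i j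
        using that M(1) arg_cong[OF M(3), of "\<lambda>A. A $$ (i, j)"] carrier_matD[OF N_carrier] by simp
      have "cnj (M $$ (j, i)) = M $$ (i, j)" using M(1,2) ij by (metis carrier_matD ct_index)
      then show ?case using ij by (simp add: e pc)
    qed
  qed
qed (use det_F det_F_upper in auto)

definition M :: "complex poly mat" where
  "M = mat m m (\<lambda>(i, j). N $$ (i, j) div det F)"

lemma M_carrier [simp]: "M \<in> carrier_mat m m"
  by (simp add: M_def)

lemma N_eq: "N = det F \<cdot>\<^sub>m M"
  using det_F_dvd_N carrier_matD[OF N_carrier] by (intro eq_matI) (auto simp: M_def)

lemma M_F: "M * F = F * C"
proof (rule eq_matI)
  note dims = carrier_matD[OF F_carrier] carrier_matD[OF C_carrier] carrier_matD[OF M_carrier]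
  fix i j assume "i < dim_row (F * C)" "j < dim_col (F * C)"
  then have ij: "i < m" "j < m" using dims by auto
  have eq: "det F \<cdot>\<^sub>m (M * F) = det F \<cdot>\<^sub>m (F * C)"
    using N_F unfolding N_eq using dims by (simp add: mat_ring)
  have "det F * (M * F) $$ (i, j) = det F * (F * C) $$ (i, j)"
    using arg_cong[OF eq, of "\<lambda>A. A $$ (i, j)"] ij dims by simp
  then show "(M * F) $$ (i, j) = (F * C) $$ (i, j)" using det_F by simp
qed (auto simp: M_def C_def carrier_matD[OF F_carrier])

lemma M_conjugate:
  "\<forall>\<^sub>\<infinity>y :: real. \<exists>ws. good y ws \<and> det (evm F (of_real y)) \<noteq> 0 \<and> ct (evm M (of_real y)) = evm M (of_real y)"
  using exists_conjugate
proof eventually_elim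
  case (elim y)
  then obtain M' ws where M': "good y ws" "det (evm F (of_real y)) \<noteq> 0" "M' \<in> carrier_mat m m" "ct M' = M'"
    "evm N (of_real y) = poly (det F) (of_real y) \<cdot>\<^sub>m M'" by blast
  have eq: "poly (det F) (of_real y) \<cdot>\<^sub>m evm M (of_real y) = poly (det F) (of_real y) \<cdot>\<^sub>m M'"
    using M'(5) by (simp add: N_eq evm_smult)
  have "evm M (of_real y) = M'"
  proof (rule eq_matI)
    fix i j assume ij: "i < dim_row M'" "j < dim_col M'"
    show "evm M (of_real y) $$ (i, j) = M' $$ (i, j)"
      using arg_cong[OF eq, of "\<lambda>A. A $$ (i, j)"] ij M'(2,3) carrier_matD[OF M_carrier] by (simp add: poly_det_evm)
  qed (use M'(3) carrier_matD[OF M_carrier] in auto)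
  then show ?case using M' by auto
qed

lemma M_conj_F: "evm M z * evm F z = evm F z * evm C z"
  using arg_cong[OF M_F, of "\<lambda>A. evm A z"] carrier_matD[OF M_carrier] carrier_matD[OF F_carrier] carrier_matD[OF C_carrier]
  by (simp add: evm_mult)

lemma M_cnj:
  assumes ij: "i < m" "j < m"
  shows "poly (M $$ (i, j)) z = cnj (poly (M $$ (j, i)) (cnj z))"
proof -
  have "M $$ (i, j) = map_poly cnj (M $$ (j, i))"
  proof (rule poly_eqI_MOST)
    show "\<forall>\<^sub>\<infinity>y :: real. poly (M $$ (i, j)) (of_real y) = poly (map_poly cnj (M $$ (j, i))) (of_real y)"
      using M_conjugate
    proof eventually_elim
      case (elim y)
      then have h: "ct (evm M (of_real y)) = evm M (of_real y)" by auto
      have "poly (M $$ (i, j)) (of_real y) = cnj (poly (M $$ (j, i)) (of_real y))"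
        using arg_cong[OF h, of "\<lambda>A. A $$ (i, j)"] ij carrier_matD[OF M_carrier] by simp
      then show ?case by (metis poly_cnj complex_cnj_complex_of_real)
    qed
  qed
  then show ?thesis by (metis poly_cnj complex_cnj_cnj)
qed

lemma degree_C: "i < m \<Longrightarrow> j < m \<Longrightarrow> degree (C $$ (i, j)) \<le> n"
  using degree_coeffs by (auto simp: C_def)

text \<open>The entries of \<open>C\<close> have degree at most \<open>n\<close>, so
  \<open>T\<close> has degree at most \<open>2 * n\<close>, and it bounds the squared moduli of the
  entries of \<open>M\<close> on the real line.\<close>

lemma degree_M:
  assumes ij: "i < m" "j < m"
  shows "degree (M $$ (i, j)) \<le> n"
proof (rule degree_le_of_square_bound)
  have "T = (\<Sum>i<m. \<Sum>j<m. C $$ (i, j) * C $$ (j, i))"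
    unfolding T_def by (subst tr_mult) (simp_all add: carrier_matD[OF C_carrier])
  then show "degree T \<le> 2 * n"
  proof (simp only:, intro degree_sum_le finite_lessThan)
    fix i j assume "i \<in> {..<m}" "j \<in> {..<m}"
    then have "degree (C $$ (i, j)) \<le> n" "degree (C $$ (j, i)) \<le> n"
      using degree_C carrier_matD[OF C_carrier] by auto
    then show "degree (C $$ (i, j) * C $$ (j, i)) \<le> 2 * n"
      using degree_mult_le[of "C $$ (i, j)" "C $$ (j, i)"] by linarith
  qed
  show "\<forall>\<^sub>\<infinity>y :: real. (cmod (poly (M $$ (i, j)) (of_real y)))\<^sup>2 \<le> cmod (poly T (of_real y))"
    using M_conjugate
  proof eventually_elim
    case (elim y)
    then have d: "det (evm F (of_real y)) \<noteq> 0" and h: "ct (evm M (of_real y)) = evm M (of_real y)" by auto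
    have "(cmod (evm M (of_real y) $$ (i, j)))\<^sup>2 \<le> cmod (poly T (of_real y))"
      using hermitian_entry_bound[OF evm_carrier[OF M_carrier] h ij]
      unfolding tr_conjugate(1)[OF evm_carrier[OF M_carrier] M_conj_F d] .
    then show ?case using ij carrier_matD[OF M_carrier] by simp
  qed
qed

text \<open>\<open>M\<close> is similar to \<open>C\<close>, whose eigenvalues are the roots times
  the top coefficient. Each of the \<open>m\<close> factors of the determinant carries that
  coefficient, whereas \<open>q\<close> carries it once.\<close>

lemma det_pencil_M:
  "\<forall>\<^sub>\<infinity>y :: real. poly (b m) (of_real y) \<noteq> 0 \<and> (\<forall>w. det ((w * poly (b m) (of_real y)) \<cdot>\<^sub>m 1\<^sub>m m - evm M (of_real y)) =
     poly (b m) (of_real y) ^ (m - 1) * q (of_real y) w)"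
  using M_conjugate
proof eventually_elim
  case (elim y)
  then obtain ws where g: "good y ws" and dF: "det (evm F (of_real y)) \<noteq> 0" by auto
  let ?F = "evm F (of_real y)" and ?C = "evm C (of_real y)" and ?M = "evm M (of_real y)" and ?a = "poly (b m) (complex_of_real y)"
  have a: "?a \<noteq> 0" using g by (simp add: good_def)
  note dims = carrier_matD[OF F_carrier] carrier_matD[OF C_carrier] carrier_matD[OF M_carrier]
    carrier_matD[OF vander_carrier[of ws]]
  have "det ((w * ?a) \<cdot>\<^sub>m 1\<^sub>m m - ?M) = ?a ^ (m - 1) * q (of_real y) w" for w
  proof -
    have "((w * ?a) \<cdot>\<^sub>m 1\<^sub>m m - ?M) * ?F = ?F * ((w * ?a) \<cdot>\<^sub>m 1\<^sub>m m - ?C)"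
      using dims by (simp add: mat_ring M_conj_F)
    moreover have "det (((w * ?a) \<cdot>\<^sub>m 1\<^sub>m m - ?M) * ?F) = det ((w * ?a) \<cdot>\<^sub>m 1\<^sub>m m - ?M) * det ?F"
      "det (?F * ((w * ?a) \<cdot>\<^sub>m 1\<^sub>m m - ?C)) = det ?F * det ((w * ?a) \<cdot>\<^sub>m 1\<^sub>m m - ?C)"
      using dims by (intro det_mult[of _ m]; auto intro!: carrier_matI)+
    ultimately have 1: "det ((w * ?a) \<cdot>\<^sub>m 1\<^sub>m m - ?M) = det ((w * ?a) \<cdot>\<^sub>m 1\<^sub>m m - ?C)"
      using dF by simp
    have "vander ws * ((w * ?a) \<cdot>\<^sub>m 1\<^sub>m m - ?C) = diag_of (\<lambda>j. ?a * (w - of_real (ws ! j))) * vander ws"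
    proof -
      have "vander ws * ((w * ?a) \<cdot>\<^sub>m 1\<^sub>m m - ?C) = (w * ?a) \<cdot>\<^sub>m vander ws - vander ws * ?C"
        using dims by (simp add: mat_ring)
      also have "\<dots> = diag_of (\<lambda>j. ?a * (w - of_real (ws ! j))) * vander ws"
        unfolding vander_C[OF g]
      proof (rule eq_matI)
        fix i j assume "i < dim_row (diag_of (\<lambda>j. ?a * (w - of_real (ws ! j))) * vander ws)"
          "j < dim_col (diag_of (\<lambda>j. ?a * (w - of_real (ws ! j))) * vander ws)"
        then have ij: "i < m" "j < m" using dims by (auto simp: diag_of_def)
        show "((w * ?a) \<cdot>\<^sub>m vander ws - diag_of (\<lambda>j. ?a * of_real (ws ! j)) * vander ws) $$ (i, j) =
          (diag_of (\<lambda>j. ?a * (w - of_real (ws ! j))) * vander ws) $$ (i, j)"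
          unfolding diag_of_mult[OF vander_carrier ij] using ij dims
          by (simp add: diag_of_mult[OF vander_carrier ij] carrier_matD[OF diag_of_carrier] algebra_simps del: index_mult_mat(1))
      qed (use dims in \<open>auto simp: diag_of_def\<close>)
      finally show ?thesis .
    qed
    moreover have "det (vander ws * ((w * ?a) \<cdot>\<^sub>m 1\<^sub>m m - ?C)) = det (vander ws) * det ((w * ?a) \<cdot>\<^sub>m 1\<^sub>m m - ?C)"
      "det (diag_of (\<lambda>j. ?a * (w - of_real (ws ! j))) * vander ws) = det (diag_of (\<lambda>j. ?a * (w - of_real (ws ! j)))) * det (vander ws)"
      using dims by (intro det_mult[of _ m]; auto intro!: carrier_matI)+
    ultimately have "det ((w * ?a) \<cdot>\<^sub>m 1\<^sub>m m - ?C) = (\<Prod>j<m. ?a * (w - of_real (ws ! j)))"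
      using det_vander[OF g] by (simp add: det_diag_of)
    also have "\<dots> = ?a ^ m * (\<Prod>j<m. w - of_real (ws ! j))" by (simp add: prod.distrib)
    also have "?a * (\<Prod>j<m. w - of_real (ws ! j)) = q (of_real y) w"
    proof -
      \<comment> \<open>The expanded and the factored form of \<open>q\<close> share their
        coefficient at \<open>w ^ m\<close> and vanish at the same \<open>m\<close> roots, so their
        difference has degree below \<open>m\<close> and too many zeros.\<close>
      define p where "p = (\<Sum>k\<le>m. monom (poly (b k) (of_real y)) k)"
      define p' where "p' = smult ?a (\<Prod>j<m. [:- complex_of_real (ws ! j), 1:])"
      have cp: "coeff p k = (if k \<le> m then poly (b k) (of_real y) else 0)" for k by (auto simp: p_def coeff_sum)
      have dp: "degree p \<le> m" using cp by (intro degree_le) auto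
      have dp': "degree p' = m" "lead_coeff p' = ?a"
      proof -
        let ?P = "\<Prod>j<m. [:- complex_of_real (ws ! j), 1:]"
        have "degree ?P = m" by (subst degree_prod_eq_sum_degree) auto
        moreover have "lead_coeff ?P = 1" by (simp add: lead_coeff_prod)
        ultimately show "degree p' = m" "lead_coeff p' = ?a" using a by (simp_all add: p'_def)
      qed
      have "p - p' = 0"
      proof (rule ccontr)
        assume nz: "p - p' \<noteq> 0"
        have "degree (p - p') < m"
        proof (rule degree_lessI)
          show "\<forall>k\<ge>m. coeff (p - p') k = 0"
          proof (intro allI impI)
            fix k assume "k \<ge> m"
            then show "coeff (p - p') k = 0" using dp' cp[of k] coeff_eq_0[of p' k] by (cases "k = m") auto
          qed
        qed (use m_pos in auto)
        have "poly (p - p') (of_real (ws ! j)) = 0" if j: "j < m" for j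
        proof -
          have "poly p (of_real (ws ! j)) = q (of_real y) (of_real (ws ! j))"
            by (simp add: p_def q_def poly_sum poly_monom)
          also have "\<dots> = 0" using g j by (auto simp: good_def)
          finally have "poly p (of_real (ws ! j)) = 0" .
          moreover have "poly p' (of_real (ws ! j)) = 0"
            using j by (auto simp: p'_def poly_prod intro!: prod_zero bexI[of _ j])
          ultimately show ?thesis by simp
        qed
        then have "complex_of_real ` set ws \<subseteq> {z. poly (p - p') z = 0}" using g by (auto simp: good_def in_set_conv_nth)
        moreover have "card (complex_of_real ` set ws) = m"
          using g by (simp add: card_image inj_on_def good_def distinct_card)
        ultimately have "m \<le> card {z. poly (p - p') z = 0}" using poly_roots_finite[OF nz] card_mono by metis
        also have "\<dots> \<le> degree (p - p')" by (rule card_poly_roots_bound[OF nz])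
        finally show False using \<open>degree (p - p') < m\<close> by simp
      qed
      then have "poly p w = poly p' w" by simp
      then show ?thesis by (simp add: p_def p'_def q_def poly_sum poly_monom poly_prod)
    qed
    then have "?a ^ m * (\<Prod>j<m. w - of_real (ws ! j)) = ?a ^ (m - 1) * q (of_real y) w"
      using m_pos by (cases m) (simp_all add: mult_ac)
    finally show ?thesis using 1 by simp
  qed
  with a show ?case by blast
qed

end

section \<open>Partial fractions at the zeros of the top coefficient\<close>

text \<open>Uniqueness of interpolation. A condition on the coefficients from \<open>card S\<close>
  on stands in for a strict degree bound, so that the empty set is covered as well.\<close>

lemma poly_eq_0_of_roots:
  fixes p :: "complex poly"
  assumes "\<And>k. k \<ge> card S \<Longrightarrow> coeff p k = 0" and "finite S" and "\<And>z. z \<in> S \<Longrightarrow> poly p z = 0"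
  shows "p = 0"
proof (rule ccontr)
  assume nz: "p \<noteq> 0"
  have "card S \<le> card {z. poly p z = 0}" using assms(3) poly_roots_finite[OF nz] by (intro card_mono) auto
  also have "\<dots> \<le> degree p" by (rule card_poly_roots_bound[OF nz])
  finally have "coeff p (degree p) = 0" by (rule assms(1))
  then show False using nz by simp
qed

lemma degree_prod_roots: "finite S \<Longrightarrow> degree (\<Prod>z\<in>S. [:- z, 1 :: complex:]) = card S"
  by (subst degree_prod_eq_sum_degree) auto

context hyperbolic_family
begin

definition Z :: "complex set" where "Z = {z. poly (b m) z = 0}"

lemma top_nonzero: "b m \<noteq> 0"
  using MOST_real_nonempty[OF MOST_good] by (auto simp: good_def)

lemma finite_Z: "finite Z" and card_Z: "card Z = n"
  using poly_roots_finite[OF top_nonzero] simple_top by (simp_all add: Z_def)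

definition lc :: complex where "lc = lead_coeff (b m)"

lemma lc_nonzero: "lc \<noteq> 0"
  using top_nonzero by (simp add: lc_def)

lemma top_factor: "b m = smult lc (\<Prod>z\<in>Z. [:- z, 1:])"
proof -
  let ?P = "\<Prod>z\<in>Z. [:- z, 1 :: complex:]"
  have dP: "degree ?P = n" "lead_coeff ?P = 1"
  proof -
    show "degree ?P = n" using degree_prod_roots[OF finite_Z] card_Z by simp
    show "lead_coeff ?P = 1" by (simp add: lead_coeff_prod)
  qed
  have "b m - smult lc ?P = 0"
  proof (rule poly_eq_0_of_roots[where S = Z])
    fix k assume k: "k \<ge> card Z"
    show "coeff (b m - smult lc ?P) k = 0"
    proof (cases "k = n")
      case True
      then show ?thesis using dP degree_top by (simp add: lc_def)
    next
      case False
      then have "k > n" using k card_Z by auto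
      then show ?thesis using dP degree_top by (simp add: coeff_eq_0)
    qed
  next
    fix z assume z: "z \<in> Z"
    then have "poly ?P z = 0" using finite_Z by (auto simp: poly_prod intro!: prod_zero)
    then show "poly (b m - smult lc ?P) z = 0" using z by (simp add: Z_def)
  qed (rule finite_Z)
  then show ?thesis by simp
qed

lemma coeffs_cnj: "k \<le> m \<Longrightarrow> map_poly cnj (b k) = b k"
proof (rule poly_eqI_MOST, rule always_eventually, rule allI)
  fix y :: real assume "k \<le> m"
  then show "poly (map_poly cnj (b k)) (of_real y) = poly (b k) (of_real y)"
    using real_coeffs by (metis poly_cnj complex_cnj_complex_of_real)
qed

lemma lc_real: "cnj lc = lc"
proof -
  have "coeff (map_poly cnj (b m)) n = coeff (b m) n" using coeffs_cnj[of m] by simp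
  then show ?thesis by (simp add: lc_def degree_top coeff_map_poly)
qed

lemma cnj_Z: "z \<in> Z \<Longrightarrow> cnj z \<in> Z"
  using coeffs_cnj[of m] by (auto simp: Z_def) (metis complex_cnj_zero poly_cnj)

text \<open>At a zero \<open>z\<close> of the top coefficient this is the value of its derivative,
  so that \<open>R\<close> below is the matrix of residues of \<open>M\<close> divided by the top
  coefficient.\<close>

definition a1 :: "complex \<Rightarrow> complex" where "a1 z = lc * (\<Prod>w\<in>Z - {z}. z - w)"

lemma a1_nonzero: "a1 z \<noteq> 0"
  using lc_nonzero finite_Z by (auto simp: a1_def)

lemma a1_cnj: "a1 (cnj z) = cnj (a1 z)"
proof -
  have "(\<Prod>w\<in>Z - {cnj z}. cnj z - w) = (\<Prod>w\<in>Z - {z}. cnj (z - w))"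
    by (rule prod.reindex_bij_witness[of _ cnj cnj]) (auto simp: cnj_Z)
  then show ?thesis by (simp add: a1_def lc_real)
qed

definition R :: "complex \<Rightarrow> nat \<Rightarrow> nat \<Rightarrow> complex" where
  "R z i j = poly (M $$ (i, j)) z / a1 z"

lemma R_cnj: "i < m \<Longrightarrow> j < m \<Longrightarrow> R (cnj z) i j = cnj (R z j i)"
  using M_cnj[of i j "cnj z"] by (simp add: R_def a1_cnj)

text \<open>The subdiagonal of \<open>C\<close> consists of copies of the top coefficient. At a zero
  of it only the last column survives, and this is the source of the rank-one residues.\<close>

lemma C_at_root:
  assumes "z \<in> Z" "i < m" "k < m"
  shows "evm C z $$ (i, k) = (if k = m - 1 then - poly (b i) z else 0)"
  using assms carrier_matD[OF C_carrier] by (auto simp: C_def Z_def)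

lemma C_mult_at_root:
  assumes z: "z \<in> Z" and A: "A \<in> carrier_mat m m" and ij: "i < m" "j < m"
  shows "(evm C z * A) $$ (i, j) = - poly (b i) z * A $$ (m - 1, j)"
proof -
  have "(evm C z * A) $$ (i, j) = (\<Sum>k<m. evm C z $$ (i, k) * A $$ (k, j))"
    using A ij carrier_matD[OF C_carrier] by (auto simp: scalar_prod_def atLeast0LessThan)
  also have "\<dots> = (\<Sum>k<m. if k = m - 1 then - poly (b i) z * A $$ (m - 1, j) else 0)"
    using ij C_at_root[OF z] by (intro sum.cong) auto
  finally show ?thesis using m_pos by simp
qed

text \<open>A matrix of rank at most one satisfies A * A = tr A times A; here the trace is the only
  diagonal entry left, at the lower right corner.\<close>

lemma C_square_at_root:
  assumes z: "z \<in> Z"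
  shows "evm C z * evm C z = (- poly (b (m - 1)) z) \<cdot>\<^sub>m evm C z"
proof (rule eq_matI)
  fix i j assume "i < dim_row ((- poly (b (m - 1)) z) \<cdot>\<^sub>m evm C z)" "j < dim_col ((- poly (b (m - 1)) z) \<cdot>\<^sub>m evm C z)"
  then have ij: "i < m" "j < m" using carrier_matD[OF C_carrier] by auto
  show "(evm C z * evm C z) $$ (i, j) = ((- poly (b (m - 1)) z) \<cdot>\<^sub>m evm C z) $$ (i, j)"
    unfolding C_mult_at_root[OF z evm_carrier[OF C_carrier] ij]
    using ij C_at_root[OF z] m_pos carrier_matD[OF C_carrier] by simp
qed auto

lemma tr_smult: "tr (k \<cdot>\<^sub>m A) = k * tr (A :: complex mat)" if "dim_row A = dim_col A"
  using that by (simp add: tr_def sum_distrib_left)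

text \<open>\<open>F\<close> may be singular at a real zero, so the rank of \<open>C\<close> does
  not pass to \<open>M\<close> by similarity there. At generic real points, however, the squared
  minors of \<open>M\<close> are bounded by an invariant computed from \<open>C\<close>; by
  continuity the bound persists, and the invariant vanishes where \<open>C\<close> has rank at most
  one.\<close>

lemma minors_at_real_root:
  assumes z: "z \<in> Z" "Im z = 0" and ij: "i < m" "j < m" "k < m" "l < m"
  shows "poly (M $$ (i, j)) z * poly (M $$ (k, l)) z = poly (M $$ (i, l)) z * poly (M $$ (k, j)) z"
proof -
  note dims = carrier_matD[OF C_carrier] carrier_matD[OF M_carrier]
  define T4 where "T4 = tr ((C * C) * (C * C))"
  let ?g = "\<lambda>y. cmod (2 * (poly T (complex_of_real y) * poly T (of_real y) - poly T4 (of_real y))) -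
      (cmod (poly (M $$ (i, j)) (of_real y) * poly (M $$ (k, l)) (of_real y) - poly (M $$ (i, l)) (of_real y) * poly (M $$ (k, j)) (of_real y)))\<^sup>2"
  have "0 \<le> ?g (Re z)"
  proof (rule cofinite_nonneg_imp_nonneg[where f = ?g])
    show "continuous_on UNIV ?g" by (intro continuous_intros)
    show "\<forall>\<^sub>\<infinity>y. 0 \<le> ?g y"
      using M_conjugate
    proof eventually_elim
      case (elim y)
      then have d: "det (evm F (of_real y)) \<noteq> 0" and h: "ct (evm M (of_real y)) = evm M (of_real y)" by auto
      show ?case
        using hermitian_minor_bound[OF evm_carrier[OF M_carrier] h ij] ij dims
        unfolding tr_conjugate[OF evm_carrier[OF M_carrier] M_conj_F d] T4_def by simp
    qed
  qed
  moreover have zr: "complex_of_real (Re z) = z" using z(2) by (simp add: complex_eq_iff)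
  moreover have "poly T z * poly T z - poly T4 z = 0"
  proof -
    let ?C = "evm C z" and ?\<tau> = "- poly (b (m - 1)) z"
    note sq = C_square_at_root[OF z(1)]
    have "poly T z = tr (?C * ?C)" using dims by (simp add: T_def tr_evm evm_mult)
    then have "poly T z = ?\<tau> * tr ?C" unfolding sq using dims by (simp add: tr_smult)
    moreover have "tr ?C = ?\<tau>"
    proof -
      have "tr ?C = (\<Sum>i<m. if i = m - 1 then ?\<tau> else 0)"
        unfolding tr_def using C_at_root[OF z(1)] dims by (intro sum.cong) auto
      then show ?thesis using m_pos by simp
    qed
    moreover have "poly T4 z = ?\<tau> * (?\<tau> * (?\<tau> * tr ?C))"
    proof -
      have "poly T4 z = tr ((?C * ?C) * (?C * ?C))" unfolding T4_def using dims by (simp add: tr_evm evm_mult)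
      also have "(?C * ?C) * (?C * ?C) = ?\<tau> \<cdot>\<^sub>m (?\<tau> \<cdot>\<^sub>m (?\<tau> \<cdot>\<^sub>m ?C))"
        unfolding sq using dims sq by (simp add: mat_ring)
      finally show ?thesis using dims by (simp add: tr_smult)
    qed
    ultimately show ?thesis by simp
  qed
  ultimately show ?thesis by (simp only: zr) simp
qed

text \<open>Above the real axis \<open>F\<close> is invertible, and the surviving column of
  \<open>C\<close> supplies the two vectors. On the axis the residue matrix is Hermitian with
  vanishing minors of order two, hence plus or minus the outer square of one vector.\<close>

lemma residue_factor:
  assumes z: "z \<in> Z" "Im z \<ge> 0"
  shows "\<exists>\<epsilon> u v. (\<epsilon> = 1 \<or> \<epsilon> = (-1 :: real)) \<and> (Im z = 0 \<longrightarrow> u = v) \<and> (Im z > 0 \<longrightarrow> \<epsilon> = 1) \<and>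
    (\<forall>i<m. \<forall>j<m. R z i j = of_real \<epsilon> * u i * cnj (v j))"
proof (cases "Im z = 0")
  case False
  then have z': "Im z > 0" using z(2) by simp
  have "det (evm F z) \<noteq> 0" using det_F_upper[OF z'] by (simp add: poly_det_evm)
  then obtain G where G: "G \<in> carrier_mat m m" "evm F z * G = 1\<^sub>m m" "G * evm F z = 1\<^sub>m m"
    using det_nonzero_inverse[OF evm_carrier[OF F_carrier]] by metis
  note dims = carrier_matD[OF C_carrier] carrier_matD[OF M_carrier] carrier_matD[OF F_carrier] carrier_matD[OF G(1)]
  have "evm M z = (evm M z * evm F z) * G" using dims G(2) by (simp add: mat_ring)
  also have "\<dots> = evm F z * (evm C z * G)" unfolding M_conj_F using dims by (simp add: mat_ring)
  finally have e: "evm M z = evm F z * (evm C z * G)" .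
  define u where "u i = (\<Sum>k<m. poly (F $$ (i, k)) z * - poly (b k) z) / a1 z" for i
  define v where "v j = cnj (G $$ (m - 1, j))" for j
  have "R z i j = of_real 1 * u i * cnj (v j)" if ij: "i < m" "j < m" for i j
  proof -
    have "poly (M $$ (i, j)) z = (evm F z * (evm C z * G)) $$ (i, j)"
      using arg_cong[OF e, of "\<lambda>A. A $$ (i, j)"] ij dims by simp
    also have "\<dots> = (\<Sum>k<m. poly (F $$ (i, k)) z * (evm C z * G) $$ (k, j))"
      using ij dims by (auto simp: scalar_prod_def atLeast0LessThan)
    also have "\<dots> = (\<Sum>k<m. poly (F $$ (i, k)) z * - poly (b k) z) * G $$ (m - 1, j)"
      unfolding sum_distrib_right using ij C_mult_at_root[OF z(1) G(1)] by (intro sum.cong) auto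
    finally show ?thesis by (simp add: R_def u_def v_def)
  qed
  then show ?thesis using False z' by (intro exI[of _ 1] exI[of _ u] exI[of _ v]) auto
next
  case True
  then have zc: "cnj z = z" by (simp add: complex_eq_iff)
  have h: "cnj (R z j i) = R z i j" if "i < m" "j < m" for i j using R_cnj[OF that, of z] by (simp add: zc)
  have mi: "R z i j * R z k l = R z i l * R z k j" if "i < m" "j < m" "k < m" "l < m" for i j k l
    using minors_at_real_root[OF z(1) True that] by (simp add: R_def)
  show ?thesis
  proof (cases "\<exists>k<m. R z k k \<noteq> 0")
    case False
    \<comment> \<open>With a zero diagonal, the minor in rows and columns \<open>i\<close>,
      \<open>j\<close> reduces to the squared modulus of \<open>R z i j\<close>.\<close>
    have "R z i j = 0" if "i < m" "j < m" for i j
    proof -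
      have "R z i j * R z j i = 0" using mi[OF that(1,2,2,1)] False that by auto
      then show ?thesis using h[of j i] that by auto
    qed
    then show ?thesis using True by (intro exI[of _ 1] exI[of _ "\<lambda>_. 0"]) auto
  next
    case k: True
    then obtain k where k: "k < m" "R z k k \<noteq> 0" by auto
    have "Im (R z k k) = 0" using h[OF k(1) k(1)] by (metis Reals_cnj_iff complex_is_Real_iff)
    then obtain d :: real where d: "R z k k = of_real d" by (metis complex_is_Real_iff Reals_cases)
    then have d0: "d \<noteq> 0" using k by auto
    \<comment> \<open>The column through a nonzero diagonal entry, scaled so that \<open>u k\<close>
      has squared modulus \<open>\<bar>d\<bar>\<close>; the minors then determine all other entries,
      and the sign of \<open>d\<close> remains as a factor.\<close>
    define u where "u i = R z i k / of_real (sqrt \<bar>d\<bar>)" for i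
    have "R z i j = of_real (sgn d) * u i * cnj (u j)" if ij: "i < m" "j < m" for i j
    proof -
      have "R z i j * of_real d = R z i k * cnj (R z j k)"
        using mi[OF ij k(1) k(1)] h[OF k(1) ij(2)] by (simp add: d)
      moreover have "u i * cnj (u j) * of_real \<bar>d\<bar> = R z i k * cnj (R z j k)"
        using d0 by (simp add: u_def flip: of_real_mult)
      moreover have "of_real (sgn d) * (of_real d :: complex) = of_real \<bar>d\<bar>"
        by (simp flip: of_real_mult add: sgn_mult_self_eq abs_sgn mult.commute)
      ultimately have "(of_real (sgn d) * u i * cnj (u j)) * of_real \<bar>d\<bar> = R z i j * of_real \<bar>d\<bar>"
        by (metis mult.assoc mult.left_commute)
      then show ?thesis using d0 by simp
    qed
    moreover have "sgn d = 1 \<or> sgn d = -1" using d0 by (auto simp: sgn_if)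
    ultimately show ?thesis using True by (intro exI[of _ "sgn d"] exI[of _ u]) auto
  qed
qed

text \<open>The two vectors found at a point of the upper half plane serve as \<open>r\<close> at
  that point and at its conjugate. As the residues at conjugate points are adjoint, a single formula
  then covers all zeros, and the sign differs from 1 at most on the real axis.\<close>

lemma residues:
  "\<exists>(r :: complex \<Rightarrow> nat \<Rightarrow> complex) (\<eta> :: complex \<Rightarrow> real). \<forall>z \<in> Z. (\<eta> z = 1 \<or> \<eta> z = -1) \<and> \<eta> (cnj z) = \<eta> z \<and>
     (\<forall>i<m. \<forall>j<m. R z i j = of_real (\<eta> z) * r z i * cnj (r (cnj z) j))"
proof -
  define Q where "Q z t \<longleftrightarrow> (case t of (\<epsilon>, u, v) \<Rightarrow> (\<epsilon> = 1 \<or> \<epsilon> = (-1 :: real)) \<and> (Im z = 0 \<longrightarrow> u = v) \<and> (Im z > 0 \<longrightarrow> \<epsilon> = 1) \<and>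
    (\<forall>i<m. \<forall>j<m. R z i j = of_real \<epsilon> * u i * cnj (v j)))" for z and t :: "real \<times> (nat \<Rightarrow> complex) \<times> (nat \<Rightarrow> complex)"
  have "\<forall>z. \<exists>t. z \<in> Z \<and> Im z \<ge> 0 \<longrightarrow> Q z t"
  proof
    fix z
    show "\<exists>t. z \<in> Z \<and> Im z \<ge> 0 \<longrightarrow> Q z t"
    proof (cases "z \<in> Z \<and> Im z \<ge> 0")
      case True
      then obtain \<epsilon> u v where "(\<epsilon> = 1 \<or> \<epsilon> = (-1 :: real)) \<and> (Im z = 0 \<longrightarrow> u = v) \<and> (Im z > 0 \<longrightarrow> \<epsilon> = 1) \<and>
        (\<forall>i<m. \<forall>j<m. R z i j = of_real \<epsilon> * u i * cnj (v j))" using residue_factor[of z] by blast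
      then have "Q z (\<epsilon>, u, v)" by (simp add: Q_def)
      then show ?thesis by blast
    qed blast
  qed
  from choice[OF this] obtain t where t: "\<And>z. z \<in> Z \<Longrightarrow> Im z \<ge> 0 \<Longrightarrow> Q z (t z)" by blast
  define \<epsilon> where "\<epsilon> z = fst (t z)" for z
  define u where "u z = fst (snd (t z))" for z
  define v where "v z = snd (snd (t z))" for z
  have *: "(\<epsilon> z = 1 \<or> \<epsilon> z = (-1 :: real)) \<and> (Im z = 0 \<longrightarrow> u z = v z) \<and>
    (Im z > 0 \<longrightarrow> \<epsilon> z = 1) \<and> (\<forall>i<m. \<forall>j<m. R z i j = of_real (\<epsilon> z) * u z i * cnj (v z j))"
    if "z \<in> Z" "Im z \<ge> 0" for z
    using t[OF that] by (simp add: Q_def \<epsilon>_def u_def v_def case_prod_unfold)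
  define r where "r z = (if Im z \<ge> 0 then u z else v (cnj z))" for z
  define \<eta> where "\<eta> z = (if Im z = 0 then \<epsilon> z else 1)" for z
  show ?thesis
  proof (intro exI[of _ r] exI[of _ \<eta>] ballI conjI allI impI)
    fix z assume z: "z \<in> Z"
    show "\<eta> z = 1 \<or> \<eta> z = -1" using *[OF z] by (auto simp: \<eta>_def)
    show "\<eta> (cnj z) = \<eta> z"
    proof (cases "Im z = 0")
      case True
      then have "cnj z = z" by (simp add: complex_eq_iff)
      then show ?thesis by simp
    qed (simp add: \<eta>_def)
    fix i j assume ij: "i < m" "j < m"
    consider "Im z > 0" | "Im z = 0" | "Im z < 0" by linarith
    then show "R z i j = of_real (\<eta> z) * r z i * cnj (r (cnj z) j)"
    proof cases
      case 1
      then show ?thesis using *[OF z] ij by (auto simp: r_def \<eta>_def)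
    next
      case 2
      then have zc: "cnj z = z" by (simp add: complex_eq_iff)
      show ?thesis unfolding zc using *[OF z] ij 2 by (auto simp: r_def \<eta>_def)
    next
      case 3
      have "R z i j = cnj (R (cnj z) j i)" using R_cnj[OF ij, of "cnj z"] by simp
      then show ?thesis using *[OF cnj_Z[OF z]] ij 3 by (auto simp: r_def \<eta>_def)
    qed
  qed
qed

text \<open>The value at infinity of the quotient of \<open>M\<close> by the top
  coefficient.\<close>

definition \<kappa> :: "nat \<Rightarrow> nat \<Rightarrow> complex" where
  "\<kappa> i j = coeff (M $$ (i, j)) n / lc"

lemma \<kappa>_cnj: assumes "i < m" "j < m" shows "cnj (\<kappa> j i) = \<kappa> i j"
proof -
  have "M $$ (i, j) = map_poly cnj (M $$ (j, i))"
  proof (rule poly_eqI_MOST, rule always_eventually, rule allI)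
    fix y :: real
    show "poly (M $$ (i, j)) (of_real y) = poly (map_poly cnj (M $$ (j, i))) (of_real y)"
      using M_cnj[OF assms, of "of_real y"] by (metis poly_cnj complex_cnj_complex_of_real)
  qed
  then show ?thesis by (simp add: \<kappa>_def lc_real coeff_map_poly)
qed

text \<open>Multiplied by the top coefficient, both sides are polynomials that agree at its
  \<open>n\<close> zeros and in all coefficients from \<open>n\<close> on; the residue terms are
  Lagrange interpolants.\<close>

lemma partial_fractions:
  assumes ij: "i < m" "j < m" and y: "y \<notin> Z"
  shows "poly (M $$ (i, j)) y / poly (b m) y = \<kappa> i j + (\<Sum>z\<in>Z. R z i j / (y - z))"
proof -
  let ?P = "\<lambda>S. \<Prod>w\<in>S. [:- w, 1 :: complex:]"
  have "M $$ (i, j) - smult (\<kappa> i j) (b m) - (\<Sum>z\<in>Z. smult (R z i j * lc) (?P (Z - {z}))) = 0"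
  proof (rule poly_eq_0_of_roots[where S = Z])
    fix k assume k: "k \<ge> card Z"
    have "coeff (?P (Z - {z})) k = 0" if "z \<in> Z" for z
    proof -
      have "degree (?P (Z - {z})) < card Z"
        using that finite_Z by (subst degree_prod_roots) (auto intro: card_Diff1_less simp del: card_Diff_insert)
      then show ?thesis using k by (intro coeff_eq_0) auto
    qed
    moreover have "coeff (M $$ (i, j)) k = \<kappa> i j * coeff (b m) k"
    proof (cases "k = n")
      case True
      then show ?thesis using lc_nonzero degree_top by (simp add: \<kappa>_def lc_def)
    next
      case False
      then have "k > n" using k card_Z by auto
      then show ?thesis using degree_M[OF ij] degree_top by (simp add: coeff_eq_0)
    qed
    ultimately show "coeff (M $$ (i, j) - smult (\<kappa> i j) (b m) - (\<Sum>z\<in>Z. smult (R z i j * lc) (?P (Z - {z})))) k = 0"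
      by (simp add: coeff_sum)
  next
    fix z assume z: "z \<in> Z"
    have "poly (?P (Z - {w})) z = 0" if "w \<in> Z" "w \<noteq> z" for w
      using that z finite_Z by (auto simp: poly_prod intro!: prod_zero)
    then have "(\<Sum>w\<in>Z. R w i j * lc * poly (?P (Z - {w})) z) = (\<Sum>w\<in>Z. if w = z then R z i j * lc * poly (?P (Z - {z})) z else 0)"
      by (intro sum.cong) auto
    also have "\<dots> = R z i j * a1 z" using z finite_Z by (simp add: a1_def poly_prod)
    also have "\<dots> = poly (M $$ (i, j)) z" using a1_nonzero by (simp add: R_def)
    finally show "poly (M $$ (i, j) - smult (\<kappa> i j) (b m) - (\<Sum>z\<in>Z. smult (R z i j * lc) (?P (Z - {z})))) z = 0"
      using z by (simp add: poly_sum Z_def)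
  qed (rule finite_Z)
  from arg_cong[OF this, of "\<lambda>p. poly p y"]
  have "poly (M $$ (i, j)) y - \<kappa> i j * poly (b m) y - (\<Sum>z\<in>Z. R z i j * lc * poly (?P (Z - {z})) y) = 0"
    by (simp add: poly_sum)
  then have "poly (M $$ (i, j)) y = \<kappa> i j * poly (b m) y + (\<Sum>z\<in>Z. R z i j * lc * poly (?P (Z - {z})) y)"
    by (simp add: diff_eq_eq)
  moreover have "lc * poly (?P (Z - {z})) y = poly (b m) y / (y - z)" if "z \<in> Z" for z
  proof -
    have "poly (b m) y = lc * ((y - z) * poly (?P (Z - {z})) y)"
      unfolding top_factor using that finite_Z by (subst prod.remove[of _ z]) (auto simp: poly_prod left_diff_distrib)
    then show ?thesis using that y by auto
  qed
  ultimately have "poly (M $$ (i, j)) y = \<kappa> i j * poly (b m) y + (\<Sum>z\<in>Z. R z i j * (poly (b m) y / (y - z)))"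
    by (simp add: mult.assoc)
  then show ?thesis using y by (simp add: Z_def add_divide_distrib sum_divide_distrib)
qed

theorem realization:
  "\<exists>J K11 K21 K22 c. J \<in> carrier_mat n n \<and> ct J = J \<and> det J \<noteq> 0 \<and> K11 \<in> carrier_mat n n \<and> ct K11 = K11 \<and>
     K21 \<in> carrier_mat m n \<and> K22 \<in> carrier_mat m m \<and> ct K22 = K22 \<and> c \<noteq> 0 \<and>
     (\<forall>y w. det (four_block_mat (w \<cdot>\<^sub>m 1\<^sub>m m + K22) K21 (ct K21) (y \<cdot>\<^sub>m J + K11)) = c * q y w)"
proof -
  obtain r and \<eta> :: "complex \<Rightarrow> real" where r: "\<And>z. z \<in> Z \<Longrightarrow> \<eta> z = 1 \<or> \<eta> z = -1" "\<And>z. z \<in> Z \<Longrightarrow> \<eta> (cnj z) = \<eta> z"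
    "\<And>z i j. z \<in> Z \<Longrightarrow> i < m \<Longrightarrow> j < m \<Longrightarrow> R z i j = of_real (\<eta> z) * r z i * cnj (r (cnj z) j)"
    using residues by blast
  obtain zs where zs: "set zs = Z" "distinct zs" using finite_distinct_list[OF finite_Z] by auto
  have len: "length zs = n" using distinct_card[OF zs(2)] zs(1) card_Z by simp
  have zsZ: "zs ! k \<in> Z" if "k < n" for k
    using nth_mem[of k zs] that by (simp add: zs(1) len)
  have bij: "bij_betw ((!) zs) {..<n} Z" by (rule bij_betw_nth) (simp_all add: zs len)
  have sumZ: "(\<Sum>l<n. h (zs ! l)) = (\<Sum>z\<in>Z. h z)" for h :: "complex \<Rightarrow> complex"
    by (rule sum.reindex_bij_betw[OF bij])
  have sum1: "(\<Sum>l<n. (if zs ! k = cnj (zs ! l) then h (zs ! l) else 0)) = h (cnj (zs ! k))" if "k < n" for k and h :: "complex \<Rightarrow> complex"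
  proof -
    have "(\<Sum>l<n. (if zs ! k = cnj (zs ! l) then h (zs ! l) else 0)) = (\<Sum>z\<in>Z. if zs ! k = cnj z then h z else 0)"
      by (rule sumZ)
    also have "\<dots> = (\<Sum>z\<in>Z. if z = cnj (zs ! k) then h (cnj (zs ! k)) else 0)"
    proof (intro sum.cong refl)
      fix z
      have "zs ! k = cnj z \<longleftrightarrow> z = cnj (zs ! k)" by (auto simp: complex_eq_iff)
      then show "(if zs ! k = cnj z then h z else 0) = (if z = cnj (zs ! k) then h (cnj (zs ! k)) else 0)" by simp
    qed
    finally show ?thesis using cnj_Z[OF zsZ[OF that]] finite_Z by simp
  qed
  \<comment> \<open>The permutation matrix of complex conjugation on the zeros. It pairs the residue
    vectors of \<open>z\<close> and \<open>cnj z\<close> and makes the diagonal data Hermitian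
    although zeros may be nonreal.\<close>
  define P :: "complex mat" where "P = mat n n (\<lambda>(i, j). if zs ! i = cnj (zs ! j) then 1 else 0)"
  have P: "P \<in> carrier_mat n n" by (simp add: P_def)
  have PP: "P * P = 1\<^sub>m n"
  proof (rule eq_matI)
    fix i j assume "i < dim_row (1\<^sub>m n)" "j < dim_col (1\<^sub>m n)"
    then have ij: "i < n" "j < n" by auto
    have "(P * P) $$ (i, j) = (\<Sum>k<n. (if zs ! i = cnj (zs ! k) then (\<lambda>z. if z = cnj (zs ! j) then 1 else 0) (zs ! k) else 0))"
      using ij by (auto simp: P_def scalar_prod_def atLeast0LessThan intro!: sum.cong)
    also have "\<dots> = (\<lambda>z. if z = cnj (zs ! j) then 1 else 0) (cnj (zs ! i))" by (rule sum1[OF ij(1)])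
    also have "\<dots> = (if zs ! i = zs ! j then 1 else 0)" by simp
    finally show "(P * P) $$ (i, j) = 1\<^sub>m n $$ (i, j)" using ij zs(2) len by (simp add: nth_eq_iff_index_eq)
  qed (use P in auto)
  have detP: "det P \<noteq> 0" using det_nonzero_left_inverse(1)[OF P P PP] .
  have detD: "det (mat_diag n f) = (\<Prod>k<n. f k)" for f :: "nat \<Rightarrow> complex"
  proof -
    have "upper_triangular (mat_diag n f)" by (auto simp: mat_diag_def upper_triangular_def)
    from det_upper_triangular[OF this, of n] show ?thesis
      by (simp add: diag_mat_def mat_diag_def prod.list_conv_set_nth atLeast0LessThan)
  qed
  have mdc: "mat_diag n f \<in> carrier_mat n n" for f :: "nat \<Rightarrow> complex" by (simp add: mat_diag_def)
  \<comment> \<open>Chosen so that \<open>y \<cdot>\<^sub>m J + K11\<close> is \<open>P\<close>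
    times the diagonal matrix of the numbers \<open>\<eta> * (y - z)\<close>: its inverse produces
    the partial fractions, its determinant a multiple of the top coefficient. As
    \<open>\<eta>\<close> is 1 or -1, dividing by it or multiplying by it is the same.\<close>
  define J where "J = P * mat_diag n (\<lambda>k. of_real (\<eta> (zs ! k)))"
  define K11 where "K11 = P * mat_diag n (\<lambda>k. - of_real (\<eta> (zs ! k)) * zs ! k)"
  define K21 where "K21 = mat m n (\<lambda>(i, k). r (zs ! k) i)"
  define K22 where "K22 = mat m m (\<lambda>(i, j). - \<kappa> i j)"
  have J: "J \<in> carrier_mat n n" and K11: "K11 \<in> carrier_mat n n" using P mdc by (auto simp: J_def K11_def)
  have K21: "K21 \<in> carrier_mat m n" and K22: "K22 \<in> carrier_mat m m" by (auto simp: K21_def K22_def)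
  have ctPD: "ct (P * mat_diag n (\<lambda>k. f (zs ! k))) = P * mat_diag n (\<lambda>k. f (zs ! k))" if "\<And>z. z \<in> Z \<Longrightarrow> f (cnj z) = cnj (f z)" for f
    unfolding mat_diag_mult_right[OF P]
  proof (rule eq_matI)
    fix i j assume "i < dim_row (mat n n (\<lambda>(i, j). P $$ (i, j) * f (zs ! j)))" "j < dim_col (mat n n (\<lambda>(i, j). P $$ (i, j) * f (zs ! j)))"
    then have ij: "i < n" "j < n" by auto
    then show "ct (mat n n (\<lambda>(i, j). P $$ (i, j) * f (zs ! j))) $$ (i, j) = mat n n (\<lambda>(i, j). P $$ (i, j) * f (zs ! j)) $$ (i, j)"
      using that[OF zsZ[OF ij(2)]] that[OF zsZ[OF ij(1)]] by (auto simp: P_def)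
  qed auto
  have ctJ: "ct J = J" unfolding J_def by (rule ctPD[where f = "\<lambda>z. of_real (\<eta> z)"]) (simp add: r(2))
  have ctK11: "ct K11 = K11" unfolding K11_def by (rule ctPD[where f = "\<lambda>z. - of_real (\<eta> z) * z"]) (simp add: r(2))
  have ctK22: "ct K22 = K22" by (rule eq_matI) (auto simp: K22_def \<kappa>_cnj)
  have \<eta>0: "\<eta> (zs ! k) \<noteq> 0" if "k < n" for k using r(1)[OF zsZ[OF that]] by auto
  have dJ: "det J \<noteq> 0"
    using detP \<eta>0 by (simp add: J_def det_mult[OF P mdc] detD)
  define e where "e = (\<Prod>k<n. complex_of_real (\<eta> (zs ! k)))"
  have e0: "e \<noteq> 0" using \<eta>0 by (simp add: e_def)
  define c where "c = det P * e / lc"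
  have c0: "c \<noteq> 0" using detP e0 lc_nonzero by (simp add: c_def)
  have yJ: "y \<cdot>\<^sub>m J + K11 = P * mat_diag n (\<lambda>k. of_real (\<eta> (zs ! k)) * (y - zs ! k))" for y
    unfolding J_def K11_def mat_diag_mult_right[OF P] by (rule eq_matI) (auto simp: algebra_simps)
  have dyJ: "det (y \<cdot>\<^sub>m J + K11) = c * poly (b m) y" for y
  proof -
    have "(\<Prod>k<n. y - zs ! k) = (\<Prod>z\<in>Z. y - z)"
      by (rule prod.reindex_bij_betw[OF bij])
    then have "lc * (\<Prod>k<n. y - zs ! k) = poly (b m) y" unfolding top_factor by (simp add: poly_prod)
    then have "(\<Prod>k<n. y - zs ! k) = poly (b m) y / lc" using lc_nonzero by (simp add: field_simps)
    then show ?thesis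
      unfolding yJ det_mult[OF P mdc] detD prod.distrib e_def[symmetric] using lc_nonzero by (simp add: c_def)
  qed
  have main: "\<forall>\<^sub>\<infinity>y :: real. \<forall>w. det (four_block_mat (w \<cdot>\<^sub>m 1\<^sub>m m + K22) K21 (ct K21) (of_real y \<cdot>\<^sub>m J + K11)) = c * q (of_real y) w"
    using det_pencil_M
  proof eventually_elim
    case (elim y)
    let ?y = "complex_of_real y"
    let ?a = "poly (b m) ?y"
    have a: "?a \<noteq> 0" and yZ: "?y \<notin> Z" using elim by (auto simp: Z_def)
    let ?f = "\<lambda>k. of_real (\<eta> (zs ! k)) * (?y - zs ! k)"
    define E where "E = mat_diag n (\<lambda>k. 1 / ?f k) * P"
    have E: "E \<in> carrier_mat n n" using mult_carrier_mat[OF mdc P] by (simp add: E_def)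
    have f0: "?f k \<noteq> 0" if "k < n" for k using \<eta>0[OF that] zsZ[OF that] yZ by auto
    have DE: "(?y \<cdot>\<^sub>m J + K11) * E = 1\<^sub>m n"
    proof -
      have "(?y \<cdot>\<^sub>m J + K11) * E = P * (mat_diag n ?f * mat_diag n (\<lambda>k. 1 / ?f k)) * P"
      proof -
        have "P * A * (B * P) = P * (A * B) * P" if "A \<in> carrier_mat n n" "B \<in> carrier_mat n n" for A B
          using that P by (simp add: mat_ring)
        then show ?thesis unfolding yJ E_def using mdc by blast
      qed
      also have "mat_diag n ?f * mat_diag n (\<lambda>k. 1 / ?f k) = 1\<^sub>m n"
        unfolding mat_diag_mult_right[OF mdc] using f0 by (intro eq_matI) (auto simp: mat_diag_def)
      finally show ?thesis using P PP by (simp add: mat_ring)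
    qed
    have KEK: "(K21 * E * ct K21) $$ (i, j) = (\<Sum>z\<in>Z. R z i j / (?y - z))" if ij: "i < m" "j < m" for i j
    proof -
      have PK: "(P * ct K21) $$ (k, j) = cnj (r (cnj (zs ! k)) j)" if k: "k < n" for k
      proof -
        have "(P * ct K21) $$ (k, j) = (\<Sum>l<n. (if zs ! k = cnj (zs ! l) then (\<lambda>z. cnj (r z j)) (zs ! l) else 0))"
          using k ij by (auto simp: P_def K21_def scalar_prod_def atLeast0LessThan intro!: sum.cong)
        then show ?thesis using sum1[OF k] by simp
      qed
      have "K21 * E * ct K21 = (K21 * mat_diag n (\<lambda>k. 1 / ?f k)) * (P * ct K21)"
        unfolding E_def using K21 P by (simp add: mat_ring carrier_matD[OF mdc])
      then have "(K21 * E * ct K21) $$ (i, j) = (\<Sum>k<n. (K21 * mat_diag n (\<lambda>k. 1 / ?f k)) $$ (i, k) * (P * ct K21) $$ (k, j))"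
        using ij K21 P carrier_matD[OF mdc] by (simp add: scalar_prod_def atLeast0LessThan del: mat_diag_mult_right)
      also have "\<dots> = (\<Sum>k<n. (\<lambda>z. R z i j / (?y - z)) (zs ! k))"
      proof (intro sum.cong refl)
        fix k assume "k \<in> {..<n}"
        then have k: "k < n" by simp
        have "(K21 * mat_diag n (\<lambda>k. 1 / ?f k)) $$ (i, k) = r (zs ! k) i / ?f k"
          unfolding mat_diag_mult_right[OF K21] using ij k by (simp add: K21_def)
        moreover have "R (zs ! k) i j = of_real (\<eta> (zs ! k)) * r (zs ! k) i * cnj (r (cnj (zs ! k)) j)"
          by (rule r(3)[OF zsZ[OF k] ij])
        moreover have "\<eta> (zs ! k) = 1 \<or> \<eta> (zs ! k) = -1" by (rule r(1)[OF zsZ[OF k]])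
        ultimately show "(K21 * mat_diag n (\<lambda>k. 1 / ?f k)) $$ (i, k) * (P * ct K21) $$ (k, j) = (\<lambda>z. R z i j / (?y - z)) (zs ! k)"
          unfolding PK[OF k] by (auto simp: minus_divide_right)
      qed
      also have "\<dots> = (\<Sum>z\<in>Z. R z i j / (?y - z))" by (rule sumZ)
      finally show ?thesis .
    qed
    \<comment> \<open>Eliminating the lower right block leaves \<open>w\<close> minus the quotient
      of \<open>M\<close> by the top coefficient: \<open>K22\<close> carries minus the value at
      infinity and the off-diagonal blocks carry the residues.\<close>
    have "det (four_block_mat (w \<cdot>\<^sub>m 1\<^sub>m m + K22) K21 (ct K21) (?y \<cdot>\<^sub>m J + K11)) = c * q ?y w" for w
    proof -
      have "det (four_block_mat (w \<cdot>\<^sub>m 1\<^sub>m m + K22) K21 (ct K21) (?y \<cdot>\<^sub>m J + K11)) =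
        det (w \<cdot>\<^sub>m 1\<^sub>m m + K22 - K21 * E * ct K21) * det (?y \<cdot>\<^sub>m J + K11)"
        using K22 K21 J K11 E DE by (intro det_schur_complement) auto
      also have "w \<cdot>\<^sub>m 1\<^sub>m m + K22 - K21 * E * ct K21 = (1 / ?a) \<cdot>\<^sub>m ((w * ?a) \<cdot>\<^sub>m 1\<^sub>m m - evm M ?y)"
      proof (rule eq_matI)
        fix i j assume "i < dim_row ((1 / ?a) \<cdot>\<^sub>m ((w * ?a) \<cdot>\<^sub>m 1\<^sub>m m - evm M ?y))" "j < dim_col ((1 / ?a) \<cdot>\<^sub>m ((w * ?a) \<cdot>\<^sub>m 1\<^sub>m m - evm M ?y))"
        then have ij: "i < m" "j < m" using carrier_matD[OF M_carrier] by auto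
        have "(w \<cdot>\<^sub>m 1\<^sub>m m + K22 - K21 * E * ct K21) $$ (i, j) = w * 1\<^sub>m m $$ (i, j) + - \<kappa> i j - (K21 * E * ct K21) $$ (i, j)"
          using ij K21 E by (simp add: K22_def del: index_mult_mat(1))
        also have "\<dots> = w * 1\<^sub>m m $$ (i, j) - poly (M $$ (i, j)) ?y / ?a"
          unfolding KEK[OF ij] partial_fractions[OF ij yZ] by simp
        finally show "(w \<cdot>\<^sub>m 1\<^sub>m m + K22 - K21 * E * ct K21) $$ (i, j) = ((1 / ?a) \<cdot>\<^sub>m ((w * ?a) \<cdot>\<^sub>m 1\<^sub>m m - evm M ?y)) $$ (i, j)"
          using ij a carrier_matD[OF M_carrier] by (simp add: field_simps)
      qed (use K21 E K22 carrier_matD[OF M_carrier] in auto)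
      also have "det \<dots> = (1 / ?a) ^ m * (?a ^ (m - 1) * q ?y w)"
        using elim carrier_matD[OF M_carrier] by (simp add: det_smult)
      also have "\<dots> = q ?y w / ?a" using a m_pos by (cases m) (simp_all add: power_divide field_simps)
      finally show ?thesis using a by (simp add: dyJ)
    qed
    then show ?case by blast
  qed
  \<comment> \<open>For fixed \<open>w\<close> both sides are polynomials in \<open>y\<close>, so
    the identity extends from generic real \<open>y\<close> to all complex \<open>y\<close>.\<close>
  have "det (four_block_mat (w \<cdot>\<^sub>m 1\<^sub>m m + K22) K21 (ct K21) (y \<cdot>\<^sub>m J + K11)) = c * q y w" for y w
  proof -
    define B where "B = four_block_mat (map_mat (\<lambda>c. [:c:]) (w \<cdot>\<^sub>m 1\<^sub>m m + K22)) (map_mat (\<lambda>c. [:c:]) K21)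
      (map_mat (\<lambda>c. [:c:]) (ct K21)) ([:0, 1:] \<cdot>\<^sub>m map_mat (\<lambda>c. [:c:]) J + map_mat (\<lambda>c. [:c:]) K11)"
    have eB: "evm B y = four_block_mat (w \<cdot>\<^sub>m 1\<^sub>m m + K22) K21 (ct K21) (y \<cdot>\<^sub>m J + K11)" for y
      unfolding B_def using K22 K21 J K11 by (subst evm_four_block) (simp_all add: evm_const evm_add evm_smult)
    have eq: "poly (smult c (\<Sum>k\<le>m. smult (w ^ k) (b k))) y = c * q y w" for y
      by (simp add: q_def poly_sum mult.commute)
    have "det B = smult c (\<Sum>k\<le>m. smult (w ^ k) (b k))"
    proof (rule poly_eqI_MOST)
      show "\<forall>\<^sub>\<infinity>y :: real. poly (det B) (of_real y) = poly (smult c (\<Sum>k\<le>m. smult (w ^ k) (b k))) (of_real y)"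
        using main by eventually_elim (simp only: poly_det_evm eB eq)
    qed
    then have "poly (det B) y = c * q y w" by (simp only: eq)
    then show ?thesis by (simp only: poly_det_evm eB)
  qed
  then show ?thesis using J ctJ dJ K11 ctK11 K21 K22 ctK22 c0 by blast
qed

end

section \<open>Hermitian representations of bivariate polynomials\<close>

definition dsum :: "'a :: zero mat \<Rightarrow> 'a mat \<Rightarrow> 'a mat" where
  "dsum A B = four_block_mat A (0\<^sub>m (dim_row A) (dim_col B)) (0\<^sub>m (dim_row B) (dim_col A)) B"

lemma dsum_dim [simp]: "dim_row (dsum A B) = dim_row A + dim_row B" "dim_col (dsum A B) = dim_col A + dim_col B"
  by (simp_all add: dsum_def)

lemma dsum_carrier [simp]:
  "A \<in> carrier_mat a b \<Longrightarrow> B \<in> carrier_mat c d \<Longrightarrow> dsum A B \<in> carrier_mat (a + c) (b + d)"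
  by (auto intro!: carrier_matI)

lemma dsum_mult:
  fixes A :: "'a :: comm_semiring_0 mat"
  assumes "dim_col A = dim_row A'" "dim_col B = dim_row B'"
  shows "dsum A B * dsum A' B' = dsum (A * A') (B * B')"
proof -
  have "A \<in> carrier_mat (dim_row A) (dim_row A')" "B \<in> carrier_mat (dim_row B) (dim_row B')"
    "A' \<in> carrier_mat (dim_row A') (dim_col A')" "B' \<in> carrier_mat (dim_row B') (dim_col B')"
    using assms by (auto intro!: carrier_matI)
  from diag_block_mult[OF this] show ?thesis unfolding dsum_def assms by simp
qed

lemma ct_dsum: "ct (dsum A B) = dsum (ct A) (ct B)"
  unfolding dsum_def by (subst ct_four_block) auto

lemma dsum_add: "dim_row A = dim_row A' \<Longrightarrow> dim_col A = dim_col A' \<Longrightarrow> dim_row B = dim_row B' \<Longrightarrow> dim_col B = dim_col B' \<Longrightarrow>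
    dsum A B + dsum A' B' = dsum (A + A') (B + (B' :: 'a :: comm_monoid_add mat))"
  by (rule eq_matI) (auto simp: dsum_def)

lemma dsum_smult: "k \<cdot>\<^sub>m dsum A B = dsum (k \<cdot>\<^sub>m A) (k \<cdot>\<^sub>m (B :: 'a :: comm_semiring_0 mat))"
  by (rule eq_matI) (auto simp: dsum_def)

lemma dsum_one: "dsum (1\<^sub>m a) (1\<^sub>m b) = (1\<^sub>m (a + b) :: 'a :: comm_semiring_1 mat)"
  by (rule eq_matI) (auto simp: dsum_def)

lemma dsum_zero: "dsum (0\<^sub>m a b) (0\<^sub>m c d) = 0\<^sub>m (a + c) (b + d)"
  by (rule eq_matI) (auto simp: dsum_def)

lemma det_dsum:
  "A \<in> carrier_mat a a \<Longrightarrow> B \<in> carrier_mat b b \<Longrightarrow> det (dsum A B) = det A * det (B :: 'a :: idom mat)"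
  unfolding dsum_def by (subst det_four_block_mat_lower_left_zero[of _ a _ b]) auto

lemma sign_mat_append_dsum: "sign_mat (ls @ ls') = dsum (sign_mat ls) (sign_mat ls')"
  by (simp add: sign_mat_append dsum_def)

lemma det_schur_complement_upper:
  fixes A :: "complex mat"
  assumes A: "A \<in> carrier_mat n n" and B: "B \<in> carrier_mat n m" and C: "C \<in> carrier_mat m n"
    and D: "D \<in> carrier_mat m m" and E: "E \<in> carrier_mat n n" "E * A = 1\<^sub>m n"
  shows "det (four_block_mat A B C D) = det A * det (D - C * E * B)"
proof -
  have u: "(- M) * N = - (M * N)" if "dim_col M = dim_row N" for M N :: "complex mat"
    using that by (intro eq_matI) (auto simp: scalar_prod_def sum_negf)
  have "(C * E) * A = C * (E * A)" using A C E by (intro mat_mult_assoc) auto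
  then have CEA: "(C * E) * A = C" using C by (simp add: E(2) mat_ring)
  have "four_block_mat (1\<^sub>m n) (0\<^sub>m n m) (- (C * E)) (1\<^sub>m m) * four_block_mat A B C D =
    four_block_mat A B (0\<^sub>m m n) (D - C * E * B)"
  proof (subst mult_four_block_mat[of _ n n _ m _ m _ _ n _ m])
    show "four_block_mat (1\<^sub>m n * A + 0\<^sub>m n m * C) (1\<^sub>m n * B + 0\<^sub>m n m * D)
      (- (C * E) * A + 1\<^sub>m m * C) (- (C * E) * B + 1\<^sub>m m * D) = four_block_mat A B (0\<^sub>m m n) (D - C * E * B)"
    proof (intro cong_four_block_mat)
      have "- (C * E) * A = - C" using A C E CEA by (subst u) auto
      then show "- (C * E) * A + 1\<^sub>m m * C = 0\<^sub>m m n" using C by (auto simp: mat_ring intro!: eq_matI)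
      have "- (C * E) * B = - (C * E * B)" using B C E by (subst u) auto
      then show "- (C * E) * B + 1\<^sub>m m * D = D - C * E * B"
        using B C E D by (auto simp: mat_one_mult simp del: index_mult_mat(1) intro!: eq_matI)
    qed (use A B C D in \<open>auto simp: mat_ring intro!: eq_matI\<close>)
  qed (use A B C D E in \<open>auto intro!: carrier_matI\<close>)
  then have "det (four_block_mat (1\<^sub>m n) (0\<^sub>m n m) (- (C * E)) (1\<^sub>m m)) * det (four_block_mat A B C D) =
      det (four_block_mat A B (0\<^sub>m m n) (D - C * E * B))"
    using A B C D E by (subst det_mult[symmetric, of _ "n + m"]) (auto intro!: carrier_matI)
  also have "det (four_block_mat (1\<^sub>m n) (0\<^sub>m n m) (- (C * E)) (1\<^sub>m m)) = 1"
    using C E by (subst det_four_block_mat_upper_right_zero[of _ n _ m]) (auto intro!: carrier_matI)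
  also have "det (four_block_mat A B (0\<^sub>m m n) (D - C * E * B)) = det A * det (D - C * E * B)"
    using A B C D E by (subst det_four_block_mat_lower_left_zero[of _ n _ m]) (auto intro!: carrier_matI)
  finally show ?thesis by simp
qed

text \<open>Here \<open>A\<^sub>1 = Y\<^sub>1\<^sup>* J Y\<^sub>1\<close> with the signature matrix \<open>J\<close> of \<open>ls\<close>, and \<open>A\<^sub>2 = Y\<^sub>2\<^sup>* Y\<^sub>2\<close>; the right inverses encode the ranks.  Nonvanishing of
  \<open>det (A\<^sub>1 + e A\<^sub>2)\<close> says that the determinant has degree exactly \<open>D\<close> in \<open>y, z\<close>.\<close>

definition hermitian_rep :: "(complex \<Rightarrow> complex \<Rightarrow> complex) \<Rightarrow> nat \<Rightarrow> complex list \<Rightarrow> nat \<Rightarrow> bool" where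
  "hermitian_rep f D ls m \<longleftrightarrow> (\<exists>A0 Y1 Y2 X1 X2 c.
     A0 \<in> carrier_mat D D \<and> ct A0 = A0 \<and>
     Y1 \<in> carrier_mat (length ls) D \<and> X1 \<in> carrier_mat D (length ls) \<and> Y1 * X1 = 1\<^sub>m (length ls) \<and>
     Y2 \<in> carrier_mat m D \<and> X2 \<in> carrier_mat D m \<and> Y2 * X2 = 1\<^sub>m m \<and>
     ct Y1 * Y1 + ct Y2 * Y2 = 1\<^sub>m D \<and>
     (\<forall>y z. f y z = c * det (A0 + y \<cdot>\<^sub>m (ct Y1 * sign_mat ls * Y1) + z \<cdot>\<^sub>m (ct Y2 * Y2))) \<and>
     (\<forall>\<^sub>\<infinity>e :: real. det (ct Y1 * sign_mat ls * Y1 + of_real e \<cdot>\<^sub>m (ct Y2 * Y2)) \<noteq> 0))"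

lemma hermitian_rep_mult:
  assumes "hermitian_rep f D ls m" "hermitian_rep g D' ls' m'"
  shows "hermitian_rep (\<lambda>y z. f y z * g y z) (D + D') (ls @ ls') (m + m')"
proof -
  obtain A0 Y1 Y2 X1 X2 c where A0: "A0 \<in> carrier_mat D D" "ct A0 = A0"
    and Y1: "Y1 \<in> carrier_mat (length ls) D" "X1 \<in> carrier_mat D (length ls)" "Y1 * X1 = 1\<^sub>m (length ls)"
    and Y2: "Y2 \<in> carrier_mat m D" "X2 \<in> carrier_mat D m" "Y2 * X2 = 1\<^sub>m m"
    and one: "ct Y1 * Y1 + ct Y2 * Y2 = 1\<^sub>m D"
    and f: "\<And>y z. f y z = c * det (A0 + y \<cdot>\<^sub>m (ct Y1 * sign_mat ls * Y1) + z \<cdot>\<^sub>m (ct Y2 * Y2))"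
    and e: "\<forall>\<^sub>\<infinity>e :: real. det (ct Y1 * sign_mat ls * Y1 + of_real e \<cdot>\<^sub>m (ct Y2 * Y2)) \<noteq> 0"
    using assms(1) unfolding hermitian_rep_def by blast
  obtain A0' Y1' Y2' X1' X2' c' where A0': "A0' \<in> carrier_mat D' D'" "ct A0' = A0'"
    and Y1': "Y1' \<in> carrier_mat (length ls') D'" "X1' \<in> carrier_mat D' (length ls')" "Y1' * X1' = 1\<^sub>m (length ls')"
    and Y2': "Y2' \<in> carrier_mat m' D'" "X2' \<in> carrier_mat D' m'" "Y2' * X2' = 1\<^sub>m m'"
    and one': "ct Y1' * Y1' + ct Y2' * Y2' = 1\<^sub>m D'"
    and g: "\<And>y z. g y z = c' * det (A0' + y \<cdot>\<^sub>m (ct Y1' * sign_mat ls' * Y1') + z \<cdot>\<^sub>m (ct Y2' * Y2'))"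
    and e': "\<forall>\<^sub>\<infinity>e :: real. det (ct Y1' * sign_mat ls' * Y1' + of_real e \<cdot>\<^sub>m (ct Y2' * Y2')) \<noteq> 0"
    using assms(2) unfolding hermitian_rep_def by blast
  note dims = carrier_matD[OF A0(1)] carrier_matD[OF Y1(1)] carrier_matD[OF Y1(2)] carrier_matD[OF Y2(1)] carrier_matD[OF Y2(2)]
    carrier_matD[OF A0'(1)] carrier_matD[OF Y1'(1)] carrier_matD[OF Y1'(2)] carrier_matD[OF Y2'(1)] carrier_matD[OF Y2'(2)]
  let ?A1 = "ct Y1 * sign_mat ls * Y1" and ?A2 = "ct Y2 * Y2"
  let ?A1' = "ct Y1' * sign_mat ls' * Y1'" and ?A2' = "ct Y2' * Y2'"
  have s1: "ct (dsum Y1 Y1') * sign_mat (ls @ ls') * dsum Y1 Y1' = dsum ?A1 ?A1'"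
    using dims by (simp add: ct_dsum sign_mat_append_dsum dsum_mult)
  have s2: "ct (dsum Y2 Y2') * dsum Y2 Y2' = dsum ?A2 ?A2'"
    using dims by (simp add: ct_dsum dsum_mult)
  have c1: "A0 + y \<cdot>\<^sub>m ?A1 + z \<cdot>\<^sub>m ?A2 \<in> carrier_mat D D" "A0' + y \<cdot>\<^sub>m ?A1' + z \<cdot>\<^sub>m ?A2' \<in> carrier_mat D' D'"
    "?A1 + z \<cdot>\<^sub>m ?A2 \<in> carrier_mat D D" "?A1' + z \<cdot>\<^sub>m ?A2' \<in> carrier_mat D' D'" for y z
    using dims by (auto intro!: carrier_matI)
  show ?thesis
    unfolding hermitian_rep_def
  proof (intro exI conjI allI)
    show "dsum A0 A0' \<in> carrier_mat (D + D') (D + D')" using A0 A0' by auto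
    show "ct (dsum A0 A0') = dsum A0 A0'" using A0 A0' by (simp add: ct_dsum)
    show "dsum Y1 Y1' \<in> carrier_mat (length (ls @ ls')) (D + D')" using Y1 Y1' by auto
    show "dsum X1 X1' \<in> carrier_mat (D + D') (length (ls @ ls'))" using Y1 Y1' by auto
    show "dsum Y1 Y1' * dsum X1 X1' = 1\<^sub>m (length (ls @ ls'))" using dims Y1 Y1' by (simp add: dsum_mult dsum_one)
    show "dsum Y2 Y2' \<in> carrier_mat (m + m') (D + D')" using Y2 Y2' by auto
    show "dsum X2 X2' \<in> carrier_mat (D + D') (m + m')" using Y2 Y2' by auto
    show "dsum Y2 Y2' * dsum X2 X2' = 1\<^sub>m (m + m')" using dims Y2 Y2' by (simp add: dsum_mult dsum_one)
    show "ct (dsum Y1 Y1') * dsum Y1 Y1' + ct (dsum Y2 Y2') * dsum Y2 Y2' = 1\<^sub>m (D + D')"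
      using dims one one' by (simp add: ct_dsum dsum_mult dsum_add dsum_one)
    show "f y z * g y z = (c * c') * det (dsum A0 A0' + y \<cdot>\<^sub>m (ct (dsum Y1 Y1') * sign_mat (ls @ ls') * dsum Y1 Y1') +
        z \<cdot>\<^sub>m (ct (dsum Y2 Y2') * dsum Y2 Y2'))" for y z
    proof -
      have "dsum A0 A0' + y \<cdot>\<^sub>m dsum ?A1 ?A1' + z \<cdot>\<^sub>m dsum ?A2 ?A2' =
        dsum (A0 + y \<cdot>\<^sub>m ?A1 + z \<cdot>\<^sub>m ?A2) (A0' + y \<cdot>\<^sub>m ?A1' + z \<cdot>\<^sub>m ?A2')"
        using dims by (simp add: dsum_smult dsum_add)
      then show ?thesis unfolding s1 s2 by (simp add: det_dsum[OF c1(1,2)] f g)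
    qed
    show "\<forall>\<^sub>\<infinity>e :: real. det (ct (dsum Y1 Y1') * sign_mat (ls @ ls') * dsum Y1 Y1' + of_real e \<cdot>\<^sub>m (ct (dsum Y2 Y2') * dsum Y2 Y2')) \<noteq> 0"
      using e e'
    proof eventually_elim
      case (elim e)
      have "dsum ?A1 ?A1' + of_real e \<cdot>\<^sub>m dsum ?A2 ?A2' = dsum (?A1 + of_real e \<cdot>\<^sub>m ?A2) (?A1' + of_real e \<cdot>\<^sub>m ?A2')"
        using dims by (simp add: dsum_smult dsum_add)
      then show ?case unfolding s1 s2 using elim by (simp add: det_dsum[OF c1(3,4)])
    qed
  qed
qed

section \<open>Hermitian blocks: kernels, inverses and inertia\<close>

lemma hcat_split:
  assumes "A \<in> carrier_mat n (p + r)"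
  obtains B C where "B \<in> carrier_mat n p" "C \<in> carrier_mat n r" "A = hcat B C"
proof
  show "A = hcat (mat n p (\<lambda>(i, j). A $$ (i, j))) (mat n r (\<lambda>(i, j). A $$ (i, j + p)))"
    using assms by (intro eq_matI) (auto simp: hcat_index)
qed auto

lemma det_pencil_poly:
  fixes A B :: "complex mat"
  assumes "A \<in> carrier_mat n n" "B \<in> carrier_mat n n"
  obtains p where "\<And>z. poly p z = det (A + z \<cdot>\<^sub>m B)"
proof
  fix z
  show "poly (det (map_mat (\<lambda>c. [:c:]) A + [:0, 1:] \<cdot>\<^sub>m map_mat (\<lambda>c. [:c:]) B)) z = det (A + z \<cdot>\<^sub>m B)"
    using assms by (simp add: poly_det_evm evm_add evm_smult evm_const)
qed

lemma four_block_kernel_det: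
  fixes A :: "complex mat"
  assumes A: "A \<in> carrier_mat a a" "B \<in> carrier_mat a d" "C \<in> carrier_mat d a" "D \<in> carrier_mat d d"
    and u: "u \<in> carrier_mat a 1" "v \<in> carrier_mat d 1" "u \<noteq> 0\<^sub>m a 1 \<or> v \<noteq> 0\<^sub>m d 1"
    and "A * u + B * v = 0\<^sub>m a 1" "C * u + D * v = 0\<^sub>m d 1"
  shows "det (four_block_mat A B C D) = 0"
proof -
  define x where "x = four_block_mat u (0\<^sub>m a 0) v (0\<^sub>m d 0)"
  have x: "x \<in> carrier_mat (a + d) 1" using u by (auto simp: x_def intro!: carrier_matI)
  have "four_block_mat A B C D * x = four_block_mat (0\<^sub>m a 1) (0\<^sub>m a 0) (0\<^sub>m d 1) (0\<^sub>m d 0)"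
    unfolding x_def using A u assms(8,9)
    by (subst mult_four_block_mat[of _ a a _ d _ d _ _ 1 _ 0]) (auto simp: mat_ring)
  also have "\<dots> = 0\<^sub>m (a + d) 1" by (rule eq_matI) auto
  finally have "four_block_mat A B C D * x = 0\<^sub>m (a + d) 1" .
  moreover have "x \<noteq> 0\<^sub>m (a + d) 1"
  proof
    assume x0: "x = 0\<^sub>m (a + d) 1"
    have "u = 0\<^sub>m a 1"
    proof (rule eq_matI)
      fix i j assume "i < dim_row (0\<^sub>m a 1 :: complex mat)" "j < dim_col (0\<^sub>m a 1 :: complex mat)"
      then show "u $$ (i, j) = 0\<^sub>m a 1 $$ (i, j)" using arg_cong[OF x0, of "\<lambda>M. M $$ (i, 0)"] u by (simp add: x_def)
    qed (use u in auto)
    moreover have "v = 0\<^sub>m d 1"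
    proof (rule eq_matI)
      fix i j assume "i < dim_row (0\<^sub>m d 1 :: complex mat)" "j < dim_col (0\<^sub>m d 1 :: complex mat)"
      then show "v $$ (i, j) = 0\<^sub>m d 1 $$ (i, j)" using arg_cong[OF x0, of "\<lambda>M. M $$ (a + i, 0)"] u by (simp add: x_def)
    qed (use u in auto)
    ultimately show False using u(3) by simp
  qed
  ultimately show ?thesis using det_zero_iff_kernel[of "four_block_mat A B C D" "a + d"] A x by auto
qed

text \<open>On a kernel vector the form of \<open>K\<close> is real, so the imaginary part of the
  relation is \<open>Im w\<close> times the squared norm of the vector.\<close>

lemma det_hermitian_shift:
  assumes K: "K \<in> carrier_mat m m" "ct K = K" and w: "Im w \<noteq> 0"
  shows "det (w \<cdot>\<^sub>m 1\<^sub>m m + K) \<noteq> 0"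
proof
  assume "det (w \<cdot>\<^sub>m 1\<^sub>m m + K) = 0"
  then obtain x where x: "x \<in> carrier_mat m 1" "x \<noteq> 0\<^sub>m m 1" "(w \<cdot>\<^sub>m 1\<^sub>m m + K) * x = 0\<^sub>m m 1"
    using det_zero_iff_kernel[of "w \<cdot>\<^sub>m 1\<^sub>m m + K" m] K by auto
  obtain a where a: "ct x * K * x = complex_of_real a \<cdot>\<^sub>m 1\<^sub>m 1" using hermitian_form_real[OF K x(1)] by auto
  obtain r where r: "r \<ge> 0" "ct x * x = complex_of_real r \<cdot>\<^sub>m 1\<^sub>m 1" "r \<noteq> 0" using gram_form[OF x(1)] x(2) by auto
  have "ct x * ((w \<cdot>\<^sub>m 1\<^sub>m m + K) * x) = w \<cdot>\<^sub>m (ct x * x) + ct x * K * x" using x(1) K(1) by (simp add: mat_ring)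
  also have "\<dots> = (w * of_real r + of_real a) \<cdot>\<^sub>m 1\<^sub>m 1" unfolding r a by (rule eq_matI) auto
  finally have "(w * of_real r + of_real a) \<cdot>\<^sub>m 1\<^sub>m 1 = (0\<^sub>m 1 1 :: complex mat)"
    unfolding x(3) using x(1) by (simp add: mat_mult_zero)
  from arg_cong[OF this, of "\<lambda>M. M $$ (0, 0)"] have "w * of_real r + of_real a = 0" by simp
  from arg_cong[OF this, of Im] show False using w r by simp
qed

lemma dsum_congruence:
  fixes A :: "complex mat"
  assumes "A \<in> carrier_mat a a" "B \<in> carrier_mat a d" "C \<in> carrier_mat d a" "D \<in> carrier_mat d d"
    and "P \<in> carrier_mat a a" "P' \<in> carrier_mat a a" "Q \<in> carrier_mat d d" "Q' \<in> carrier_mat d d"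
  shows "dsum P Q * four_block_mat A B C D * dsum P' Q' = four_block_mat (P * A * P') (P * B * Q') (Q * C * P') (Q * D * Q')"
proof -
  have 1: "dsum P Q * four_block_mat A B C D = four_block_mat (P * A) (P * B) (Q * C) (Q * D)"
    unfolding dsum_def using assms
    by (subst mult_four_block_mat[of _ a a _ d _ d _ _ a _ d]) (auto simp: mat_ring intro!: cong_four_block_mat eq_matI)
  show ?thesis
    unfolding 1 unfolding dsum_def using assms
    by (subst mult_four_block_mat[of _ a a _ d _ d _ _ a _ d]) (auto simp: mat_ring intro!: cong_four_block_mat eq_matI)
qed

lemma posdef_one_plus_gram:
  assumes L: "L \<in> carrier_mat n p"
  shows "posdef n (1\<^sub>m n + L * ct L)"
  unfolding posdef_def
proof (intro conjI ballI impI)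
  show "1\<^sub>m n + L * ct L \<in> carrier_mat n n" using L by (auto intro!: carrier_matI)
  show "ct (1\<^sub>m n + L * ct L) = 1\<^sub>m n + L * ct L" using L by (simp add: ct_add ct_mult)
  fix x :: "complex mat" assume x: "x \<in> carrier_mat n 1" "x \<noteq> 0\<^sub>m n 1"
  obtain r where r: "r \<ge> 0" "ct x * x = complex_of_real r \<cdot>\<^sub>m 1\<^sub>m 1" "r \<noteq> 0" using gram_form[OF x(1)] x(2) by auto
  have "ct L * x \<in> carrier_mat p 1" using L x by (auto intro!: carrier_matI)
  then obtain s where s: "s \<ge> 0" "ct (ct L * x) * (ct L * x) = complex_of_real s \<cdot>\<^sub>m 1\<^sub>m 1" using gram_form by blast
  have "ct x * (1\<^sub>m n + L * ct L) * x = ct x * x + ct (ct L * x) * (ct L * x)"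
    using x(1) L by (simp add: mat_ring ct_mult)
  also have "\<dots> = of_real (r + s) \<cdot>\<^sub>m 1\<^sub>m 1" unfolding r s by (rule eq_matI) auto
  finally show "\<exists>r>0. ct x * (1\<^sub>m n + L * ct L) * x = of_real r \<cdot>\<^sub>m 1\<^sub>m 1"
    using r s by (intro exI[of _ "r + s"]) auto
qed

lemma gram_kernel:
  assumes L: "L \<in> carrier_mat n p" and u: "u \<in> carrier_mat p 1" and z: "ct L * L * u = 0\<^sub>m p 1"
  shows "L * u = 0\<^sub>m n 1"
proof -
  have "ct (L * u) * (L * u) = ct u * (ct L * L * u)" using L u by (simp add: ct_mult mat_ring)
  also have "\<dots> = 0\<^sub>m 1 1" unfolding z using u by (simp add: mat_mult_zero)
  finally show ?thesis using gram_eq_0_iff[of "L * u"] L u by auto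
qed

lemma hermitian_inverse:
  assumes N: "N \<in> carrier_mat r r" "ct N = N" "det N \<noteq> 0"
  obtains Ni where "Ni \<in> carrier_mat r r" "ct Ni = Ni" "N * Ni = 1\<^sub>m r" "Ni * N = 1\<^sub>m r" "det Ni \<noteq> 0"
proof -
  obtain Ni where Ni: "Ni \<in> carrier_mat r r" "N * Ni = 1\<^sub>m r" "Ni * N = 1\<^sub>m r" using det_nonzero_inverse[OF N(1,3)] by metis
  have "ct Ni * N = ct (N * Ni)" using N Ni(1) by (simp add: ct_mult)
  then have 1: "ct Ni * N = 1\<^sub>m r" by (simp add: Ni(2))
  have "ct Ni = ct Ni * (N * Ni)" using Ni by (simp add: mat_mult_one)
  also have "\<dots> = (ct Ni * N) * Ni" using N(1) Ni(1) by (intro mat_mult_assoc[symmetric]) auto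
  also have "\<dots> = Ni" unfolding 1 using Ni(1) by (simp add: mat_one_mult)
  finally have "ct Ni = Ni" .
  moreover have "det Ni \<noteq> 0" using det_nonzero_left_inverse(1)[OF Ni(1) N(1) Ni(2)] .
  ultimately show thesis using that Ni by blast
qed

text \<open>Eliminating the block \<open>G\<close>, invertible because \<open>w0\<close> is not
  real, leaves the pencil \<open>y \<cdot>\<^sub>m J + S\<close>. The difference of \<open>S\<close>
  and its adjoint stems from the inverse of \<open>G\<close> alone and is \<open>2 * \<i>\<close>
  times the Gram matrix of \<open>R\<close>. A kernel vector annihilated by \<open>R\<close> would
  make the full block matrix singular for every \<open>w\<close>, against \<open>nf\<close>.\<close>

lemma realization_inertia:
  fixes Q :: "complex \<Rightarrow> complex \<Rightarrow> complex"
  assumes J: "J \<in> carrier_mat n n" "ct J = J" "det J \<noteq> 0"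
    and K11: "K11 \<in> carrier_mat n n" "ct K11 = K11" and K21: "K21 \<in> carrier_mat m n"
    and K22: "K22 \<in> carrier_mat m m" "ct K22 = K22" and c: "c \<noteq> 0"
    and det: "\<And>y w. det (four_block_mat (w \<cdot>\<^sub>m 1\<^sub>m m + K22) K21 (ct K21) (y \<cdot>\<^sub>m J + K11)) = c * Q y w"
    and nf: "\<And>y. \<exists>w. Q y w \<noteq> 0" and w0: "Im w0 > 0"
  shows "\<exists>X \<in> carrier_mat n n. \<exists>ls k. det X \<noteq> 0 \<and> length ls = n \<and> (\<forall>l \<in> set ls. Im l \<noteq> 0) \<and>
    ct X * J * X = sign_mat ls \<and> k \<noteq> 0 \<and> (\<forall>y. Q y w0 = k * (\<Prod>l\<leftarrow>ls. y - l))"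
proof -
  define G where "G = w0 \<cdot>\<^sub>m 1\<^sub>m m + K22"
  have G: "G \<in> carrier_mat m m" "det G \<noteq> 0" using K22 det_hermitian_shift[OF K22] w0 by (auto simp: G_def)
  obtain E where E: "E \<in> carrier_mat m m" "G * E = 1\<^sub>m m" "E * G = 1\<^sub>m m" using det_nonzero_inverse[OF G] by metis
  note dims = carrier_matD[OF J(1)] carrier_matD[OF K11(1)] carrier_matD[OF K21] carrier_matD[OF K22(1)]
    carrier_matD[OF G(1)] carrier_matD[OF E(1)]
  define S where "S = K11 - ct K21 * E * K21"
  have S: "S \<in> carrier_mat n n" using dims by (auto simp: S_def intro!: carrier_matI)
  define R where "R = of_real (sqrt (Im w0)) \<cdot>\<^sub>m (E * K21)"
  have R: "R \<in> carrier_mat m n" using dims by (auto simp: R_def intro!: carrier_matI)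
  \<comment> \<open>Resolvent identity: \<open>E - ct E = ct E * (ct G - G) * E\<close>, where the
    Hermitian part of \<open>G\<close> cancels.\<close>
  have EE: "E - ct E = (- 2 * \<i> * of_real (Im w0)) \<cdot>\<^sub>m (ct E * E)"
  proof -
    have "ct E * ct G = ct (G * E)" using dims by (simp add: ct_mult)
    then have 1: "ct E * ct G = 1\<^sub>m m" by (simp add: E(2))
    have "ct G - G = (cnj w0 - w0) \<cdot>\<^sub>m 1\<^sub>m m"
      unfolding G_def using K22 by (simp add: ct_add ct_smult) (rule eq_matI, auto)
    also have "cnj w0 - w0 = - 2 * \<i> * of_real (Im w0)" by (simp add: complex_eq_iff)
    finally have 2: "ct G - G = (- 2 * \<i> * of_real (Im w0)) \<cdot>\<^sub>m 1\<^sub>m m" .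
    have "(ct E * ct G) * E - ct E * (G * E) = ct E * (ct G - G) * E" using dims by (simp add: mat_ring)
    then show ?thesis unfolding 1 2 E(2) using dims by (simp add: mat_ring)
  qed
  have SS: "S = ct S + (2 * \<i>) \<cdot>\<^sub>m (ct R * R)"
  proof -
    have "ct S = K11 - ct K21 * ct E * K21" unfolding S_def using dims K11 by (simp add: ct_minus ct_mult mat_ring)
    moreover have "ct K21 * E * K21 - ct K21 * ct E * K21 = ct K21 * (E - ct E) * K21" using dims by (simp add: mat_ring)
    then have "ct K21 * E * K21 - ct K21 * ct E * K21 = (- 2 * \<i> * of_real (Im w0)) \<cdot>\<^sub>m (ct K21 * (ct E * E) * K21)"
      unfolding EE using dims by (simp add: mat_ring)
    moreover have "ct R * R = of_real (Im w0) \<cdot>\<^sub>m (ct K21 * (ct E * E) * K21)"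
    proof -
      have "ct R * R = (of_real (sqrt (Im w0)) * of_real (sqrt (Im w0))) \<cdot>\<^sub>m (ct K21 * (ct E * E) * K21)"
        unfolding R_def using dims by (simp add: ct_smult ct_mult mat_ring) (rule eq_matI, auto simp del: index_mult_mat(1))
      also have "complex_of_real (sqrt (Im w0)) * of_real (sqrt (Im w0)) = of_real (Im w0)"
        using w0 by (simp flip: of_real_mult)
      finally show ?thesis .
    qed
    ultimately have e: "ct S = K11 - ct K21 * ct E * K21"
      "ct K21 * E * K21 - ct K21 * ct E * K21 = (- 2 * \<i> * of_real (Im w0)) \<cdot>\<^sub>m (ct K21 * (ct E * E) * K21)"
      "ct R * R = of_real (Im w0) \<cdot>\<^sub>m (ct K21 * (ct E * E) * K21)" by blast+
    define A where "A = ct K21 * E * K21"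
    define B where "B = ct K21 * ct E * K21"
    define D where "D = ct K21 * (ct E * E) * K21"
    have c: "A \<in> carrier_mat n n" "B \<in> carrier_mat n n" "D \<in> carrier_mat n n"
      using dims by (auto simp: A_def B_def D_def intro!: carrier_matI)
    have AB: "A - B = (- 2 * \<i> * of_real (Im w0)) \<cdot>\<^sub>m D" using e(2) by (simp only: A_def B_def D_def)
    have ent: "A $$ (i, j) - B $$ (i, j) = - 2 * \<i> * of_real (Im w0) * D $$ (i, j)" if "i < n" "j < n" for i j
    proof -
      have "(A - B) $$ (i, j) = ((- 2 * \<i> * of_real (Im w0)) \<cdot>\<^sub>m D) $$ (i, j)" by (simp only: AB)
      then show ?thesis using that c by simp
    qed
    have "S = K11 - A" by (simp add: S_def A_def)
    moreover have "K11 - A = K11 - B + (2 * \<i>) \<cdot>\<^sub>m (of_real (Im w0) \<cdot>\<^sub>m D)"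
    proof (rule eq_matI)
      fix i j assume "i < dim_row (K11 - B + (2 * \<i>) \<cdot>\<^sub>m (of_real (Im w0) \<cdot>\<^sub>m D))"
        "j < dim_col (K11 - B + (2 * \<i>) \<cdot>\<^sub>m (of_real (Im w0) \<cdot>\<^sub>m D))"
      then have ij: "i < n" "j < n" using c by auto
      have "A $$ (i, j) = B $$ (i, j) - 2 * \<i> * of_real (Im w0) * D $$ (i, j)" using ent[OF ij] by (simp add: algebra_simps)
      then show "(K11 - A) $$ (i, j) = (K11 - B + (2 * \<i>) \<cdot>\<^sub>m (of_real (Im w0) \<cdot>\<^sub>m D)) $$ (i, j)"
        using ij c dims by simp
    qed (use c dims in auto)
    ultimately show ?thesis unfolding e(1,3) by (simp only: A_def B_def D_def)
  qed
  have obs: "R * x \<noteq> 0\<^sub>m m 1" if x: "x \<in> carrier_mat n 1" "x \<noteq> 0\<^sub>m n 1" "(l \<cdot>\<^sub>m J + S) * x = 0\<^sub>m n 1" for l x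
  proof
    assume Rx: "R * x = 0\<^sub>m m 1"
    note dx = carrier_matD[OF x(1)]
    have "of_real (1 / sqrt (Im w0)) \<cdot>\<^sub>m (R * x) = E * (K21 * x)"
    proof -
      have "R * x = of_real (sqrt (Im w0)) \<cdot>\<^sub>m (E * (K21 * x))" unfolding R_def using dims dx by (simp add: mat_ring)
      then show ?thesis using w0 dims dx by (auto intro!: eq_matI simp del: index_mult_mat(1))
    qed
    then have "E * (K21 * x) = 0\<^sub>m m 1" unfolding Rx by (auto intro!: eq_matI)
    moreover have "K21 * x = (G * E) * (K21 * x)" unfolding E(2) using dims dx by (simp add: mat_ring)
    then have "K21 * x = G * (E * (K21 * x))" using dims dx by (simp add: mat_ring)
    ultimately have Kx: "K21 * x = 0\<^sub>m m 1" using dims by (simp add: mat_mult_zero)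
    have "(l \<cdot>\<^sub>m J + S) * x = (l \<cdot>\<^sub>m J + K11) * x - ct K21 * (E * (K21 * x))"
      unfolding S_def using dims dx by (simp add: mat_ring) (rule eq_matI, auto simp del: index_mult_mat(1))
    then have "(l \<cdot>\<^sub>m J + K11) * x - 0\<^sub>m n 1 = 0\<^sub>m n 1" unfolding x(3) Kx using dims by (simp add: mat_mult_zero)
    moreover have "(l \<cdot>\<^sub>m J + K11) * x - 0\<^sub>m n 1 = (l \<cdot>\<^sub>m J + K11) * x" using dims dx by (auto intro!: eq_matI simp del: index_mult_mat(1))
    ultimately have lx: "(l \<cdot>\<^sub>m J + K11) * x = 0\<^sub>m n 1" by simp
    have "det (four_block_mat (w \<cdot>\<^sub>m 1\<^sub>m m + K22) K21 (ct K21) (l \<cdot>\<^sub>m J + K11)) = 0" for w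
      by (rule four_block_kernel_det[where u = "0\<^sub>m m 1" and v = x])
        (use x Kx lx dims K22 K21 J K11 in \<open>auto simp: mat_mult_zero\<close>)
    then have "Q l w = 0" for w using det c by simp
    then show False using nf by blast
  qed
  have "\<exists>X \<in> carrier_mat n n. \<exists>ls k. det X \<noteq> 0 \<and> length ls = n \<and> (\<forall>l \<in> set ls. Im l \<noteq> 0) \<and>
    ct X * J * X = sign_mat ls \<and> k \<noteq> 0 \<and> (\<forall>y. det (y \<cdot>\<^sub>m J + S) = k * (\<Prod>l\<leftarrow>ls. y - l))"
    by (rule dissipative_pencil_inertia[OF J S R SS]) (rule obs)
  then obtain X ls k where X: "X \<in> carrier_mat n n" "det X \<noteq> 0" "length ls = n" "\<forall>l \<in> set ls. Im l \<noteq> 0"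
    "ct X * J * X = sign_mat ls" "k \<noteq> 0" "\<forall>y. det (y \<cdot>\<^sub>m J + S) = k * (\<Prod>l\<leftarrow>ls. y - l)" by blast
  have "Q y w0 = (det G * k / c) * (\<Prod>l\<leftarrow>ls. y - l)" for y
  proof -
    have "c * Q y w0 = det G * det ((y \<cdot>\<^sub>m J + K11) - ct K21 * E * K21)"
      unfolding det[symmetric] G_def[symmetric] using dims E by (intro det_schur_complement_upper) (auto intro!: carrier_matI)
    also have "(y \<cdot>\<^sub>m J + K11) - ct K21 * E * K21 = y \<cdot>\<^sub>m J + S"
      unfolding S_def using dims by (auto intro!: eq_matI simp del: index_mult_mat(1))
    finally show ?thesis using c X(7) by (simp add: field_simps)
  qed
  moreover have "det G * k / c \<noteq> 0" using G X(6) c by simp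
  ultimately show ?thesis using X by blast
qed

section \<open>Undoing the inversion of the variable\<close>

lemma pencil_blocks:
  fixes S :: "complex mat"
  assumes "S \<in> carrier_mat n n" "T \<in> carrier_mat n n" "G \<in> carrier_mat n n" "H \<in> carrier_mat n n"
    "B \<in> carrier_mat n r" "C \<in> carrier_mat r n" "N \<in> carrier_mat r r"
  shows "four_block_mat (S - T) B C (- N) + y \<cdot>\<^sub>m four_block_mat G (0\<^sub>m n r) (0\<^sub>m r n) (0\<^sub>m r r)
      + z \<cdot>\<^sub>m four_block_mat H (0\<^sub>m n r) (0\<^sub>m r n) (1\<^sub>m r) =
    four_block_mat (y \<cdot>\<^sub>m G + z \<cdot>\<^sub>m H + S - T) B C (z \<cdot>\<^sub>m 1\<^sub>m r - N)"
  by (rule eq_matI) (use assms in auto)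

text \<open>The two parts of the upper left block behave differently. On the kernel the inverse of
  \<open>w\<close> is \<open>- z\<close>, which yields the linear term
  \<open>z \<cdot>\<^sub>m (L * ct L)\<close>. On the complement, with \<open>E\<close> the inverse
  of \<open>z \<cdot>\<^sub>m 1\<^sub>m r - Ni\<close>, the inverse of \<open>w + N\<close> is
  \<open>Ni + Ni * E * Ni\<close>; its second summand is again a Schur complement, which explains
  the new block linear in \<open>z\<close>.\<close>

lemma det_pencil_inversion:
  fixes L K N S :: "complex mat"
  assumes L: "L \<in> carrier_mat n p" and K: "K \<in> carrier_mat n r"
    and N: "N \<in> carrier_mat r r" and Ni: "Ni \<in> carrier_mat r r" "ct Ni = Ni" "N * Ni = 1\<^sub>m r" "Ni * N = 1\<^sub>m r"
    and T: "T \<in> carrier_mat n n" and z: "z \<noteq> 0" and dz: "det (z \<cdot>\<^sub>m 1\<^sub>m r - Ni) \<noteq> 0" and w: "w = - 1 / z"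
  shows "(- z) ^ (p + r) * det (four_block_mat (w \<cdot>\<^sub>m 1\<^sub>m (p + r) + dsum (0\<^sub>m p p) N) (ct (hcat L K)) (hcat L K) T) =
    (- 1) ^ r * det N * det (four_block_mat (T + z \<cdot>\<^sub>m (L * ct L) - K * Ni * ct K) (K * Ni) (ct (K * Ni)) (z \<cdot>\<^sub>m 1\<^sub>m r - Ni))"
proof -
  define m where "m = p + r"
  note dims = carrier_matD[OF L] carrier_matD[OF K] carrier_matD[OF N] carrier_matD[OF Ni(1)] carrier_matD[OF T]
  define B where "B = K * Ni"
  have B: "B \<in> carrier_mat n r" using dims by (auto simp: B_def intro!: carrier_matI)
  let ?M = "four_block_mat (T + z \<cdot>\<^sub>m (L * ct L) - K * Ni * ct K) B (ct B) (z \<cdot>\<^sub>m 1\<^sub>m r - Ni)"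
  define D where "D = z \<cdot>\<^sub>m 1\<^sub>m r - Ni"
  have D: "D \<in> carrier_mat r r" "det D \<noteq> 0" using Ni dz by (auto simp: D_def intro!: carrier_matI)
  obtain E where E: "E \<in> carrier_mat r r" "D * E = 1\<^sub>m r" "E * D = 1\<^sub>m r" using det_nonzero_inverse[OF D] by metis
  note dims = dims carrier_matD[OF D(1)] carrier_matD[OF E(1)]
  have m1: "det ?M = det (T + z \<cdot>\<^sub>m (L * ct L) - K * Ni * ct K - B * E * ct B) * det D"
    unfolding D_def[symmetric] using dims B E D by (intro det_schur_complement) (auto intro!: carrier_matI)
  note w_def = w
  have w: "w \<noteq> 0" using z by (simp add: w_def)
  have wN: "w \<cdot>\<^sub>m 1\<^sub>m r + N = (1 / z) \<cdot>\<^sub>m (N * D)"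
  proof -
    have "N * D = z \<cdot>\<^sub>m N - 1\<^sub>m r" unfolding D_def using dims Ni(3) by (simp add: mat_ring)
    then show ?thesis using z dims by (intro eq_matI) (auto simp: w_def field_simps)
  qed
  define H where "H = z \<cdot>\<^sub>m (E * Ni)"
  have H: "H \<in> carrier_mat r r" using dims by (auto simp: H_def intro!: carrier_matI)
  have HN: "H * (w \<cdot>\<^sub>m 1\<^sub>m r + N) = 1\<^sub>m r"
  proof -
    have "(E * Ni) * (N * D) = E * (Ni * N) * D" using dims by (simp add: mat_ring)
    also have "\<dots> = 1\<^sub>m r" unfolding Ni(4) using dims E by (simp add: mat_ring)
    finally have "(E * Ni) * (N * D) = 1\<^sub>m r" .
    then show ?thesis unfolding wN H_def using dims z
      by (simp add: mat_smult_mult mat_mult_smult) (rule eq_matI, auto)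
  qed
  have wD: "w \<cdot>\<^sub>m 1\<^sub>m m + dsum (0\<^sub>m p p) N = dsum (w \<cdot>\<^sub>m 1\<^sub>m p) (w \<cdot>\<^sub>m 1\<^sub>m r + N)"
    unfolding m_def dsum_one[symmetric] dsum_smult using dims by (subst dsum_add) (auto intro!: arg_cong2[of _ _ _ _ dsum] eq_matI)
  have inv: "dsum ((1 / w) \<cdot>\<^sub>m 1\<^sub>m p) H * dsum (w \<cdot>\<^sub>m 1\<^sub>m p) (w \<cdot>\<^sub>m 1\<^sub>m r + N) = 1\<^sub>m m"
    using dims carrier_matD[OF H] HN w
    by (subst dsum_mult) (auto simp: mat_ring dsum_one[symmetric] m_def intro!: arg_cong2[of _ _ _ _ dsum] eq_matI)
  define q where "q = det (four_block_mat (w \<cdot>\<^sub>m 1\<^sub>m m + dsum (0\<^sub>m p p) N) (ct (hcat L K)) (hcat L K) T)"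
  have "q = det (four_block_mat (dsum (w \<cdot>\<^sub>m 1\<^sub>m p) (w \<cdot>\<^sub>m 1\<^sub>m r + N)) (ct (hcat L K)) (hcat L K) T)"
    unfolding q_def wD ..
  also have "\<dots> = det (dsum (w \<cdot>\<^sub>m 1\<^sub>m p) (w \<cdot>\<^sub>m 1\<^sub>m r + N)) *
    det (T - hcat L K * dsum ((1 / w) \<cdot>\<^sub>m 1\<^sub>m p) H * ct (hcat L K))"
    using dims m_def inv carrier_matD[OF H] by (intro det_schur_complement_upper) (auto intro!: carrier_matI)
  also have "hcat L K * dsum ((1 / w) \<cdot>\<^sub>m 1\<^sub>m p) H * ct (hcat L K) = (1 / w) \<cdot>\<^sub>m (L * ct L) + K * H * ct K"
  proof -
    have "hcat L K * dsum ((1 / w) \<cdot>\<^sub>m 1\<^sub>m p) H = hcat ((1 / w) \<cdot>\<^sub>m L) (K * H)"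
    proof -
      have "hcat L K * dsum ((1 / w) \<cdot>\<^sub>m 1\<^sub>m p) H =
        hcat (L * ((1 / w) \<cdot>\<^sub>m 1\<^sub>m p) + K * 0\<^sub>m r p) (L * 0\<^sub>m p r + K * H)"
        unfolding dsum_def using dims carrier_matD[OF H] by (subst hcat_mult_four_block) auto
      also have "L * ((1 / w) \<cdot>\<^sub>m 1\<^sub>m p) + K * 0\<^sub>m r p = (1 / w) \<cdot>\<^sub>m L" using dims by (simp add: mat_ring) (rule eq_matI, auto)
      also have "L * 0\<^sub>m p r + K * H = K * H"
        using dims carrier_matD[OF H] by (simp add: mat_mult_zero) (rule eq_matI, auto simp del: index_mult_mat(1))
      finally show ?thesis .
    qed
    then show ?thesis using dims carrier_matD[OF H] by (simp add: hcat_mult_ct_hcat mat_ring)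
  qed
  also have "T - ((1 / w) \<cdot>\<^sub>m (L * ct L) + K * H * ct K) =
    T + z \<cdot>\<^sub>m (L * ct L) - K * Ni * ct K - B * E * ct B"
  proof -
    have "D * E = z \<cdot>\<^sub>m E - Ni * E" unfolding D_def using dims by (simp add: mat_ring)
    then have zE: "z \<cdot>\<^sub>m E - Ni * E = 1\<^sub>m r" by (simp add: E(2))
    have "z \<cdot>\<^sub>m (E * Ni) - Ni * E * Ni = (z \<cdot>\<^sub>m E - Ni * E) * Ni" using dims by (simp add: mat_ring)
    also have "\<dots> = Ni" unfolding zE using dims by (simp add: mat_ring)
    finally have "K * (z \<cdot>\<^sub>m (E * Ni) - Ni * E * Ni) * ct K = K * Ni * ct K" by simp
    then have "K * H * ct K - K * Ni * E * Ni * ct K = K * Ni * ct K" unfolding H_def using dims by (simp add: mat_ring)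
    moreover have "B * E * ct B = K * Ni * E * Ni * ct K" unfolding B_def using dims Ni(2) by (simp add: ct_mult mat_ring)
    ultimately have e: "K * H * ct K - B * E * ct B = K * Ni * ct K" by simp
    define R1 where "R1 = K * H * ct K"
    define R2 where "R2 = B * E * ct B"
    define R3 where "R3 = K * Ni * ct K"
    define R4 where "R4 = L * ct L"
    have c: "R1 \<in> carrier_mat n n" "R2 \<in> carrier_mat n n" "R3 \<in> carrier_mat n n" "R4 \<in> carrier_mat n n"
      using dims B carrier_matD[OF H] by (auto simp: R1_def R2_def R3_def R4_def intro!: carrier_matI)
    have ent: "R1 $$ (i, j) = R2 $$ (i, j) + R3 $$ (i, j)" if "i < n" "j < n" for i j
    proof -
      have "(R1 - R2) $$ (i, j) = R3 $$ (i, j)" unfolding R1_def R2_def R3_def e ..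
      then show ?thesis using that c by (simp add: algebra_simps)
    qed
    have "1 / w = - z" using z by (simp add: w_def)
    moreover have "T - ((- z) \<cdot>\<^sub>m R4 + R1) = T + z \<cdot>\<^sub>m R4 - R3 - R2"
    proof (rule eq_matI)
      fix i j assume "i < dim_row (T + z \<cdot>\<^sub>m R4 - R3 - R2)" "j < dim_col (T + z \<cdot>\<^sub>m R4 - R3 - R2)"
      then have ij: "i < n" "j < n" using c by auto
      then show "(T - ((- z) \<cdot>\<^sub>m R4 + R1)) $$ (i, j) = (T + z \<cdot>\<^sub>m R4 - R3 - R2) $$ (i, j)"
        using ent[OF ij] c T by simp
    qed (use c T in auto)
    ultimately show ?thesis
      unfolding R1_def[symmetric] R2_def[symmetric] R3_def[symmetric] R4_def[symmetric] by simp
  qed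
  finally have "q * det D = det (dsum (w \<cdot>\<^sub>m 1\<^sub>m p) (w \<cdot>\<^sub>m 1\<^sub>m r + N)) * det ?M"
    by (simp add: m1)
  also have "det (dsum (w \<cdot>\<^sub>m 1\<^sub>m p) (w \<cdot>\<^sub>m 1\<^sub>m r + N)) = w ^ p * ((1 / z) ^ r * (det N * det D))"
  proof -
    have c: "w \<cdot>\<^sub>m 1\<^sub>m p \<in> carrier_mat p p" "(1 / z) \<cdot>\<^sub>m (N * D) \<in> carrier_mat r r" using dims by (auto intro!: carrier_matI)
    show ?thesis unfolding wN det_dsum[OF c] using dims by (simp add: det_smult det_mult[OF N(1) D(1)])
  qed
  finally have "q = w ^ p * (1 / z) ^ r * det N * det ?M" using D(2) by simp
  \<comment> \<open>The exponent \<open>m = p + r\<close> is used up exactly: each \<open>w\<close>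
    cancels a factor \<open>- z\<close>, and each \<open>1 / z\<close> leaves a sign.\<close>
  moreover have "(- z) ^ m * (w ^ p * (1 / z) ^ r) = (- 1) ^ r"
  proof -
    have "(- z) ^ m * (w ^ p * (1 / z) ^ r) = ((- z) * w) ^ p * ((- z) * (1 / z)) ^ r"
      unfolding m_def power_add by (simp only: power_mult_distrib mult_ac)
    also have "\<dots> = 1 ^ p * (- 1) ^ r"
    proof -
      have "(- z) * w = 1" "(- z) * (1 / z) = - 1" using z by (simp_all add: w_def)
      then show ?thesis by (simp only:)
    qed
    finally show ?thesis by simp
  qed
  ultimately have e: "q = w ^ p * (1 / z) ^ r * det N * det ?M" "(- z) ^ m * (w ^ p * (1 / z) ^ r) = (- 1) ^ r" by blast+
  have "(- z) ^ m * q = ((- z) ^ m * (w ^ p * (1 / z) ^ r)) * det N * det ?M" unfolding e(1) by (simp only: mult_ac)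
  then have "(- z) ^ m * q = (- 1) ^ r * det N * det ?M" unfolding e(2) .
  then show ?thesis by (simp only: q_def m_def B_def)
qed

text \<open>\<open>L\<close> has full column rank, since otherwise the block matrix would be
  singular at \<open>w = 0\<close> for every \<open>y\<close>, against \<open>top\<close>; this
  gives the right inverse of \<open>Y2\<close>. The basis \<open>Y\<close> normalizes
  \<open>1\<^sub>m n + L * ct L\<close>, so the Gram matrices of \<open>Y1\<close> and
  \<open>Y2\<close> add up to the identity, with the last \<open>r\<close> coordinates belonging to
  \<open>Y2\<close> alone.\<close>

lemma hermitian_rep_of_block:
  fixes Q :: "complex \<Rightarrow> complex \<Rightarrow> complex" and P :: "complex \<Rightarrow> complex poly" and L K N S :: "complex mat"
  assumes ls: "length ls = n" and L: "L \<in> carrier_mat n p" and K: "K \<in> carrier_mat n r"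
    and N: "N \<in> carrier_mat r r" "ct N = N" "det N \<noteq> 0" and S: "S \<in> carrier_mat n n" "ct S = S"
    and m: "m = p + r" and dd: "dd \<noteq> 0"
    and detT: "\<And>y w. det (four_block_mat (w \<cdot>\<^sub>m 1\<^sub>m m + dsum (0\<^sub>m p p) N) (ct (hcat L K)) (hcat L K) (y \<cdot>\<^sub>m sign_mat ls + S)) = dd * Q y w"
    and P: "\<And>y z. z \<noteq> 0 \<Longrightarrow> poly (P y) z = (- z) ^ m * Q y (- 1 / z)"
    and top: "\<exists>y. Q y 0 \<noteq> 0"
  shows "hermitian_rep (\<lambda>y z. poly (P y) z) (n + r) ls m"
proof -
  let ?sg = "sign_mat ls"
  have sg: "?sg \<in> carrier_mat n n" using sign_mat_carrier[of ls] ls by simp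
  obtain Ni where Ni: "Ni \<in> carrier_mat r r" "ct Ni = Ni" "N * Ni = 1\<^sub>m r" "Ni * N = 1\<^sub>m r" "det Ni \<noteq> 0"
    using hermitian_inverse[OF N] by metis
  note dims = carrier_matD[OF L] carrier_matD[OF K] carrier_matD[OF N(1)] carrier_matD[OF Ni(1)] carrier_matD[OF S(1)]
  have detLL: "det (ct L * L) \<noteq> 0"
  proof
    assume "det (ct L * L) = 0"
    then obtain u where u: "u \<in> carrier_mat p 1" "u \<noteq> 0\<^sub>m p 1" "ct L * L * u = 0\<^sub>m p 1"
      using det_zero_iff_kernel[OF mult_carrier_mat[OF ct_carrier[OF L] L]] by auto
    have Lu: "L * u = 0\<^sub>m n 1" by (rule gram_kernel[OF L u(1,3)])
    note du = carrier_matD[OF u(1)]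
    define v where "v = dsum u (0\<^sub>m r 0)"
    have v: "v \<in> carrier_mat m 1" using du by (auto simp: v_def m intro!: carrier_matI)
    have "v \<noteq> 0\<^sub>m m 1"
    proof
      assume v0: "v = 0\<^sub>m m 1"
      have "u = 0\<^sub>m p 1"
      proof (rule eq_matI)
        fix i j assume "i < dim_row (0\<^sub>m p 1 :: complex mat)" "j < dim_col (0\<^sub>m p 1 :: complex mat)"
        then have ij: "i < p" "j = 0" by auto
        have "v $$ (i, 0) = u $$ (i, j)" using du ij by (simp add: v_def dsum_def)
        moreover have "v $$ (i, 0) = 0" using ij m by (simp add: v0)
        ultimately show "u $$ (i, j) = 0\<^sub>m p 1 $$ (i, j)" using ij by simp
      qed (use du in auto)
      then show False using u(2) by simp
    qed
    moreover have "(0 \<cdot>\<^sub>m 1\<^sub>m m + dsum (0\<^sub>m p p) N) * v = 0\<^sub>m m 1"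
    proof -
      have "0 \<cdot>\<^sub>m 1\<^sub>m m + dsum (0\<^sub>m p p) N = dsum (0\<^sub>m p p) N" using dims m by (intro eq_matI) auto
      moreover have "dsum (0\<^sub>m p p) N * v = dsum (0\<^sub>m p 1) (0\<^sub>m r 0)"
        unfolding v_def using du dims by (simp add: dsum_mult mat_ring)
      ultimately show ?thesis by (simp add: dsum_zero m)
    qed
    moreover have "hcat L K * v = 0\<^sub>m n 1"
    proof -
      have "hcat L K * v = hcat (L * u + K * 0\<^sub>m r 1) (L * 0\<^sub>m p 0 + K * 0\<^sub>m r 0)"
        unfolding v_def dsum_def using dims du by (subst hcat_mult_four_block) auto
      also have "\<dots> = 0\<^sub>m n 1" unfolding Lu using dims by (simp add: mat_mult_zero) (rule eq_matI, auto simp: hcat_index)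
      finally show ?thesis .
    qed
    ultimately have v': "v \<noteq> 0\<^sub>m m 1" "(0 \<cdot>\<^sub>m 1\<^sub>m m + dsum (0\<^sub>m p p) N) * v = 0\<^sub>m m 1" "hcat L K * v = 0\<^sub>m n 1"
      by blast+
    have LKc: "hcat L K \<in> carrier_mat n m" using hcat_carrier[OF L K] by (simp add: m)
    have Ac: "0 \<cdot>\<^sub>m 1\<^sub>m m + dsum (0\<^sub>m p p) N \<in> carrier_mat m m" using dims m by (intro carrier_matI) auto
    have Sc: "y \<cdot>\<^sub>m ?sg + S \<in> carrier_mat n n" for y using S by simp
    have "det (four_block_mat (0 \<cdot>\<^sub>m 1\<^sub>m m + dsum (0\<^sub>m p p) N) (ct (hcat L K)) (hcat L K) (y \<cdot>\<^sub>m ?sg + S)) = 0" for y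
    proof (rule four_block_kernel_det[OF Ac ct_carrier[OF LKc] LKc Sc v zero_carrier_mat])
      show "(0 \<cdot>\<^sub>m 1\<^sub>m m + dsum (0\<^sub>m p p) N) * v + ct (hcat L K) * 0\<^sub>m n 1 = 0\<^sub>m m 1"
        unfolding v'(2) using carrier_matD[OF LKc] by (simp add: mat_mult_zero)
      show "hcat L K * v + (y \<cdot>\<^sub>m ?sg + S) * 0\<^sub>m n 1 = 0\<^sub>m n 1"
        unfolding v'(3) using carrier_matD[OF Sc] by (simp add: mat_mult_zero)
    qed (use v'(1) in simp)
    then have "Q y 0 = 0" for y unfolding detT using dd by simp
    then show False using top by blast
  qed
  obtain V where V: "V \<in> carrier_mat p p" "ct L * L * V = 1\<^sub>m p"
    using det_nonzero_inverse[OF mult_carrier_mat[OF ct_carrier[OF L] L] detLL] by metis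
  obtain Y where Y: "Y \<in> carrier_mat n n" "ct Y * (1\<^sub>m n + L * ct L) * Y = 1\<^sub>m n"
    using posdef_orthonormal_basis(1)[OF posdef_one_plus_gram[OF L]] by blast
  note dims = dims carrier_matD[OF Y(1)] carrier_matD[OF V(1)] carrier_matD[OF S(1)] carrier_matD[OF sg]
  define Yi where "Yi = ct Y * (1\<^sub>m n + L * ct L)"
  have Yi: "Yi \<in> carrier_mat n n" using dims by (auto simp: Yi_def intro!: carrier_matI)
  have "Yi * Y = 1\<^sub>m n" unfolding Yi_def by (rule Y(2))
  then have dY: "det Y \<noteq> 0" and YYi: "Y * Yi = 1\<^sub>m n" using det_nonzero_left_inverse[OF Y(1) Yi] by auto
  have dcY: "det (ct Y) \<noteq> 0" using dY by (simp add: det_ct[OF Y(1)])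
  define B where "B = K * Ni"
  have B: "B \<in> carrier_mat n r" using dims by (auto simp: B_def intro!: carrier_matI)
  define A00 where "A00 = four_block_mat (S - K * Ni * ct K) B (ct B) (- Ni)"
  have A00: "A00 \<in> carrier_mat (n + r) (n + r)" using dims B by (auto simp: A00_def intro!: carrier_matI)
  have ctA00: "ct A00 = A00"
  proof -
    have "ct (- Ni) = - Ni" using Ni(1,2) by (intro eq_matI) (auto, metis carrier_matD ct_index)
    then show ?thesis
      unfolding A00_def using dims B S Ni by (subst ct_four_block) (auto simp: ct_minus ct_mult mat_ring)
  qed
  define U where "U = dsum Y (1\<^sub>m r)"
  have U: "U \<in> carrier_mat (n + r) (n + r)" using dims by (auto simp: U_def)
  define A0 where "A0 = ct U * A00 * U"
  define Y1 where "Y1 = hcat Y (0\<^sub>m n r)"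
  define X1 where "X1 = four_block_mat Yi (0\<^sub>m n 0) (0\<^sub>m r n) (0\<^sub>m r 0)"
  define Y2 where "Y2 = dsum (ct L * Y) (1\<^sub>m r)"
  define X2 where "X2 = dsum (Yi * (L * V)) (1\<^sub>m r)"
  note dims = dims carrier_matD[OF U] carrier_matD[OF A00] carrier_matD[OF Yi]
  let ?G = "ct Y * (L * ct L) * Y"
  have A1: "ct Y1 * ?sg * Y1 = dsum (ct Y * ?sg * Y) (0\<^sub>m r r)"
  proof -
    have "ct Y1 * ?sg * Y1 = ct Y1 * (?sg * Y1)" using dims by (simp add: Y1_def mat_ring)
    also have "?sg * Y1 = hcat (?sg * Y) (0\<^sub>m n r)" unfolding Y1_def using dims by (subst mult_hcat) (auto simp: mat_mult_zero)
    also have "ct Y1 * \<dots> = four_block_mat (ct Y * (?sg * Y)) (ct Y * 0\<^sub>m n r) (ct (0\<^sub>m n r) * (?sg * Y)) (ct (0\<^sub>m n r) * 0\<^sub>m n r)"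
      unfolding Y1_def using dims by (subst ct_hcat_mult) auto
    finally show ?thesis unfolding dsum_def using dims by (simp add: mat_ring)
  qed
  have YY: "ct Y1 * Y1 = dsum (ct Y * Y) (0\<^sub>m r r)"
    unfolding Y1_def dsum_def using dims by (subst ct_hcat_mult) (auto simp: mat_ring)
  have A2: "ct Y2 * Y2 = dsum ?G (1\<^sub>m r)"
    unfolding Y2_def using dims by (simp add: ct_dsum dsum_mult ct_mult mat_ring)
  have A1': "ct Y1 * ?sg * Y1 = ct U * dsum ?sg (0\<^sub>m r r) * U"
    unfolding A1 U_def using dims by (simp add: ct_dsum dsum_mult mat_ring)
  have A2': "ct Y2 * Y2 = ct U * dsum (L * ct L) (1\<^sub>m r) * U"
    unfolding A2 U_def using dims by (simp add: ct_dsum dsum_mult mat_ring)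
  \<comment> \<open>Affine in \<open>y\<close> and \<open>z\<close>, with coefficients
    \<open>dsum ?sg (0\<^sub>m r r)\<close> and \<open>dsum (L * ct L) (1\<^sub>m r)\<close>; the
    congruence by \<open>U\<close> turns these into the Gram expressions in \<open>Y1\<close> and
    \<open>Y2\<close>.\<close>
  define M where "M y z = four_block_mat (y \<cdot>\<^sub>m ?sg + z \<cdot>\<^sub>m (L * ct L) + S - K * Ni * ct K) B (ct B) (z \<cdot>\<^sub>m 1\<^sub>m r - Ni)" for y z
  have M: "M y z \<in> carrier_mat (n + r) (n + r)" for y z using dims B by (auto simp: M_def intro!: carrier_matI)
  have dU: "det U = det Y" "det (ct U) = det (ct Y)"
    unfolding U_def ct_dsum using det_dsum[OF Y(1), of "1\<^sub>m r" r] det_dsum[OF ct_carrier[OF Y(1)], of "1\<^sub>m r" r] by simp_all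
  have pencil: "det (A0 + y \<cdot>\<^sub>m (ct Y1 * ?sg * Y1) + z \<cdot>\<^sub>m (ct Y2 * Y2)) = det (ct Y) * det (M y z) * det Y" for y z
  proof -
    have "A0 + y \<cdot>\<^sub>m (ct Y1 * ?sg * Y1) + z \<cdot>\<^sub>m (ct Y2 * Y2) =
      ct U * (A00 + y \<cdot>\<^sub>m dsum ?sg (0\<^sub>m r r) + z \<cdot>\<^sub>m dsum (L * ct L) (1\<^sub>m r)) * U"
      unfolding A0_def A1' A2' using dims by (simp add: mat_ring)
    also have "A00 + y \<cdot>\<^sub>m dsum ?sg (0\<^sub>m r r) + z \<cdot>\<^sub>m dsum (L * ct L) (1\<^sub>m r) = M y z"
    proof -
      have c: "S - K * Ni * ct K \<in> carrier_mat n n" "L * ct L \<in> carrier_mat n n" "ct B \<in> carrier_mat r n"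
        "K * Ni * ct K \<in> carrier_mat n n"
        using dims B by (auto intro!: carrier_matI)
      show ?thesis
        unfolding M_def A00_def dsum_def by (simp only: pencil_blocks[OF S(1) c(4) sg c(2) B c(3) Ni(1)] index_one_mat index_zero_mat carrier_matD[OF c(2)] carrier_matD[OF sg])
    qed
    finally show ?thesis using det_mult3[OF ct_carrier[OF U] M U] by (simp add: dU)
  qed
  have detM: "poly (P y) z = (- 1) ^ r * det N / dd * det (M y z)"
    if z: "z \<noteq> 0" and dz: "det (z \<cdot>\<^sub>m 1\<^sub>m r - Ni) \<noteq> 0" for y z
  proof -
    have T: "y \<cdot>\<^sub>m ?sg + S \<in> carrier_mat n n" using S(1) sg by simp
    have "y \<cdot>\<^sub>m ?sg + S + z \<cdot>\<^sub>m (L * ct L) - K * Ni * ct K = y \<cdot>\<^sub>m ?sg + z \<cdot>\<^sub>m (L * ct L) + S - K * Ni * ct K"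
    proof -
      have "a + b + c - d = a + c + b - d" if "a \<in> carrier_mat n n" "b \<in> carrier_mat n n" "c \<in> carrier_mat n n" "d \<in> carrier_mat n n"
        for a b c d :: "complex mat" using that by (intro eq_matI) auto
      then show ?thesis using S(1) sg L K Ni(1) by (auto intro!: carrier_matI)
    qed
    then have "(- z) ^ m * (dd * Q y (- 1 / z)) = (- 1) ^ r * det N * det (M y z)"
      using det_pencil_inversion[OF L K N(1) Ni(1-4) T z dz refl] unfolding M_def B_def m detT[symmetric] by simp
    then show ?thesis unfolding P[OF z] using dd by (simp add: field_simps)
  qed
  define C where "C = (- 1) ^ r * det N / dd / (det (ct Y) * det Y)"
  have rep: "poly (P y) z = C * det (A0 + y \<cdot>\<^sub>m (ct Y1 * ?sg * Y1) + z \<cdot>\<^sub>m (ct Y2 * Y2))" for y z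
  proof -
    have A0c: "A0 + y \<cdot>\<^sub>m (ct Y1 * ?sg * Y1) \<in> carrier_mat (n + r) (n + r)" "ct Y2 * Y2 \<in> carrier_mat (n + r) (n + r)"
      unfolding A0_def A1' A2' using dims by (auto intro!: carrier_matI)
    obtain p1 where p1: "\<And>z. poly p1 z = det ((A0 + y \<cdot>\<^sub>m (ct Y1 * ?sg * Y1)) + z \<cdot>\<^sub>m (ct Y2 * Y2))"
      using det_pencil_poly[OF A0c] by blast
    obtain p2 where p2: "\<And>z. poly p2 z = det (- Ni + z \<cdot>\<^sub>m 1\<^sub>m r)"
      using det_pencil_poly[of "- Ni" r "1\<^sub>m r"] Ni(1) by auto
    have sw: "- Ni + z \<cdot>\<^sub>m 1\<^sub>m r = z \<cdot>\<^sub>m 1\<^sub>m r - Ni" "z \<cdot>\<^sub>m 1\<^sub>m r + (- Ni) = z \<cdot>\<^sub>m 1\<^sub>m r - Ni" for z using dims by (auto intro!: eq_matI)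
    have "ct (- Ni) = - Ni" using Ni(1,2) by (intro eq_matI) (auto, metis carrier_matD ct_index)
    \<comment> \<open>The identity for \<open>P\<close> is available away from \<open>z = 0\<close>
      and the eigenvalues of \<open>Ni\<close>. These are real, so the value at \<open>\<i>\<close>
      shows that \<open>p2\<close> is not the zero polynomial and the exceptions are finite in
      number.\<close>
    then have "poly p2 \<i> \<noteq> 0" using det_hermitian_shift[of "- Ni" r \<i>] Ni(1) by (simp add: p2 sw)
    then have "p2 \<noteq> 0" by auto
    have "P y = smult C p1"
    proof (rule poly_eqI_MOST)
      have "\<forall>\<^sub>\<infinity>z :: real. z \<noteq> 0" by (simp add: eventually_cofinite)
      then show "\<forall>\<^sub>\<infinity>z :: real. poly (P y) (of_real z) = poly (smult C p1) (of_real z)"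
        using MOST_poly_nonzero[OF \<open>p2 \<noteq> 0\<close>]
      proof eventually_elim
        case (elim z)
        then have "poly (P y) (of_real z) = (- 1) ^ r * det N / dd * det (M y (of_real z))" by (intro detM) (auto simp: p2 sw)
        also have "\<dots> = C * (det (ct Y) * det (M y (of_real z)) * det Y)" using dY dcY by (simp add: C_def)
        finally show ?case by (simp add: p1 pencil)
      qed
    qed
    then show ?thesis by (simp add: p1)
  qed
  show ?thesis
    unfolding hermitian_rep_def ls
  proof (intro exI conjI allI)
    show "A0 \<in> carrier_mat (n + r) (n + r)" using dims by (auto simp: A0_def intro!: carrier_matI)
    show "ct A0 = A0" unfolding A0_def using dims ctA00 by (simp add: ct_mult mat_ring)
    show "Y1 \<in> carrier_mat n (n + r)" using dims by (auto simp: Y1_def intro!: carrier_matI)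
    show "X1 \<in> carrier_mat (n + r) n" using dims by (auto simp: X1_def intro!: carrier_matI)
    show "Y1 * X1 = 1\<^sub>m n"
    proof -
      have "Y1 * X1 = hcat (Y * Yi + 0\<^sub>m n r * 0\<^sub>m r n) (Y * 0\<^sub>m n 0 + 0\<^sub>m n r * 0\<^sub>m r 0)"
        unfolding Y1_def X1_def using dims by (subst hcat_mult_four_block) auto
      also have "\<dots> = 1\<^sub>m n" unfolding YYi by (rule eq_matI) (auto simp: hcat_index mat_mult_zero)
      finally show ?thesis .
    qed
    show "Y2 \<in> carrier_mat m (n + r)" using dims by (auto simp: Y2_def m intro!: carrier_matI)
    show "X2 \<in> carrier_mat (n + r) m" using dims by (auto simp: X2_def m intro!: carrier_matI)
    show "Y2 * X2 = 1\<^sub>m m"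
    proof -
      have "(ct L * Y) * (Yi * (L * V)) = ct L * (Y * Yi) * (L * V)" using dims by (simp add: mat_ring)
      also have "\<dots> = 1\<^sub>m p" unfolding YYi using V(2) dims by (simp add: mat_ring)
      finally have e: "(ct L * Y) * (Yi * (L * V)) = 1\<^sub>m p" .
      have "Y2 * X2 = dsum ((ct L * Y) * (Yi * (L * V))) (1\<^sub>m r * 1\<^sub>m r)"
        unfolding Y2_def X2_def using dims by (subst dsum_mult) auto
      then show ?thesis unfolding e by (simp add: mat_ring dsum_one m)
    qed
    show "ct Y1 * Y1 + ct Y2 * Y2 = 1\<^sub>m (n + r)"
    proof -
      have "ct Y * Y + ?G = ct Y * (1\<^sub>m n + L * ct L) * Y" using dims by (simp add: mat_ring)
      then have e: "ct Y * Y + ?G = 1\<^sub>m n" by (simp add: Y(2))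
      have "dsum (ct Y * Y) (0\<^sub>m r r) + dsum ?G (1\<^sub>m r) = dsum (ct Y * Y + ?G) (0\<^sub>m r r + 1\<^sub>m r)"
        using dims by (subst dsum_add) auto
      then show ?thesis unfolding YY A2 e by (simp add: dsum_one)
    qed
    show "poly (P y) z = C * det (A0 + y \<cdot>\<^sub>m (ct Y1 * ?sg * Y1) + z \<cdot>\<^sub>m (ct Y2 * Y2))" for y z by (rule rep)
    show "\<forall>\<^sub>\<infinity>e :: real. det (ct Y1 * ?sg * Y1 + of_real e \<cdot>\<^sub>m (ct Y2 * Y2)) \<noteq> 0"
    proof -
      have LL: "L * ct L \<in> carrier_mat n n" using L by (auto intro!: carrier_matI)
      obtain p1 where p1: "\<And>z. poly p1 z = det (?sg + z \<cdot>\<^sub>m (L * ct L))" using det_pencil_poly[OF sg LL] by blast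
      have sgs: "?sg * ?sg = 1\<^sub>m n" using sign_mat_square[of ls] ls by simp
      \<comment> \<open>At \<open>e = 0\<close> the invertible signature matrix is left, so
        \<open>p1\<close> is not the zero polynomial; the other block contributes
        \<open>e ^ r\<close>, which is nonzero for nonzero \<open>e\<close>.\<close>
      have "?sg + 0 \<cdot>\<^sub>m (L * ct L) = ?sg" using dims by (intro eq_matI) auto
      then have "poly p1 0 \<noteq> 0" using det_nonzero_left_inverse(1)[OF sg sg sgs] by (simp add: p1)
      then have "p1 \<noteq> 0" by auto
      have "\<forall>\<^sub>\<infinity>e :: real. e \<noteq> 0" by (simp add: eventually_cofinite)
      then show ?thesis using MOST_poly_nonzero[OF \<open>p1 \<noteq> 0\<close>]
      proof eventually_elim
        case (elim e)
        have c: "?sg + of_real e \<cdot>\<^sub>m (L * ct L) \<in> carrier_mat n n" "of_real e \<cdot>\<^sub>m 1\<^sub>m r \<in> carrier_mat r r"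
          using dims by (auto intro!: carrier_matI)
        have "ct Y1 * ?sg * Y1 + of_real e \<cdot>\<^sub>m (ct Y2 * Y2) = ct U * (dsum ?sg (0\<^sub>m r r) + of_real e \<cdot>\<^sub>m dsum (L * ct L) (1\<^sub>m r)) * U"
          unfolding A1' A2' using dims by (simp add: mat_ring)
        also have "dsum ?sg (0\<^sub>m r r) + of_real e \<cdot>\<^sub>m dsum (L * ct L) (1\<^sub>m r) = dsum (?sg + of_real e \<cdot>\<^sub>m (L * ct L)) (of_real e \<cdot>\<^sub>m 1\<^sub>m r)"
          unfolding dsum_smult using dims by (subst dsum_add) (auto intro!: arg_cong2[of _ _ _ _ dsum] eq_matI simp del: index_mult_mat(1))
        finally show ?case
          using det_mult3[OF ct_carrier[OF U] dsum_carrier[OF c] U] dY dcY elim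
          by (simp add: dU det_dsum[OF c] p1 det_smult)
      qed
    qed
  qed
qed

text \<open>As \<open>- 1 / z\<close> preserves the upper half plane, the inertia may be read off at
  \<open>w = - 1 / z0\<close>, and the list then consists of the zeros at \<open>z0\<close>. A
  congruence brings \<open>J\<close> to signature form and a unitary change splits
  \<open>K22\<close>; both multiply the determinant by a nonzero constant.\<close>

theorem hermitian_rep_of_realization:
  fixes Q :: "complex \<Rightarrow> complex \<Rightarrow> complex" and P :: "complex \<Rightarrow> complex poly"
  assumes J: "J \<in> carrier_mat n n" "ct J = J" "det J \<noteq> 0"
    and K11: "K11 \<in> carrier_mat n n" "ct K11 = K11" and K21: "K21 \<in> carrier_mat m n"
    and K22: "K22 \<in> carrier_mat m m" "ct K22 = K22" and c: "c \<noteq> 0"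
    and det: "\<And>y w. det (four_block_mat (w \<cdot>\<^sub>m 1\<^sub>m m + K22) K21 (ct K21) (y \<cdot>\<^sub>m J + K11)) = c * Q y w"
    and P: "\<And>y z. z \<noteq> 0 \<Longrightarrow> poly (P y) z = (- z) ^ m * Q y (- 1 / z)"
    and nf: "\<And>y. \<exists>w. Q y w \<noteq> 0" and top: "\<exists>y. Q y 0 \<noteq> 0" and z0: "Im z0 > 0"
  shows "\<exists>ls D k. (\<forall>l \<in> set ls. Im l \<noteq> 0) \<and> hermitian_rep (\<lambda>y z. poly (P y) z) D ls m \<and>
    k \<noteq> 0 \<and> (\<forall>y. poly (P y) z0 = k * (\<Prod>l\<leftarrow>ls. y - l))"
proof -
  have z00: "z0 \<noteq> 0" using z0 by auto
  have "Im (- 1 / z0) = Im z0 / (cmod z0)\<^sup>2" by (simp add: Im_divide cmod_power2)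
  then have w0: "Im (- 1 / z0) > 0" using z0 z00 by simp
  obtain X ls k where X: "X \<in> carrier_mat n n" "det X \<noteq> 0" and ls: "length ls = n" "\<forall>l \<in> set ls. Im l \<noteq> 0"
    and XJ: "ct X * J * X = sign_mat ls" and k: "k \<noteq> 0" "\<forall>y. Q y (- 1 / z0) = k * (\<Prod>l\<leftarrow>ls. y - l)"
    using realization_inertia[OF J K11 K21 K22 c det nf w0] by blast
  obtain r W N where r: "r \<le> m" and W: "W \<in> carrier_mat m m" "ct W * W = 1\<^sub>m m"
    and N: "N \<in> carrier_mat r r" "ct N = N" "det N \<noteq> 0"
    and WK: "ct W * K22 * W = four_block_mat (0\<^sub>m (m - r) (m - r)) (0\<^sub>m (m - r) r) (0\<^sub>m r (m - r)) N"
    using hermitian_split_kernel[OF K22] by blast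
  define p where "p = m - r"
  have m: "m = p + r" using r by (simp add: p_def)
  have WK': "ct W * K22 * W = dsum (0\<^sub>m p p) N" unfolding WK dsum_def using N by (simp add: p_def)
  have "ct X * ct K21 * W \<in> carrier_mat n (p + r)" using X W K21 by (auto simp: m intro!: carrier_matI)
  then obtain L K where L: "L \<in> carrier_mat n p" and K: "K \<in> carrier_mat n r" and LK: "ct X * ct K21 * W = hcat L K"
    using hcat_split by metis
  define S where "S = ct X * K11 * X"
  note dims = carrier_matD[OF J(1)] carrier_matD[OF K11(1)] carrier_matD[OF K21] carrier_matD[OF K22(1)]
    carrier_matD[OF X(1)] carrier_matD[OF W(1)] carrier_matD[OF N(1)] carrier_matD[OF L] carrier_matD[OF K]
  have S: "S \<in> carrier_mat n n" "ct S = S" using dims K11 by (auto simp: S_def ct_mult mat_ring intro!: carrier_matI)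
  let ?sg = "sign_mat ls"
  have sg: "?sg \<in> carrier_mat n n" using sign_mat_carrier[of ls] ls(1) by simp
  define dd where "dd = det (ct W) * det (ct X) * (det W * det X) * c"
  have "det (ct W) \<noteq> 0" "det W \<noteq> 0"
    using det_nonzero_left_inverse(1)[OF W(1) ct_carrier[OF W(1)] W(2)] by (auto simp: det_ct[OF W(1)])
  then have dd: "dd \<noteq> 0" using X c by (simp add: dd_def det_ct[OF X(1)])
  have detT: "det (four_block_mat (w \<cdot>\<^sub>m 1\<^sub>m m + dsum (0\<^sub>m p p) N) (ct (hcat L K)) (hcat L K) (y \<cdot>\<^sub>m ?sg + S)) = dd * Q y w" for y w
  proof -
    let ?B = "four_block_mat (w \<cdot>\<^sub>m 1\<^sub>m m + K22) K21 (ct K21) (y \<cdot>\<^sub>m J + K11)"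
    have B: "?B \<in> carrier_mat (m + n) (m + n)" using dims by (auto intro!: carrier_matI)
    have "dsum (ct W) (ct X) * ?B * dsum W X = four_block_mat (ct W * (w \<cdot>\<^sub>m 1\<^sub>m m + K22) * W) (ct W * K21 * X)
      (ct X * ct K21 * W) (ct X * (y \<cdot>\<^sub>m J + K11) * X)"
      using K22 K21 J K11 W X by (intro dsum_congruence) auto
    also have "ct W * (w \<cdot>\<^sub>m 1\<^sub>m m + K22) * W = w \<cdot>\<^sub>m (ct W * W) + ct W * K22 * W" using dims by (simp add: mat_ring)
    also have "\<dots> = w \<cdot>\<^sub>m 1\<^sub>m m + dsum (0\<^sub>m p p) N" unfolding W(2) WK' ..
    also have "ct W * K21 * X = ct (ct X * ct K21 * W)" using dims by (simp add: ct_mult mat_ring)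
    also have "ct X * (y \<cdot>\<^sub>m J + K11) * X = y \<cdot>\<^sub>m (ct X * J * X) + S" unfolding S_def using dims by (simp add: mat_ring)
    finally have e: "dsum (ct W) (ct X) * ?B * dsum W X =
      four_block_mat (w \<cdot>\<^sub>m 1\<^sub>m m + dsum (0\<^sub>m p p) N) (ct (hcat L K)) (hcat L K) (y \<cdot>\<^sub>m ?sg + S)"
      unfolding LK XJ .
    have "det (dsum (ct W) (ct X) * ?B * dsum W X) = det (dsum (ct W) (ct X)) * det ?B * det (dsum W X)"
      by (rule det_mult3[OF dsum_carrier[OF ct_carrier[OF W(1)] ct_carrier[OF X(1)]] B dsum_carrier[OF W(1) X(1)]])
    then show ?thesis
      unfolding e det det_dsum[OF ct_carrier[OF W(1)] ct_carrier[OF X(1)]] det_dsum[OF W(1) X(1)] by (simp add: dd_def mult_ac)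
  qed
  have "hermitian_rep (\<lambda>y z. poly (P y) z) (n + r) ls m"
    by (rule hermitian_rep_of_block[OF ls(1) L K N S m dd detT P top])
  moreover have "poly (P y) z0 = ((- z0) ^ m * k) * (\<Prod>l\<leftarrow>ls. y - l)" for y using P[OF z00] k(2) by simp
  moreover have "(- z0) ^ m * k \<noteq> 0" using z00 k(1) by simp
  ultimately show ?thesis using ls(2) by blast
qed

section \<open>Irreducible bivariate polynomials\<close>

definition emb :: "complex \<Rightarrow> real poly \<Rightarrow> complex" where
  "emb y b = poly (map_poly complex_of_real b) y"

interpretation emb: comm_ring_hom "emb y" for y
proof -
  interpret r: map_poly_comm_ring_hom complex_of_real by unfold_locales auto
  show "comm_ring_hom (emb y)"
    by unfold_locales (auto simp: emb_def r.hom_add r.hom_mult)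
qed

interpretation map_emb: map_poly_comm_ring_hom "emb y" for y ..

text \<open>The outer variable of a \<open>real poly poly\<close> is \<open>z\<close>, the inner one \<open>y\<close>.\<close>

definition ev2 :: "real poly poly \<Rightarrow> complex \<Rightarrow> complex \<Rightarrow> complex" where
  "ev2 q y z = poly (map_poly (emb y) q) z"

lemma ev2_mult: "ev2 (p * q) y z = ev2 p y z * ev2 q y z"
  by (simp add: ev2_def map_emb.hom_mult)

lemma ev2_add: "ev2 (p + q) y z = ev2 p y z + ev2 q y z"
  by (simp add: ev2_def map_emb.hom_add)

lemma ev2_const: "ev2 [:r:] y z = emb y r"
  by (cases "r = 0") (simp_all add: ev2_def map_poly_pCons emb_def)

lemma emb_pCons [simp]: "emb y (pCons c b) = of_real c + y * emb y b"
  by (cases "c = 0 \<and> b = 0") (auto simp: emb_def map_poly_pCons)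

lemma emb_zero [simp]: "emb y 0 = 0" by (simp add: emb_def)

lemma emb_real: "emb (of_real y) b = of_real (poly b y)"
  by (induction b) simp_all

lemma emb_eq_0_finite: "b \<noteq> 0 \<Longrightarrow> finite {y. emb y b = 0}"
  unfolding emb_def by (rule poly_roots_finite) (simp add: map_poly_eq_0_iff)

lemma poly_map_poly_altdef:
  assumes "f 0 = 0" "degree p \<le> n"
  shows "poly (map_poly f p) (x :: 'a :: comm_ring_1) = (\<Sum>k\<le>n. f (coeff p k) * x ^ k)"
proof -
  have "poly (map_poly f p) x = (\<Sum>k\<le>n. coeff (map_poly f p) k * x ^ k)"
    unfolding poly_altdef
  proof (intro sum.mono_neutral_left)
    show "{..degree (map_poly f p)} \<subseteq> {..n}" using assms(2) degree_map_poly_le[of f p] by auto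
    show "\<forall>k \<in> {..n} - {..degree (map_poly f p)}. coeff (map_poly f p) k * x ^ k = 0"
      using coeff_eq_0[of "map_poly f p"] by (simp del: coeff_map_poly)
  qed simp
  then show ?thesis using assms(1) by (simp add: coeff_map_poly)
qed

lemma ev2_altdef: "degree q \<le> m \<Longrightarrow> ev2 q y z = (\<Sum>k\<le>m. emb y (coeff q k) * z ^ k)"
  unfolding ev2_def by (rule poly_map_poly_altdef) simp_all

definition swap_poly :: "real poly poly \<Rightarrow> complex \<Rightarrow> complex poly" where
  "swap_poly q z = (\<Sum>k\<le>degree q. smult (z ^ k) (map_poly complex_of_real (coeff q k)))"

lemma poly_swap: "poly (swap_poly q z) y = ev2 q y z"
  by (simp add: swap_poly_def ev2_altdef[OF order.refl] poly_sum emb_def mult.commute)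

text \<open>Coprimality over \<open>\<real>(y)\<close> of an irreducible element and a nonmultiple, with denominators
  cleared.\<close>

lemma elimination:
  fixes q g :: "real poly poly"
  assumes irr: "irreducible q" and deg: "degree q > 0" and ndvd: "\<not> q dvd g"
  shows "\<exists>u v w. w \<noteq> 0 \<and> u * q + v * g = [:w:]"
proof -
  have prime: "prime_elem q" using irr by (rule irreducible_imp_prime_elem)
  define I where "I = {h. \<exists>u v. h = u * q + v * g}"
  have Isub: "smult c h1 - h2 * s \<in> I" if h: "h1 \<in> I" "h2 \<in> I" for h1 h2 s c
  proof -
    obtain u1 v1 u2 v2 where e: "h1 = u1 * q + v1 * g" "h2 = u2 * q + v2 * g" using h by (auto simp: I_def)
    have "smult c h1 - h2 * s = (smult c u1 - u2 * s) * q + (smult c v1 - v2 * s) * g"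
      unfolding e by (simp add: algebra_simps smult_add_right)
    then show ?thesis unfolding I_def by blast
  qed
  have qI: "q \<in> I" and gI: "g \<in> I" unfolding I_def by (auto intro: exI[of _ 1] exI[of _ 0])
  have q0: "q \<noteq> 0" using deg by auto
  \<comment> \<open>An element of least degree in the ideal generated by \<open>q\<close> and
    \<open>g\<close>. Pseudo-division shows that it divides every element up to a factor in the
    inner variable; if its degree were positive, primality of \<open>q\<close> would lead to a
    contradiction.\<close>
  obtain h where h: "h \<in> I" "h \<noteq> 0" and min: "\<And>h'. h' \<in> I \<Longrightarrow> h' \<noteq> 0 \<Longrightarrow> degree h \<le> degree h'"
    using ex_has_least_nat[of "\<lambda>h. h \<in> I \<and> h \<noteq> 0" q degree] qI q0 by auto
  show ?thesis
  proof (cases "degree h = 0")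
    case True
    then obtain w where w: "h = [:w:]" by (rule degree_eq_zeroE)
    then have "w \<noteq> 0" using h(2) by auto
    moreover obtain u v where "h = u * q + v * g" using h(1) by (auto simp: I_def)
    ultimately show ?thesis using w by metis
  next
    case False
    have dvd: "\<exists>c. c \<noteq> 0 \<and> h dvd [:c:] * f" if f: "f \<in> I" for f
    proof -
      obtain s r where sr: "pseudo_divmod f h = (s, r)" by (cases "pseudo_divmod f h")
      define c where "c = lead_coeff h ^ (Suc (degree f) - degree h)"
      have e: "smult c f = h * s + r" "r = 0 \<or> degree r < degree h"
        using pseudo_divmod[OF h(2) sr] by (auto simp: c_def)
      have "r = smult c f - h * s" using e(1) by simp
      then have "r \<in> I" using Isub[OF f h(1)] by simp
      then have "r = 0" using min[of r] e(2) by (metis not_le)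
      then have "[:c:] * f = h * s" using e(1) by simp
      moreover have "c \<noteq> 0" using h(2) by (simp add: c_def)
      ultimately show ?thesis by (metis dvd_triv_left)
    qed
    obtain c where c: "c \<noteq> 0" "h dvd [:c:] * q" using dvd[OF qI] by auto
    obtain c' where c': "c' \<noteq> 0" "h dvd [:c':] * g" using dvd[OF gI] by auto
    have nc: "\<not> q dvd [:c:]" if "c \<noteq> 0" for c
    proof
      assume "q dvd [:c:]"
      then have "degree q \<le> degree [:c:]" using that by (intro dvd_imp_degree_le) auto
      then show False using deg by simp
    qed
    obtain s where s: "[:c:] * q = h * s" using c(2) by (auto simp: dvd_def)
    then have "q dvd h * s" by (metis dvd_triv_right)
    then consider "q dvd h" | "q dvd s" using prime by (auto simp: prime_elem_dvd_mult_iff)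
    then show ?thesis
    proof cases
      case 1
      then have "q dvd [:c':] * g" using c'(2) by (rule dvd_trans)
      then have "q dvd [:c':] \<or> q dvd g" using prime by (simp only: prime_elem_dvd_mult_iff)
      then show ?thesis using nc[OF c'(1)] ndvd by blast
    next
      case 2
      then obtain s' where "s = q * s'" by (auto simp: dvd_def)
      then have "q * [:c:] = q * (h * s')" using s by (simp only: mult_ac)
      then have e: "[:c:] = h * s'" using q0 by (simp only: mult_cancel_left) simp
      then have "s' \<noteq> 0" using c(1) by auto
      then have "degree [:c:] = degree h + degree s'" unfolding e using h(2) by (intro degree_mult_eq) auto
      then show ?thesis using False by simp
    qed
  qed
qed

section \<open>Generic fibres in both directions\<close>

definition y_primitive :: "real poly poly \<Rightarrow> bool" where
  "y_primitive q \<longleftrightarrow> (\<forall>d. [:d:] dvd q \<longrightarrow> is_unit d)"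

text \<open>The real polynomials that vanish at the complex point \<open>y\<close> form an ideal,
  generated by a nonzero member of least degree.\<close>

lemma common_root_imp_common_factor:
  fixes B :: "real poly set"
  assumes "\<And>b. b \<in> B \<Longrightarrow> emb y b = 0" "\<exists>b \<in> B. b \<noteq> 0"
  shows "\<exists>d. \<not> is_unit d \<and> emb y d = 0 \<and> d \<noteq> 0 \<and> (\<forall>b \<in> B. d dvd b)"
proof -
  define I where "I = {b. emb y b = 0}"
  obtain b0 where b0: "b0 \<in> B" "b0 \<noteq> 0" using assms(2) by auto
  have "b0 \<in> I" using assms(1) b0 by (simp add: I_def)
  then obtain d where d: "d \<in> I" "d \<noteq> 0" and min: "\<And>b. b \<in> I \<Longrightarrow> b \<noteq> 0 \<Longrightarrow> degree d \<le> degree b"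
    using ex_has_least_nat[of "\<lambda>b. b \<in> I \<and> b \<noteq> 0" b0 degree] b0 by auto
  have "d dvd b" if "b \<in> B" for b
  proof -
    have "b = b div d * d + b mod d" by simp
    then have "emb y b = emb y (b div d) * emb y d + emb y (b mod d)" by (metis emb.hom_add emb.hom_mult)
    then have "b mod d \<in> I" using assms(1)[OF that] d(1) by (simp add: I_def)
    then have "b mod d = 0" using min[of "b mod d"] degree_mod_less[OF d(2), of b] by (metis not_le)
    then show ?thesis by auto
  qed
  moreover have "\<not> is_unit d"
  proof
    assume "is_unit d"
    then have "degree d = 0" by (simp add: is_unit_iff_degree d(2))
    then obtain c where "d = [:c:]" by (rule degree_eq_zeroE)
    then show False using d by (simp add: I_def)
  qed
  ultimately show ?thesis using d by (auto simp: I_def)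
qed

lemma y_primitive_fibre:
  assumes "y_primitive q" shows "\<exists>k. emb y (coeff q k) \<noteq> 0"
proof (rule ccontr)
  assume *: "\<not> (\<exists>k. emb y (coeff q k) \<noteq> 0)"
  have "q \<noteq> 0"
  proof
    assume "q = 0"
    then have "[:0:] dvd q" by simp
    then have "is_unit (0 :: real poly)" using assms unfolding y_primitive_def by blast
    then show False by simp
  qed
  then have "\<exists>b \<in> range (coeff q). b \<noteq> 0" by (auto simp: poly_eq_iff)
  then obtain d where "\<not> is_unit d" "\<forall>b \<in> range (coeff q). d dvd b"
    using common_root_imp_common_factor[of "range (coeff q)" y] * by auto
  then show False using assms by (auto simp: y_primitive_def const_poly_dvd_iff)
qed

lemma y_primitive_irreducible:
  assumes "irreducible q" "degree q > 0" shows "y_primitive q"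
  unfolding y_primitive_def
proof (intro allI impI)
  fix d assume "[:d:] dvd q"
  then obtain q' where q': "q = [:d:] * q'" by (auto simp: dvd_def)
  from irreducibleD[OF assms(1) this] consider "is_unit [:d:]" | "is_unit q'" by blast
  then show "is_unit d"
  proof cases
    case 1
    then show ?thesis by (simp add: is_unit_const_poly_iff)
  next
    case 2
    then have "degree q' = 0" by (auto simp: is_unit_poly_iff)
    then have "degree q = 0" using degree_mult_le[of "[:d:]" q'] q' by simp
    then show ?thesis using assms(2) by simp
  qed
qed

lemma finite_fibre: "y_primitive q \<Longrightarrow> finite {z. ev2 q y z = 0}"
proof -
  assume "y_primitive q"
  then obtain k where "coeff (map_poly (emb y) q) k \<noteq> 0" using y_primitive_fibre[of q y] by (auto simp: coeff_map_poly)
  then have "map_poly (emb y) q \<noteq> 0" by (metis coeff_0)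
  then show ?thesis unfolding ev2_def by (rule poly_roots_finite)
qed

lemma card_roots_rsquarefree:
  fixes p :: "complex poly"
  assumes "p \<noteq> 0" "\<And>z. poly p z = 0 \<Longrightarrow> poly (pderiv p) z \<noteq> 0"
  shows "card {z. poly p z = 0} = degree p"
proof -
  have "rsquarefree p" using assms(2) by (auto simp: rsquarefree_roots)
  from complex_poly_decompose_rsquarefree[OF this]
  have e: "smult (lead_coeff p) (\<Prod>z | poly p z = 0. [:- z, 1:]) = p" .
  have "degree p = degree (\<Prod>z | poly p z = 0. [:- z, 1:])"
    using assms(1) by (subst e[symmetric]) simp
  then show ?thesis using degree_prod_roots[OF poly_roots_finite[OF assms(1)]] by simp
qed

lemma emb_of_nat: "emb y (of_nat n) = of_nat n"
  by (induction n) (simp_all add: emb.hom_add)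

lemma ev2_pderiv: "ev2 (pderiv q) y z = poly (pderiv (map_poly (emb y) q)) z"
proof -
  have "map_poly (emb y) (pderiv q) = pderiv (map_poly (emb y) q)"
    by (rule poly_eqI) (simp add: coeff_map_poly coeff_pderiv emb.hom_mult emb_of_nat del: of_nat_Suc)
  then show ?thesis by (simp add: ev2_def)
qed

text \<open>By degree, \<open>q\<close> does not divide its derivative in \<open>z\<close>, so
  elimination gives a nonzero \<open>w\<close> in \<open>y\<close> alone. Off the zeros of
  \<open>w\<close> and of the leading coefficient, a fibre has full degree and simple roots.\<close>

lemma generic_fibre:
  fixes q :: "real poly poly"
  assumes irr: "irreducible q" and deg: "degree q > 0"
  shows "\<forall>\<^sub>\<infinity>y :: real. degree (map_poly (emb (of_real y)) q) = degree q \<and> card {z. ev2 q (of_real y) z = 0} = degree q"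
proof -
  have "pderiv q \<noteq> 0" using deg by (simp add: pderiv_eq_0_iff)
  then have "\<not> q dvd pderiv q" using deg dvd_imp_degree_le[of q "pderiv q"] by (auto simp: degree_pderiv)
  from elimination[OF irr deg this] obtain u v w where w: "w \<noteq> 0" and e: "u * q + v * pderiv q = [:w:]" by blast
  have "finite {y. emb y (w * lead_coeff q) = 0}" using w deg by (intro emb_eq_0_finite) auto
  then have "finite (complex_of_real -` {y. emb y (w * lead_coeff q) = 0})"
    by (intro finite_vimageI) (auto simp: inj_on_def)
  then have "\<forall>\<^sub>\<infinity>y :: real. emb (of_real y) (w * lead_coeff q) \<noteq> 0" by (simp add: eventually_cofinite vimage_def)
  then show ?thesis
  proof eventually_elim
    case (elim y)
    let ?y = "complex_of_real y" let ?p = "map_poly (emb ?y) q"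
    have nz: "emb ?y w \<noteq> 0" "emb ?y (lead_coeff q) \<noteq> 0" using elim by (auto simp: emb.hom_mult)
    then have "coeff ?p (degree q) \<noteq> 0" by (simp add: coeff_map_poly)
    then have d: "degree ?p = degree q" using le_degree[of ?p "degree q"] degree_map_poly_le[of "emb ?y" q] by simp
    have "card {z. poly ?p z = 0} = degree ?p"
    proof (rule card_roots_rsquarefree)
      show "?p \<noteq> 0" using d deg by auto
      fix z assume z: "poly ?p z = 0"
      have "ev2 u ?y z * ev2 q ?y z + ev2 v ?y z * ev2 (pderiv q) ?y z = emb ?y w"
        using arg_cong[OF e, of "\<lambda>p. ev2 p ?y z"] by (simp only: ev2_add ev2_mult ev2_const)
      then show "poly (pderiv ?p) z \<noteq> 0" using z nz(1) by (auto simp: ev2_pderiv) (simp add: ev2_def)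
    qed
    then show ?case using d by (simp add: ev2_def)
  qed
qed

definition ydeg :: "real poly poly \<Rightarrow> nat" where
  "ydeg q = Max ((\<lambda>k. degree (coeff q k)) ` {..degree q})"

lemma degree_coeff_le_ydeg: "degree (coeff q k) \<le> ydeg q"
proof (cases "k \<le> degree q")
  case True
  then show ?thesis unfolding ydeg_def by (intro Max_ge) auto
qed (simp add: coeff_eq_0)

lemma degree_swap_poly_le: "degree (swap_poly q z) \<le> ydeg q"
  unfolding swap_poly_def
proof (intro degree_sum_le)
  fix k
  have "degree (smult (z ^ k) (map_poly complex_of_real (coeff q k))) \<le> degree (coeff q k)"
    by (meson degree_map_poly_le degree_smult_le order_trans)
  then show "degree (smult (z ^ k) (map_poly complex_of_real (coeff q k))) \<le> ydeg q"
    using degree_coeff_le_ydeg[of q k] by linarith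
qed simp

text \<open>\<open>p\<close> is the coefficient of the highest occurring power of \<open>y\<close>,
  viewed as a polynomial in \<open>z\<close>.\<close>

lemma swap_poly_degree_generic:
  assumes q0: "q \<noteq> 0"
  obtains p :: "complex poly" where "p \<noteq> 0"
    "\<And>z. poly p z \<noteq> 0 \<Longrightarrow> degree (swap_poly q z) = ydeg q \<and> swap_poly q z \<noteq> 0"
proof -
  let ?n = "ydeg q"
  have "?n \<in> (\<lambda>k. degree (coeff q k)) ` {..degree q}" unfolding ydeg_def by (rule Max_in) auto
  then obtain k0 where k0: "degree (coeff q k0) = ?n" "k0 \<le> degree q" by auto
  obtain k1 where k1: "coeff (coeff q k1) ?n \<noteq> 0"
  proof (cases "coeff q k0 = 0")
    case False
    then show ?thesis using that[of k0] k0(1) by (metis leading_coeff_0_iff)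
  next
    case True
    \<comment> \<open>The zero coefficient has degree 0 and may attain the maximum. Then all
      coefficients are constants, and the leading one takes its place.\<close>
    then have n0: "?n = 0" using k0(1) by simp
    have "degree (lead_coeff q) = 0" using degree_coeff_le_ydeg[of q "degree q"] n0 by simp
    then show ?thesis using that[of "degree q"] q0 n0 by (metis leading_coeff_0_iff)
  qed
  define p where "p = (\<Sum>k\<le>degree q. monom (complex_of_real (coeff (coeff q k) ?n)) k)"
  have cp: "poly p z = coeff (swap_poly q z) ?n" for z
    by (simp add: p_def poly_sum poly_monom swap_poly_def coeff_sum coeff_map_poly mult.commute)
  have "k1 \<le> degree q" using k1 by (metis coeff_0 coeff_eq_0 not_le)
  then have "coeff p k1 = of_real (coeff (coeff q k1) ?n)" by (simp add: p_def coeff_sum)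
  then have "coeff p k1 \<noteq> 0" using k1 by simp
  then have p0: "p \<noteq> 0" by auto
  have dS: "degree (swap_poly q z) = ?n" "swap_poly q z \<noteq> 0" if "poly p z \<noteq> 0" for z
  proof -
    show "degree (swap_poly q z) = ?n" using that degree_swap_poly_le[of q z] le_degree[of "swap_poly q z" ?n] by (simp add: cp)
    show "swap_poly q z \<noteq> 0" using that by (auto simp: cp)
  qed
  show thesis using that[OF p0] dS by blast
qed

lemma pderiv_map_of_real: "pderiv (map_poly complex_of_real b) = map_poly complex_of_real (pderiv b)"
  by (rule poly_eqI) (simp add: coeff_pderiv coeff_map_poly)

text \<open>Elimination against the derivative \<open>g\<close> in \<open>y\<close> still produces a
  \<open>w\<close> that depends on \<open>y\<close>. A multiple root at level \<open>t\<close>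
  therefore lies over a zero of \<open>w\<close>; primitivity makes the fibres over these finitely
  many points finite, so finitely many levels are excluded.\<close>

lemma generic_horizontal:
  fixes q :: "real poly poly"
  assumes irr: "irreducible q" and deg: "degree q > 0"
  shows "\<exists>t :: real. degree (swap_poly q (of_real t)) = ydeg q \<and> card {y. ev2 q y (of_real t) = 0} = ydeg q \<and>
    swap_poly q (of_real t) \<noteq> 0"
proof -
  have q0: "q \<noteq> 0" using deg by auto
  have yp: "y_primitive q" by (rule y_primitive_irreducible[OF irr deg])
  let ?n = "ydeg q"
  obtain p where p0: "p \<noteq> 0" and dS': "\<And>z. poly p z \<noteq> 0 \<Longrightarrow> degree (swap_poly q z) = ?n \<and> swap_poly q z \<noteq> 0"
    using swap_poly_degree_generic[OF q0] by blast
  have dS: "degree (swap_poly q z) = ?n" "swap_poly q z \<noteq> 0" if "poly p z \<noteq> 0" for z using dS'[OF that] by auto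
  define g where "g = map_poly pderiv q"
  have ps: "poly (pderiv (swap_poly q z)) y = ev2 g y z" for y z
  proof -
    have "degree g \<le> degree q" unfolding g_def by (rule degree_map_poly_le)
    then have "ev2 g y z = (\<Sum>k\<le>degree q. emb y (pderiv (coeff q k)) * z ^ k)"
      by (subst ev2_altdef) (auto simp: g_def coeff_map_poly)
    moreover have "pderiv (swap_poly q z) = (\<Sum>k\<le>degree q. smult (z ^ k) (map_poly complex_of_real (pderiv (coeff q k))))"
      unfolding swap_poly_def by (simp add: pderiv_sum pderiv_smult pderiv_map_of_real)
    ultimately show ?thesis by (simp add: poly_sum emb_def mult.commute)
  qed
  show ?thesis
  proof (cases "g = 0")
    case True
    have "\<forall>\<^sub>\<infinity>t :: real. poly p (of_real t) \<noteq> 0" by (rule MOST_poly_nonzero[OF p0])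
    then obtain t :: real where t: "poly p (of_real t) \<noteq> 0" using MOST_real_nonempty by blast
    have c: "degree (coeff q k) = 0" for k
    proof -
      have "coeff g k = 0" using True by simp
      then show ?thesis by (simp add: g_def coeff_map_poly pderiv_eq_0_iff)
    qed
    then have n0: "?n = 0" by (simp add: ydeg_def)
    then obtain d where d: "swap_poly q (of_real t) = [:d:]" using dS[OF t] by (metis degree_eq_zeroE)
    then have "{y. ev2 q y (of_real t) = 0} = {}" using dS(2)[OF t] by (auto simp: poly_swap[symmetric])
    then show ?thesis using dS(1,2)[OF t] n0 by (intro exI[of _ t]) simp
  next
    case g0: False
    \<comment> \<open>Comparing degrees in \<open>z\<close>, the cofactor would be some
      \<open>s0\<close> in \<open>y\<close> alone; but the derivative of a nonconstant coefficient
      is not a multiple of that coefficient, as its degree is smaller.\<close>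
    have "\<not> q dvd g"
    proof
      assume "q dvd g"
      then obtain s where s: "g = q * s" by (auto simp: dvd_def)
      then have "s \<noteq> 0" using g0 by auto
      then have "degree g = degree q + degree s" using q0 s by (simp add: degree_mult_eq)
      moreover have "degree g \<le> degree q" unfolding g_def by (rule degree_map_poly_le)
      ultimately have "degree s = 0" by simp
      then obtain s0 where s0: "s = [:s0:]" by (rule degree_eq_zeroE)
      have "coeff g k = 0" for k
      proof (rule ccontr)
        assume nz: "coeff g k \<noteq> 0"
        have e: "pderiv (coeff q k) = coeff q k * s0" using arg_cong[OF s, of "\<lambda>p. coeff p k"] s0
          by (simp add: g_def coeff_map_poly mult.commute)
        then have "coeff q k \<noteq> 0" "s0 \<noteq> 0" using nz by (auto simp: g_def coeff_map_poly)
        then have "degree (pderiv (coeff q k)) \<ge> degree (coeff q k)" unfolding e by (simp add: degree_mult_eq)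
        then have "degree (coeff q k) = 0" by (simp add: degree_pderiv)
        then have "pderiv (coeff q k) = 0" by (simp add: pderiv_eq_0_iff)
        then show False using nz by (simp add: g_def coeff_map_poly)
      qed
      then show False using g0 by (simp add: poly_eq_iff)
    qed
    from elimination[OF irr deg this] obtain u v w where w: "w \<noteq> 0" and e: "u * q + v * g = [:w:]" by blast
    define bad where "bad = (\<Union>y \<in> {y. emb y w = 0}. {z. ev2 q y z = 0})"
    have "finite bad" unfolding bad_def using emb_eq_0_finite[OF w] finite_fibre[OF yp] by auto
    then have "finite (complex_of_real -` bad)" by (intro finite_vimageI) (auto simp: inj_on_def)
    then have "\<forall>\<^sub>\<infinity>t :: real. of_real t \<notin> bad" by (simp add: eventually_cofinite vimage_def)
    then have "\<forall>\<^sub>\<infinity>t :: real. of_real t \<notin> bad \<and> poly p (of_real t) \<noteq> 0"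
      using MOST_poly_nonzero[OF p0] by eventually_elim auto
    then obtain t :: real where t: "of_real t \<notin> bad" "poly p (of_real t) \<noteq> 0" using MOST_real_nonempty by blast
    have "card {y. poly (swap_poly q (of_real t)) y = 0} = degree (swap_poly q (of_real t))"
    proof (rule card_roots_rsquarefree[OF dS(2)[OF t(2)]])
      fix y assume y: "poly (swap_poly q (of_real t)) y = 0"
      have "ev2 u y (of_real t) * ev2 q y (of_real t) + ev2 v y (of_real t) * ev2 g y (of_real t) = emb y w"
        using arg_cong[OF e, of "\<lambda>p. ev2 p y (of_real t)"] by (simp only: ev2_add ev2_mult ev2_const)
      moreover have "emb y w \<noteq> 0" using t(1) y by (auto simp: bad_def poly_swap)
      ultimately show "poly (pderiv (swap_poly q (of_real t))) y \<noteq> 0" using y by (auto simp: ps poly_swap)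
    qed
    then show ?thesis using dS(1,2)[OF t(2)] by (auto simp: poly_swap)
  qed
qed

lemma ev2_pCons: "ev2 (pCons a p) y z = emb y a + z * ev2 p y z"
  by (cases "a = 0 \<and> p = 0") (auto simp: ev2_def map_poly_pCons)

lemma ev2_translate: "ev2 (pcompose q [:[:t:], 1:]) y z = ev2 q y (z + of_real t)"
proof (induction q)
  case 0
  show ?case by (simp add: ev2_def)
next
  case (pCons a p)
  have "ev2 [:[:t:], 1:] y z = of_real t + z" by (simp add: ev2_pCons) (simp add: ev2_def)
  then show ?case by (simp only: pcompose_pCons ev2_add ev2_mult ev2_const ev2_pCons pCons.IH) (simp add: algebra_simps)
qed

lemma degree_coeff_translate:
  assumes "\<And>k. degree (coeff q k) \<le> n"
  shows "degree (coeff (pcompose q [:[:t:], 1:]) k) \<le> (n :: nat)"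
  using assms
proof (induction q arbitrary: k)
  case (pCons a p)
  have p: "degree (coeff p k) \<le> n" for k using pCons.prems[of "Suc k"] by simp
  have a: "degree a \<le> n" using pCons.prems[of 0] by simp
  note IH = pCons.IH[OF p]
  let ?X = "pcompose p [:[:t:], 1:]"
  have "coeff (pcompose (pCons a p) [:[:t:], 1:]) k = coeff [:a:] k + smult t (coeff ?X k) + coeff (pCons 0 ?X) k"
    by (simp add: pcompose_pCons add.assoc)
  moreover have "degree (coeff [:a:] k) \<le> n" using a by (cases k) (simp_all add: coeff_pCons split: nat.split)
  moreover have "degree (smult t (coeff ?X k)) \<le> n" using IH degree_smult_le le_trans by blast
  moreover have "degree (coeff (pCons 0 ?X) k) \<le> n" using IH by (cases k) simp_all
  ultimately show ?case by (simp only: degree_add_le)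
qed simp

text \<open>A real shift of \<open>z\<close> is absorbed into the constant matrix, which stays
  Hermitian; the other data are unchanged.\<close>

lemma hermitian_rep_translate:
  assumes "hermitian_rep f D ls m"
  shows "hermitian_rep (\<lambda>y z. f y (z - complex_of_real t)) D ls m"
proof -
  obtain A0 Y1 Y2 X1 X2 c where A0: "A0 \<in> carrier_mat D D" "ct A0 = A0"
    and Y1: "Y1 \<in> carrier_mat (length ls) D" "X1 \<in> carrier_mat D (length ls)" "Y1 * X1 = 1\<^sub>m (length ls)"
    and Y2: "Y2 \<in> carrier_mat m D" "X2 \<in> carrier_mat D m" "Y2 * X2 = 1\<^sub>m m"
    and one: "ct Y1 * Y1 + ct Y2 * Y2 = 1\<^sub>m D"
    and f: "\<And>y z. f y z = c * det (A0 + y \<cdot>\<^sub>m (ct Y1 * sign_mat ls * Y1) + z \<cdot>\<^sub>m (ct Y2 * Y2))"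
    and e: "\<forall>\<^sub>\<infinity>e :: real. det (ct Y1 * sign_mat ls * Y1 + of_real e \<cdot>\<^sub>m (ct Y2 * Y2)) \<noteq> 0"
    using assms unfolding hermitian_rep_def by blast
  define A1 where "A1 = ct Y1 * sign_mat ls * Y1"
  define A2 where "A2 = ct Y2 * Y2"
  have c: "A1 \<in> carrier_mat D D" "A2 \<in> carrier_mat D D" "ct A2 = A2"
    using Y1 Y2 by (auto simp: A1_def A2_def ct_mult intro!: carrier_matI)
  define B where "B = A0 + (- of_real t) \<cdot>\<^sub>m A2"
  have B: "B \<in> carrier_mat D D" "ct B = B" using A0 c by (auto simp: B_def ct_add ct_smult)
  have "f y (z - of_real t) = c * det (B + y \<cdot>\<^sub>m A1 + z \<cdot>\<^sub>m A2)" for y z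
  proof -
    have "A0 + y \<cdot>\<^sub>m A1 + (z - of_real t) \<cdot>\<^sub>m A2 = B + y \<cdot>\<^sub>m A1 + z \<cdot>\<^sub>m A2"
      unfolding B_def using A0 c by (intro eq_matI) (auto simp: algebra_simps)
    then show ?thesis by (simp add: f A1_def A2_def)
  qed
  then show ?thesis unfolding hermitian_rep_def using B Y1 Y2 one e unfolding A1_def A2_def by blast
qed

theorem hermitian_rep_irreducible:
  fixes q :: "real poly poly"
  assumes irr: "irreducible q" and deg: "degree q > 0"
    and hyp: "\<forall>\<^sub>\<infinity>y :: real. \<forall>z. ev2 q (of_real y) z = 0 \<longrightarrow> Im z = 0"
  shows "\<exists>ls D k. (\<forall>l \<in> set ls. Im l \<noteq> 0) \<and> hermitian_rep (ev2 q) D ls (degree q) \<and>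
    k \<noteq> 0 \<and> (\<forall>y. ev2 q y \<i> = k * (\<Prod>l\<leftarrow>ls. y - l))"
proof -
  define m where "m = degree q"
  define n where "n = ydeg q"
  have m0: "m > 0" using deg by (simp add: m_def)
  have yp: "y_primitive q" by (rule y_primitive_irreducible[OF irr deg])
  obtain t :: real where t: "degree (swap_poly q (of_real t)) = n" "card {y. ev2 q y (of_real t) = 0} = n"
    "swap_poly q (of_real t) \<noteq> 0"
    using generic_horizontal[OF irr deg] unfolding n_def by blast
  define s where "s = pcompose q [:[:t:], 1:]"
  have es: "ev2 s y z = ev2 q y (z + of_real t)" for y z unfolding s_def by (rule ev2_translate)
  have ds: "degree s = m" by (simp add: s_def degree_pcompose m_def)
  have ls: "coeff s m = lead_coeff q" using lead_coeff_comp[of "[:[:t:], 1:]" q] ds by (simp add: s_def)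
  have dsn: "degree (coeff s k) \<le> n" for k unfolding s_def n_def by (rule degree_coeff_translate[OF degree_coeff_le_ydeg])
  \<comment> \<open>Coefficients in reversed order and with signs, as dictated by
    \<open>ev2 s y z = (- z) ^ m * Q y (- 1 / z)\<close>.\<close>
  define b where "b k = smult ((-1) ^ (m - k)) (map_poly complex_of_real (coeff s (m - k)))" for k
  have pb: "poly (b k) y = (-1) ^ (m - k) * emb y (coeff s (m - k))" for k y by (simp add: b_def emb_def)
  define Q where "Q y w = (\<Sum>k\<le>m. poly (b k) y * w ^ k)" for y w
  have PQ: "ev2 s y z = (- z) ^ m * Q y (- 1 / z)" if z: "z \<noteq> 0" for y z
  proof -
    have "(- z) ^ m * Q y (- 1 / z) = (\<Sum>k\<le>m. (- z) ^ m * ((-1) ^ (m - k) * emb y (coeff s (m - k)) * (- 1 / z) ^ k))"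
      by (simp add: Q_def pb sum_distrib_left)
    also have "\<dots> = (\<Sum>j\<le>m. emb y (coeff s j) * z ^ j)"
    proof (rule sum.reindex_bij_witness[of _ "\<lambda>j. m - j" "\<lambda>j. m - j"])
      fix k assume "k \<in> {..m}"
      then have "(- z) ^ m = (- z) ^ (m - k) * (- z) ^ k" by (simp flip: power_add)
      moreover have "(- z) ^ k * (- 1 / z) ^ k = 1" using z by (simp flip: power_mult_distrib)
      moreover have "(- z) ^ (m - k) * (-1) ^ (m - k) = z ^ (m - k)" by (simp flip: power_mult_distrib)
      ultimately show "emb y (coeff s (m - k)) * z ^ (m - k) = (- z) ^ m * ((-1) ^ (m - k) * emb y (coeff s (m - k)) * (- 1 / z) ^ k)"
        by (simp add: mult_ac) (metis (no_types, lifting) mult.commute mult.left_commute mult.right_neutral)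
    qed auto
    also have "\<dots> = ev2 s y z" using ds by (subst ev2_altdef[of s m]) auto
    finally show ?thesis by simp
  qed
  \<comment> \<open>The top coefficient in \<open>w\<close> is \<open>s\<close> at 0, that is,
    \<open>q\<close> at level \<open>t\<close>; the choice of \<open>t\<close> gives it maximal
    degree and simple zeros.\<close>
  have bm: "b m = swap_poly q (of_real t)"
  proof (rule poly_eqI_MOST, rule always_eventually, rule allI)
    fix y :: real
    have "poly (b m) (of_real y) = ev2 s (of_real y) 0" by (simp add: pb ev2_def poly_0_coeff_0 coeff_map_poly)
    then show "poly (b m) (of_real y) = poly (swap_poly q (of_real t)) (of_real y)" by (simp add: poly_swap es)
  qed
  interpret hf: hyperbolic_family b m n
  proof
    show "m > 0" by (rule m0)
    show "cnj (poly (b k) (of_real y)) = poly (b k) (of_real y)" for k and y :: real by (simp add: pb emb_real)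
    show "degree (b k) \<le> n" for k
      unfolding b_def using dsn[of "m - k"] degree_map_poly_le[of complex_of_real "coeff s (m - k)"]
      by (meson degree_smult_le le_trans)
    show "degree (b m) = n" using t(1) by (simp add: bm)
    show "card {z. poly (b m) z = 0} = n" using t(2) by (simp add: bm poly_swap)
    have "b m \<noteq> 0" using t(3) by (simp add: bm)
    show "\<forall>\<^sub>\<infinity>y :: real. poly (b m) (of_real y) \<noteq> 0 \<and> (\<exists>ws :: real list. distinct ws \<and> length ws = m \<and>
        (\<forall>w \<in> set ws. (\<Sum>k\<le>m. poly (b k) (of_real y) * of_real w ^ k) = 0))"
      using generic_fibre[OF irr deg] hyp MOST_poly_nonzero[OF \<open>b m \<noteq> 0\<close>]
    proof eventually_elim
      case (elim y)
      let ?S = "{z. ev2 q (of_real y) z = 0}"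
      have fin: "finite ?S" by (rule finite_fibre[OF yp])
      have re: "z = of_real (Re z)" if "z \<in> ?S" for z proof -
        have "Im z = 0" using elim(2) that by blast
        then show ?thesis by (intro complex_eqI) simp_all
      qed
      have inj: "inj_on Re ?S"
      proof (rule inj_onI)
        fix x y assume xy: "x \<in> ?S" "y \<in> ?S" "Re x = Re y"
        show "x = y" by (subst re[OF xy(1)], subst re[OF xy(2)]) (simp add: xy(3))
      qed
      define zs where "zs = sorted_list_of_set (Re ` ?S)"
      have zs: "distinct zs" "length zs = m" "set zs = Re ` ?S"
        using fin inj elim(1) by (simp_all add: zs_def card_image m_def)
      \<comment> \<open>A root at \<open>t\<close> would be sent to infinity by the substitution; it
        is excluded because \<open>b m\<close> does not vanish at \<open>y\<close>.\<close>
      have nt: "x \<noteq> t" and root: "ev2 q (of_real y) (of_real x) = 0" if "x \<in> set zs" for x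
      proof -
        from that obtain z where z: "z \<in> ?S" "x = Re z" unfolding zs(3) by auto
        then show r: "ev2 q (of_real y) (of_real x) = 0" using re[OF z(1)] by auto
        show "x \<noteq> t" using elim(3) r by (auto simp: bm poly_swap)
      qed
      define ws where "ws = map (\<lambda>x. - 1 / (x - t)) zs"
      have "inj_on (\<lambda>x. - 1 / (x - t)) (set zs)"
        using nt by (auto simp: inj_on_def field_simps)
      then have "distinct ws" using zs(1) by (simp add: ws_def distinct_map)
      moreover have "(\<Sum>k\<le>m. poly (b k) (of_real y) * of_real w ^ k) = 0" if "w \<in> set ws" for w
      proof -
        from that obtain x where x: "x \<in> set zs" "w = - 1 / (x - t)" by (auto simp: ws_def)
        define z where "z = complex_of_real (x - t)"
        have z0: "z \<noteq> 0" using nt[OF x(1)] by (simp add: z_def)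
        have "ev2 s (of_real y) z = 0" using root[OF x(1)] by (simp add: es z_def)
        then have "Q (of_real y) (- 1 / z) = 0" using PQ[OF z0] z0 by simp
        then show ?thesis by (simp add: Q_def x(2) z_def)
      qed
      ultimately show ?case using elim(3) zs(2) by (intro conjI exI[of _ ws]) (auto simp: ws_def)
    qed
  qed
  have hq: "hf.q = Q" by (intro ext) (simp add: hf.q_def Q_def)
  obtain J K11 K21 K22 c where J: "J \<in> carrier_mat n n" "ct J = J" "det J \<noteq> 0" and K11: "K11 \<in> carrier_mat n n" "ct K11 = K11"
    and K21: "K21 \<in> carrier_mat m n" and K22: "K22 \<in> carrier_mat m m" "ct K22 = K22" and c: "c \<noteq> 0"
    and det: "\<And>y w. det (four_block_mat (w \<cdot>\<^sub>m 1\<^sub>m m + K22) K21 (ct K21) (y \<cdot>\<^sub>m J + K11)) = c * Q y w"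
    using hf.realization unfolding hq by blast
  define P where "P y = map_poly (emb y) s" for y
  have pP: "poly (P y) z = ev2 s y z" for y z by (simp add: P_def ev2_def)
  have P: "poly (P y) z = (- z) ^ m * Q y (- 1 / z)" if "z \<noteq> 0" for y z unfolding pP by (rule PQ[OF that])
  \<comment> \<open>Primitivity makes every fibre finite, so some point other than \<open>t\<close>
    avoids it.\<close>
  have nf: "\<exists>w. Q y w \<noteq> 0" for y
  proof -
    have "finite (insert (of_real t) {z. ev2 q y z = 0})" using finite_fibre[OF yp] by simp
    then have "\<exists>z. z \<notin> insert (of_real t) {z. ev2 q y z = 0}"
      using ex_new_if_finite infinite_UNIV_char_0 by blast
    then obtain z where "z \<noteq> of_real t" "ev2 q y z \<noteq> 0" by auto
    then have "ev2 s y (z - of_real t) \<noteq> 0" "z - of_real t \<noteq> 0" by (simp_all add: es)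
    then show ?thesis using PQ[of "z - of_real t" y] by auto
  qed
  \<comment> \<open>\<open>Q y 0\<close> is, up to sign, the leading coefficient of \<open>q\<close>
    in \<open>z\<close>.\<close>
  have top: "\<exists>y. Q y 0 \<noteq> 0"
  proof -
    have "lead_coeff q \<noteq> 0" using deg by auto
    then have "\<exists>y. y \<notin> {y. emb y (lead_coeff q) = 0}"
      using ex_new_if_finite[OF infinite_UNIV_char_0 emb_eq_0_finite] by blast
    then obtain y where "emb y (lead_coeff q) \<noteq> 0" by auto
    moreover have "Q y 0 = poly (b 0) y" unfolding Q_def by (subst sum.remove[of _ 0]) (auto simp: power_0_left)
    ultimately show ?thesis by (intro exI[of _ y]) (simp add: pb ls)
  qed
  have z0: "Im (\<i> - of_real t) > 0" by simp
  obtain ls D k where r: "\<forall>l \<in> set ls. Im l \<noteq> 0" "hermitian_rep (\<lambda>y z. poly (P y) z) D ls m" "k \<noteq> 0"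
    "\<forall>y. poly (P y) (\<i> - of_real t) = k * (\<Prod>l\<leftarrow>ls. y - l)"
    using hermitian_rep_of_realization[OF J K11 K21 K22 c det P nf top z0] by blast
  have "(\<lambda>y z. poly (P y) (z - of_real t)) = ev2 q" by (intro ext) (simp add: pP es)
  then have "hermitian_rep (ev2 q) D ls m" using hermitian_rep_translate[OF r(2), of t] by simp
  moreover have "ev2 q y \<i> = k * (\<Prod>l\<leftarrow>ls. y - l)" for y using r(4) by (simp add: pP es)
  ultimately show ?thesis using r(1,3) unfolding m_def by blast
qed

lemma hermitian_rep_const:
  assumes "\<And>y z. f y z = c" shows "hermitian_rep f 0 [] 0"
  unfolding hermitian_rep_def
proof (intro exI[of _ "0\<^sub>m 0 0"] exI[of _ c] conjI allI)
  show "f y z = c * det (0\<^sub>m 0 0 + y \<cdot>\<^sub>m (ct (0\<^sub>m 0 0) * sign_mat [] * 0\<^sub>m 0 0) + z \<cdot>\<^sub>m (ct (0\<^sub>m 0 0) * 0\<^sub>m 0 0))" for y z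
    by (subst det_dim_zero) (auto simp: assms intro!: carrier_matI)
  show "\<forall>\<^sub>\<infinity>e :: real. det (ct (0\<^sub>m 0 0) * sign_mat [] * 0\<^sub>m 0 0 + of_real e \<cdot>\<^sub>m (ct (0\<^sub>m 0 0) * 0\<^sub>m 0 0)) \<noteq> 0"
    by (subst det_dim_zero) (auto intro!: carrier_matI)
qed (auto intro!: carrier_matI eq_matI)

lemma y_primitive_dvd: "y_primitive q \<Longrightarrow> a dvd q \<Longrightarrow> y_primitive a"
  by (auto simp: y_primitive_def intro: dvd_trans)

lemma y_primitive_nonzero: "y_primitive q \<Longrightarrow> q \<noteq> 0"
  using y_primitive_fibre[of q 0] by auto

text \<open>Primitivity forces every nonunit factor to have positive degree in \<open>z\<close>, so
  factoring lowers the degree and ends with irreducible polynomials or constants.\<close>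

theorem bivariate_hermitian_rep:
  fixes q :: "real poly poly"
  assumes "y_primitive q" and "\<forall>\<^sub>\<infinity>y :: real. \<forall>z. ev2 q (of_real y) z = 0 \<longrightarrow> Im z = 0"
  shows "\<exists>ls D k. (\<forall>l \<in> set ls. Im l \<noteq> 0) \<and> hermitian_rep (ev2 q) D ls (degree q) \<and>
    k \<noteq> 0 \<and> (\<forall>y. ev2 q y \<i> = k * (\<Prod>l\<leftarrow>ls. y - l))"
  using assms
proof (induction "degree q" arbitrary: q rule: less_induct)
  case less
  note yp = less.prems(1) and hyp = less.prems(2)
  have q0: "q \<noteq> 0" by (rule y_primitive_nonzero[OF yp])
  consider "degree q = 0" | "degree q > 0" "irreducible q" | "degree q > 0" "\<not> irreducible q" by blast
  then show ?case
  proof cases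
    case 1
    then obtain r where r: "q = [:r:]" by (rule degree_eq_zeroE)
    then have u: "is_unit r" using yp by (simp add: y_primitive_def)
    then have "degree r = 0" by (auto simp: is_unit_poly_iff)
    then obtain c where c: "r = [:c:]" by (rule degree_eq_zeroE)
    have c0: "c \<noteq> 0" using u c by auto
    have e: "ev2 q y z = of_real c" for y z by (simp add: r c ev2_const)
    then have ek: "\<forall>y. ev2 q y \<i> = of_real c" by blast
    have "hermitian_rep (ev2 q) 0 [] 0" by (rule hermitian_rep_const[OF e])
    then show ?thesis using c0 ek by (intro exI[of _ "[]"] exI[of _ "0 :: nat"] exI[of _ "of_real c"]) (simp add: 1)
  next
    case 2
    then show ?thesis using hermitian_rep_irreducible hyp by blast
  next
    case 3
    have "\<not> is_unit q" using 3(1) by (auto simp: is_unit_poly_iff)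
    then obtain a b where ab: "q = a * b" "\<not> is_unit a" "\<not> is_unit b"
      using 3(2) q0 unfolding irreducible_def by blast
    have pos: "degree x > 0" if "x dvd q" "\<not> is_unit x" for x
    proof (rule ccontr)
      assume "\<not> degree x > 0"
      then obtain d where d: "x = [:d:]" using degree_eq_zeroE by blast
      then have "is_unit d" using yp that(1) by (simp add: y_primitive_def)
      then show False using that(2) d by (simp add: is_unit_const_poly_iff)
    qed
    have dvd: "a dvd q" "b dvd q" using ab by simp_all
    have deg: "degree q = degree a + degree b" using q0 ab by (auto intro: degree_mult_eq)
    have lt: "degree a < degree q" "degree b < degree q"
      using pos[OF dvd(1) ab(2)] pos[OF dvd(2) ab(3)] deg by auto
    have e: "ev2 q y z = ev2 a y z * ev2 b y z" for y z by (simp add: ab(1) ev2_mult)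
    have "\<forall>\<^sub>\<infinity>y :: real. \<forall>z. ev2 a (of_real y) z = 0 \<longrightarrow> Im z = 0" "\<forall>\<^sub>\<infinity>y :: real. \<forall>z. ev2 b (of_real y) z = 0 \<longrightarrow> Im z = 0"
      using hyp by (auto simp: e elim!: eventually_mono)
    note IH = less.hyps[OF lt(1) y_primitive_dvd[OF yp dvd(1)] this(1)]
      less.hyps[OF lt(2) y_primitive_dvd[OF yp dvd(2)] this(2)]
    from IH(1) obtain ls D k where 1: "\<forall>l \<in> set ls. Im l \<noteq> 0" "hermitian_rep (ev2 a) D ls (degree a)"
      "k \<noteq> 0" "\<And>y. ev2 a y \<i> = k * (\<Prod>l\<leftarrow>ls. y - l)" by blast
    from IH(2) obtain ls' D' k' where 2: "\<forall>l \<in> set ls'. Im l \<noteq> 0" "hermitian_rep (ev2 b) D' ls' (degree b)"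
      "k' \<noteq> 0" "\<And>y. ev2 b y \<i> = k' * (\<Prod>l\<leftarrow>ls'. y - l)" by blast
    have "hermitian_rep (ev2 q) (D + D') (ls @ ls') (degree q)"
      using hermitian_rep_mult[OF 1(2) 2(2)] by (simp add: e[abs_def] deg)
    moreover have "ev2 q y \<i> = (k * k') * (\<Prod>l\<leftarrow>ls @ ls'. y - l)" for y by (simp add: e 1(4) 2(4))
    moreover have "\<forall>l \<in> set (ls @ ls'). Im l \<noteq> 0" using 1(1) 2(1) by auto
    ultimately show ?thesis using 1(3) 2(3) by (metis mult_eq_0_iff)
  qed
qed

section \<open>Representations without rank data\<close>

text \<open>The weakening of \<open>hermitian_rep\<close> that also suits factors in
  \<open>y\<close> alone, for which the coefficient of \<open>z\<close> vanishes. The nondegeneracy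
  clause is kept because it controls the size of the matrices in homogenization.\<close>

definition det_rep :: "(complex \<Rightarrow> complex \<Rightarrow> complex) \<Rightarrow> nat \<Rightarrow> bool" where
  "det_rep f D \<longleftrightarrow> (\<exists>A0 A1 Y c.
     A0 \<in> carrier_mat D D \<and> ct A0 = A0 \<and> A1 \<in> carrier_mat D D \<and> ct A1 = A1 \<and> dim_col Y = D \<and>
     (\<forall>y z. f y z = c * det (A0 + y \<cdot>\<^sub>m A1 + z \<cdot>\<^sub>m (ct Y * Y))) \<and>
     (\<forall>\<^sub>\<infinity>e :: real. det (A1 + of_real e \<cdot>\<^sub>m (ct Y * Y)) \<noteq> 0))"

lemma hermitian_rep_imp_det_rep:
  assumes "hermitian_rep f D ls m" shows "det_rep f D"
proof -
  obtain A0 Y1 Y2 X1 X2 c where A0: "A0 \<in> carrier_mat D D" "ct A0 = A0"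
    and Y1: "Y1 \<in> carrier_mat (length ls) D" and Y2: "Y2 \<in> carrier_mat m D"
    and f: "\<And>y z. f y z = c * det (A0 + y \<cdot>\<^sub>m (ct Y1 * sign_mat ls * Y1) + z \<cdot>\<^sub>m (ct Y2 * Y2))"
    and e: "\<forall>\<^sub>\<infinity>e :: real. det (ct Y1 * sign_mat ls * Y1 + of_real e \<cdot>\<^sub>m (ct Y2 * Y2)) \<noteq> 0"
    using assms unfolding hermitian_rep_def by blast
  note dims = carrier_matD[OF Y1] carrier_matD[OF Y2] carrier_matD[OF sign_mat_carrier[of ls]]
  have "ct Y1 * sign_mat ls * Y1 \<in> carrier_mat D D" using dims by (auto intro!: carrier_matI)
  moreover have "ct (ct Y1 * sign_mat ls * Y1) = ct Y1 * sign_mat ls * Y1"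
    using dims by (simp add: ct_mult ct_sign_mat mat_mult_assoc)
  ultimately show ?thesis unfolding det_rep_def using A0 f e dims
    by (intro exI[of _ A0] exI[of _ "ct Y1 * sign_mat ls * Y1"] exI[of _ Y2] exI[of _ c]) simp
qed

lemma det_rep_mult:
  assumes "det_rep f D" "det_rep g D'" shows "det_rep (\<lambda>y z. f y z * g y z) (D + D')"
proof -
  obtain A0 A1 Y c where A: "A0 \<in> carrier_mat D D" "ct A0 = A0" "A1 \<in> carrier_mat D D" "ct A1 = A1" "dim_col Y = D"
    and f: "\<And>y z. f y z = c * det (A0 + y \<cdot>\<^sub>m A1 + z \<cdot>\<^sub>m (ct Y * Y))"
    and e: "\<forall>\<^sub>\<infinity>e :: real. det (A1 + of_real e \<cdot>\<^sub>m (ct Y * Y)) \<noteq> 0"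
    using assms(1) unfolding det_rep_def by blast
  obtain A0' A1' Y' c' where A': "A0' \<in> carrier_mat D' D'" "ct A0' = A0'" "A1' \<in> carrier_mat D' D'" "ct A1' = A1'" "dim_col Y' = D'"
    and g: "\<And>y z. g y z = c' * det (A0' + y \<cdot>\<^sub>m A1' + z \<cdot>\<^sub>m (ct Y' * Y'))"
    and e': "\<forall>\<^sub>\<infinity>e :: real. det (A1' + of_real e \<cdot>\<^sub>m (ct Y' * Y')) \<noteq> 0"
    using assms(2) unfolding det_rep_def by blast
  note dims = carrier_matD[OF A(1)] carrier_matD[OF A(3)] A(5) carrier_matD[OF A'(1)] carrier_matD[OF A'(3)] A'(5)
  have s2: "ct (dsum Y Y') * dsum Y Y' = dsum (ct Y * Y) (ct Y' * Y')" by (simp add: ct_dsum dsum_mult)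
  show ?thesis unfolding det_rep_def
  proof (intro exI conjI allI)
    show "dsum A0 A0' \<in> carrier_mat (D + D') (D + D')" "dsum A1 A1' \<in> carrier_mat (D + D') (D + D')" using A A' by auto
    show "ct (dsum A0 A0') = dsum A0 A0'" "ct (dsum A1 A1') = dsum A1 A1'" using A A' by (simp_all add: ct_dsum)
    show "dim_col (dsum Y Y') = D + D'" using A A' by simp
    show "f y z * g y z = (c * c') * det (dsum A0 A0' + y \<cdot>\<^sub>m dsum A1 A1' + z \<cdot>\<^sub>m (ct (dsum Y Y') * dsum Y Y'))" for y z
    proof -
      have "dsum A0 A0' + y \<cdot>\<^sub>m dsum A1 A1' + z \<cdot>\<^sub>m dsum (ct Y * Y) (ct Y' * Y') =
        dsum (A0 + y \<cdot>\<^sub>m A1 + z \<cdot>\<^sub>m (ct Y * Y)) (A0' + y \<cdot>\<^sub>m A1' + z \<cdot>\<^sub>m (ct Y' * Y'))"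
        using dims by (simp add: dsum_smult dsum_add)
      moreover have "A0 + y \<cdot>\<^sub>m A1 + z \<cdot>\<^sub>m (ct Y * Y) \<in> carrier_mat D D" "A0' + y \<cdot>\<^sub>m A1' + z \<cdot>\<^sub>m (ct Y' * Y') \<in> carrier_mat D' D'"
        using dims by (auto intro!: carrier_matI)
      ultimately show ?thesis unfolding s2 by (simp add: det_dsum[of _ D _ D'] f g)
    qed
    show "\<forall>\<^sub>\<infinity>e :: real. det (dsum A1 A1' + of_real e \<cdot>\<^sub>m (ct (dsum Y Y') * dsum Y Y')) \<noteq> 0"
      using e e'
    proof eventually_elim
      case (elim e)
      have "dsum A1 A1' + of_real e \<cdot>\<^sub>m dsum (ct Y * Y) (ct Y' * Y') =
        dsum (A1 + of_real e \<cdot>\<^sub>m (ct Y * Y)) (A1' + of_real e \<cdot>\<^sub>m (ct Y' * Y'))"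
        using dims by (simp add: dsum_smult dsum_add)
      moreover have "A1 + of_real e \<cdot>\<^sub>m (ct Y * Y) \<in> carrier_mat D D" "A1' + of_real e \<cdot>\<^sub>m (ct Y' * Y') \<in> carrier_mat D' D'"
        using dims by (auto intro!: carrier_matI)
      ultimately show ?case unfolding s2 using elim by (simp add: det_dsum[of _ D _ D'])
    qed
  qed
qed

lemma det_rep_const:
  assumes "\<And>y z. f y z = c" shows "det_rep f 0"
  using hermitian_rep_imp_det_rep[OF hermitian_rep_const[OF assms]] .

lemma det_rep_linear: "det_rep (\<lambda>y z. y - of_real a) 1"
  unfolding det_rep_def
proof (intro exI conjI allI)
  let ?A0 = "complex_of_real (- a) \<cdot>\<^sub>m 1\<^sub>m 1" and ?Y = "0\<^sub>m 1 1 :: complex mat"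
  have z: "z \<cdot>\<^sub>m (ct ?Y * ?Y) = 0\<^sub>m 1 1" for z by (auto intro!: eq_matI)
  show "y - of_real a = 1 * det (?A0 + y \<cdot>\<^sub>m 1\<^sub>m 1 + z \<cdot>\<^sub>m (ct ?Y * ?Y))" for y z
    unfolding z by (subst det_single) (auto intro!: carrier_matI)
  show "\<forall>\<^sub>\<infinity>e :: real. det (1\<^sub>m 1 + of_real e \<cdot>\<^sub>m (ct ?Y * ?Y)) \<noteq> 0"
    unfolding z by (subst det_single) (auto intro!: carrier_matI)
qed (auto simp: ct_smult)

lemma det_antidiagonal:
  "det (four_block_mat (0\<^sub>m 1 1) (u \<cdot>\<^sub>m 1\<^sub>m 1) (v \<cdot>\<^sub>m 1\<^sub>m 1) (0\<^sub>m 1 1)) = - (u * v :: complex)"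
proof -
  have "det (four_block_mat (0\<^sub>m 1 1) (u \<cdot>\<^sub>m 1\<^sub>m 1) (v \<cdot>\<^sub>m 1\<^sub>m 1) (0\<^sub>m 1 1)) =
    det (0\<^sub>m 1 1 * 0\<^sub>m 1 1 - (u \<cdot>\<^sub>m 1\<^sub>m 1) * (v \<cdot>\<^sub>m 1\<^sub>m 1))"
    by (rule det_four_block_mat) (auto intro!: eq_matI)
  also have "\<dots> = - (u * v)" by (subst det_single) (auto intro!: carrier_matI simp: scalar_prod_def)
  finally show ?thesis .
qed

text \<open>For real \<open>y\<close> the antidiagonal matrix with entries \<open>y - a\<close> and
  \<open>y - cnj a\<close> is Hermitian; its determinant is minus their product, whence the constant
  -1.\<close>

lemma det_rep_quadratic: "det_rep (\<lambda>y z. (y - a) * (y - cnj a)) 2"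
  unfolding det_rep_def
proof (intro exI conjI allI)
  let ?F = "\<lambda>u v. four_block_mat (0\<^sub>m 1 1) (u \<cdot>\<^sub>m 1\<^sub>m 1) (v \<cdot>\<^sub>m 1\<^sub>m 1) (0\<^sub>m 1 1) :: complex mat"
  let ?Y = "0\<^sub>m 2 2 :: complex mat"
  have z: "z \<cdot>\<^sub>m (ct ?Y * ?Y) = 0\<^sub>m 2 2" for z by (auto intro!: eq_matI simp: scalar_prod_def)
  show "?F (- a) (- cnj a) \<in> carrier_mat 2 2" "?F 1 1 \<in> carrier_mat 2 2" by (auto intro!: carrier_matI)
  show "ct (?F (- a) (- cnj a)) = ?F (- a) (- cnj a)" "ct (?F 1 1) = ?F 1 1"
    by (subst ct_four_block; simp add: ct_smult)+
  show "(y - a) * (y - cnj a) = (-1) * det (?F (- a) (- cnj a) + y \<cdot>\<^sub>m ?F 1 1 + z \<cdot>\<^sub>m (ct ?Y * ?Y))" for y z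
  proof -
    have "?F (- a) (- cnj a) + y \<cdot>\<^sub>m ?F 1 1 + 0\<^sub>m 2 2 = ?F (y - a) (y - cnj a)"
      by (rule eq_matI) (auto simp: less_Suc_eq)
    then show ?thesis unfolding z by (simp only: det_antidiagonal) simp
  qed
  show "\<forall>\<^sub>\<infinity>e :: real. det (?F 1 1 + of_real e \<cdot>\<^sub>m (ct ?Y * ?Y)) \<noteq> 0"
  proof -
    have "?F 1 1 + 0\<^sub>m 2 2 = ?F 1 1" by (rule eq_matI) (auto simp: less_Suc_eq)
    then show ?thesis unfolding z by (simp only: det_antidiagonal) simp
  qed
qed simp

text \<open>A real zero splits off a linear factor, a nonreal one the real quadratic factor of its
  conjugate pair. The remainder modulo that factor has degree at most one and a nonreal zero, so it
  is zero.\<close>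

lemma det_rep_univariate: "r \<noteq> 0 \<Longrightarrow> \<exists>D. det_rep (\<lambda>y z. emb y r) D"
proof (induction "degree r" arbitrary: r rule: less_induct)
  case less
  have step: ?case if s: "s dvd r" "degree s > 0" "\<exists>D. det_rep (\<lambda>y z. emb y s) D" for s
  proof -
    obtain r' where r': "r = s * r'" using s(1) by (auto simp: dvd_def)
    then have "r' \<noteq> 0" "s \<noteq> 0" using less.prems by auto
    moreover from this have "degree r' < degree r" using s(2) by (simp add: r' degree_mult_eq)
    ultimately obtain D' where "det_rep (\<lambda>y z. emb y r') D'" using less.hyps by blast
    then show ?thesis using s(3) det_rep_mult[of "\<lambda>y z. emb y s" _ "\<lambda>y z. emb y r'" D']
      by (auto simp: r' emb.hom_mult)
  qed
  show ?case
  proof (cases "degree r = 0")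
    case True
    then obtain c where "r = [:c:]" by (rule degree_eq_zeroE)
    then have "emb y r = of_real c" for y by simp
    then show ?thesis using det_rep_const[of "\<lambda>y z. emb y r"] by blast
  next
    case False
    then have "degree (map_poly complex_of_real r) \<noteq> 0" by (simp add: degree_map_poly)
    then obtain a where a: "emb a r = 0"
      using fundamental_theorem_of_algebra_alt[of "map_poly complex_of_real r"]
      unfolding emb_def by (metis degree_pCons_0)
    show ?thesis
    proof (cases "Im a = 0")
      case True
      then have e: "a = of_real (Re a)" by (simp add: complex_eq_iff)
      have "poly r (Re a) = 0" using a e emb_real[of "Re a" r] by simp
      then have "[:- Re a, 1:] dvd r" by (simp add: poly_eq_0_iff_dvd)
      moreover have "emb y [:- Re a, 1:] = y - of_real (Re a)" for y by simp
      ultimately show ?thesis using det_rep_linear[of "Re a"] by (intro step[of "[:- Re a, 1:]"]) auto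
    next
      case im: False
      let ?s = "[:(cmod a)\<^sup>2, - 2 * Re a, 1:]"
      have es: "emb y ?s = (y - a) * (y - cnj a)" for y
      proof -
        have "complex_of_real ((cmod a)\<^sup>2) = a * cnj a" by (rule complex_norm_square)
        moreover have "complex_of_real (- 2 * Re a) = - (a + cnj a)" by (simp add: complex_add_cnj)
        ultimately have "emb y ?s = a * cnj a + y * (- (a + cnj a) + y)" by (simp only: emb_pCons emb_zero) simp
        then show ?thesis by (simp add: algebra_simps)
      qed
      define r1 where "r1 = r mod ?s"
      have "degree r1 \<le> 1" using degree_mod_less[of ?s r] unfolding r1_def by fastforce
      then obtain c0 c1 where c: "r1 = [:c0, c1:]"
        by (cases r1 rule: pCons_cases; rename_tac c0 t; case_tac t rule: pCons_cases) (auto split: if_splits)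
      have "emb a r = emb a (r div ?s) * emb a ?s + emb a r1"
        unfolding r1_def by (metis div_mult_mod_eq emb.hom_add emb.hom_mult)
      then have "emb a r1 = 0" by (simp only: a es[of a] diff_self mult_zero_left mult_zero_right add_0_left)
      then have "of_real c0 + a * of_real c1 = 0" by (simp add: c)
      then have "c1 = 0" "c0 = 0" using im by (auto simp: complex_eq_iff)
      then have "?s dvd r" using c by (simp add: r1_def mod_eq_0_iff_dvd)
      moreover have "det_rep (\<lambda>y z. emb y ?s) 2" unfolding es by (rule det_rep_quadratic)
      ultimately show ?thesis by (intro step[of ?s] exI[of _ 2]) auto
    qed
  qed
qed

text \<open>The content carries all factors in \<open>y\<close> alone; the primitive part falls
  under the finer result.\<close>

theorem bivariate_det_rep:
  fixes q :: "real poly poly"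
  assumes q0: "q \<noteq> 0" and hyp: "\<forall>\<^sub>\<infinity>y :: real. \<forall>z. ev2 q (of_real y) z = 0 \<longrightarrow> Im z = 0"
  shows "\<exists>D. det_rep (ev2 q) D"
proof -
  define p where "p = primitive_part q"
  have q: "q = [:content q:] * p" unfolding p_def using content_times_primitive_part[of q] by simp
  have "content p = 1" unfolding p_def using q0 by (simp add: content_primitive_part)
  then have "y_primitive p" by (simp add: y_primitive_def const_poly_dvd_iff_dvd_content)
  moreover have e: "ev2 q y z = emb y (content q) * ev2 p y z" for y z
    using arg_cong[OF q, of "\<lambda>q. ev2 q y z"] by (simp only: ev2_mult ev2_const)
  moreover have "\<forall>\<^sub>\<infinity>y :: real. \<forall>z. ev2 p (of_real y) z = 0 \<longrightarrow> Im z = 0"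
    using hyp by (auto simp: e elim!: eventually_mono)
  ultimately obtain D where "det_rep (ev2 p) D"
    using bivariate_hermitian_rep hermitian_rep_imp_det_rep by blast
  moreover obtain D' where "det_rep (\<lambda>y z. emb y (content q)) D'"
    using det_rep_univariate[of "content q"] q0 by auto
  ultimately show ?thesis using det_rep_mult[of "\<lambda>y z. emb y (content q)" D' "ev2 p" D] e by (auto simp: fun_eq_iff[symmetric] e[abs_def])
qed

section \<open>Homogeneous polynomials\<close>

definition dehomogenize :: "real poly poly poly \<Rightarrow> real poly poly" where
  "dehomogenize p = map_poly (map_poly (\<lambda>c. poly c 1)) p"

lemma coeff_dehomogenize: "coeff (coeff (dehomogenize p) k) j = poly (coeff (coeff p k) j) 1"
  by (simp add: dehomogenize_def coeff_map_poly)

text \<open>Homogeneity reduces each coefficient to a monomial in \<open>x0\<close>. The exponent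
  \<open>d - j - k\<close> is truncated when \<open>j + k > d\<close>, and then the coefficient is
  zero.\<close>

lemma poly_coeff_homogeneous:
  assumes "homogeneous d p" "h 0 = 0"
  shows "poly (map_poly h (coeff (coeff p k) j)) (x :: 'a :: comm_ring_1) =
    h (coeff (coeff (dehomogenize p) k) j) * x ^ (d - j - k)"
proof -
  let ?c = "coeff (coeff p k) j"
  let ?a = "coeff ?c (d - j - k)"
  have "?c = monom ?a (d - j - k)"
  proof (rule poly_eqI)
    fix i
    have "coeff ?c i \<noteq> 0 \<Longrightarrow> i + j + k = d" using assms(1) unfolding homogeneous_def by blast
    then have "coeff ?c i \<noteq> 0 \<Longrightarrow> i = d - j - k" by linarith
    then show "coeff ?c i = coeff (monom ?a (d - j - k)) i" by (auto simp: coeff_monom)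
  qed
  then have e: "?c = monom ?a (d - j - k)" .
  have "poly ?c 1 = ?a" by (subst e) (simp add: poly_monom)
  moreover have "poly (map_poly h ?c) x = h ?a * x ^ (d - j - k)"
    by (subst e) (simp add: map_poly_monom poly_monom assms(2))
  ultimately show ?thesis by (simp add: coeff_dehomogenize)
qed

lemma coeff_eq_0_homogeneous:
  assumes "homogeneous d p" "j + k > d" shows "coeff (coeff p k) j = 0"
proof (rule poly_eqI)
  fix i
  have "coeff (coeff (coeff p k) j) i \<noteq> 0 \<longrightarrow> i + j + k = d" using assms(1) unfolding homogeneous_def by blast
  then show "coeff (coeff (coeff p k) j) i = coeff 0 i" using assms(2) by auto
qed

lemma homogeneous_degree_le:
  assumes "homogeneous d p" shows "degree p \<le> d" "degree (coeff p k) \<le> d - k"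
proof -
  show k: "degree (coeff p k) \<le> d - k" for k
    using coeff_eq_0_homogeneous[OF assms] by (intro degree_le) auto
  have "coeff p k = 0" if "k > d" for k
    using coeff_eq_0_homogeneous[OF assms] that by (intro poly_eqI) simp
  then show "degree p \<le> d" by (intro degree_le) auto
qed

lemma eval3_homogeneous:
  assumes p: "homogeneous d p" and h: "h 0 = 0"
  shows "eval3 h p a0 a1 a2 =
    (\<Sum>k\<le>d. (\<Sum>j\<le>d. h (coeff (coeff (dehomogenize p) k) j) * a0 ^ (d - j - k) * a1 ^ j) * a2 ^ k)"
proof -
  have dj: "degree (coeff p k) \<le> d" for k using homogeneous_degree_le(2)[OF p, of k] by simp
  have "poly (map_poly (\<lambda>r. poly (map_poly h r) a0) (coeff p k)) a1 =
     (\<Sum>j\<le>d. h (coeff (coeff (dehomogenize p) k) j) * a0 ^ (d - j - k) * a1 ^ j)" for k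
    by (subst poly_map_poly_altdef[OF _ dj]) (simp_all add: poly_coeff_homogeneous[where h = h, OF p h])
  then show ?thesis
    unfolding eval3_def by (subst poly_map_poly_altdef[OF _ homogeneous_degree_le(1)[OF p]]) simp_all
qed

lemma coeff_dehomogenize_eq_0:
  assumes "homogeneous d p" shows "coeff (coeff (dehomogenize p) k) j = 0 \<longleftrightarrow> coeff (coeff p k) j = 0"
proof
  assume z: "coeff (coeff (dehomogenize p) k) j = 0"
  have "poly (coeff (coeff p k) j) x = 0" for x
    using poly_coeff_homogeneous[OF assms, of "\<lambda>x. x" k j x] z by (simp add: map_poly_idI)
  then show "coeff (coeff p k) j = 0" by (simp add: poly_all_0_iff_0[symmetric])
qed (simp add: coeff_dehomogenize)

lemma degree_eqI: "(\<And>k. coeff p k = 0 \<longleftrightarrow> coeff q k = 0) \<Longrightarrow> degree p = degree q"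
  unfolding degree_def by simp

lemma dehomogenize_degrees:
  assumes "homogeneous d p"
  shows "degree (dehomogenize p) = degree p" "degree (coeff (dehomogenize p) k) = degree (coeff p k)"
    "dehomogenize p = 0 \<longleftrightarrow> p = 0" "ydeg (dehomogenize p) = degree1 p"
proof -
  note e = coeff_dehomogenize_eq_0[OF assms]
  have c: "coeff (dehomogenize p) k = 0 \<longleftrightarrow> coeff p k = 0" for k by (simp add: poly_eq_iff e)
  show "degree (dehomogenize p) = degree p" by (rule degree_eqI) (rule c)
  moreover show d: "degree (coeff (dehomogenize p) k) = degree (coeff p k)" for k by (rule degree_eqI) (rule e)
  ultimately show "ydeg (dehomogenize p) = degree1 p" by (simp add: ydeg_def degree1_def)
  show "dehomogenize p = 0 \<longleftrightarrow> p = 0" using c by (simp add: poly_eq_iff)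
qed

lemma ev2_dehomogenize:
  assumes "homogeneous d p"
  shows "ev2 (dehomogenize p) y z = (\<Sum>k\<le>d. (\<Sum>j\<le>d. of_real (coeff (coeff (dehomogenize p) k) j) * y ^ j) * z ^ k)"
proof -
  have "emb y (coeff (dehomogenize p) k) = (\<Sum>j\<le>d. of_real (coeff (coeff (dehomogenize p) k) j) * y ^ j)" for k
    unfolding emb_def using homogeneous_degree_le(2)[OF assms, of k]
    by (intro poly_map_poly_altdef) (auto simp: dehomogenize_degrees[OF assms])
  then show ?thesis
    using homogeneous_degree_le(1)[OF assms] dehomogenize_degrees(1)[OF assms] by (subst ev2_altdef[of _ d]) auto
qed

lemma eval3_eq_ev2:
  assumes p: "homogeneous d p" and x0: "x0 \<noteq> 0"
  shows "complex_of_real (eval3 (\<lambda>a. a) p x0 x1 x2) = of_real x0 ^ d * ev2 (dehomogenize p) (of_real (x1 / x0)) (of_real (x2 / x0))"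
proof -
  let ?c = "\<lambda>j k. coeff (coeff (dehomogenize p) k) j"
  have t: "?c j k * x0 ^ (d - j - k) * x1 ^ j * x2 ^ k = x0 ^ d * (?c j k * (x1 / x0) ^ j * (x2 / x0) ^ k)" for j k
  proof (cases "j + k \<le> d")
    case True
    then have "x0 ^ d = x0 ^ (d - j - k) * x0 ^ j * x0 ^ k" by (simp flip: power_add)
    then show ?thesis using x0 by (simp add: power_divide)
  next
    case False
    then show ?thesis using coeff_eq_0_homogeneous[OF p] by (simp add: coeff_dehomogenize_eq_0[OF p])
  qed
  have "eval3 (\<lambda>a. a) p x0 x1 x2 = (\<Sum>k\<le>d. \<Sum>j\<le>d. ?c j k * x0 ^ (d - j - k) * x1 ^ j * x2 ^ k)"
    by (subst eval3_homogeneous[OF p]) (simp_all add: sum_distrib_right)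
  also have "\<dots> = x0 ^ d * (\<Sum>k\<le>d. (\<Sum>j\<le>d. ?c j k * (x1 / x0) ^ j) * (x2 / x0) ^ k)"
    unfolding t by (simp add: sum_distrib_left sum_distrib_right)
  finally show ?thesis by (simp add: ev2_dehomogenize[OF p])
qed

lemma poly_eval3_i:
  assumes p: "homogeneous d p"
  shows "eval3 (\<lambda>a. [:complex_of_real a:]) p 1 [:0, 1:] [:\<i>:] = swap_poly (dehomogenize p) \<i>"
proof (rule poly_eqI_MOST, rule always_eventually, rule allI)
  fix t :: real
  show "poly (eval3 (\<lambda>a. [:complex_of_real a:]) p 1 [:0, 1:] [:\<i>:]) (of_real t) = poly (swap_poly (dehomogenize p) \<i>) (of_real t)"
    by (subst eval3_homogeneous[OF p]) (simp_all add: poly_sum poly_swap ev2_dehomogenize[OF p])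
qed

lemma emb_smult: "emb w (smult c b) = of_real c * emb w b"
  by (induction b) (simp_all add: algebra_simps)

text \<open>The points of the line are \<open>x - t e\<close>, which accounts for the sign in
  \<open>- w\<close>; it does not affect reality of the roots.\<close>

lemma emb_line_poly:
  assumes p: "homogeneous d p"
  shows "emb w (line_poly p (0, 0, 1) (1, y, 0)) = ev2 (dehomogenize p) (of_real y) (- w)"
proof -
  have "emb w (line_poly p (0, 0, 1) (1, y, 0)) = emb w (eval3 (\<lambda>a. [:a:]) p 1 [:y:] [:0, -1:])"
    by (simp add: line_poly_def one_pCons)
  also have "\<dots> = ev2 (dehomogenize p) (of_real y) (- w)"
    by (subst eval3_homogeneous[OF p])
      (simp_all add: emb_smult emb.hom_sum emb.hom_mult emb.hom_power ev2_dehomogenize[OF p])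
  finally show ?thesis .
qed

text \<open>Semi-hyperbolicity permits identically zero restrictions. For nonzero \<open>p\<close>
  the restriction to the line through \<open>(1, y, 0)\<close> is nonzero unless the leading
  coefficient vanishes at \<open>y\<close>, which leaves finitely many exceptions.\<close>

lemma real_rooted_fibres:
  assumes p: "homogeneous d p" and s: "semi_hyperbolic p (0, 0, 1)"
  shows "\<forall>\<^sub>\<infinity>y :: real. \<forall>z. ev2 (dehomogenize p) (of_real y) z = 0 \<longrightarrow> Im z = 0 \<or> p = 0"
proof (cases "p = 0")
  case False
  let ?q = "dehomogenize p"
  have q0: "lead_coeff ?q \<noteq> 0" using False dehomogenize_degrees(3)[OF p] by simp
  have "\<forall>\<^sub>\<infinity>y :: real. poly (map_poly complex_of_real (lead_coeff ?q)) (of_real y) \<noteq> 0"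
    using q0 by (intro MOST_poly_nonzero) (simp add: map_poly_eq_0_iff)
  then show ?thesis
  proof eventually_elim
    case (elim y)
    let ?l = "line_poly p (0, 0, 1) (1, y, 0)"
    have "map_poly (emb (of_real y)) ?q \<noteq> 0"
    proof
      assume "map_poly (emb (of_real y)) ?q = 0"
      then have "emb (of_real y) (lead_coeff ?q) = 0" by (metis coeff_map_poly coeff_0 emb_zero)
      then show False using elim by (simp add: emb_def)
    qed
    then obtain z where "poly (map_poly (emb (of_real y)) ?q) z \<noteq> 0" by (metis poly_all_0_iff_0)
    then have "emb (- z) ?l \<noteq> 0" by (simp add: emb_line_poly[OF p] ev2_def)
    then have "?l \<noteq> 0" by auto
    then have r: "only_real_roots ?l" using s unfolding semi_hyperbolic_def by blast
    show ?case
    proof (intro allI impI disjI1)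
      fix z assume "ev2 ?q (of_real y) z = 0"
      then have "emb (- z) ?l = 0" by (simp add: emb_line_poly[OF p])
      then have "- z \<in> \<real>" using r unfolding only_real_roots_def emb_def by blast
      then show "Im z = 0" by (simp add: complex_is_Real_iff)
    qed
  qed
qed simp

section \<open>Homogenization and factors in two variables\<close>

definition homogenize :: "nat \<Rightarrow> real poly \<Rightarrow> real poly poly" where
  "homogenize n b = (\<Sum>j\<le>n. monom (monom (coeff b j) (n - j)) j)"

definition eval_pair :: "real \<Rightarrow> real \<Rightarrow> real poly poly \<Rightarrow> real" where
  "eval_pair x0 x1 B = poly (poly B [:x1:]) x0"

lemma eval_pair_homogenize:
  assumes "degree b \<le> n" "x0 \<noteq> 0"
  shows "eval_pair x0 x1 (homogenize n b) = x0 ^ n * poly b (x1 / x0)"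
proof -
  have "eval_pair x0 x1 (homogenize n b) = (\<Sum>j\<le>n. coeff b j * x0 ^ (n - j) * x1 ^ j)"
    by (simp add: eval_pair_def homogenize_def poly_sum poly_monom)
  also have "\<dots> = (\<Sum>j\<le>n. x0 ^ n * (coeff b j * (x1 / x0) ^ j))"
    using assms(2) by (intro sum.cong) (auto simp: power_divide field_simps simp flip: power_add)
  also have "\<dots> = x0 ^ n * (\<Sum>j\<le>n. coeff b j * (x1 / x0) ^ j)" by (simp add: sum_distrib_left)
  also have "(\<Sum>j\<le>n. coeff b j * (x1 / x0) ^ j) = poly b (x1 / x0)"
    using poly_map_poly_altdef[of "\<lambda>x. x" b n "x1 / x0"] assms(1) by (simp add: map_poly_idI)
  finally show ?thesis .
qed

lemma eval_pair_mult: "eval_pair x0 x1 (A * B) = eval_pair x0 x1 A * eval_pair x0 x1 B"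
  by (simp add: eval_pair_def)

text \<open>Points with \<open>x0 = 0\<close> are left out because homogenizations are evaluated
  through the quotient \<open>x1 / x0\<close>; infinitely many \<open>x0\<close> remain for each
  \<open>x1\<close>.\<close>

lemma eval_pair_eqI:
  assumes "\<And>x0 x1. x0 \<noteq> 0 \<Longrightarrow> eval_pair x0 x1 A = eval_pair x0 x1 B" shows "A = B"
proof (rule ccontr)
  let ?D = "A - B"
  assume "A \<noteq> B"
  then have D: "?D \<noteq> 0" by simp
  have "poly ?D [:x1:] = 0" for x1
  proof (rule ccontr)
    assume "poly ?D [:x1:] \<noteq> 0"
    then have "finite {x. poly (poly ?D [:x1:]) x = 0}" by (rule poly_roots_finite)
    then have "finite (insert 0 {x. poly (poly ?D [:x1:]) x = 0})" by simp
    then obtain x where "x \<noteq> 0" "poly (poly ?D [:x1:]) x \<noteq> 0"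
      using ex_new_if_finite[OF infinite_UNIV_char_0[where 'a = real]] by blast
    then show False using assms[of x x1] by (simp add: eval_pair_def)
  qed
  then have "range (\<lambda>x. [:x:]) \<subseteq> {c. poly ?D c = 0}" by auto
  then have "finite (range (\<lambda>x :: real. [:x:]))" using poly_roots_finite[OF D] finite_subset by blast
  then show False using finite_imageD[of "\<lambda>x :: real. [:x:]" UNIV] infinite_UNIV_char_0[where 'a = real] by (auto simp: inj_on_def)
qed

text \<open>The coefficient of \<open>x2 ^ k\<close> is homogeneous of degree \<open>d - k\<close>
  in the other two variables, so it is recovered from its values at \<open>x0 = 1\<close>.\<close>

lemma coeff_eq_homogenize:
  assumes p: "homogeneous d p" and k: "k \<le> d"
  shows "coeff p k = homogenize (d - k) (coeff (dehomogenize p) k)"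
proof (rule poly_eqI, rule poly_eqI)
  fix j i
  let ?c = "coeff (coeff p k) j"
  have "poly ?c x = coeff (coeff (dehomogenize p) k) j * x ^ (d - j - k)" for x
    using poly_coeff_homogeneous[OF p, of "\<lambda>x. x" k j x] by (simp add: map_poly_idI)
  then have c: "?c = monom (coeff (coeff (dehomogenize p) k) j) (d - j - k)"
    by (intro poly_eq_poly_eq_iff[THEN iffD1] ext) (simp add: poly_monom)
  have "coeff (homogenize (d - k) (coeff (dehomogenize p) k)) j =
      (if j \<le> d - k then monom (coeff (coeff (dehomogenize p) k) j) (d - k - j) else 0)"
    by (simp add: homogenize_def coeff_sum)
  moreover have "coeff (coeff (dehomogenize p) k) j = 0" if "\<not> j \<le> d - k"
    using coeff_eq_0_homogeneous[OF p, of j k] that k by (simp add: coeff_dehomogenize_eq_0[OF p])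
  ultimately show "coeff ?c i = coeff (coeff (homogenize (d - k) (coeff (dehomogenize p) k)) j) i"
    by (subst c) (simp add: diff_commute)
qed

text \<open>A divisor \<open>r\<close> of the dehomogenized polynomial lifts: homogenized at its own
  degree, it divides every coefficient of \<open>p\<close>, because degrees of products add up. At
  that degree the leading coefficient of \<open>r\<close> stands at the pure power of
  \<open>x1\<close>, so a constant lift comes from a constant \<open>r\<close>.\<close>

lemma y_primitive_dehomogenize:
  assumes p: "homogeneous d p" and n: "no_factor_in_x0_x1 p"
  shows "y_primitive (dehomogenize p)"
  unfolding y_primitive_def
proof (intro allI impI)
  fix r assume r: "[:r:] dvd dehomogenize p"
  let ?q = "dehomogenize p"
  have p0: "p \<noteq> 0"
  proof
    assume "p = 0"
    then have "[:[:[:0, 1:]:]:] dvd p" by simp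
    then show False using n unfolding no_factor_in_x0_x1_def by fastforce
  qed
  then have q0: "?q \<noteq> 0" by (simp add: dehomogenize_degrees(3)[OF p])
  have dvd: "r dvd coeff ?q k" for k using r by (simp add: const_poly_dvd_iff)
  have r0: "r \<noteq> 0" using dvd[of "degree ?q"] q0 by auto
  let ?s = "degree r"
  have "homogenize ?s r dvd coeff p k" for k
  proof (cases "coeff p k = 0")
    case False
    then have k: "k \<le> d" using homogeneous_degree_le(1)[OF p] le_degree[of p k] by simp
    obtain u where u: "coeff ?q k = r * u" using dvd[of k] by (auto simp: dvd_def)
    have "coeff ?q k \<noteq> 0" using False coeff_eq_homogenize[OF p k] by (auto simp: homogenize_def)
    then have "degree (coeff ?q k) = ?s + degree u" using r0 u by (auto intro: degree_mult_eq)
    then have d: "?s + degree u \<le> d - k" using homogeneous_degree_le(2)[OF p, of k] dehomogenize_degrees(2)[OF p, of k] by simp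
    have "coeff p k = homogenize ?s r * homogenize (d - k - ?s) u"
    proof (rule eval_pair_eqI)
      fix x0 x1 :: real assume x0: "x0 \<noteq> 0"
      have "d - k = ?s + (d - k - ?s)" using d by simp
      then have "x0 ^ (d - k) = x0 ^ ?s * x0 ^ (d - k - ?s)" by (metis power_add)
      moreover have "degree (coeff ?q k) \<le> d - k" "degree u \<le> d - k - ?s"
        using d homogeneous_degree_le(2)[OF p, of k] dehomogenize_degrees(2)[OF p, of k] by simp_all
      ultimately show "eval_pair x0 x1 (coeff p k) = eval_pair x0 x1 (homogenize ?s r * homogenize (d - k - ?s) u)"
        using x0 by (simp add: eval_pair_mult eval_pair_homogenize coeff_eq_homogenize[OF p k]) (simp add: u)
    qed
    then show ?thesis by simp
  qed simp
  then have "[:homogenize ?s r:] dvd p" by (simp add: const_poly_dvd_iff)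
  then obtain a where a: "homogenize ?s r = [:[:a:]:]" using n unfolding no_factor_in_x0_x1_def by blast
  have "coeff (homogenize ?s r) ?s = [:lead_coeff r:]" by (simp add: homogenize_def coeff_sum monom_0)
  then have "coeff (homogenize ?s r) ?s \<noteq> 0" using r0 by simp
  then have "?s = 0" unfolding a by (cases ?s) auto
  then show "is_unit r" using r0 by (simp add: is_unit_iff_degree)
qed

text \<open>Root by root: for real \<open>a\<close>, Cauchy-Schwarz bounds the square of
  \<open>x - a\<close> by the product of \<open>1 + x\<^sup>2\<close> and
  \<open>1 + a\<^sup>2\<close>, and the latter is the squared distance of \<open>a\<close> from
  \<open>\<i>\<close>.\<close>

lemma real_rooted_bound:
  fixes h :: "complex poly" and x :: real
  assumes "\<And>z. poly h z = 0 \<Longrightarrow> Im z = 0"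
  shows "(cmod (poly h (of_real x)))\<^sup>2 \<le> (1 + x\<^sup>2) ^ degree h * (cmod (poly h \<i>))\<^sup>2"
proof -
  obtain as where as: "smult (lead_coeff h) (\<Prod>a\<leftarrow>as. [:- a, 1:]) = h" "length as = degree h"
    using fundamental_theorem_algebra_factorized by blast
  have ph: "poly h z = lead_coeff h * (\<Prod>a\<leftarrow>as. z - a)" for z
    by (subst as(1)[symmetric]) (simp add: poly_prod_list o_def)
  have b: "(cmod (of_real x - a))\<^sup>2 \<le> (1 + x\<^sup>2) * (cmod (\<i> - a))\<^sup>2" if "Im a = 0" for a
  proof -
    have "(x - Re a)\<^sup>2 \<le> (1 + x\<^sup>2) * ((Re a)\<^sup>2 + 1)"
      using zero_le_power2[of "1 + x * Re a"] by (simp add: power2_eq_square algebra_simps)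
    then show ?thesis using that by (simp add: cmod_power2)
  qed
  have "(cmod (\<Prod>a\<leftarrow>as. of_real x - a))\<^sup>2 \<le> (1 + x\<^sup>2) ^ length as * (cmod (\<Prod>a\<leftarrow>as. \<i> - a))\<^sup>2"
    if "\<And>a. a \<in> set as \<Longrightarrow> Im a = 0" for as
    using that
  proof (induction as)
    case (Cons a as)
    have "(cmod (of_real x - a))\<^sup>2 * (cmod (\<Prod>a\<leftarrow>as. of_real x - a))\<^sup>2 \<le>
      ((1 + x\<^sup>2) * (cmod (\<i> - a))\<^sup>2) * ((1 + x\<^sup>2) ^ length as * (cmod (\<Prod>a\<leftarrow>as. \<i> - a))\<^sup>2)"
      using Cons by (intro mult_mono b Cons.IH) auto
    then show ?case by (simp add: norm_mult power_mult_distrib mult_ac)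
  qed simp
  moreover have "Im a = 0" if "a \<in> set as" for a
  proof (rule assms)
    have "(\<Prod>b\<leftarrow>as. a - b) = 0" using that by (induction as) auto
    then show "poly h a = 0" by (simp add: ph)
  qed
  ultimately have "(cmod (\<Prod>a\<leftarrow>as. of_real x - a))\<^sup>2 \<le> (1 + x\<^sup>2) ^ degree h * (cmod (\<Prod>a\<leftarrow>as. \<i> - a))\<^sup>2"
    unfolding as(2)[symmetric] by blast
  then have "(cmod (lead_coeff h))\<^sup>2 * (cmod (\<Prod>a\<leftarrow>as. of_real x - a))\<^sup>2 \<le>
      (cmod (lead_coeff h))\<^sup>2 * ((1 + x\<^sup>2) ^ degree h * (cmod (\<Prod>a\<leftarrow>as. \<i> - a))\<^sup>2)"
    by (intro mult_left_mono) auto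
  then show ?thesis by (simp add: ph norm_mult power_mult_distrib mult_ac)
qed

text \<open>At a generic real level the degree in \<open>y\<close> is maximal, and
  \<open>real_rooted_bound\<close> dominates the values there by those at level \<open>\<i>\<close>,
  up to a constant independent of \<open>y\<close>. Growth in \<open>y\<close> then shows that the
  degree does not drop at \<open>\<i>\<close>.\<close>

lemma degree_swap_poly_i:
  assumes q0: "q \<noteq> 0" and hyp: "\<forall>\<^sub>\<infinity>y :: real. \<forall>z. ev2 q (of_real y) z = 0 \<longrightarrow> Im z = 0"
  shows "degree (swap_poly q \<i>) = ydeg q"
proof (rule antisym[OF degree_swap_poly_le])
  obtain p where p0: "p \<noteq> 0" and dS: "\<And>z. poly p z \<noteq> 0 \<Longrightarrow> degree (swap_poly q z) = ydeg q \<and> swap_poly q z \<noteq> 0"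
    using swap_poly_degree_generic[OF q0] by blast
  obtain x :: real where x: "poly p (of_real x) \<noteq> 0" using MOST_poly_nonzero[OF p0] MOST_real_nonempty by blast
  let ?S = "swap_poly q \<i>"
  define C where "C = (1 + x\<^sup>2) ^ degree q"
  have C0: "0 \<le> C" by (simp add: C_def)
  have one: "1 \<le> 1 + x\<^sup>2" by simp
  have "\<forall>\<^sub>\<infinity>y :: real. (cmod (poly (swap_poly q (of_real x)) (of_real y)))\<^sup>2 \<le> cmod (poly (smult (of_real C) (?S * ?S)) (of_real y))"
    using hyp
  proof eventually_elim
    case (elim y)
    let ?h = "map_poly (emb (of_real y)) q"
    have "(cmod (poly ?h (of_real x)))\<^sup>2 \<le> (1 + x\<^sup>2) ^ degree ?h * (cmod (poly ?h \<i>))\<^sup>2"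
      using elim by (intro real_rooted_bound) (simp add: ev2_def)
    also have "\<dots> \<le> C * (cmod (poly ?h \<i>))\<^sup>2"
      unfolding C_def using degree_map_poly_le[of "emb (of_real y)" q] one
      by (intro mult_right_mono power_increasing) auto
    finally show ?case using C0 by (simp add: poly_swap ev2_def norm_mult power2_eq_square)
  qed
  moreover have "degree (smult (of_real C) (?S * ?S)) \<le> 2 * degree ?S"
    using degree_smult_le[of "complex_of_real C" "?S * ?S"] degree_mult_le[of ?S ?S] by simp
  ultimately have "degree (swap_poly q (of_real x)) \<le> degree ?S" by (rule degree_le_of_square_bound)
  then show "ydeg q \<le> degree ?S" using dS[OF x] by simp
qed

section \<open>Ranks and signatures\<close>

lemma continuous_eq_at_0:
  fixes f g :: "real \<Rightarrow> complex"
  assumes "isCont f 0" "isCont g 0" "\<And>x. x \<noteq> 0 \<Longrightarrow> f x = g x"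
  shows "f x = g x"
proof (cases "x = 0")
  case True
  have f: "f \<midarrow>0\<rightarrow> f 0" and g: "g \<midarrow>0\<rightarrow> g 0" using assms(1,2) by (simp_all add: isCont_def)
  have "g \<midarrow>0\<rightarrow> f 0"
    by (rule Lim_transform_eventually[OF f]) (auto simp: eventually_at_filter assms(3))
  then have "f 0 = g 0" using g by (rule LIM_unique)
  then show ?thesis using True by simp
qed (rule assms(3))

text \<open>The two sides are compared for nonzero \<open>x0\<close> and then at 0 by continuity. If
  \<open>D\<close> exceeded \<open>d\<close>, the surplus power of \<open>x0\<close> would force the
  determinant to vanish at a nonsingular point of the pencil of \<open>A1\<close> and
  \<open>A2\<close>, or else \<open>c = 0\<close> and with it \<open>p = 0\<close>.\<close>

lemma homogenize_det:
  assumes p: "homogeneous d p" "p \<noteq> 0"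
    and A: "A0 \<in> carrier_mat D D" "A1 \<in> carrier_mat D D" "A2 \<in> carrier_mat D D"
    and q: "\<And>y z. ev2 (dehomogenize p) y z = c * det (A0 + y \<cdot>\<^sub>m A1 + z \<cdot>\<^sub>m A2)"
    and nz: "\<exists>e :: real. det (A1 + of_real e \<cdot>\<^sub>m A2) \<noteq> 0"
  shows "D \<le> d"
    and "complex_of_real (eval3 (\<lambda>a. a) p x0 x1 x2) =
      c * of_real x0 ^ (d - D) * det (of_real x0 \<cdot>\<^sub>m A0 + of_real x1 \<cdot>\<^sub>m A1 + of_real x2 \<cdot>\<^sub>m A2)"
proof -
  define M where "M x0 x1 x2 = complex_of_real x0 \<cdot>\<^sub>m A0 + of_real x1 \<cdot>\<^sub>m A1 + of_real x2 \<cdot>\<^sub>m A2" for x0 x1 x2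
  define f where "f x0 x1 x2 = complex_of_real (eval3 (\<lambda>a. a) p x0 x1 x2)" for x0 x1 x2
  note dims = carrier_matD[OF A(1)] carrier_matD[OF A(2)] carrier_matD[OF A(3)]
  have e: "of_real x0 ^ D * f x0 x1 x2 = c * of_real x0 ^ d * det (M x0 x1 x2)" if x0: "x0 \<noteq> 0" for x0 x1 x2
  proof -
    let ?N = "A0 + of_real (x1 / x0) \<cdot>\<^sub>m A1 + of_real (x2 / x0) \<cdot>\<^sub>m A2"
    have "M x0 x1 x2 = of_real x0 \<cdot>\<^sub>m ?N" unfolding M_def using dims x0 by (intro eq_matI) (auto simp: distrib_left)
    then have "det (M x0 x1 x2) = of_real x0 ^ D * det ?N" using dims by simp
    then show ?thesis unfolding f_def eval3_eq_ev2[OF p(1) x0] q by (simp add: mult_ac)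
  qed
  have cf: "isCont (\<lambda>x0. f x0 x1 x2) 0" for x1 x2
    unfolding f_def by (subst eval3_homogeneous[OF p(1)]) (auto intro!: continuous_intros)
  have cM: "isCont (\<lambda>x0. det (M x0 x1 x2)) 0" for x1 x2
  proof -
    let ?B = "of_real x1 \<cdot>\<^sub>m A1 + of_real x2 \<cdot>\<^sub>m A2"
    obtain r where r: "\<And>z. poly r z = det (?B + z \<cdot>\<^sub>m A0)" using det_pencil_poly[of ?B D A0] A by auto
    have "M x0 x1 x2 = ?B + of_real x0 \<cdot>\<^sub>m A0" for x0 unfolding M_def using dims by (intro eq_matI) auto
    then have "(\<lambda>x0. det (M x0 x1 x2)) = (\<lambda>x0. poly r (of_real x0))" by (simp add: r)
    moreover have "isCont (\<lambda>x0 :: real. poly r (of_real x0)) 0" by (intro continuous_intros)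
    ultimately show ?thesis by simp
  qed
  show Dd: "D \<le> d"
  proof (rule ccontr)
    assume "\<not> D \<le> d"
    then have s: "D - d > 0" "D = (D - d) + d" by simp_all
    obtain t :: real where t: "det (A1 + of_real t \<cdot>\<^sub>m A2) \<noteq> 0" using nz by blast
    have "of_real x0 ^ (D - d) * f x0 1 t = c * det (M x0 1 t)" for x0
    proof (rule continuous_eq_at_0[of "\<lambda>x0. of_real x0 ^ (D - d) * f x0 1 t"])
      show "of_real x ^ (D - d) * f x 1 t = c * det (M x 1 t)" if "x \<noteq> 0" for x
      proof -
        have "of_real x ^ d * (of_real x ^ (D - d) * f x 1 t) = of_real x ^ d * (c * det (M x 1 t))"
          using e[OF that, of 1 t] s(2) by (metis mult.assoc mult.left_commute power_add mult.commute)
        then show ?thesis using that by simp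
      qed
    qed (intro continuous_intros cf cM)+
    from this[of 0] have "c * det (M 0 1 t) = 0" using s(1) by (simp add: power_0_left)
    moreover have "M 0 1 t = A1 + of_real t \<cdot>\<^sub>m A2" unfolding M_def using dims by (intro eq_matI) auto
    ultimately have "c = 0" using t by simp
    then have "ev2 (dehomogenize p) y z = 0" for y z by (simp add: q)
    then have "map_poly (emb y) (dehomogenize p) = 0" for y unfolding ev2_def by (simp add: poly_all_0_iff_0[symmetric])
    then have "emb y (coeff (dehomogenize p) k) = 0" for y k by (metis coeff_map_poly coeff_0 emb_zero)
    then have "map_poly complex_of_real (coeff (dehomogenize p) k) = 0" for k
      unfolding emb_def by (simp add: poly_all_0_iff_0[symmetric])
    then have "dehomogenize p = 0" by (simp add: poly_eq_iff map_poly_eq_0_iff)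
    then show False using p(2) by (simp add: dehomogenize_degrees(3)[OF p(1)])
  qed
  have "f x0 x1 x2 = c * of_real x0 ^ (d - D) * det (M x0 x1 x2)"
  proof (rule continuous_eq_at_0[of "\<lambda>x0. f x0 x1 x2"])
    show "f x x1 x2 = c * of_real x ^ (d - D) * det (M x x1 x2)" if "x \<noteq> 0" for x
    proof -
      have "complex_of_real x ^ d = of_real x ^ D * of_real x ^ (d - D)" using Dd by (simp flip: power_add)
      then have "of_real x ^ D * f x x1 x2 = of_real x ^ D * (c * of_real x ^ (d - D) * det (M x x1 x2))"
        using e[OF that, of x1 x2] by (simp add: mult_ac)
      then show ?thesis using that by simp
    qed
  qed (intro continuous_intros cf cM)+
  then show "complex_of_real (eval3 (\<lambda>a. a) p x0 x1 x2) =
      c * of_real x0 ^ (d - D) * det (of_real x0 \<cdot>\<^sub>m A0 + of_real x1 \<cdot>\<^sub>m A1 + of_real x2 \<cdot>\<^sub>m A2)"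
    by (simp add: f_def M_def)
qed

lemma ct_mult_self_vec:
  assumes "v \<in> carrier_vec (dim_col Y)"
  shows "((ct Y * Y) *\<^sub>v v) \<bullet>c v = (Y *\<^sub>v v) \<bullet>c (Y *\<^sub>v v)"
proof -
  let ?n = "dim_col Y" let ?k = "dim_row Y"
  define w where "w = Y *\<^sub>v v"
  have v: "dim_vec v = ?n" using assms by auto
  have w: "w $ r = (\<Sum>j<?n. Y $$ (r, j) * v $ j)" if "r < ?k" for r
    unfolding w_def using that v by (simp add: scalar_prod_def atLeast0LessThan)
  have "(ct Y * Y) *\<^sub>v v = ct Y *\<^sub>v w"
    unfolding w_def by (rule assoc_mult_mat_vec[of _ ?n ?k _ ?n]) (use assms in auto)
  then have "((ct Y * Y) *\<^sub>v v) \<bullet>c v = (\<Sum>j<?n. (\<Sum>r<?k. cnj (Y $$ (r, j)) * w $ r) * cnj (v $ j))"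
    using v by (simp add: scalar_prod_def atLeast0LessThan w_def)
  also have "\<dots> = (\<Sum>r<?k. w $ r * cnj (\<Sum>j<?n. Y $$ (r, j) * v $ j))"
    by (simp add: sum_distrib_left sum_distrib_right mult_ac, rule sum.swap)
  also have "\<dots> = (\<Sum>r<?k. w $ r * cnj (w $ r))" by (simp add: w)
  also have "\<dots> = w \<bullet>c w" by (simp add: scalar_prod_def atLeast0LessThan w_def)
  finally show ?thesis by (simp add: w_def)
qed

lemma pos_semidef_gram: "pos_semidef (ct Y * Y)"
  unfolding pos_semidef_def hermitian_def
proof (intro conjI ballI)
  show "ct (ct Y * Y) = ct Y * Y" by (simp add: ct_mult)
  fix v :: "complex vec" assume "v \<in> carrier_vec (dim_row (ct Y * Y))"
  then have v: "v \<in> carrier_vec (dim_col Y)" by simp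
  show "0 \<le> ((ct Y * Y) *\<^sub>v v) \<bullet>c v" proof -
    have "0 \<le> a * cnj a" for a by (simp add: less_eq_complex_def)
    then have "0 \<le> w \<bullet>c w" for w :: "complex vec"
      by (auto simp: scalar_prod_def intro!: sum_nonneg)
    then show ?thesis unfolding ct_mult_self_vec[OF v] .
  qed
qed

text \<open>Determinants of Hermitian matrices are real, so a complex constant can be replaced by
  its real part.\<close>

lemma det_representationI:
  assumes "A0 \<in> carrier_mat d d" "A1 \<in> carrier_mat d d" "A2 \<in> carrier_mat d d"
    and "ct A0 = A0" "ct A1 = A1" "pos_semidef A2"
    and "\<And>x0 x1 x2. complex_of_real (eval3 (\<lambda>a. a) p x0 x1 x2) =
      c * det (of_real x0 \<cdot>\<^sub>m A0 + of_real x1 \<cdot>\<^sub>m A1 + of_real x2 \<cdot>\<^sub>m A2)"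
  shows "det_representation d p (Re c) A0 A1 A2"
proof -
  have A2: "ct A2 = A2" using assms(6) by (simp add: pos_semidef_def hermitian_def)
  have "complex_of_real (eval3 (\<lambda>a. a) p x0 x1 x2) =
      of_real (Re c) * det (of_real x0 \<cdot>\<^sub>m A0 + of_real x1 \<cdot>\<^sub>m A1 + of_real x2 \<cdot>\<^sub>m A2)" for x0 x1 x2
  proof -
    let ?M = "of_real x0 \<cdot>\<^sub>m A0 + of_real x1 \<cdot>\<^sub>m A1 + of_real x2 \<cdot>\<^sub>m A2"
    have "ct ?M = ?M" using carrier_matD[OF assms(1)] carrier_matD[OF assms(2)] carrier_matD[OF assms(3)] assms(4,5) A2
      by (simp add: ct_add ct_smult)
    moreover have "?M \<in> carrier_mat d d" using assms(1-3) by auto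
    ultimately have "cnj (det ?M) = det ?M" using det_ct[of ?M d] by simp
    then have "Im (det ?M) = 0" by (simp add: complex_eq_iff)
    then show ?thesis using assms(7)[of x0 x1 x2] by (simp add: complex_eq_iff)
  qed
  then show ?thesis using assms A2 by (simp add: det_representation_def hermitian_def)
qed

text \<open>Under the adjoint, the right inverse of \<open>V\<close> becomes a left inverse of
  \<open>ct V\<close>, which completes the certificate for \<open>rank_eq_factor\<close>.\<close>

lemma rank_gram:
  assumes "V \<in> carrier_mat k n" "V' \<in> carrier_mat n k" "V * V' = 1\<^sub>m k"
  shows "mat_rank (ct V * V) = k"
proof -
  have "ct V' * ct V = 1\<^sub>m k" using assms by (simp flip: ct_mult)
  moreover have "dim_row (ct V * V) = n" using assms(1) by simp
  ultimately show ?thesis unfolding mat_rank_def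
    using rank_eq_factor[of "ct V * V" "ct V" V n k "ct V'" n V'] assms by simp
qed

section \<open>Splitting the signature and counting zeros\<close>

definition row_selection :: "nat \<Rightarrow> (nat \<Rightarrow> bool) \<Rightarrow> complex mat" where
  "row_selection n P = mat (length (filter P [0..<n])) n (\<lambda>(r, j). if filter P [0..<n] ! r = j then 1 else 0)"

lemma row_selection_gram:
  "ct (row_selection n P) * row_selection n P = mat n n (\<lambda>(i, j). if i = j \<and> P i then 1 else 0)"
proof (rule eq_matI)
  fix i j assume "i < dim_row (mat n n (\<lambda>(i, j). if i = j \<and> P i then 1 else 0 :: complex))"
    "j < dim_col (mat n n (\<lambda>(i, j). if i = j \<and> P i then 1 else 0 :: complex))"
  then have ij: "i < n" "j < n" by simp_all
  let ?l = "filter P [0..<n]"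
  have "(ct (row_selection n P) * row_selection n P) $$ (i, j) =
      (\<Sum>r<length ?l. (if ?l ! r = i \<and> ?l ! r = j then 1 else 0))"
    using ij by (auto simp: row_selection_def scalar_prod_def atLeast0LessThan intro!: sum.cong)
  also have "\<dots> = sum_list (map (\<lambda>a. if a = i \<and> a = j then 1 else 0) ?l)"
    by (simp add: sum_list_sum_nth atLeast0LessThan)
  also have "\<dots> = (\<Sum>a\<in>set ?l. if a = i \<and> a = j then 1 else 0)"
    by (rule sum_list_distinct_conv_sum_set) simp
  also have "\<dots> = (if i = j \<and> P i then 1 else 0)"
  proof (cases "i = j")
    case True
    then show ?thesis using ij by (simp add: sum.delta)
  next
    case False
    then have "\<not> (a = i \<and> a = j)" for a by auto
    then show ?thesis using False by (simp only: if_False sum.neutral_const) auto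
  qed
  finally show "(ct (row_selection n P) * row_selection n P) $$ (i, j) = mat n n (\<lambda>(i, j). if i = j \<and> P i then 1 else 0) $$ (i, j)"
    using ij by simp
qed (simp_all add: row_selection_def)

lemma row_selection_right_inverse:
  "row_selection n P * ct (row_selection n P) = 1\<^sub>m (length (filter P [0..<n]))"
proof (rule eq_matI)
  let ?l = "filter P [0..<n]"
  fix r s assume "r < dim_row (1\<^sub>m (length ?l) :: complex mat)" "s < dim_col (1\<^sub>m (length ?l) :: complex mat)"
  then have rs: "r < length ?l" "s < length ?l" by simp_all
  have lt: "?l ! r < n" "?l ! s < n" using nth_mem[OF rs(1)] nth_mem[OF rs(2)] by auto
  have "(row_selection n P * ct (row_selection n P)) $$ (r, s) =
      (\<Sum>j<n. (if ?l ! r = j then 1 else 0) * (if ?l ! s = j then 1 else 0))"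
    using rs by (auto simp: row_selection_def scalar_prod_def atLeast0LessThan intro!: sum.cong)
  also have "\<dots> = (\<Sum>j<n. (if ?l ! r = j then (if ?l ! s = j then 1 else 0) else 0))" by (intro sum.cong) auto
  also have "\<dots> = (if ?l ! s = ?l ! r then 1 else 0)" using lt by (subst sum.delta') auto
  also have "\<dots> = 1\<^sub>m (length ?l) $$ (r, s)" using rs by (simp add: nth_eq_iff_index_eq)
  finally show "(row_selection n P * ct (row_selection n P)) $$ (r, s) = 1\<^sub>m (length ?l) $$ (r, s)" .
qed (simp_all add: row_selection_def)

lemma length_filter_upt: "length (filter (\<lambda>i. P (xs ! i)) [0..<length xs]) = length (filter P xs)"
  by (simp add: length_filter_conv_card cong: conj_cong)

lemma order_linear_factors: "order z (\<Prod>l\<leftarrow>ls. [:- l, 1:]) = count_list ls (z :: complex)"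
proof (induction ls)
  case (Cons l ls)
  have nz: "(\<Prod>l\<leftarrow>l # ls. [:- l, 1:]) \<noteq> 0" by (auto simp: prod_list_zero_iff simp del: mult_pCons_left)
  have "order z [:- l, 1:] = (if z = l then 1 else 0)"
  proof (cases "z = l")
    case True
    then show ?thesis using order_power_n_n[of l 1] by simp
  next
    case False
    then show ?thesis by (simp add: order_0I)
  qed
  then show ?case using nz Cons by (simp only: list.map prod_list.Cons) (subst order_mult; auto)
qed (simp add: order_0I)

lemma num_roots_upper_linear_factors:
  assumes "k \<noteq> 0"
  shows "num_roots_upper (smult k (\<Prod>l\<leftarrow>ls. [:- l, 1:])) = length (filter (\<lambda>l. Im l > 0) ls)"
proof -
  let ?u = "filter (\<lambda>l. Im l > 0) ls"
  have "poly (smult k (\<Prod>l\<leftarrow>ls. [:- l, 1:])) z = 0 \<longleftrightarrow> z \<in> set ls" for z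
    using assms by (induction ls) auto
  then have "{z. poly (smult k (\<Prod>l\<leftarrow>ls. [:- l, 1:])) z = 0 \<and> Im z > 0} = set ?u" by auto
  moreover have "(\<Sum>z\<in>set ?u. count_list ls z) = (\<Sum>z\<in>set ?u. count_list ?u z)"
  proof (rule sum.cong[OF refl])
    fix z assume that: "z \<in> set ?u"
    have "Im z > 0" using that by simp
    then show "count_list ls z = count_list ?u z" by (induction ls) auto
  qed
  moreover have "(\<Sum>z\<in>set ?u. count_list ?u z) = length ?u" by (rule sum_count_set) auto
  ultimately show ?thesis by (simp add: num_roots_upper_def order_smult assms order_linear_factors cong: sum.cong)
qed

lemma sign_mat_split:
  defines "Ep \<equiv> \<lambda>ls. row_selection (length ls) (\<lambda>i. \<not> Im (ls ! i) > 0)"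
    and "Em \<equiv> \<lambda>ls. row_selection (length ls) (\<lambda>i. Im (ls ! i) > 0)"
  shows "sign_mat ls = ct (Ep ls) * Ep ls - ct (Em ls) * Em ls"
    and "1\<^sub>m (length ls) = ct (Em ls) * Em ls + ct (Ep ls) * Ep ls"
  unfolding Ep_def Em_def row_selection_gram by (rule eq_matI; auto simp: sign_mat_def)+


text \<open>The missing power of \<open>x0\<close> is the determinant of \<open>x0\<close> times an
  identity block of size \<open>d - D\<close>, added as a direct summand on which \<open>A1\<close>
  and \<open>A2\<close> vanish.\<close>

theorem determinantal_representation:
  assumes p: "homogeneous d p" and s: "semi_hyperbolic p (0, 0, 1)"
  shows "\<exists>c A0 A1 A2. det_representation d p c A0 A1 A2"
proof (cases "p = 0")
  case True
  have "pos_semidef (0\<^sub>m d d)" using pos_semidef_gram[of "0\<^sub>m d d"] by simp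
  then show ?thesis unfolding True
    by (intro exI[of _ "Re 0"] exI[of _ "0\<^sub>m d d"] det_representationI) (auto simp: eval3_def)
next
  case False
  then have q0: "dehomogenize p \<noteq> 0" by (simp add: dehomogenize_degrees(3)[OF p])
  have hyp: "\<forall>\<^sub>\<infinity>y :: real. \<forall>z. ev2 (dehomogenize p) (of_real y) z = 0 \<longrightarrow> Im z = 0"
    using real_rooted_fibres[OF p s] False by simp
  obtain D where "det_rep (ev2 (dehomogenize p)) D" using bivariate_det_rep[OF q0 hyp] by blast
  then obtain A0 A1 Y c where A: "A0 \<in> carrier_mat D D" "ct A0 = A0" "A1 \<in> carrier_mat D D" "ct A1 = A1" "dim_col Y = D"
    and f: "\<And>y z. ev2 (dehomogenize p) y z = c * det (A0 + y \<cdot>\<^sub>m A1 + z \<cdot>\<^sub>m (ct Y * Y))"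
    and e: "\<forall>\<^sub>\<infinity>e :: real. det (A1 + of_real e \<cdot>\<^sub>m (ct Y * Y)) \<noteq> 0"
    unfolding det_rep_def by blast
  have cY: "ct Y * Y \<in> carrier_mat D D" using A(5) by (auto intro!: carrier_matI)
  note hd = homogenize_det[OF p False A(1) A(3) cY f MOST_real_nonempty[OF e]]
  define n where "n = d - D"
  have d: "d = D + n" using hd(1) by (simp add: n_def)
  let ?Y = "dsum Y (0\<^sub>m n n)"
  note dims = carrier_matD[OF A(1)] carrier_matD[OF A(3)] A(5)
  have g: "ct ?Y * ?Y = dsum (ct Y * Y) (0\<^sub>m n n)" by (simp add: ct_dsum dsum_mult)
  show ?thesis
  proof (rule exI[of _ "Re c"], rule exI[of _ "dsum A0 (1\<^sub>m n)"], rule exI[of _ "dsum A1 (0\<^sub>m n n)"],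
      rule exI[of _ "ct ?Y * ?Y"], rule det_representationI)
    show "dsum A0 (1\<^sub>m n) \<in> carrier_mat d d" "dsum A1 (0\<^sub>m n n) \<in> carrier_mat d d" using A by (auto simp: d)
    show "ct ?Y * ?Y \<in> carrier_mat d d" using A by (auto simp: d intro!: carrier_matI)
    show "ct (dsum A0 (1\<^sub>m n)) = dsum A0 (1\<^sub>m n)" "ct (dsum A1 (0\<^sub>m n n)) = dsum A1 (0\<^sub>m n n)"
      using A by (simp_all add: ct_dsum)
    show "pos_semidef (ct ?Y * ?Y)" by (rule pos_semidef_gram)
    fix x0 x1 x2 :: real
    let ?M = "of_real x0 \<cdot>\<^sub>m A0 + of_real x1 \<cdot>\<^sub>m A1 + of_real x2 \<cdot>\<^sub>m (ct Y * Y)"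
    have "of_real x0 \<cdot>\<^sub>m dsum A0 (1\<^sub>m n) + of_real x1 \<cdot>\<^sub>m dsum A1 (0\<^sub>m n n) + of_real x2 \<cdot>\<^sub>m (ct ?Y * ?Y) =
      dsum ?M (of_real x0 \<cdot>\<^sub>m 1\<^sub>m n + of_real x1 \<cdot>\<^sub>m 0\<^sub>m n n + of_real x2 \<cdot>\<^sub>m 0\<^sub>m n n)"
      unfolding g using dims by (simp add: dsum_smult dsum_add)
    moreover have "of_real x0 \<cdot>\<^sub>m 1\<^sub>m n + of_real x1 \<cdot>\<^sub>m 0\<^sub>m n n + of_real x2 \<cdot>\<^sub>m 0\<^sub>m n n = complex_of_real x0 \<cdot>\<^sub>m 1\<^sub>m n"
      by (rule eq_matI) auto
    moreover have "?M \<in> carrier_mat D D" using A cY by auto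
    ultimately show "complex_of_real (eval3 (\<lambda>a. a) p x0 x1 x2) = c * det (of_real x0 \<cdot>\<^sub>m dsum A0 (1\<^sub>m n) +
        of_real x1 \<cdot>\<^sub>m dsum A1 (0\<^sub>m n n) + of_real x2 \<cdot>\<^sub>m (ct ?Y * ?Y))"
      by (simp add: det_dsum[of _ D _ n] hd(2) n_def[symmetric] mult_ac)
  qed
qed

text \<open>\<open>Bp\<close> and \<open>Bm\<close> are the Gram matrices of the rows of
  \<open>Y1\<close> that belong to zeros outside and inside the upper half plane. The right inverse
  of \<open>Y1\<close> yields their ranks, and the list of zeros of p(1, y, i) supplies the
  counts.\<close>

theorem determinantal_representation_with_signature:
  assumes p: "homogeneous d p" and s: "semi_hyperbolic p (0, 0, 1)" and n: "no_factor_in_x0_x1 p"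
  shows "\<exists>c A0 A1 A2. det_representation d p c A0 A1 A2 \<and>
         mat_rank A1 = degree1 p \<and> mat_rank A2 = degree2 p \<and>
         (\<exists>Bp \<in> carrier_mat d d. \<exists>Bm \<in> carrier_mat d d.
            pos_semidef Bp \<and> pos_semidef Bm \<and> A1 = Bp - Bm \<and>
            mat_rank Bm =
              num_roots_upper (eval3 (\<lambda>a. [:complex_of_real a:]) p 1 [:0, 1:] [:\<i>:]) \<and>
            mat_rank Bp + mat_rank Bm = mat_rank A1 \<and>
            Bm + Bp + A2 = 1\<^sub>m d)"
proof -
  let ?q = "dehomogenize p"
  have yp: "y_primitive ?q" by (rule y_primitive_dehomogenize[OF p n])
  have q0: "?q \<noteq> 0" by (rule y_primitive_nonzero[OF yp])
  then have p0: "p \<noteq> 0" by (simp add: dehomogenize_degrees(3)[OF p])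
  have hyp: "\<forall>\<^sub>\<infinity>y :: real. \<forall>z. ev2 ?q (of_real y) z = 0 \<longrightarrow> Im z = 0"
    using real_rooted_fibres[OF p s] p0 by simp
  obtain ls D k where rep: "hermitian_rep (ev2 ?q) D ls (degree ?q)" and k: "k \<noteq> 0"
    and roots: "\<And>y. ev2 ?q y \<i> = k * (\<Prod>l\<leftarrow>ls. y - l)"
    using bivariate_hermitian_rep[OF yp hyp] by blast
  have m: "degree ?q = degree2 p" by (simp add: dehomogenize_degrees(1)[OF p] degree2_def)
  obtain A0 Y1 Y2 X1 X2 c where A0: "A0 \<in> carrier_mat D D" "ct A0 = A0"
    and Y1: "Y1 \<in> carrier_mat (length ls) D" "X1 \<in> carrier_mat D (length ls)" "Y1 * X1 = 1\<^sub>m (length ls)"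
    and Y2: "Y2 \<in> carrier_mat (degree2 p) D" "X2 \<in> carrier_mat D (degree2 p)" "Y2 * X2 = 1\<^sub>m (degree2 p)"
    and one: "ct Y1 * Y1 + ct Y2 * Y2 = 1\<^sub>m D"
    and f: "\<And>y z. ev2 ?q y z = c * det (A0 + y \<cdot>\<^sub>m (ct Y1 * sign_mat ls * Y1) + z \<cdot>\<^sub>m (ct Y2 * Y2))"
    and e: "\<forall>\<^sub>\<infinity>e :: real. det (ct Y1 * sign_mat ls * Y1 + of_real e \<cdot>\<^sub>m (ct Y2 * Y2)) \<noteq> 0"
    using rep unfolding hermitian_rep_def m by blast
  define S where "S = sign_mat ls"
  have S: "S \<in> carrier_mat (length ls) (length ls)" "ct S = S" "S * S = 1\<^sub>m (length ls)"
    by (simp_all add: S_def ct_sign_mat sign_mat_square)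
  define A1 where "A1 = ct Y1 * S * Y1"
  define A2 where "A2 = ct Y2 * Y2"
  note dims = carrier_matD[OF A0(1)] carrier_matD[OF Y1(1)] carrier_matD[OF Y1(2)] carrier_matD[OF Y2(1)] carrier_matD[OF S(1)]
  have A1: "A1 \<in> carrier_mat D D" "ct A1 = A1" unfolding A1_def
    using dims S(2) by (auto intro!: carrier_matI) (simp add: ct_mult mat_mult_assoc)
  have A2: "A2 \<in> carrier_mat D D" unfolding A2_def using dims by (auto intro!: carrier_matI)
  note hd = homogenize_det[OF p p0 A0(1) A1(1) A2 f[folded S_def, folded A1_def A2_def]
    MOST_real_nonempty[OF e[folded S_def, folded A1_def A2_def]]]
  \<comment> \<open>A surplus power of \<open>x0\<close> would make \<open>p\<close> vanish on
    \<open>x0 = 0\<close>, hence be divisible by \<open>x0\<close>, a nonconstant factor in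
    \<open>x0\<close>, \<open>x1\<close> alone.\<close>
  have Dd: "D = d"
  proof (rule ccontr)
    assume "D \<noteq> d"
    then have lt: "D < d" using hd(1) by simp
    have "eval3 (\<lambda>a. a) p 0 x1 x2 = 0" for x1 x2
      using hd(2)[of 0 x1 x2] lt by (simp add: power_0_left)
    then have "poly (map_poly (\<lambda>q. poly (map_poly (\<lambda>r. poly r 0) q) x1) p) x2 = 0" for x1 x2
      by (simp add: eval3_def map_poly_idI)
    then have "map_poly (\<lambda>q. poly (map_poly (\<lambda>r. poly r 0) q) x1) p = 0" for x1
      by (simp add: poly_all_0_iff_0[symmetric])
    then have "coeff (map_poly (\<lambda>q. poly (map_poly (\<lambda>r. poly r 0) q) x1) p) k = 0" for x1 k by simp
    then have "poly (map_poly (\<lambda>r. poly r 0) (coeff p k)) x1 = 0" for x1 k by (simp add: coeff_map_poly)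
    then have "map_poly (\<lambda>r. poly r 0) (coeff p k) = 0" for k by (simp add: poly_all_0_iff_0[symmetric])
    then have "coeff (map_poly (\<lambda>r. poly r 0) (coeff p k)) j = 0" for k j by simp
    then have z: "poly (coeff (coeff p k) j) 0 = 0" for k j by (simp add: coeff_map_poly)
    have "[:0, 1:] dvd coeff (coeff p k) j" for k j using z[of k j] by (simp add: dvd_iff_poly_eq_0)
    then have "[:[:[:0, 1:]:]:] dvd p" by (simp add: const_poly_dvd_iff)
    then show False using n unfolding no_factor_in_x0_x1_def by fastforce
  qed
  have rep: "complex_of_real (eval3 (\<lambda>a. a) p x0 x1 x2) =
      c * det (of_real x0 \<cdot>\<^sub>m A0 + of_real x1 \<cdot>\<^sub>m A1 + of_real x2 \<cdot>\<^sub>m A2)" for x0 x1 x2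
    using hd(2)[of x0 x1 x2] by (simp add: Dd)
  define Ep where "Ep = row_selection (length ls) (\<lambda>i. \<not> Im (ls ! i) > 0)"
  define Em where "Em = row_selection (length ls) (\<lambda>i. Im (ls ! i) > 0)"
  let ?a = "length (filter (\<lambda>l. \<not> Im l > 0) ls)" and ?b = "length (filter (\<lambda>l. Im l > 0) ls)"
  have E: "Ep \<in> carrier_mat ?a (length ls)" "Em \<in> carrier_mat ?b (length ls)"
    "Ep * ct Ep = 1\<^sub>m ?a" "Em * ct Em = 1\<^sub>m ?b"
    unfolding Ep_def Em_def row_selection_right_inverse
    by (simp_all add: row_selection_def length_filter_upt[where P = "\<lambda>l. Im l > 0"] length_filter_upt[where P = "\<lambda>l. \<not> Im l > 0"] del: not_less)
  have SE: "S = ct Ep * Ep - ct Em * Em" "1\<^sub>m (length ls) = ct Em * Em + ct Ep * Ep"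
    unfolding S_def Ep_def Em_def by (rule sign_mat_split)+
  note dims = dims carrier_matD[OF E(1)] carrier_matD[OF E(2)]
  define Bp where "Bp = ct (Ep * Y1) * (Ep * Y1)"
  define Bm where "Bm = ct (Em * Y1) * (Em * Y1)"
  have B: "Bp \<in> carrier_mat d d" "Bm \<in> carrier_mat d d"
    unfolding Bp_def Bm_def using dims Dd by (auto intro!: carrier_matI)
  have rank_B: "mat_rank (ct (E * Y1) * (E * Y1)) = a" if E: "E \<in> carrier_mat a (length ls)" "E * ct E = 1\<^sub>m a" for E a
  proof (rule rank_gram)
    note dims = carrier_matD[OF E(1)] carrier_matD[OF Y1(1)] carrier_matD[OF Y1(2)]
    show "E * Y1 \<in> carrier_mat a D" "X1 * ct E \<in> carrier_mat D a" using dims by (auto intro!: carrier_matI)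
    have "E * Y1 * (X1 * ct E) = E * ((Y1 * X1) * ct E)" using dims by (simp add: mat_mult_assoc)
    also have "\<dots> = E * ct E" unfolding Y1(3) using dims by (simp add: mat_one_mult)
    finally show "E * Y1 * (X1 * ct E) = 1\<^sub>m a" using E(2) by simp
  qed
  have rp: "mat_rank Bp = ?a" and rm: "mat_rank Bm = ?b"
    unfolding Bp_def Bm_def using rank_B E by blast+
  have r2: "mat_rank A2 = degree2 p" unfolding A2_def by (rule rank_gram[OF Y2])
  have r1: "mat_rank A1 = length ls"
  proof -
    \<comment> \<open>As the signature matrix squares to the identity, it moves to the left factor
      of \<open>A1\<close> without losing the one-sided inverse.\<close>
    have "(S * ct X1) * (ct Y1 * S) = S * (ct (Y1 * X1) * S)" using dims by (simp add: mat_mult_assoc ct_mult)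
    also have "\<dots> = 1\<^sub>m (length ls)" unfolding Y1(3) using dims S(3) by (simp add: mat_one_mult)
    finally have "(S * ct X1) * (ct Y1 * S) = 1\<^sub>m (length ls)" .
    then have "vec_space.rank D A1 = length ls"
      using S Y1 by (intro rank_eq_factor[OF A1_def, of _ _ "S * ct X1" D X1]) auto
    then show ?thesis unfolding mat_rank_def using carrier_matD[OF A1(1)] by simp
  qed
  have split: "ct Y1 * (ct E * E) * Y1 = ct (E * Y1) * (E * Y1)" if "dim_col E = length ls" for E
    using that carrier_matD[OF Y1(1)] by (simp add: mat_mult_assoc ct_mult)
  have A1B: "A1 = Bp - Bm"
  proof -
    have "A1 = ct Y1 * (ct Ep * Ep) * Y1 - ct Y1 * (ct Em * Em) * Y1"
      unfolding A1_def SE(1) using dims by (simp add: mat_mult_minus mat_minus_mult)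
    then show ?thesis unfolding Bp_def Bm_def using dims by (simp add: split)
  qed
  have sum: "Bm + Bp + A2 = 1\<^sub>m d"
  proof -
    have "ct Y1 * Y1 = ct Y1 * 1\<^sub>m (length ls) * Y1" using dims by (simp add: mat_mult_one)
    also have "\<dots> = ct Y1 * (ct Em * Em) * Y1 + ct Y1 * (ct Ep * Ep) * Y1"
      unfolding SE(2) using dims by (simp add: mat_mult_add mat_add_mult)
    also have "\<dots> = Bm + Bp" unfolding Bp_def Bm_def using dims by (simp add: split)
    finally show ?thesis using one by (simp add: A2_def Dd)
  qed
  have P: "swap_poly ?q \<i> = smult k (\<Prod>l\<leftarrow>ls. [:- l, 1:])"
    by (rule poly_eq_poly_eq_iff[THEN iffD1], rule ext) (simp add: poly_swap roots poly_prod_list o_def)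
  have "degree (\<Prod>l\<leftarrow>ls. [:- l, 1:] :: complex poly) = length ls"
    by (rule degree_linear_factors)
  \<comment> \<open>The list has as many entries as the degree in \<open>y\<close> at level
    \<open>\<i>\<close>, and by real-rootedness this is the full degree in \<open>y\<close>.\<close>
  then have deg: "length ls = degree1 p"
    using degree_swap_poly_i[OF q0 hyp] k by (simp add: P dehomogenize_degrees(4)[OF p])
  have num: "num_roots_upper (eval3 (\<lambda>a. [:complex_of_real a:]) p 1 [:0, 1:] [:\<i>:]) = ?b"
    unfolding poly_eval3_i[OF p] P by (rule num_roots_upper_linear_factors[OF k])
  have ab: "?a + ?b = length ls" using sum_length_filter_compl[of "\<lambda>l. Im l > 0" ls] by simp
  have "det_representation d p (Re c) A0 A1 A2"
    using A0 A1 A2 rep by (intro det_representationI) (auto simp: Dd A2_def pos_semidef_gram)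
  then show ?thesis
    using r1 r2 deg B A1B sum num rp rm ab pos_semidef_gram[of "Ep * Y1"] pos_semidef_gram[of "Em * Y1"]
    unfolding Bp_def[symmetric] Bm_def[symmetric]
    by (intro exI[of _ "Re c"] exI[of _ A0] exI[of _ A1] exI[of _ A2] conjI bexI[of _ Bp] bexI[of _ Bm]) simp_all
qed

theorem theorem1:
  fixes p :: "real poly poly poly" and d :: nat
  assumes "homogeneous d p"
    and "semi_hyperbolic p (0, 0, 1)"
  shows "(\<exists>c A0 A1 A2. det_representation d p c A0 A1 A2) \<and>
    (no_factor_in_x0_x1 p \<longrightarrow>
      (\<exists>c A0 A1 A2. det_representation d p c A0 A1 A2 \<and>
         mat_rank A1 = degree1 p \<and> mat_rank A2 = degree2 p \<and>
         (\<exists>Bp \<in> carrier_mat d d. \<exists>Bm \<in> carrier_mat d d.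
            pos_semidef Bp \<and> pos_semidef Bm \<and> A1 = Bp - Bm \<and>
            mat_rank Bm =
              num_roots_upper (eval3 (\<lambda>a. [:complex_of_real a:]) p 1 [:0, 1:] [:\<i>:]) \<and>
            mat_rank Bp + mat_rank Bm = mat_rank A1 \<and>
            Bm + Bp + A2 = 1\<^sub>m d)))"
  using determinantal_representation[OF assms] determinantal_representation_with_signature[OF assms] by blast

end
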